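(* Let $(M,\langle\cdot,\cdot\rangle^*,dv_M)$ be a subriemannian manifold of dimension $m+1$ with background volume form, having isometric translations $\Psi_a$, $a\in(-\delta,\delta)$, near $p_0\in M$, and let $U$ be the neighborhood of $p_0$ on which they act. Assume $\dim\xi$ is constant, equal to $m+1-l$, near $p_0$. Let $\Sigma_1,\Sigma_2$ be hypersurfaces in $U$ such that $\{\Psi_a\}$ is transversal to $\Sigma_1$ and $\Sigma_2$ in $U$. Choose defining functions $\phi$ and $\psi$ for $\Sigma_1=\{\phi=0\}$ and $\Sigma_2=\{\psi=0\}$ in $U$, compatible with $\{\Psi_a\}$. Suppose $\Sigma_1$ and $\Sigma_2$ are tangent to each other at $p_0$, where $|d\phi|_*\ne0$, $|d\psi|_*\neq0$. Assume: (1) for any $q\in\Sigma_1\cap U$ there exists $a(q)$ with $\delta>a(q)\ge0$ such that $\Psi_{a(q)}(q)\in\Sigma_2$; and (2) for some $p\ge0$, $H_{\Sigma_2,p}(\Psi_{a(q)}(q))\le H_{\Sigma_1,p}(q)$ for any $q\in\Sigma_1\cap U$. Moreover, assume that near $p_0$ the rank condition holds: $\operatorname{rank}\mathcal{L}(X_1,\dots,X_{m-l})\ge m$ for any local sections $X_1,\dots,X_{m-l}$ of $\xi$ which are linearly independent wherever defined. Then $\Sigma_2$ coincides with $\Sigma_1$ near $p_0$.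
   Context: A subriemannian manifold is a $C^\infty$ manifold $M$ with a (smooth) nonnegative definite inner product $\langle\cdot,\cdot\rangle^*$ on $T^*M$ (possibly degenerate); $|\omega|_*:=(\langle\omega,\omega\rangle^* )^{1/2}$. A background volume form $dv_M$ is a nowhere vanishing $(m+1)$-form. For a 1-form $\omega$, $\omega\lrcorner dv_M$ is the $m$-form with $\eta\wedge(\omega\lrcorner dv_M)=\langle\eta,\omega\rangle^*dv_M$ for all 1-forms $\eta$. $G:T^*M\to TM$ is defined by $\omega(G(\eta))=\langle\omega,\eta\rangle^*$, and $\xi:=\operatorname{Range}(G)$. Hypersurfaces and defining functions ($d\phi\neq0$) are $C^\infty$. Isometric translations near $p_0$: a one-parameter family of local diffeomorphisms $\Psi_a$, $a\in(-\delta,\delta)$ ($\delta>0$ small), in a small neighborhood $U$ of $p_0$, with $\Psi_0=\mathrm{Id}$, $\Psi_{a+b}=\Psi_a\circ\Psi_b$ wherever defined, $\langle\Psi_a^*\omega,\Psi_a^*\eta\rangle^*=\langle\omega,\eta\rangle^*$ for $\omega,\eta\in T^*U$, and $\Psi_a^*(dv_M)=dv_M$. A defining function $\phi$ is compatible with $\{\Psi_a\}$ if $\phi(\Psi_a(x))=\phi(x)-a$. $\{\Psi_a\}$ is transversal to $\Sigma$ if $\frac{d}{da}\Psi_a(x)|_{a=0}\notin T_x\Sigma$ for all $x\in\Sigma$. For $\Sigma=\{\phi=0\}$ and $p\ge0$, at points with $|d\phi|_*\ne0$ put $dv_{\phi,p}:=\frac{d\phi}{|d\phi|_*^{1-p}}\lrcorner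 dv_M$, let $\nu_p$ be the vector field with $\nu_p\lrcorner dv_M=dv_{\phi,p}$, and define $H_{\Sigma,p}$ on the set of points of $\Sigma$ with $|d\phi|_*\neq0$ by the first variation formula $\delta_{f\nu_p}\int_\Sigma dv_{\phi,p}=\int_\Sigma fH_{\Sigma,p}\,dv_{\phi,p}$ for all $f\in C_0^\infty(\Sigma\setminus\{|d\phi|_*=0\})$, where $\delta_{f\nu_p}\int_\Sigma dv_{\phi,p}=\int_\Sigma L_{f\nu_p}(dv_{\phi,p})$ ($L$ the Lie derivative). (Equivalently $H_{\Sigma,p}$ is the restriction to $\Sigma$ of the function $H_{\phi,p}$ given by $d(dv_{\phi,p})=H_{\phi,p}dv_M$.) $\mathcal{L}(X_1,\dots,X_r)$ is the smallest $C^\infty$-module of vector fields containing the $C^\infty$ vector fields $X_1,\dots,X_r$ and closed under Lie bracket; its rank at $q$ is the dimension of the span of $\{Z(q):Z\in\mathcal{L}(X_1,\dots,X_r)\}$. *)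

theory Defs
  imports "HOL-Analysis.Analysis"
begin

section \<open>Smooth functions on open subsets of Euclidean spaces\<close>

primrec Ck_on :: "nat \<Rightarrow> 'a::euclidean_space set \<Rightarrow> ('a \<Rightarrow> 'b::real_normed_vector) \<Rightarrow> bool" where
  "Ck_on 0 S f \<longleftrightarrow> continuous_on S f"
| "Ck_on (Suc k) S f \<longleftrightarrow>
     (\<forall>x\<in>S. f differentiable (at x)) \<and> (\<forall>v. Ck_on k S (\<lambda>x. frechet_derivative f (at x) v))"

text \<open>Only meaningful for open \<open>S\<close>.\<close>

definition smooth_on :: "'a::euclidean_space set \<Rightarrow> ('a \<Rightarrow> 'b::real_normed_vector) \<Rightarrow> bool" where
  "smooth_on S f \<longleftrightarrow> (\<forall>k. Ck_on k S f)"


section \<open>Smooth manifolds\<close>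

text \<open>The manifold is the whole type \<open>'a\<close> with the smooth structure given by an atlas \<open>A\<close>; its
  dimension is \<open>CARD('n)\<close>.\<close>

type_synonym ('a, 'n) chart = "'a set \<times> ('a \<Rightarrow> (real, 'n) vec)"

definition cinv :: "('a, 'n::finite) chart \<Rightarrow> real ^ 'n \<Rightarrow> 'a" where
  "cinv c = inv_into (fst c) (snd c)"

text \<open>\<open>is_chart A c\<close> holds for all charts \<open>c\<close> of the maximal atlas containing \<open>A\<close>.\<close>

definition is_chart :: "('a::topological_space, 'n::finite) chart set \<Rightarrow> ('a, 'n) chart \<Rightarrow> bool" where
  "is_chart A c \<longleftrightarrow>
     open (fst c) \<and> open (snd c ` fst c) \<and>
     homeomorphism (fst c) (snd c ` fst c) (snd c) (cinv c) \<and>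
     (\<forall>d\<in>A. smooth_on (snd c ` (fst c \<inter> fst d)) (snd d \<circ> cinv c) \<and>
            smooth_on (snd d ` (fst c \<inter> fst d)) (snd c \<circ> cinv d))"

definition smooth_manifold :: "('a::topological_space, 'n::finite) chart set \<Rightarrow> bool" where
  "smooth_manifold A \<longleftrightarrow> (\<Union>c\<in>A. fst c) = UNIV \<and> (\<forall>c\<in>A. is_chart A c)"

definition smooth_fun ::
  "('a::topological_space, 'n::finite) chart set \<Rightarrow> 'a set \<Rightarrow> ('a \<Rightarrow> real) \<Rightarrow> bool" where
  "smooth_fun A W f \<longleftrightarrow> (\<forall>c\<in>A. smooth_on (snd c ` (fst c \<inter> W)) (f \<circ> cinv c))"

definition smooth_map ::
  "('a::topological_space, 'n::finite) chart set \<Rightarrow> 'a set \<Rightarrow> ('a \<Rightarrow> 'a) \<Rightarrow> bool" where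
  "smooth_map A W F \<longleftrightarrow> continuous_on W F \<and>
     (\<forall>c\<in>A. \<forall>d\<in>A. smooth_on (snd c ` (fst c \<inter> W \<inter> F -` fst d)) (snd d \<circ> F \<circ> cinv c))"

definition local_diffeo ::
  "('a::topological_space, 'n::finite) chart set \<Rightarrow> 'a set \<Rightarrow> ('a \<Rightarrow> 'a) \<Rightarrow> bool" where
  "local_diffeo A U F \<longleftrightarrow>
     (\<forall>x\<in>U. \<exists>V W K. open V \<and> x \<in> V \<and> V \<subseteq> U \<and> open W \<and> homeomorphism V W F K \<and>
        smooth_map A V F \<and> smooth_map A W K)"


section \<open>Tangent and cotangent vectors\<close>

text \<open>As usual for charted spaces, a preferred chart \<open>chart_at A x\<close> is chosen around every point
  \<open>x\<close>, and the tangent space at \<open>x\<close> is the model space \<open>real ^ 'n\<close>: a vector stands for the tangent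
  vector having these components in the preferred chart at \<open>x\<close>. Components in another chart are
  obtained by \<open>tchange\<close>, so no notion below depends on the choice. A cotangent vector is a linear
  functional on the tangent space.\<close>

type_synonym 'n covector = "((real, 'n) vec) \<Rightarrow>\<^sub>L real"

definition chart_at :: "('a::topological_space, 'n::finite) chart set \<Rightarrow> 'a \<Rightarrow> ('a, 'n) chart" where
  "chart_at A x = (SOME c. c \<in> A \<and> x \<in> fst c)"

text \<open>Components in the chart \<open>d\<close> of the tangent vector at \<open>x\<close> whose components in the chart \<open>c\<close>
  are \<open>v\<close>.\<close>

definition tchange ::
  "('a, 'n::finite) chart \<Rightarrow> ('a, 'n) chart \<Rightarrow> 'a \<Rightarrow> real ^ 'n \<Rightarrow> real ^ 'n" where
  "tchange c d x v = frechet_derivative (snd d \<circ> cinv c) (at (snd c x)) v"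

definition coord_vector ::
  "('a::topological_space, 'n::finite) chart set \<Rightarrow> ('a, 'n) chart \<Rightarrow> 'n \<Rightarrow> 'a \<Rightarrow> real ^ 'n" where
  "coord_vector A c i x = tchange c (chart_at A x) x (axis i 1)"

definition differential ::
  "('a::topological_space, 'n::finite) chart set \<Rightarrow> ('a \<Rightarrow> real) \<Rightarrow> 'a \<Rightarrow> 'n covector" where
  "differential A f x =
     Blinfun (frechet_derivative (f \<circ> cinv (chart_at A x)) (at (snd (chart_at A x) x)))"

definition tangent_map ::
  "('a::topological_space, 'n::finite) chart set \<Rightarrow> ('a \<Rightarrow> 'a) \<Rightarrow> 'a \<Rightarrow> real ^ 'n \<Rightarrow> real ^ 'n" where
  "tangent_map A F x v =
     frechet_derivative (snd (chart_at A (F x)) \<circ> F \<circ> cinv (chart_at A x))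
       (at (snd (chart_at A x) x)) v"

definition pullback_covector ::
  "('a::topological_space, 'n::finite) chart set \<Rightarrow> ('a \<Rightarrow> 'a) \<Rightarrow> 'a \<Rightarrow> 'n covector \<Rightarrow> 'n covector"
where
  "pullback_covector A F x w = Blinfun (\<lambda>v. blinfun_apply w (tangent_map A F x v))"

definition velocity ::
  "('a::topological_space, 'n::finite) chart set \<Rightarrow> (real \<Rightarrow> 'a) \<Rightarrow> real ^ 'n" where
  "velocity A \<gamma> = vector_derivative (\<lambda>t. snd (chart_at A (\<gamma> 0)) (\<gamma> t)) (at 0)"

definition tangent_space ::
  "('a::topological_space, 'n::finite) chart set \<Rightarrow> 'a set \<Rightarrow> 'a \<Rightarrow> (real ^ 'n) set" where
  "tangent_space A S x =
     {velocity A \<gamma> | \<gamma>. \<gamma> 0 = x \<and>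
        (\<exists>\<epsilon>>0. (\<forall>t\<in>{-\<epsilon><..<\<epsilon>}. \<gamma> t \<in> S) \<and> continuous_on {-\<epsilon><..<\<epsilon>} \<gamma> \<and>
           (\<forall>c\<in>A. smooth_on {t \<in> {-\<epsilon><..<\<epsilon>}. \<gamma> t \<in> fst c} (\<lambda>t. snd c (\<gamma> t))))}"


section \<open>Vector fields\<close>

definition smooth_vector_field ::
  "('a::topological_space, 'n::finite) chart set \<Rightarrow> 'a set \<Rightarrow> ('a \<Rightarrow> real ^ 'n) \<Rightarrow> bool" where
  "smooth_vector_field A W X \<longleftrightarrow>
     (\<forall>c\<in>A. \<forall>i. smooth_fun A (fst c \<inter> W)
        (\<lambda>x. blinfun_apply (differential A (\<lambda>y. snd c y $ i) x) (X x)))"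

text \<open>The components of a vector field in the chart \<open>c\<close>, as a function of the coordinates.\<close>

definition vector_rep ::
  "('a::topological_space, 'n::finite) chart set \<Rightarrow> ('a, 'n) chart \<Rightarrow> ('a \<Rightarrow> real ^ 'n)
     \<Rightarrow> real ^ 'n \<Rightarrow> real ^ 'n" where
  "vector_rep A c X y = tchange (chart_at A (cinv c y)) c (cinv c y) (X (cinv c y))"

definition lie_bracket ::
  "('a::topological_space, 'n::finite) chart set \<Rightarrow> ('a \<Rightarrow> real ^ 'n) \<Rightarrow> ('a \<Rightarrow> real ^ 'n)
     \<Rightarrow> 'a \<Rightarrow> real ^ 'n" where
  "lie_bracket A X Y x =
     (let c = chart_at A x in
        frechet_derivative (vector_rep A c Y) (at (snd c x)) (X x)
      - frechet_derivative (vector_rep A c X) (at (snd c x)) (Y x))"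

text \<open>The smallest module over the smooth functions on \<open>V\<close> that contains \<open>X 0, \<dots>, X (r - 1)\<close> and
  is closed under brackets. Vector fields on \<open>V\<close> are total functions whose values off \<open>V\<close> are
  irrelevant.\<close>

inductive_set lie_module ::
  "('a::topological_space, 'n::finite) chart set \<Rightarrow> 'a set \<Rightarrow> nat \<Rightarrow> (nat \<Rightarrow> 'a \<Rightarrow> real ^ 'n)
     \<Rightarrow> ('a \<Rightarrow> real ^ 'n) set"
  for A V r X where
  generator: "i < r \<Longrightarrow> X i \<in> lie_module A V r X"
| zero: "(\<lambda>_. 0) \<in> lie_module A V r X"
| add: "Y \<in> lie_module A V r X \<Longrightarrow> Z \<in> lie_module A V r X
    \<Longrightarrow> (\<lambda>x. Y x + Z x) \<in> lie_module A V r X"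
| scale: "smooth_fun A V f \<Longrightarrow> Z \<in> lie_module A V r X
    \<Longrightarrow> (\<lambda>x. f x *\<^sub>R Z x) \<in> lie_module A V r X"
| bracket: "Y \<in> lie_module A V r X \<Longrightarrow> Z \<in> lie_module A V r X
    \<Longrightarrow> lie_bracket A Y Z \<in> lie_module A V r X"

definition lie_rank ::
  "('a::topological_space, 'n::finite) chart set \<Rightarrow> 'a set \<Rightarrow> nat \<Rightarrow> (nat \<Rightarrow> 'a \<Rightarrow> real ^ 'n)
     \<Rightarrow> 'a \<Rightarrow> nat" where
  "lie_rank A V r X q = dim (span {Z q | Z. Z \<in> lie_module A V r X})"


section \<open>Differential forms\<close>

text \<open>A \<open>k\<close>-form at a point is an alternating function of a list of \<open>k\<close> tangent vectors, set to \<open>0\<close>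
  on lists of any other length, so that equality of forms is equality of functions.\<close>

type_synonym 'n form = "((real, 'n) vec) list \<Rightarrow> real"

definition alternating_form :: "nat \<Rightarrow> ('n::finite) form \<Rightarrow> bool" where
  "alternating_form k \<alpha> \<longleftrightarrow>
     (\<forall>vs. length vs = k \<longrightarrow> (\<forall>i<k. linear (\<lambda>v. \<alpha> (vs[i := v]))) \<and> (\<not> distinct vs \<longrightarrow> \<alpha> vs = 0)) \<and>
     (\<forall>vs. length vs \<noteq> k \<longrightarrow> \<alpha> vs = 0)"

definition wedge_covector :: "('n::finite) covector \<Rightarrow> 'n form \<Rightarrow> 'n form" where
  "wedge_covector \<eta> \<beta> vs =
     (\<Sum>i<length vs. (-1) ^ i * blinfun_apply \<eta> (vs ! i) * \<beta> (take i vs @ drop (Suc i) vs))"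

definition interior_product :: "real ^ 'n \<Rightarrow> ('n::finite) form \<Rightarrow> 'n form" where
  "interior_product v \<alpha> vs = \<alpha> (v # vs)"

definition smooth_form ::
  "('a::topological_space, 'n::finite) chart set \<Rightarrow> 'a set \<Rightarrow> ('a \<Rightarrow> 'n form) \<Rightarrow> bool" where
  "smooth_form A W \<alpha> \<longleftrightarrow>
     (\<forall>c\<in>A. \<forall>is. smooth_fun A (fst c \<inter> W) (\<lambda>x. \<alpha> x (map (\<lambda>i. coord_vector A c i x) is)))"

definition volume_form ::
  "('a::topological_space, 'n::finite) chart set \<Rightarrow> ('a \<Rightarrow> 'n form) \<Rightarrow> bool" where
  "volume_form A vol \<longleftrightarrow>
     (\<forall>x. alternating_form CARD('n) (vol x) \<and> vol x \<noteq> (\<lambda>_. 0)) \<and> smooth_form A UNIV vol"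

text \<open>The form \<open>\<alpha>\<close> in the coordinates of the chart \<open>c\<close>: its value at \<open>y\<close> on vectors given by their
  components in \<open>c\<close>.\<close>

definition form_rep ::
  "('a::topological_space, 'n::finite) chart set \<Rightarrow> ('a, 'n) chart \<Rightarrow> ('a \<Rightarrow> 'n form)
     \<Rightarrow> real ^ 'n \<Rightarrow> 'n form" where
  "form_rep A c \<alpha> y vs =
     \<alpha> (cinv c y) (map (tchange c (chart_at A (cinv c y)) (cinv c y)) vs)"

text \<open>This is
  \<open>(L\<^sub>X \<alpha>)(v\<^sub>1,\<dots>,v\<^sub>k) = X(\<alpha>(v\<^sub>1,\<dots>,v\<^sub>k)) - (\<Sum>i. \<alpha>(v\<^sub>1,\<dots>,[X,v\<^sub>i],\<dots>,v\<^sub>k))\<close>,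
  where the \<open>v\<^sub>i\<close> are extended with constant components in the preferred chart at \<open>x\<close>, so that
  \<open>[X,v\<^sub>i] = - D X (v\<^sub>i)\<close>.\<close>

definition lie_derivative ::
  "('a::topological_space, 'n::finite) chart set \<Rightarrow> ('a \<Rightarrow> real ^ 'n) \<Rightarrow> ('a \<Rightarrow> 'n form)
     \<Rightarrow> 'a \<Rightarrow> 'n form" where
  "lie_derivative A X \<alpha> x vs =
     (let c = chart_at A x in
        frechet_derivative (\<lambda>y. form_rep A c \<alpha> y vs) (at (snd c x)) (X x)
      + (\<Sum>i<length vs.
           \<alpha> x (vs[i := frechet_derivative (vector_rep A c X) (at (snd c x)) (vs ! i)])))"


section \<open>Integration of forms over hypersurfaces\<close>

text \<open>A slice chart presents the hypersurface \<open>S\<close> inside its domain as a coordinate hyperplane.\<close>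

definition slice_chart ::
  "('a::topological_space, 'n::finite) chart set \<Rightarrow> 'a set \<Rightarrow> ('a, 'n) chart \<Rightarrow> 'n \<Rightarrow> bool" where
  "slice_chart A S c i \<longleftrightarrow> is_chart A c \<and> (\<forall>x\<in>fst c. x \<in> S \<longleftrightarrow> snd c x $ i = 0)"

text \<open>The integrand over the hyperplane for the form \<open>\<rho> \<alpha>\<close> of degree \<open>CARD('n) - 1\<close>; the hyperplane
  is parametrised by the coordinates with index different from \<open>i\<close>. The orientation of \<open>S\<close> is the one
  for which the form \<open>\<omega>\<close> is positive. Because of the factor \<open>sgn\<close>, the order in which the coordinate
  vectors are listed does not matter.\<close>

definition slice_integrand ::
  "('a::topological_space, 'n::finite) chart set \<Rightarrow> ('a \<Rightarrow> 'n form) \<Rightarrow> ('a \<Rightarrow> 'n form)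
     \<Rightarrow> ('a, 'n) chart \<Rightarrow> 'n \<Rightarrow> ('a \<Rightarrow> real) \<Rightarrow> ('n \<Rightarrow> real) \<Rightarrow> real" where
  "slice_integrand A \<omega> \<alpha> c i \<rho> y =
     (let z = (\<chi> j. if j = i then 0 else y j);
          x = cinv c z;
          js = (SOME js. distinct js \<and> set js = - {i});
          frame = map (\<lambda>j. coord_vector A c j x) js
      in if z \<in> snd c ` fst c then \<rho> x * sgn (\<omega> x frame) * \<alpha> x frame else 0)"

text \<open>\<open>I\<close> is the integral of \<open>\<alpha>\<close> over the hypersurface \<open>S\<close> oriented by \<open>\<omega>\<close>, computed with a
  partition of unity on the support of \<open>\<alpha>\<close> in \<open>S\<close>. As usual, it does not depend on the choices.\<close>

definition has_form_integral ::
  "('a::topological_space, 'n::finite) chart set \<Rightarrow> 'a set \<Rightarrow> ('a \<Rightarrow> 'n form) \<Rightarrow> ('a \<Rightarrow> 'n form)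
     \<Rightarrow> real \<Rightarrow> bool" where
  "has_form_integral A S \<omega> \<alpha> I \<longleftrightarrow>
     (\<exists>(N::nat) c i \<rho> J.
        (\<forall>k<N. slice_chart A S (c k) (i k) \<and> smooth_fun A UNIV (\<rho> k) \<and>
           compact (closure {x. \<rho> k x \<noteq> 0}) \<and> closure {x. \<rho> k x \<noteq> 0} \<subseteq> fst (c k) \<and>
           has_bochner_integral (Pi\<^sub>M (- {i k}) (\<lambda>_. lborel))
             (slice_integrand A \<omega> \<alpha> (c k) (i k) (\<rho> k)) (J k)) \<and>
        (\<forall>x\<in>S. \<alpha> x \<noteq> (\<lambda>_. 0) \<longrightarrow> (\<Sum>k<N. \<rho> k x) = 1) \<and>
        I = (\<Sum>k<N. J k))"


section \<open>Subriemannian manifolds\<close>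

type_synonym ('a, 'n) cometric = "'a \<Rightarrow> 'n covector \<Rightarrow> 'n covector \<Rightarrow> real"

definition subriemannian ::
  "('a::topological_space, 'n::finite) chart set \<Rightarrow> ('a, 'n) cometric \<Rightarrow> bool" where
  "subriemannian A g \<longleftrightarrow>
     (\<forall>x. bilinear (g x) \<and> (\<forall>w e. g x w e = g x e w) \<and> (\<forall>w. 0 \<le> g x w w)) \<and>
     (\<forall>c\<in>A. \<forall>i j. smooth_fun A (fst c)
        (\<lambda>x. g x (differential A (\<lambda>y. snd c y $ i) x) (differential A (\<lambda>y. snd c y $ j) x)))"

definition conorm :: "('a, 'n::finite) cometric \<Rightarrow> 'a \<Rightarrow> 'n covector \<Rightarrow> real" where
  "conorm g x w = sqrt (g x w w)"

definition sharp :: "('a, 'n::finite) cometric \<Rightarrow> 'a \<Rightarrow> 'n covector \<Rightarrow> real ^ 'n" where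
  "sharp g x \<eta> = (THE v. \<forall>w. blinfun_apply w v = g x w \<eta>)"

definition horizontal :: "('a, 'n::finite) cometric \<Rightarrow> 'a \<Rightarrow> (real ^ 'n) set" where
  "horizontal g x = range (sharp g x)"

definition covector_contraction ::
  "('a, 'n::finite) cometric \<Rightarrow> ('a \<Rightarrow> 'n form) \<Rightarrow> 'a \<Rightarrow> 'n covector \<Rightarrow> 'n form" where
  "covector_contraction g vol x w =
     (THE \<beta>. alternating_form (CARD('n) - 1) \<beta> \<and>
        (\<forall>\<eta>. wedge_covector \<eta> \<beta> = (\<lambda>vs. g x \<eta> w * vol x vs)))"

text \<open>A family of maps from \<open>U\<close> to the manifold, indexed by \<open>{-\<delta><..<\<delta>}\<close> and jointly smooth.\<close>

definition smooth_family ::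
  "('a::topological_space, 'n::finite) chart set \<Rightarrow> 'a set \<Rightarrow> real \<Rightarrow> (real \<Rightarrow> 'a \<Rightarrow> 'a) \<Rightarrow> bool"
where
  "smooth_family A U \<delta> \<Psi> \<longleftrightarrow>
     continuous_on ({-\<delta><..<\<delta>} \<times> U) (\<lambda>(a, x). \<Psi> a x) \<and>
     (\<forall>c\<in>A. \<forall>d\<in>A.
        smooth_on {(a, y). a \<in> {-\<delta><..<\<delta>} \<and> y \<in> snd c ` (fst c \<inter> U) \<and> \<Psi> a (cinv c y) \<in> fst d}
          (\<lambda>(a, y). snd d (\<Psi> a (cinv c y))))"

definition isometric_translations ::
  "('a::topological_space, 'n::finite) chart set \<Rightarrow> ('a, 'n) cometric \<Rightarrow> ('a \<Rightarrow> 'n form)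
     \<Rightarrow> 'a \<Rightarrow> 'a set \<Rightarrow> real \<Rightarrow> (real \<Rightarrow> 'a \<Rightarrow> 'a) \<Rightarrow> bool" where
  "isometric_translations A g vol p\<^sub>0 U \<delta> \<Psi> \<longleftrightarrow>
     open U \<and> p\<^sub>0 \<in> U \<and> \<delta> > 0 \<and> smooth_family A U \<delta> \<Psi> \<and>
     (\<forall>a\<in>{-\<delta><..<\<delta>}. local_diffeo A U (\<Psi> a)) \<and>
     (\<forall>x\<in>U. \<Psi> 0 x = x) \<and>
     (\<forall>a\<in>{-\<delta><..<\<delta>}. \<forall>b\<in>{-\<delta><..<\<delta>}. \<forall>x\<in>U.
        a + b \<in> {-\<delta><..<\<delta>} \<and> \<Psi> b x \<in> U \<longrightarrow> \<Psi> (a + b) x = \<Psi> a (\<Psi> b x)) \<and>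
     (\<forall>a\<in>{-\<delta><..<\<delta>}. \<forall>x\<in>U. \<Psi> a x \<in> U \<longrightarrow>
        (\<forall>w e. g x (pullback_covector A (\<Psi> a) x w) (pullback_covector A (\<Psi> a) x e) = g (\<Psi> a x) w e)) \<and>
     (\<forall>a\<in>{-\<delta><..<\<delta>}. \<forall>x\<in>U. \<forall>vs. vol (\<Psi> a x) (map (tangent_map A (\<Psi> a) x) vs) = vol x vs)"

definition transversal ::
  "('a::topological_space, 'n::finite) chart set \<Rightarrow> (real \<Rightarrow> 'a \<Rightarrow> 'a) \<Rightarrow> 'a set \<Rightarrow> bool" where
  "transversal A \<Psi> S \<longleftrightarrow> (\<forall>x\<in>S. velocity A (\<lambda>a. \<Psi> a x) \<notin> tangent_space A S x)"

definition defining_function ::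
  "('a::topological_space, 'n::finite) chart set \<Rightarrow> 'a set \<Rightarrow> ('a \<Rightarrow> real) \<Rightarrow> 'a set \<Rightarrow> bool" where
  "defining_function A U \<phi> S \<longleftrightarrow>
     smooth_fun A U \<phi> \<and> S = {x\<in>U. \<phi> x = 0} \<and> (\<forall>x\<in>S. differential A \<phi> x \<noteq> 0)"

definition compatible :: "'a set \<Rightarrow> real \<Rightarrow> (real \<Rightarrow> 'a \<Rightarrow> 'a) \<Rightarrow> ('a \<Rightarrow> real) \<Rightarrow> bool" where
  "compatible U \<delta> \<Psi> \<phi> \<longleftrightarrow> (\<forall>a\<in>{-\<delta><..<\<delta>}. \<forall>x\<in>U. \<Psi> a x \<in> U \<longrightarrow> \<phi> (\<Psi> a x) = \<phi> x - a)"


section \<open>The \<open>p\<close>-mean curvature of a hypersurface\<close>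

definition regular_set ::
  "('a::topological_space, 'n::finite) chart set \<Rightarrow> ('a, 'n) cometric \<Rightarrow> ('a \<Rightarrow> real) \<Rightarrow> 'a set
     \<Rightarrow> 'a set" where
  "regular_set A g \<phi> S = {x\<in>S. conorm g x (differential A \<phi> x) \<noteq> 0}"

definition p_area_form ::
  "('a::topological_space, 'n::finite) chart set \<Rightarrow> ('a, 'n) cometric \<Rightarrow> ('a \<Rightarrow> 'n form)
     \<Rightarrow> real \<Rightarrow> ('a \<Rightarrow> real) \<Rightarrow> 'a \<Rightarrow> 'n form" where
  "p_area_form A g vol p \<phi> x =
     covector_contraction g vol x
       ((1 / conorm g x (differential A \<phi> x) powr (1 - p)) *\<^sub>R differential A \<phi> x)"

definition p_normal ::
  "('a::topological_space, 'n::finite) chart set \<Rightarrow> ('a, 'n) cometric \<Rightarrow> ('a \<Rightarrow> 'n form)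
     \<Rightarrow> real \<Rightarrow> ('a \<Rightarrow> real) \<Rightarrow> 'a \<Rightarrow> real ^ 'n" where
  "p_normal A g vol p \<phi> x = (THE v. interior_product v (vol x) = p_area_form A g vol p \<phi> x)"

text \<open>\<open>H\<close> is the \<open>p\<close>-mean curvature of \<open>\<Sigma> = {x\<in>U. \<phi> x = 0}\<close>, a continuous function on the regular
  part of \<open>\<Sigma>\<close> characterised by the first variation formula. The test functions on the regular part
  are the restrictions of compactly supported smooth functions \<open>f\<close> on the open set where
  \<open>d\<phi>\<close> has nonzero length, so that \<open>f \<nu>\<close> is a vector field near \<open>\<Sigma>\<close>. Both integrands vanish outside
  a compact subset of the regular part, which is oriented by the \<open>p\<close>-area form.\<close>

definition p_mean_curvature ::
  "('a::topological_space, 'n::finite) chart set \<Rightarrow> ('a, 'n) cometric \<Rightarrow> ('a \<Rightarrow> 'n form)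
     \<Rightarrow> 'a set \<Rightarrow> real \<Rightarrow> ('a \<Rightarrow> real) \<Rightarrow> ('a \<Rightarrow> real) \<Rightarrow> bool" where
  "p_mean_curvature A g vol U p \<phi> H \<longleftrightarrow>
     (let \<Sigma> = regular_set A g \<phi> {x\<in>U. \<phi> x = 0};
          \<omega> = p_area_form A g vol p \<phi>;
          \<nu> = p_normal A g vol p \<phi>
      in continuous_on \<Sigma> H \<and>
         (\<forall>f. smooth_fun A UNIV f \<and> compact (closure {x. f x \<noteq> 0}) \<and>
              closure {x. f x \<noteq> 0} \<subseteq> regular_set A g \<phi> U \<longrightarrow>
            (\<forall>I J. has_form_integral A \<Sigma> \<omega> (lie_derivative A (\<lambda>x. f x *\<^sub>R \<nu> x) \<omega>) I \<and>
                   has_form_integral A \<Sigma> \<omega> (\<lambda>x vs. f x * H x * \<omega> x vs) J \<longrightarrow> I = J)))"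


section \<open>The rank condition\<close>

definition rank_condition ::
  "('a::topological_space, 'n::finite) chart set \<Rightarrow> ('a, 'n) cometric \<Rightarrow> 'a \<Rightarrow> nat \<Rightarrow> nat \<Rightarrow> bool"
where
  "rank_condition A g p\<^sub>0 r k \<longleftrightarrow>
     (\<exists>W. open W \<and> p\<^sub>0 \<in> W \<and>
        (\<forall>V X. open V \<and> V \<subseteq> W \<and>
           (\<forall>i<r. smooth_vector_field A V (X i) \<and> (\<forall>q\<in>V. X i q \<in> horizontal g q)) \<and>
           (\<forall>q\<in>V. \<forall>c. (\<Sum>i<r. c i *\<^sub>R X i q) = 0 \<longrightarrow> (\<forall>i<r. c i = 0)) \<longrightarrow>
           (\<forall>q\<in>V. k \<le> lie_rank A V r X q)))"

end

(* Write Sigma_1 and Sigma_2 in a chart at p_0 as the zero sets of u and v. Compatibility makes v - u invariant under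
   the translations, and the p-curvature operator in divergence form is invariant as well. Sliding each point onto Sigma_1 turns
   the hypotheses into u <= v and Q v <= Q u in a full neighbourhood, with equality u = v at p_0. The operator Q is elliptic
   only along xi, so the maximum principle is used in Bony's form: a Hopf barrier at a proximal normal N of the contact
   set Z = {u = v} forces every section of xi that annihilates dv to be orthogonal to N, i.e. tangent to Z. Tangency
   passes to Lie brackets (by following Euler polygons around a commutator), so by the rank condition N is orthogonal
   to an m-dimensional space in ker dv. The translation field is transversal to ker dv and preserves Z, hence it too is
   orthogonal to N and N = 0. A closed set with no nonzero proximal normals near p_0 is a neighbourhood of p_0. *)

theory Submission
  imports Defs
begin

section \<open>Calculus of smooth functions\<close>

text \<open>The curvature hypothesis concerns functions known only through integral identities on
  the regular parts of the two hypersurfaces; testing with bumps in slice charts turns them into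
  pointwise values of the divergence of \<open>\<nu>\<^sub>p\<close>. Compatibility carries these
  values to all neighbouring level sets, and this is what makes the comparison hold on an open set.
  Even along xi the linearised operator may degenerate in one direction: for p = 0 its quadratic
  form is the defect in the Cauchy-Schwarz inequality, which vanishes on dv itself. Hence only the
  hyperplane of xi inside ker dv is used. Its dimension m - l is the number of sections in the rank
  condition. All brackets of such sections stay in ker dv, so m is the largest rank they can have
  and one direction is always missing; the translation supplies it. Nothing is known about the
  contact set except that it is closed, so tangency is expressed by proximal normals, and curves in
  the contact set enter only through their second-order expansion at one point.\<close>

abbreviation fd :: "('a::real_normed_vector \<Rightarrow> 'b::real_normed_vector) \<Rightarrow> 'a \<Rightarrow> 'a \<Rightarrow> 'b" where
  "fd f x \<equiv> frechet_derivative f (at x)"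

lemma fd_eq: "(f has_derivative f') (at x) \<Longrightarrow> fd f x = f'"
  using frechet_derivative_at by metis

lemma fd_works: "f differentiable at x \<Longrightarrow> (f has_derivative fd f x) (at x)"
  using frechet_derivative_works by blast

section \<open>Locality and closure properties of the classes C^k\<close>

lemma differentiable_transform_open:
  assumes "open S" "x \<in> S" "\<And>y. y \<in> S \<Longrightarrow> f y = g y" "f differentiable at x"
  shows "g differentiable at x" "fd f x = fd g x"
  using has_derivative_transform_within_open[OF fd_works[OF assms(4)] assms(1,2,3)]
  by (auto simp: differentiable_def fd_eq)

lemma Ck_on_cong_imp:
  assumes "open S" "\<And>x. x \<in> S \<Longrightarrow> f x = g x" "Ck_on k S f"
  shows "Ck_on k S g"
  using assms(2,3)
proof (induction k arbitrary: f g)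
  case 0
  then show ?case using continuous_on_cong[of S S f g] by auto
next
  case (Suc k)
  have d: "f differentiable at x" if "x \<in> S" for x using Suc that by auto
  have "fd f x = fd g x" if "x \<in> S" for x
    using differentiable_transform_open(2)[OF assms(1) that Suc.prems(1) d[OF that]] .
  then have "Ck_on k S (\<lambda>x. fd g x v)" for v
    using Suc.IH[of "\<lambda>x. fd f x v" "\<lambda>x. fd g x v"] Suc.prems by auto
  then show ?case
    using differentiable_transform_open(1)[OF assms(1) _ Suc.prems(1) d] by auto
qed

lemma Ck_on_cong:
  assumes "open S" "\<And>x. x \<in> S \<Longrightarrow> f x = g x"
  shows "Ck_on k S f \<longleftrightarrow> Ck_on k S g"
  using Ck_on_cong_imp[OF assms(1), of f g] Ck_on_cong_imp[OF assms(1), of g f] assms(2) by metis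

lemma Ck_on_subset: "Ck_on k S f \<Longrightarrow> T \<subseteq> S \<Longrightarrow> Ck_on k T f"
  by (induction k arbitrary: f) (auto intro: continuous_on_subset)

lemma Ck_on_Suc_lower: "Ck_on (Suc k) S f \<Longrightarrow> Ck_on k S f"
proof (induction k arbitrary: f)
  case 0
  then show ?case
    by (auto intro!: continuous_at_imp_continuous_on differentiable_imp_continuous_within)
next
  case (Suc k)
  then show ?case by (metis Ck_on.simps(2))
qed

lemma Ck_on_lower: "Ck_on k S f \<Longrightarrow> j \<le> k \<Longrightarrow> Ck_on j S f"
  by (induction k) (use Ck_on_Suc_lower le_Suc_eq in \<open>blast | simp\<close>)+

lemma Ck_on_continuous: "Ck_on k S f \<Longrightarrow> continuous_on S f"
  using Ck_on_lower[of k S f 0] by simp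

lemma Ck_on_local:
  assumes "open S" "\<And>x. x \<in> S \<Longrightarrow> \<exists>T. open T \<and> x \<in> T \<and> Ck_on k (S \<inter> T) f"
  shows "Ck_on k S f"
  using assms(2)
proof (induction k arbitrary: f)
  case 0
  have "continuous (at x) f" if x: "x \<in> S" for x
  proof -
    obtain T where "open T" "x \<in> T" "continuous_on (S \<inter> T) f" using 0[OF x] by auto
    then show ?thesis using x assms(1)
      by (metis Int_iff continuous_on_eq_continuous_at open_Int)
  qed
  then show ?case by (simp add: continuous_at_imp_continuous_on)
next
  case (Suc k)
  have "Ck_on k S (\<lambda>x. fd f x v)" for v
  proof (rule Suc.IH)
    fix x assume "x \<in> S"
    then show "\<exists>T. open T \<and> x \<in> T \<and> Ck_on k (S \<inter> T) (\<lambda>x. fd f x v)"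
      using Suc.prems[of x] by (metis Ck_on.simps(2))
  qed
  then show ?case using Suc.prems by fastforce
qed

lemma Ck_on_const [simp]: "Ck_on k S (\<lambda>x. c)"
proof (induction k arbitrary: c)
  case (Suc k)
  show ?case using Suc[of 0] by simp
qed simp

lemma Ck_on_bounded_linear:
  assumes "bounded_linear L"
  shows "Ck_on k S L"
proof (cases k)
  case 0
  then show ?thesis using assms by (simp add: linear_continuous_on)
next
  case (Suc j)
  have "(L has_derivative L) (at x)" for x using assms by (rule bounded_linear_imp_has_derivative)
  then have "L differentiable at x" "fd L x = L" for x by (auto simp: fd_eq differentiable_def)
  then show ?thesis using Suc by simp
qed

lemma Ck_on_id [simp]: "Ck_on k S (\<lambda>x. x)"
  by (rule Ck_on_bounded_linear) (rule bounded_linear_ident)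

lemma Ck_on_SucI:
  assumes "open S" "\<And>x. x \<in> S \<Longrightarrow> (f has_derivative f' x) (at x)"
    and "\<And>v. Ck_on k S (\<lambda>x. f' x v)"
  shows "Ck_on (Suc k) S f"
proof -
  have "fd f x v = f' x v" if "x \<in> S" for x v using assms(2)[OF that] by (simp add: fd_eq)
  then have "Ck_on k S (\<lambda>x. fd f x v)" for v
    using Ck_on_cong[OF assms(1), of "\<lambda>x. fd f x v" "\<lambda>x. f' x v"] assms(3) by auto
  then show ?thesis using assms(2) by (auto simp: differentiable_def)
qed

lemma Ck_on_differentiable: "Ck_on (Suc k) S f \<Longrightarrow> x \<in> S \<Longrightarrow> (f has_derivative fd f x) (at x)"
  by (simp add: fd_works)

lemma Ck_on_compose_linear:
  assumes "bounded_linear L" "open S" "Ck_on k S f"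
  shows "Ck_on k S (\<lambda>x. L (f x))"
  using assms(3)
proof (induction k arbitrary: f)
  case 0
  then show ?case using assms(1) by (simp add: bounded_linear.continuous_on)
next
  case (Suc k)
  show ?case
  proof (rule Ck_on_SucI[OF assms(2), where f' = "\<lambda>x v. L (fd f x v)"])
    show "((\<lambda>x. L (f x)) has_derivative (\<lambda>v. L (fd f x v))) (at x)" if "x \<in> S" for x
      using bounded_linear.has_derivative[OF assms(1) Ck_on_differentiable[OF Suc.prems that]] .
    show "Ck_on k S (\<lambda>x. L (fd f x v))" for v by (rule Suc.IH) (use Suc.prems in simp)
  qed
qed

lemma Ck_on_add:
  assumes "open S" "Ck_on k S f" "Ck_on k S g"
  shows "Ck_on k S (\<lambda>x. f x + g x)"
  using assms(2,3)
proof (induction k arbitrary: f g)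
  case 0
  then show ?case by (simp add: continuous_on_add)
next
  case (Suc k)
  show ?case
  proof (rule Ck_on_SucI[OF assms(1), where f' = "\<lambda>x v. fd f x v + fd g x v"])
    show "((\<lambda>x. f x + g x) has_derivative (\<lambda>v. fd f x v + fd g x v)) (at x)" if "x \<in> S" for x
      using has_derivative_add[OF Suc.prems[THEN Ck_on_differentiable, OF that]] .
    show "Ck_on k S (\<lambda>x. fd f x v + fd g x v)" for v by (rule Suc.IH) (use Suc.prems in simp_all)
  qed
qed

lemma Ck_on_bilinear:
  assumes "bounded_bilinear B" "open S" "Ck_on k S f" "Ck_on k S g"
  shows "Ck_on k S (\<lambda>x. B (f x) (g x))"
  using assms(3,4)
proof (induction k arbitrary: f g)
  case 0
  then show ?case using assms(1) by (simp add: bounded_bilinear.continuous_on)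
next
  case (Suc k)
  have low: "Ck_on k S f" "Ck_on k S g" using Suc.prems Ck_on_Suc_lower by blast+
  show ?case
  proof (rule Ck_on_SucI[OF assms(2), where f' = "\<lambda>x v. B (f x) (fd g x v) + B (fd f x v) (g x)"])
    show "((\<lambda>x. B (f x) (g x)) has_derivative (\<lambda>v. B (f x) (fd g x v) + B (fd f x v) (g x))) (at x)"
      if "x \<in> S" for x
      using bounded_bilinear.FDERIV[OF assms(1) Suc.prems[THEN Ck_on_differentiable, OF that]] .
    show "Ck_on k S (\<lambda>x. B (f x) (fd g x v) + B (fd f x v) (g x))" for v
      using Suc.prems by (intro Ck_on_add[OF assms(2)] Suc.IH low) simp_all
  qed
qed

lemmas Ck_on_scaleR = Ck_on_bilinear[OF bounded_bilinear_scaleR]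
lemmas Ck_on_mult = Ck_on_bilinear[OF bounded_bilinear_mult]
lemmas Ck_on_inner = Ck_on_bilinear[OF bounded_bilinear_inner]

lemma Ck_on_minus: "open S \<Longrightarrow> Ck_on k S f \<Longrightarrow> Ck_on k S (\<lambda>x. - f x)"
  by (rule Ck_on_compose_linear[OF bounded_linear_minus[OF bounded_linear_ident]])

lemma Ck_on_diff:
  "open S \<Longrightarrow> Ck_on k S f \<Longrightarrow> Ck_on k S g \<Longrightarrow> Ck_on k S (\<lambda>x. f x - g x)"
  using Ck_on_add[of S k f "\<lambda>x. - g x"] Ck_on_minus[of S k g] by simp

lemma Ck_on_sum:
  assumes "open S" "\<And>i. i \<in> I \<Longrightarrow> Ck_on k S (f i)"
  shows "Ck_on k S (\<lambda>x. \<Sum>i\<in>I. f i x)"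
  using assms(2)
proof (induction I rule: infinite_finite_induct)
  case (insert i I)
  then show ?case by (simp add: Ck_on_add[OF assms(1)])
qed simp_all

lemma Ck_on_Pair:
  fixes f :: "'a::euclidean_space \<Rightarrow> 'b::real_normed_vector" and g :: "'a \<Rightarrow> 'c::real_normed_vector"
  assumes "open S" "Ck_on k S f" "Ck_on k S g"
  shows "Ck_on k S (\<lambda>x. (f x, g x))"
proof -
  have "bounded_linear (\<lambda>y::'b. (y, 0::'c))" "bounded_linear (\<lambda>y::'c. (0::'b, y))"
    by (auto intro: bounded_linear_Pair bounded_linear_ident bounded_linear_zero)
  from Ck_on_add[OF assms(1) Ck_on_compose_linear[OF this(1) assms(1,2)]
      Ck_on_compose_linear[OF this(2) assms(1,3)]]
  show ?thesis by simp
qed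

lemma linear_fd_expand:
  fixes f :: "'a::euclidean_space \<Rightarrow> 'b::real_normed_vector"
  assumes "f differentiable at x"
  shows "fd f x v = (\<Sum>b\<in>Basis. (v \<bullet> b) *\<^sub>R fd f x b)"
proof -
  have l: "linear (fd f x)" using assms by (rule linear_frechet_derivative)
  have "fd f x v = fd f x (\<Sum>b\<in>Basis. (v \<bullet> b) *\<^sub>R b)" by (simp add: euclidean_representation)
  also have "\<dots> = (\<Sum>b\<in>Basis. (v \<bullet> b) *\<^sub>R fd f x b)"
    by (simp add: linear_sum[OF l] linear_scale[OF l])
  finally show ?thesis .
qed

text \<open>\<open>Ck_on\<close> controls directional derivatives in fixed directions only, while
  the chain rule evaluates \<open>fd g (f x)\<close> in the moving direction
  \<open>fd f x v\<close>. Expanding that direction in the basis reduces it to fixed ones with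
  coefficients of the same class.\<close>

lemma Ck_on_compose:
  fixes g :: "'b::euclidean_space \<Rightarrow> 'c::real_normed_vector" and f :: "'a::euclidean_space \<Rightarrow> 'b"
  assumes "open S" "open T" "Ck_on k S f" "Ck_on k T g" "\<And>x. x \<in> S \<Longrightarrow> f x \<in> T"
  shows "Ck_on k S (\<lambda>x. g (f x))"
  using assms(3,4)
proof (induction k arbitrary: g)
  case 0
  then show ?case using assms(5) continuous_on_compose2[of T g S f] by auto
next
  case (Suc k)
  have dg: "(g has_derivative fd g (f x)) (at (f x))" and df: "(f has_derivative fd f x) (at x)"
    if "x \<in> S" for x
    using Ck_on_differentiable[OF Suc.prems(2) assms(5)[OF that]]
      Ck_on_differentiable[OF Suc.prems(1) that] .
  have exp: "fd g (f x) v = (\<Sum>b\<in>Basis. (v \<bullet> b) *\<^sub>R fd g (f x) b)" if "x \<in> S" for x v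
    by (rule linear_fd_expand) (use dg[OF that] in \<open>auto simp: differentiable_def\<close>)
  show ?case
  proof (rule Ck_on_SucI[OF assms(1), where f' = "\<lambda>x v. \<Sum>b\<in>Basis. (fd f x v \<bullet> b) *\<^sub>R fd g (f x) b"])
    fix x assume x: "x \<in> S"
    have "((\<lambda>x. g (f x)) has_derivative (\<lambda>v. fd g (f x) (fd f x v))) (at x)"
      using has_derivative_compose[OF df[OF x] dg[OF x]] .
    then show "((\<lambda>x. g (f x)) has_derivative (\<lambda>v. \<Sum>b\<in>Basis. (fd f x v \<bullet> b) *\<^sub>R fd g (f x) b)) (at x)"
      by (rule has_derivative_eq_rhs) (rule ext, rule exp[OF x])
  next
    fix v
    have f: "Ck_on k S (\<lambda>x. fd f x v)" using Suc.prems by simp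
    have g: "Ck_on k S (\<lambda>x. fd g (f x) b)" for b
      using Suc.prems(2) by (intro Suc.IH Ck_on_Suc_lower[OF Suc.prems(1)]) simp
    show "Ck_on k S (\<lambda>x. \<Sum>b\<in>Basis. (fd f x v \<bullet> b) *\<^sub>R fd g (f x) b)"
      by (intro Ck_on_sum[OF assms(1)] Ck_on_scaleR[OF assms(1) Ck_on_inner[OF assms(1)]] f g Ck_on_const)
  qed
qed

lemma Ck_on_fd:
  assumes "open S" "Ck_on (Suc k) S f" "Ck_on k S V"
  shows "Ck_on k S (\<lambda>x. fd f x (V x))"
proof -
  have "Ck_on k S (\<lambda>x. \<Sum>b\<in>Basis. (V x \<bullet> b) *\<^sub>R fd f x b)"
    using assms by (intro Ck_on_sum[OF assms(1)] Ck_on_scaleR[OF assms(1)] Ck_on_inner[OF assms(1)]) auto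
  moreover have "(\<Sum>b\<in>Basis. (V x \<bullet> b) *\<^sub>R fd f x b) = fd f x (V x)" if "x \<in> S" for x
    by (rule linear_fd_expand[symmetric]) (use assms(2) that in simp)
  ultimately show ?thesis by (rule Ck_on_cong_imp[OF assms(1), rotated])
qed

section \<open>Reciprocals and real powers\<close>

lemma Ck_on_real_SucI:
  fixes h :: "real \<Rightarrow> real"
  assumes "open T" "\<And>x. x \<in> T \<Longrightarrow> (h has_real_derivative h' x) (at x)" "Ck_on k T h'"
  shows "Ck_on (Suc k) T h"
  by (rule Ck_on_SucI[OF assms(1), where f' = "\<lambda>x v. h' x * v"])
    (use assms in \<open>simp_all add: has_field_derivative_def Ck_on_mult\<close>)

lemma Ck_on_inverse_real: "Ck_on k (- {0::real}) inverse"
proof (induction k)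
  case 0
  then show ?case by (auto intro!: continuous_intros)
next
  case (Suc k)
  have o: "open (- {0::real})" by auto
  show ?case
    by (rule Ck_on_real_SucI[OF o, where h' = "\<lambda>x. - (inverse x * inverse x)"])
      (use Suc in \<open>auto intro!: Ck_on_minus Ck_on_mult derivative_eq_intros\<close>)
qed

lemma Ck_on_powr_real: "Ck_on k {0::real<..} (\<lambda>x. x powr a)"
proof (induction k arbitrary: a)
  case 0
  then show ?case by (auto intro!: continuous_intros)
next
  case (Suc k)
  show ?case
    by (rule Ck_on_real_SucI[where h' = "\<lambda>x. a * x powr (a - 1)"])
      (use Suc in \<open>auto intro!: Ck_on_mult derivative_eq_intros\<close>)
qed

lemma Ck_on_divide:
  fixes f g :: "'a::euclidean_space \<Rightarrow> real"
  assumes "open S" "Ck_on k S f" "Ck_on k S g" "\<And>x. x \<in> S \<Longrightarrow> g x \<noteq> 0"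
  shows "Ck_on k S (\<lambda>x. f x / g x)"
proof -
  have "Ck_on k S (\<lambda>x. inverse (g x))"
    by (rule Ck_on_compose[OF assms(1) _ assms(3) Ck_on_inverse_real]) (use assms in auto)
  then show ?thesis using Ck_on_mult[OF assms(1,2)] by (simp add: divide_inverse)
qed

lemma Ck_on_powr:
  fixes f :: "'a::euclidean_space \<Rightarrow> real"
  assumes "open S" "Ck_on k S f" "\<And>x. x \<in> S \<Longrightarrow> f x > 0"
  shows "Ck_on k S (\<lambda>x. f x powr a)"
  by (rule Ck_on_compose[OF assms(1) _ assms(2) Ck_on_powr_real]) (use assms in auto)

section \<open>Smoothness as C^k for every k\<close>

lemma smooth_on_Ck: "smooth_on S f \<Longrightarrow> Ck_on k S f"
  by (simp add: smooth_on_def)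

lemma smooth_on_compose:
  fixes g :: "'b::euclidean_space \<Rightarrow> 'c::real_normed_vector" and f :: "'a::euclidean_space \<Rightarrow> 'b"
  assumes "open S" "open T" "smooth_on S f" "smooth_on T g" "\<And>x. x \<in> S \<Longrightarrow> f x \<in> T"
  shows "smooth_on S (\<lambda>x. g (f x))"
  using assms Ck_on_compose unfolding smooth_on_def by blast

lemma smooth_on_fd: "open S \<Longrightarrow> smooth_on S f \<Longrightarrow> smooth_on S V \<Longrightarrow> smooth_on S (\<lambda>x. fd f x (V x))"
  unfolding smooth_on_def using Ck_on_fd by blast

lemma smooth_on_cong:
  "open S \<Longrightarrow> (\<And>x. x \<in> S \<Longrightarrow> f x = g x) \<Longrightarrow> smooth_on S f \<longleftrightarrow> smooth_on S g"
  unfolding smooth_on_def using Ck_on_cong by blast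

lemma smooth_on_transform:
  "open S \<Longrightarrow> smooth_on S g \<Longrightarrow> (\<And>x. x \<in> S \<Longrightarrow> f x = g x) \<Longrightarrow> smooth_on S f"
  using smooth_on_cong[of S f g] by simp

lemma smooth_on_subset: "smooth_on S f \<Longrightarrow> T \<subseteq> S \<Longrightarrow> smooth_on T f"
  unfolding smooth_on_def using Ck_on_subset by blast

lemma smooth_on_local:
  assumes "open S" "\<And>x. x \<in> S \<Longrightarrow> \<exists>T. open T \<and> x \<in> T \<and> smooth_on (S \<inter> T) f"
  shows "smooth_on S f"
  unfolding smooth_on_def
proof
  fix k
  show "Ck_on k S f"
  proof (rule Ck_on_local[OF assms(1)])
    fix x assume "x \<in> S"
    then show "\<exists>T. open T \<and> x \<in> T \<and> Ck_on k (S \<inter> T) f"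
      using assms(2)[of x] smooth_on_Ck by metis
  qed
qed

lemma smooth_on_has_derivative: "smooth_on S f \<Longrightarrow> x \<in> S \<Longrightarrow> (f has_derivative fd f x) (at x)"
  using Ck_on_differentiable smooth_on_Ck by blast

lemma smooth_on_differentiable: "smooth_on S f \<Longrightarrow> x \<in> S \<Longrightarrow> f differentiable at x"
  using smooth_on_has_derivative differentiable_def by blast

lemma smooth_on_continuous: "smooth_on S f \<Longrightarrow> continuous_on S f"
  using Ck_on_continuous smooth_on_Ck by blast

lemma smooth_on_const: "smooth_on S (\<lambda>x. c)"
  by (simp add: smooth_on_def)

lemma smooth_on_id: "smooth_on S (\<lambda>x. x)"
  by (simp add: smooth_on_def)

lemma smooth_on_add:
  "open S \<Longrightarrow> smooth_on S f \<Longrightarrow> smooth_on S g \<Longrightarrow> smooth_on S (\<lambda>x. f x + g x)"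
  by (simp add: smooth_on_def Ck_on_add)

lemma smooth_on_diff:
  "open S \<Longrightarrow> smooth_on S f \<Longrightarrow> smooth_on S g \<Longrightarrow> smooth_on S (\<lambda>x. f x - g x)"
  by (simp add: smooth_on_def Ck_on_diff)

lemma smooth_on_minus: "open S \<Longrightarrow> smooth_on S f \<Longrightarrow> smooth_on S (\<lambda>x. - f x)"
  by (simp add: smooth_on_def Ck_on_minus)

lemma smooth_on_scaleR:
  "open S \<Longrightarrow> smooth_on S f \<Longrightarrow> smooth_on S g \<Longrightarrow> smooth_on S (\<lambda>x. f x *\<^sub>R g x)"
  by (simp add: smooth_on_def Ck_on_scaleR)

lemma smooth_on_mult:
  fixes f g :: "'a::euclidean_space \<Rightarrow> real"
  shows "open S \<Longrightarrow> smooth_on S f \<Longrightarrow> smooth_on S g \<Longrightarrow> smooth_on S (\<lambda>x. f x * g x)"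
  by (simp add: smooth_on_def Ck_on_mult)

lemma smooth_on_inner:
  "open S \<Longrightarrow> smooth_on S f \<Longrightarrow> smooth_on S g \<Longrightarrow> smooth_on S (\<lambda>x. f x \<bullet> g x)"
  by (simp add: smooth_on_def Ck_on_inner)

lemma smooth_on_sum:
  "open S \<Longrightarrow> (\<And>i. i \<in> I \<Longrightarrow> smooth_on S (f i)) \<Longrightarrow> smooth_on S (\<lambda>x. \<Sum>i\<in>I. f i x)"
  by (simp add: smooth_on_def Ck_on_sum)

lemma smooth_on_Pair:
  "open S \<Longrightarrow> smooth_on S f \<Longrightarrow> smooth_on S g \<Longrightarrow> smooth_on S (\<lambda>x. (f x, g x))"
  by (simp add: smooth_on_def Ck_on_Pair)

lemma smooth_on_divide:
  fixes f g :: "'a::euclidean_space \<Rightarrow> real"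
  shows "open S \<Longrightarrow> smooth_on S f \<Longrightarrow> smooth_on S g \<Longrightarrow> (\<And>x. x \<in> S \<Longrightarrow> g x \<noteq> 0)
    \<Longrightarrow> smooth_on S (\<lambda>x. f x / g x)"
  by (simp add: smooth_on_def Ck_on_divide)

lemma smooth_on_powr:
  fixes f :: "'a::euclidean_space \<Rightarrow> real"
  shows "open S \<Longrightarrow> smooth_on S f \<Longrightarrow> (\<And>x. x \<in> S \<Longrightarrow> f x > 0) \<Longrightarrow> smooth_on S (\<lambda>x. f x powr a)"
  by (simp add: smooth_on_def Ck_on_powr)

lemmas smooth_on_intros = smooth_on_const smooth_on_id smooth_on_add smooth_on_diff smooth_on_minus
  smooth_on_scaleR smooth_on_mult smooth_on_inner smooth_on_sum smooth_on_Pair smooth_on_divide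
  smooth_on_powr

lemma smooth_on_linear: "bounded_linear L \<Longrightarrow> smooth_on S L"
  by (simp add: smooth_on_def Ck_on_bounded_linear)

text \<open>Two applications of the mean value theorem to the second difference quotient.\<close>

lemma second_difference_mean_value:
  fixes f :: "'a::euclidean_space \<Rightarrow> real"
  assumes "Ck_on 2 S f" "open S" "\<And>a b. a \<in> {0..t} \<Longrightarrow> b \<in> {0..t} \<Longrightarrow> x + a *\<^sub>R v + b *\<^sub>R w \<in> S" "t > 0"
  shows "\<exists>a\<in>{0..t}. \<exists>b\<in>{0..t}. f (x + t *\<^sub>R v + t *\<^sub>R w) - f (x + t *\<^sub>R v) - f (x + t *\<^sub>R w) + f x
     = t * t * fd (\<lambda>y. fd f y v) (x + a *\<^sub>R v + b *\<^sub>R w) w"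
proof -
  have C: "Ck_on (Suc (Suc 0)) S f" using assms(1) by (simp add: numeral_2_eq_2)
  have df: "(f has_derivative fd f y) (at y)" if "y \<in> S" for y
    using Ck_on_differentiable[OF C that] .
  have "Ck_on (Suc 0) S (\<lambda>y. fd f y v)" using C by simp
  then have ddf: "((\<lambda>y. fd f y v) has_derivative fd (\<lambda>y. fd f y v) y) (at y)" if "y \<in> S" for y
    using Ck_on_differentiable that by blast
  define \<phi> where "\<phi> s = f (x + s *\<^sub>R v + t *\<^sub>R w) - f (x + s *\<^sub>R v + 0 *\<^sub>R w)" for s
  have d1: "((\<lambda>s. f (x + s *\<^sub>R v + b *\<^sub>R w)) has_real_derivative fd f (x + s *\<^sub>R v + b *\<^sub>R w) v) (at s)"
    if "s \<in> {0..t}" "b \<in> {0..t}" for s b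
  proof -
    have "((\<lambda>s. x + s *\<^sub>R v + b *\<^sub>R w) has_derivative (\<lambda>h. h *\<^sub>R v)) (at s)"
      by (auto intro!: derivative_eq_intros)
    from has_derivative_compose[OF this, of f, OF df[OF assms(3)[OF that]]] show ?thesis
      unfolding has_field_derivative_def by (rule has_derivative_eq_rhs)
        (simp add: fun_eq_iff linear_scale[OF has_derivative_linear[OF df[OF assms(3)[OF that]]]])
  qed
  have "(\<phi> has_real_derivative fd f (x + s *\<^sub>R v + t *\<^sub>R w) v - fd f (x + s *\<^sub>R v + 0 *\<^sub>R w) v) (at s)"
    if "s \<in> {0..t}" for s
    unfolding \<phi>_def using that assms(4) by (intro DERIV_diff d1) auto
  then obtain a where a: "0 < a" "a < t"
    "\<phi> t - \<phi> 0 = (t - 0) * (fd f (x + a *\<^sub>R v + t *\<^sub>R w) v - fd f (x + a *\<^sub>R v + 0 *\<^sub>R w) v)"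
    using MVT2[OF assms(4), of \<phi> "\<lambda>s. fd f (x + s *\<^sub>R v + t *\<^sub>R w) v - fd f (x + s *\<^sub>R v + 0 *\<^sub>R w) v"]
    by auto
  have d2: "((\<lambda>b. fd f (x + a *\<^sub>R v + b *\<^sub>R w) v) has_real_derivative fd (\<lambda>y. fd f y v) (x + a *\<^sub>R v + b *\<^sub>R w) w) (at b)"
    if "b \<in> {0..t}" for b
  proof -
    have m: "x + a *\<^sub>R v + b *\<^sub>R w \<in> S" using a that by (intro assms(3)) auto
    have "((\<lambda>b. x + a *\<^sub>R v + b *\<^sub>R w) has_derivative (\<lambda>h. h *\<^sub>R w)) (at b)"
      by (auto intro!: derivative_eq_intros)
    from has_derivative_compose[OF this, of "\<lambda>y. fd f y v", OF ddf[OF m]] show ?thesis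
      unfolding has_field_derivative_def by (rule has_derivative_eq_rhs)
        (simp add: fun_eq_iff linear_scale[OF has_derivative_linear[OF ddf[OF m]]])
  qed
  obtain b where b: "0 < b" "b < t"
    "fd f (x + a *\<^sub>R v + t *\<^sub>R w) v - fd f (x + a *\<^sub>R v + 0 *\<^sub>R w) v = (t - 0) * fd (\<lambda>y. fd f y v) (x + a *\<^sub>R v + b *\<^sub>R w) w"
    using MVT2[OF assms(4), of "\<lambda>b. fd f (x + a *\<^sub>R v + b *\<^sub>R w) v"
        "\<lambda>b. fd (\<lambda>y. fd f y v) (x + a *\<^sub>R v + b *\<^sub>R w) w"] d2 by auto
  have "\<phi> t - \<phi> 0 = t * t * fd (\<lambda>y. fd f y v) (x + a *\<^sub>R v + b *\<^sub>R w) w" 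
    unfolding a(3) b(3) by simp
  moreover have "f (x + t *\<^sub>R v + t *\<^sub>R w) - f (x + t *\<^sub>R v) - f (x + t *\<^sub>R w) + f x = \<phi> t - \<phi> 0"
    by (simp add: \<phi>_def)
  moreover have "a \<in> {0..t}" "b \<in> {0..t}" using a b by auto
  ultimately show ?thesis by metis
qed

text \<open>The second difference is symmetric in \<open>v\<close> and \<open>w\<close>, and the
  mean value form expresses it by either mixed derivative at points near \<open>x\<close>. Different
  values at \<open>x\<close> would contradict continuity.\<close>

lemma second_derivative_symmetric_real:
  fixes f :: "'a::euclidean_space \<Rightarrow> real"
  assumes "open S" "Ck_on 2 S f" "x \<in> S"
  shows "fd (\<lambda>y. fd f y v) x w = fd (\<lambda>y. fd f y w) x v"
proof (rule ccontr)
  let ?F = "\<lambda>y. fd (\<lambda>y. fd f y v) y w" and ?G = "\<lambda>y. fd (\<lambda>y. fd f y w) y v"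
  assume ne: "?F x \<noteq> ?G x"
  \<comment> \<open>Half the gap, so that values within \<open>e\<close> of the two limits cannot
    coincide.\<close>
  define e where "e = \<bar>?F x - ?G x\<bar> / 2"
  have e: "e > 0" using ne by (simp add: e_def)
  have "continuous_on S ?F" "continuous_on S ?G"
    using assms(2) by (simp_all add: numeral_2_eq_2)
  then have "continuous (at x) ?F" "continuous (at x) ?G"
    using assms by (simp_all add: continuous_on_eq_continuous_at)
  then have lim: "?F \<midarrow>x\<rightarrow> ?F x" "?G \<midarrow>x\<rightarrow> ?G x" by (simp_all only: isCont_def)
  obtain d1 where d1: "d1 > 0" "\<And>y. y \<noteq> x \<Longrightarrow> dist y x < d1 \<Longrightarrow> dist (?F y) (?F x) < e"
    using LIM_D[OF lim(1) e] unfolding dist_norm by meson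
  obtain d2 where d2: "d2 > 0" "\<And>y. y \<noteq> x \<Longrightarrow> dist y x < d2 \<Longrightarrow> dist (?G y) (?G x) < e"
    using LIM_D[OF lim(2) e] unfolding dist_norm by meson
  have d: "d1 > 0" "d2 > 0" "dist y x < d1 \<Longrightarrow> \<bar>?F y - ?F x\<bar> < e"
    "dist y x < d2 \<Longrightarrow> \<bar>?G y - ?G x\<bar> < e" for y
    using d1 d2 e by (cases "y = x"; simp add: dist_real_def)+
  obtain d3 where d3: "d3 > 0" "ball x d3 \<subseteq> S" using assms openE by blast
  define d where "d = min d1 (min d2 d3)"
  have dpos: "d > 0" using d d3 by (simp add: d_def)
  define n where "n = norm v + norm w + 1"
  have n: "n > 0" unfolding n_def by (intro add_nonneg_pos) auto
  \<comment> \<open>Keeps the parallelogram spanned by \<open>t v\<close> and \<open>t w\<close>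
    within distance \<open>d\<close> of \<open>x\<close>; the summand 1 in \<open>n\<close> covers
    vanishing vectors.\<close>
  define t where "t = d / (2 * n)"
  have t: "t > 0" using dpos n by (simp add: t_def)
  have near: "dist (x + a *\<^sub>R v + b *\<^sub>R w) x < d" if "a \<in> {0..t}" "b \<in> {0..t}" for a b
  proof -
    have "dist (x + a *\<^sub>R v + b *\<^sub>R w) x \<le> a * norm v + b * norm w"
      using that norm_triangle_ineq[of "a *\<^sub>R v" "b *\<^sub>R w"] by (simp add: dist_norm)
    also have "\<dots> \<le> t * norm v + t * norm w" using that by (intro add_mono mult_right_mono) auto
    also have "\<dots> < t * n" using t by (simp add: n_def algebra_simps)
    also have "\<dots> < d" using n dpos by (simp add: t_def)
    finally show ?thesis .
  qed
  have inS: "x + a *\<^sub>R v + b *\<^sub>R w \<in> S" "x + a *\<^sub>R w + b *\<^sub>R v \<in> S" if "a \<in> {0..t}" "b \<in> {0..t}" for a b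
  proof -
    have "x + a *\<^sub>R v + b *\<^sub>R w \<in> ball x d3" using near[OF that] by (simp add: d_def dist_commute)
    moreover have "x + a *\<^sub>R w + b *\<^sub>R v \<in> ball x d3"
      using near[OF that(2,1)] by (simp add: d_def dist_commute algebra_simps)
    ultimately show "x + a *\<^sub>R v + b *\<^sub>R w \<in> S" "x + a *\<^sub>R w + b *\<^sub>R v \<in> S" using d3 by blast+
  qed
  obtain a b where ab: "a \<in> {0..t}" "b \<in> {0..t}" "f (x + t *\<^sub>R v + t *\<^sub>R w) - f (x + t *\<^sub>R v) - f (x + t *\<^sub>R w) + f x
     = t * t * ?F (x + a *\<^sub>R v + b *\<^sub>R w)"
    using second_difference_mean_value[OF assms(2,1) inS(1) t] by blast
  obtain a' b' where ab': "a' \<in> {0..t}" "b' \<in> {0..t}" "f (x + t *\<^sub>R w + t *\<^sub>R v) - f (x + t *\<^sub>R w) - f (x + t *\<^sub>R v) + f x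
     = t * t * ?G (x + a' *\<^sub>R w + b' *\<^sub>R v)"
    using second_difference_mean_value[OF assms(2,1) inS(2) t] by blast
  have "t * t * ?F (x + a *\<^sub>R v + b *\<^sub>R w) = t * t * ?G (x + b' *\<^sub>R v + a' *\<^sub>R w)"
    using ab(3) ab'(3) by (simp add: algebra_simps)
  then have eq: "?F (x + a *\<^sub>R v + b *\<^sub>R w) = ?G (x + b' *\<^sub>R v + a' *\<^sub>R w)" using t by simp
  have "\<bar>?F (x + a *\<^sub>R v + b *\<^sub>R w) - ?F x\<bar> < e" "\<bar>?G (x + b' *\<^sub>R v + a' *\<^sub>R w) - ?G x\<bar> < e"
    using d(3) d(4) near[OF ab(1,2)] near[OF ab'(2,1)] by (auto simp: d_def)
  moreover have "a = d \<Longrightarrow> \<bar>a - b\<bar> < \<bar>b - c\<bar> / 2 \<Longrightarrow> \<bar>d - c\<bar> < \<bar>b - c\<bar> / 2 \<Longrightarrow> False"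
    for a b c d :: real by (simp add: abs_if split: if_splits)
  ultimately show False using eq unfolding e_def by blast
qed

lemma fd_inner:
  assumes "f differentiable at x"
  shows "fd (\<lambda>y. f y \<bullet> b) x v = fd f x v \<bullet> b"
  by (rule fun_cong[OF fd_eq]) (auto intro!: derivative_eq_intros fd_works[OF assms])

lemma second_derivative_symmetric:
  fixes f :: "'a::euclidean_space \<Rightarrow> 'b::euclidean_space"
  assumes "open S" "Ck_on 2 S f" "x \<in> S"
  shows "fd (\<lambda>y. fd f y v) x w = fd (\<lambda>y. fd f y w) x v"
proof (rule euclidean_eqI)
  fix b :: 'b assume "b \<in> Basis"
  have C: "Ck_on 2 S (\<lambda>y. f y \<bullet> b)" using Ck_on_inner[OF assms(1,2)] by auto
  have D: "Ck_on (Suc (Suc 0)) S f" using assms(2) by (simp add: numeral_2_eq_2)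
  have "fd (\<lambda>y. fd f y v) x w \<bullet> b = fd (\<lambda>y. fd (\<lambda>y. f y \<bullet> b) y v) x w" for v w
  proof -
    have d: "(\<lambda>y. fd f y v) differentiable at x" using D assms(3) by auto
    then have "fd (\<lambda>y. fd f y v) x w \<bullet> b = fd (\<lambda>y. fd f y v \<bullet> b) x w" by (simp add: fd_inner)
    also have "\<dots> = fd (\<lambda>y. fd (\<lambda>y. f y \<bullet> b) y v) x w"
    proof -
      have "fd (\<lambda>y. fd f y v \<bullet> b) x = fd (\<lambda>y. fd (\<lambda>y. f y \<bullet> b) y v) x"
      proof (rule differentiable_transform_open(2)[OF assms(1,3)])
        show "fd f y v \<bullet> b = fd (\<lambda>y. f y \<bullet> b) y v" if "y \<in> S" for y
          using D that by (subst fd_inner) auto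
        show "(\<lambda>y. fd f y v \<bullet> b) differentiable at x"
          using d by (auto simp: differentiable_def intro!: derivative_eq_intros)
      qed
      then show ?thesis by simp
    qed
    finally show ?thesis .
  qed
  then show "fd (\<lambda>y. fd f y v) x w \<bullet> b = fd (\<lambda>y. fd f y w) x v \<bullet> b"
    using second_derivative_symmetric_real[OF assms(1) C assms(3)] by simp
qed

section \<open>Uniform first- and second-order estimates on compact convex sets\<close>

lemma C1_lipschitz_compact:
  fixes f :: "'a::euclidean_space \<Rightarrow> 'b::real_normed_vector"
  assumes "Ck_on (Suc 0) S f" "compact K" "convex K" "K \<subseteq> S"
  obtains L where "L > 0" "\<And>x v. x \<in> K \<Longrightarrow> norm (fd f x v) \<le> L * norm v"
    "\<And>x y. x \<in> K \<Longrightarrow> y \<in> K \<Longrightarrow> norm (f x - f y) \<le> L * norm (x - y)"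
proof -
  have "\<exists>M. \<forall>x\<in>K. norm (fd f x b) \<le> M" for b
  proof -
    have "continuous_on S (\<lambda>x. fd f x b)" using assms(1) by simp
    then have "continuous_on K (\<lambda>x. fd f x b)" using assms(4) by (rule continuous_on_subset)
    then have "bounded ((\<lambda>x. fd f x b) ` K)" using assms compact_continuous_image compact_imp_bounded by blast
    then show ?thesis by (auto simp: bounded_iff)
  qed
  then obtain M where M: "\<And>b x. x \<in> K \<Longrightarrow> norm (fd f x b) \<le> M b" by metis
  \<comment> \<open>Bounds for the partial derivatives add up to a bound for the operator norm; the
    summand 1 makes it positive.\<close>
  define L where "L = (\<Sum>b\<in>Basis. \<bar>M b\<bar>) + 1"
  have L: "L > 0" unfolding L_def by (intro add_nonneg_pos sum_nonneg) auto
  have d: "f differentiable at x" if "x \<in> K" for x using assms that by auto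
  have bd: "norm (fd f x v) \<le> L * norm v" if x: "x \<in> K" for x v
  proof -
    have "norm (fd f x v) \<le> (\<Sum>b\<in>Basis. norm ((v \<bullet> b) *\<^sub>R fd f x b))"
      unfolding linear_fd_expand[OF d[OF x], of v] by (rule norm_sum)
    also have "\<dots> \<le> (\<Sum>b\<in>Basis. norm v * \<bar>M b\<bar>)"
    proof (rule sum_mono)
      fix b :: 'a assume "b \<in> Basis"
      then show "norm ((v \<bullet> b) *\<^sub>R fd f x b) \<le> norm v * \<bar>M b\<bar>"
        using M[OF x, of b] Basis_le_norm[of b v] by (auto intro!: mult_mono)
    qed
    also have "\<dots> \<le> L * norm v" by (simp add: L_def algebra_simps sum_distrib_left)
    finally show ?thesis .
  qed
  have "norm (f x - f y) \<le> L * norm (x - y)" if "x \<in> K" "y \<in> K" for x y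
  proof (rule differentiable_bound[OF assms(3) _ _ that])
    show "(f has_derivative fd f x) (at x within K)" if "x \<in> K" for x
      using fd_works[OF d[OF that]] has_derivative_at_withinI by blast
    show "onorm (fd f x) \<le> L" if "x \<in> K" for x
      using bd[OF that] L by (intro onorm_bound) auto
  qed
  then show ?thesis using that[of L] L bd by blast
qed

lemma C2_derivative_lipschitz_compact:
  fixes f :: "'a::euclidean_space \<Rightarrow> 'b::real_normed_vector"
  assumes "Ck_on (Suc (Suc 0)) S f" "compact K" "convex K" "K \<subseteq> S"
  obtains C where "C > 0"
    "\<And>x y v. x \<in> K \<Longrightarrow> y \<in> K \<Longrightarrow> norm (fd f x v - fd f y v) \<le> C * norm (x - y) * norm v"
proof -
  have "\<exists>L>0. \<forall>x\<in>K. \<forall>y\<in>K. norm (fd f x b - fd f y b) \<le> L * norm (x - y)" for b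
    using C1_lipschitz_compact[OF _ assms(2-4), of "\<lambda>x. fd f x b"] assms(1) by (metis Ck_on.simps(2))
  then obtain M where M: "\<And>b. M b > 0" "\<And>b x y. x \<in> K \<Longrightarrow> y \<in> K \<Longrightarrow> norm (fd f x b - fd f y b) \<le> M b * norm (x - y)"
    by metis
  define C where "C = (\<Sum>b\<in>Basis. M b) + 1"
  have C: "C > 0" unfolding C_def using M by (intro add_nonneg_pos sum_nonneg) (auto simp: less_imp_le)
  have d: "f differentiable at x" if "x \<in> K" for x using assms that by auto
  have bd: "norm (fd f x v - fd f y v) \<le> C * norm (x - y) * norm v" if x: "x \<in> K" "y \<in> K" for x y v
  proof -
    have "fd f x v - fd f y v = (\<Sum>b\<in>Basis. (v \<bullet> b) *\<^sub>R (fd f x b - fd f y b))"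
      using linear_fd_expand[OF d[OF x(1)], of v] linear_fd_expand[OF d[OF x(2)], of v]
      by (simp add: sum_subtractf scaleR_diff_right)
    then have "norm (fd f x v - fd f y v) \<le> (\<Sum>b\<in>Basis. norm ((v \<bullet> b) *\<^sub>R (fd f x b - fd f y b)))"
      using norm_sum by metis
    also have "\<dots> \<le> (\<Sum>b\<in>Basis. norm v * (M b * norm (x - y)))"
    proof (rule sum_mono)
      fix b :: 'a assume "b \<in> Basis"
      then show "norm ((v \<bullet> b) *\<^sub>R (fd f x b - fd f y b)) \<le> norm v * (M b * norm (x - y))"
        using M(2)[OF x, of b] Basis_le_norm[of b v] by (auto intro!: mult_mono)
    qed
    also have "\<dots> = (\<Sum>b\<in>Basis. M b) * norm (x - y) * norm v"
      by (simp add: sum_distrib_left sum_distrib_right mult_ac)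
    also have "\<dots> \<le> C * norm (x - y) * norm v" by (simp add: C_def algebra_simps)
    finally show ?thesis .
  qed
  show ?thesis using that[of C] C bd by blast
qed

text \<open>On the segment from \<open>x\<close> to \<open>y\<close> the derivative differs from the
  one at \<open>x\<close> by at most \<open>C * norm (y - x)\<close>, so the mean value inequality
  for \<open>f\<close> minus its linearization gives a quadratic remainder.\<close>

lemma C2_taylor_compact:
  fixes f :: "'a::euclidean_space \<Rightarrow> 'b::real_normed_vector"
  assumes "Ck_on (Suc (Suc 0)) S f" "compact K" "convex K" "K \<subseteq> S"
  obtains C where "C > 0"
    "\<And>x y. x \<in> K \<Longrightarrow> y \<in> K \<Longrightarrow> norm (f y - f x - fd f x (y - x)) \<le> C * (norm (y - x))\<^sup>2"
proof -
  obtain C where C: "C > 0" and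
    bd: "\<And>x y v. x \<in> K \<Longrightarrow> y \<in> K \<Longrightarrow> norm (fd f x v - fd f y v) \<le> C * norm (x - y) * norm v"
    using C2_derivative_lipschitz_compact[OF assms] by blast
  have d: "f differentiable at x" if "x \<in> K" for x using assms that by auto
  have "norm (f y - f x - fd f x (y - x)) \<le> C * (norm (y - x))\<^sup>2" if "x \<in> K" "y \<in> K" for x y
  proof -
    have seg: "closed_segment x y \<subseteq> K" using that assms(3) closed_segment_subset by blast
    have "norm (f y - f x - fd f x (y - x)) \<le> norm (y - x) * (C * norm (y - x))"
    proof (rule differentiable_bound_linearization[where S = "closed_segment x y"])
      show "x + t *\<^sub>R (y - x) \<in> closed_segment x y" if "t \<in> {0..1}" for t
        using that by (auto simp: closed_segment_def algebra_simps intro!: exI[of _ t])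
      show "(f has_derivative fd f z) (at z within closed_segment x y)" if "z \<in> closed_segment x y" for z
        using fd_works[OF d] seg that has_derivative_at_withinI by blast
      show "onorm (fd f z - fd f x) \<le> C * norm (y - x)" if z: "z \<in> closed_segment x y" for z
      proof (rule onorm_bound)
        show "0 \<le> C * norm (y - x)" using C by simp
        fix v
        have "norm (fd f z v - fd f x v) \<le> C * norm (z - x) * norm v" using bd z seg \<open>x \<in> K\<close> by blast
        also have "\<dots> \<le> C * norm (y - x) * norm v"
          using segment_bound(1)[OF z] C by (intro mult_right_mono mult_left_mono) auto
        finally show "norm ((fd f z - fd f x) v) \<le> C * norm (y - x) * norm v" by simp
      qed
      show "x \<in> closed_segment x y" by simp
    qed
    then show ?thesis by (simp add: power2_eq_square mult_ac)
  qed
  then show ?thesis using that[of C] C by blast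
qed

section \<open>Alternating forms\<close>

definition multilinear :: "nat \<Rightarrow> ('v::euclidean_space list \<Rightarrow> real) \<Rightarrow> bool" where
  "multilinear k \<alpha> \<longleftrightarrow> (\<forall>vs. length vs = k \<longrightarrow> (\<forall>i<k. linear (\<lambda>v. \<alpha> (vs[i := v]))))"

lemma multilinear_linear: "multilinear k \<alpha> \<Longrightarrow> length vs = k \<Longrightarrow> i < k \<Longrightarrow> linear (\<lambda>v. \<alpha> (vs[i := v]))"
  by (simp add: multilinear_def)

lemma linear_real_expand:
  fixes L :: "'v::euclidean_space \<Rightarrow> real"
  assumes "linear L"
  shows "L v = (\<Sum>b\<in>Basis. (v \<bullet> b) * L b)"
proof -
  have "L v = L (\<Sum>b\<in>Basis. (v \<bullet> b) *\<^sub>R b)" by (simp add: euclidean_representation)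
  then show ?thesis by (simp add: linear_sum[OF assms] linear_scale[OF assms])
qed

lemma multilinear_expand:
  assumes "multilinear k \<alpha>" "length vs = k" "i < k"
  shows "\<alpha> (vs[i := v]) = (\<Sum>b\<in>Basis. (v \<bullet> b) * \<alpha> (vs[i := b]))"
  by (rule linear_real_expand) (rule multilinear_linear[OF assms])

lemma multilinear_eq_0:
  assumes "multilinear k \<alpha>" "\<And>bs. set bs \<subseteq> Basis \<Longrightarrow> length bs = k \<Longrightarrow> \<alpha> bs = 0" "length vs = k"
  shows "\<alpha> vs = 0"
proof -
  \<comment> \<open>\<open>j\<close> counts the initial entries that may still be arbitrary; one
    expansion in the basis lowers it.\<close>
  have "\<alpha> vs = 0" if "j \<le> k" "length vs = k" "\<And>i. j \<le> i \<Longrightarrow> i < k \<Longrightarrow> vs ! i \<in> Basis" for j vs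
    using that
  proof (induction j arbitrary: vs)
    case 0
    then show ?case by (intro assms(2)) (auto simp: set_conv_nth)
  next
    case (Suc j)
    have "\<alpha> (vs[j := b]) = 0" if "b \<in> Basis" for b
      using Suc that by (intro Suc.IH) (auto simp: nth_list_update)
    then have "\<alpha> (vs[j := vs ! j]) = 0"
      using multilinear_expand[OF assms(1) Suc.prems(2), of j "vs ! j"] Suc.prems by simp
    then show ?case by simp
  qed
  from this[of k vs] show ?thesis using assms(3) by simp
qed

lemma alternating_form_multilinear: "alternating_form k \<alpha> \<Longrightarrow> multilinear k \<alpha>"
  by (simp add: alternating_form_def multilinear_def)

lemma alternating_form_repeat: "alternating_form k \<alpha> \<Longrightarrow> \<not> distinct vs \<Longrightarrow> \<alpha> vs = 0"
  by (cases "length vs = k") (auto simp: alternating_form_def)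

lemma alternating_form_length: "alternating_form k \<alpha> \<Longrightarrow> length vs \<noteq> k \<Longrightarrow> \<alpha> vs = 0"
  by (auto simp: alternating_form_def)

text \<open>Alternation is encoded as vanishing on repeated entries; antisymmetry comes from
  expanding the zero value with \<open>x + y\<close> in both slots.\<close>

lemma alternating_form_swap:
  assumes "alternating_form k \<alpha>" "length vs = k" "i < k" "j < k" "i \<noteq> j"
  shows "\<alpha> (vs[i := vs ! j, j := vs ! i]) = - \<alpha> vs"
proof -
  note ml = multilinear_linear[OF alternating_form_multilinear[OF assms(1)]]
  have li: "linear (\<lambda>v. \<alpha> (vs[i := v, j := w]))" for w
    using ml[of "vs[j := w]" i] assms by (simp add: list_update_swap)
  have lj: "linear (\<lambda>w. \<alpha> (vs[i := v, j := w]))" for v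
    using ml[of "vs[i := v]" j] assms by simp
  have z: "\<alpha> (vs[i := v, j := v]) = 0" for v
  proof (rule alternating_form_repeat[OF assms(1)])
    have "vs[i := v, j := v] ! i = vs[i := v, j := v] ! j" using assms by simp
    then show "\<not> distinct (vs[i := v, j := v])" using assms by (metis length_list_update nth_eq_iff_index_eq)
  qed
  define x y where "x = vs ! i" and "y = vs ! j"
  have "0 = \<alpha> (vs[i := x + y, j := x + y])" by (simp add: z)
  also have "\<dots> = \<alpha> (vs[i := x, j := y]) + \<alpha> (vs[i := y, j := x])"
    by (simp only: linear_add[OF li] linear_add[OF lj]) (simp add: z)
  finally show ?thesis by (simp add: x_def y_def)
qed

text \<open>Each interchange of neighbours contributes a sign; one swap brings the vector from
  position \<open>Suc i\<close> to \<open>i\<close>, and the induction hypothesis moves it the rest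
  of the way.\<close>

lemma alternating_form_move_front:
  assumes "alternating_form k \<alpha>" "length vs = k" "i < k"
  shows "\<alpha> (vs ! i # take i vs @ drop (Suc i) vs) = (-1) ^ i * \<alpha> vs"
  using assms(2,3)
proof (induction i arbitrary: vs)
  case 0
  then show ?case by (cases vs) auto
next
  case (Suc i)
  define ws where "ws = vs[i := vs ! Suc i, Suc i := vs ! i]"
  have ws: "length ws = k" "ws ! i = vs ! Suc i" "take i ws = take i vs" using Suc.prems by (auto simp: ws_def)
  have "drop (Suc i) ws = vs ! i # drop (Suc (Suc i)) vs"
    using Suc.prems by (intro nth_equalityI) (auto simp: ws_def nth_list_update nth_Cons split: nat.splits)
  then have "take i ws @ drop (Suc i) ws = take (Suc i) vs @ drop (Suc (Suc i)) vs"
    using Suc.prems ws by (simp add: take_Suc_conv_app_nth)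
  then have "\<alpha> (vs ! Suc i # take (Suc i) vs @ drop (Suc (Suc i)) vs) = (-1) ^ i * \<alpha> ws"
    using Suc.IH[OF ws(1)] Suc.prems ws by simp
  also have "\<alpha> ws = - \<alpha> vs"
    unfolding ws_def using Suc.prems by (intro alternating_form_swap[OF assms(1)]) auto
  finally show ?case by simp
qed

lemma alternating_form_interior_product:
  assumes "alternating_form (Suc k) \<alpha>"
  shows "alternating_form k (interior_product v \<alpha>)"
  unfolding alternating_form_def interior_product_def
proof (intro conjI allI impI)
  fix vs :: "(real^'a) list" and i assume "length vs = k" "i < k"
  then show "linear (\<lambda>w. \<alpha> (v # vs[i := w]))"
    using multilinear_linear[OF alternating_form_multilinear[OF assms], of "v # vs" "Suc i"] by simp
next
  fix vs :: "(real^'a) list" assume "\<not> distinct vs"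
  then show "\<alpha> (v # vs) = 0" using alternating_form_repeat[OF assms] by simp
next
  fix vs :: "(real^'a) list" assume "length vs \<noteq> k"
  then show "\<alpha> (v # vs) = 0" using alternating_form_length[OF assms] by simp
qed

section \<open>Exterior product with a covector and contraction of a top form\<close>

abbreviation omit :: "nat \<Rightarrow> 'b list \<Rightarrow> 'b list" where
  "omit i vs \<equiv> take i vs @ drop (Suc i) vs"

lemma linear_sum_fun: "finite I \<Longrightarrow> (\<And>i. i \<in> I \<Longrightarrow> linear (f i)) \<Longrightarrow> linear (\<lambda>x. \<Sum>i\<in>I. f i x)"
  by (induction I rule: finite_induct) (auto intro!: linear_compose_add linear_zero)

lemma linear_mult_const: "linear (f :: 'a::real_vector \<Rightarrow> real) \<Longrightarrow> linear (\<lambda>x. c * f x)"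
  by (simp add: linear_iff algebra_simps)

lemma omit_update:
  assumes "i < length vs" "j < length vs" "i \<noteq> j"
  shows "omit i (vs[j := x]) = (omit i vs)[(if j < i then j else j - 1) := x]"
proof (cases "j < i")
  case True
  then show ?thesis using assms by (simp add: take_update_swap list_update_append)
next
  case False
  then have "j > i" using assms by simp
  then obtain d where d: "j = Suc (i + d)" by (metis less_iff_Suc_add)
  then show ?thesis using assms by (simp add: drop_update_swap list_update_append)
qed

lemma multilinear_wedge:
  assumes "alternating_form k \<beta>"
  shows "multilinear (Suc k) (wedge_covector \<eta> \<beta>)"
  unfolding multilinear_def wedge_covector_def
proof (intro allI impI)
  fix vs :: "(real^'a) list" and j assume vs: "length vs = Suc k" and j: "j < Suc k"
  have "linear (\<lambda>v. (-1) ^ i * blinfun_apply \<eta> (vs[j := v] ! i) * \<beta> (omit i (vs[j := v])))"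
    if i: "i < Suc k" for i
  proof (cases "i = j")
    case True
    have "omit i (vs[j := v]) = omit i vs" for v using True by simp
    then have "(\<lambda>v. (-1) ^ i * blinfun_apply \<eta> (vs[j := v] ! i) * \<beta> (omit i (vs[j := v])))
      = (\<lambda>v. ((-1) ^ i * \<beta> (omit i vs)) * blinfun_apply \<eta> v)"
      using True vs i by (auto simp: fun_eq_iff)
    then show ?thesis using linear_mult_const[of "blinfun_apply \<eta>"]
      by (simp add: bounded_linear.linear blinfun.bounded_linear_right)
  next
    case False
    define j' where "j' = (if j < i then j else j - 1)"
    have j': "j' < k" "length (omit i vs) = k" using i j vs False by (auto simp: j'_def)
    have "(\<lambda>v. (-1) ^ i * blinfun_apply \<eta> (vs[j := v] ! i) * \<beta> (omit i (vs[j := v])))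
      = (\<lambda>v. ((-1) ^ i * blinfun_apply \<eta> (vs ! i)) * \<beta> ((omit i vs)[j' := v]))"
      using omit_update[of i vs j] False vs i j by (simp add: j'_def fun_eq_iff)
    then show ?thesis
      using linear_mult_const[OF multilinear_linear[OF alternating_form_multilinear[OF assms] j'(2,1)]] by simp
  qed
  then have "linear (\<lambda>v. \<Sum>i<Suc k. (-1) ^ i * blinfun_apply \<eta> (vs[j := v] ! i) * \<beta> (omit i (vs[j := v])))"
    by (intro linear_sum_fun) auto
  then show "linear (\<lambda>v. \<Sum>i<length (vs[j := v]). (-1) ^ i * blinfun_apply \<eta> (vs[j := v] ! i) * \<beta> (omit i (vs[j := v])))"
    using vs by simp
qed

lemma not_distinct_omit:
  assumes "a < length vs" "b < length vs" "vs ! a = vs ! b" "a < b" "i < length vs" "i \<noteq> a" "i \<noteq> b"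
  shows "\<not> distinct (omit i vs)"
proof -
  let ?f = "\<lambda>j. if j < i then j else j - 1"
  have "omit i vs ! ?f j = vs ! j" if "j \<noteq> i" "j < length vs" for j
    using that assms(5) by (auto simp: nth_append min_def)
  then have "omit i vs ! ?f a = omit i vs ! ?f b" using assms by metis
  moreover have "?f a < length (omit i vs)" "?f b < length (omit i vs)" "?f a \<noteq> ?f b" using assms by auto
  ultimately show ?thesis using nth_eq_iff_index_eq by blast
qed

text \<open>Omitting any entry other than the two equal ones leaves a repetition. The two remaining
  terms contain the same vectors in orders that differ by \<open>b - 1 - a\<close> interchanges of
  neighbours, and together with the signs \<open>(-1)^a\<close> and \<open>(-1)^b\<close> they
  cancel.\<close>

lemma wedge_repeat:
  assumes "alternating_form k \<beta>" "length vs = Suc k" "\<not> distinct vs"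
  shows "wedge_covector \<eta> \<beta> vs = 0"
proof -
  obtain a b where ab: "a < b" "b < length vs" "vs ! a = vs ! b"
    using assms(3) by (auto simp: distinct_conv_nth) (metis linorder_neqE_nat)
  obtain d where bd: "b = Suc (a + d)" using ab(1) by (metis less_iff_Suc_add)
  \<comment> \<open>The list without both copies; moving the surviving copy to its front makes the
    two terms comparable.\<close>
  define rest where "rest = take a vs @ take (b - Suc a) (drop (Suc a) vs) @ drop (Suc b) vs"
  let ?t = "\<lambda>i. (-1) ^ i * blinfun_apply \<eta> (vs ! i) * \<beta> (omit i vs)"
  have oa: "omit a vs = take a vs @ take (b - Suc a) (drop (Suc a) vs) @ vs ! b # drop (Suc b) vs"
  proof -
    have "drop (Suc a) vs = take (b - Suc a) (drop (Suc a) vs) @ drop b vs"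
      using ab append_take_drop_id[of "b - Suc a" "drop (Suc a) vs"] by simp
    also have "drop b vs = vs ! b # drop (Suc b) vs" using ab by (simp add: Cons_nth_drop_Suc)
    finally show ?thesis by simp
  qed
  have ob: "omit b vs = take a vs @ vs ! a # take (b - Suc a) (drop (Suc a) vs) @ drop (Suc b) vs"
  proof -
    have "take b vs = take a vs @ take (b - a) (drop a vs)"
      using ab by (metis add_diff_inverse_nat less_imp_not_less take_add less_asym not_less_iff_gr_or_eq)
    also have "drop a vs = vs ! a # drop (Suc a) vs" using ab Cons_nth_drop_Suc[of a vs] by simp
    also have "take (b - a) (vs ! a # drop (Suc a) vs) = vs ! a # take (b - Suc a) (drop (Suc a) vs)"
      using ab by (metis Suc_diff_Suc take_Suc_Cons)
    finally show ?thesis by simp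
  qed
  have la: "length (omit a vs) = k" "length (omit b vs) = k" using assms(2) ab by auto
  have ia: "omit a vs ! (b - 1) = vs ! b" unfolding oa using ab(2) by (simp add: nth_append bd)
  have ta: "omit (b - 1) (omit a vs) = rest" unfolding oa rest_def using ab by simp
  have ib: "omit b vs ! a = vs ! a" unfolding ob using ab by (simp add: nth_append)
  have tb: "omit a (omit b vs) = rest" unfolding ob rest_def using ab by simp
  have A: "\<beta> (vs ! b # rest) = (-1) ^ (b - 1) * \<beta> (omit a vs)"
    using alternating_form_move_front[OF assms(1) la(1), of "b - 1"] ab assms(2) unfolding ia ta by simp
  have B: "\<beta> (vs ! a # rest) = (-1) ^ a * \<beta> (omit b vs)"
    using alternating_form_move_front[OF assms(1) la(2), of a] ab assms(2) unfolding ib tb by simp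
  obtain b' where b': "b = Suc b'" using ab by (cases b) auto
  have sq: "((-1)::real) ^ n * ((-1) ^ n * x) = x" for n x by (simp flip: mult.assoc power_mult_distrib)
  have "\<beta> (omit a vs) = (-1) ^ b' * \<beta> (vs ! b # rest)" using A b' sq[of b' "\<beta> (omit a vs)"] by simp
  moreover have "\<beta> (omit b vs) = (-1) ^ a * \<beta> (vs ! b # rest)" using B ab(3) sq[of a "\<beta> (omit b vs)"] by simp
  ultimately have z: "?t a + ?t b = 0" using ab(3) b' by simp
  have "wedge_covector \<eta> \<beta> vs = (\<Sum>i\<in>{..<length vs} - {a, b}. ?t i) + (\<Sum>i\<in>{a, b}. ?t i)"
    unfolding wedge_covector_def using ab by (intro sum.subset_diff) auto
  also have "(\<Sum>i\<in>{..<length vs} - {a, b}. ?t i) = 0"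
  proof (rule sum.neutral, rule ballI)
    fix i assume "i \<in> {..<length vs} - {a, b}"
    then have "\<not> distinct (omit i vs)" using ab by (intro not_distinct_omit[of a vs b]) auto
    then show "?t i = 0" using alternating_form_repeat[OF assms(1)] by simp
  qed
  also have "(\<Sum>i\<in>{a, b}. ?t i) = 0" using z ab by simp
  finally show ?thesis by simp
qed

lemma basis_list:
  fixes bs :: "(real^'n) list"
  assumes "distinct bs" "set bs \<subseteq> Basis" "length bs = CARD('n)"
  shows "set bs = Basis"
  using assms distinct_card[of bs] by (intro card_subset_eq) auto

text \<open>Only the component of \<open>v\<close> along the replaced vector counts: every other
  basis vector is already in the list and would be repeated.\<close>

lemma top_form_replace:
  fixes vol :: "('n::finite) form"
  assumes "alternating_form CARD('n) vol" "distinct bs" "set bs \<subseteq> Basis" "length bs = CARD('n)" "i < CARD('n)"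
  shows "vol (bs[i := v]) = (v \<bullet> (bs ! i)) * vol bs"
proof -
  have "vol (bs[i := v]) = (\<Sum>b\<in>Basis. (v \<bullet> b) * vol (bs[i := b]))"
    by (rule multilinear_expand[OF alternating_form_multilinear[OF assms(1)]]) (use assms in auto)
  also have "\<dots> = (\<Sum>b\<in>{bs ! i}. (v \<bullet> b) * vol (bs[i := b]))"
  proof (rule sum.mono_neutral_right)
    show "{bs ! i} \<subseteq> Basis" using assms by auto
    show "\<forall>b\<in>Basis - {bs ! i}. (v \<bullet> b) * vol (bs[i := b]) = 0"
    proof
      fix b assume b: "b \<in> Basis - {bs ! i}"
      then obtain j where j: "j < CARD('n)" "bs ! j = b"
        using basis_list[OF assms(2-4)] assms(4) by (metis DiffD1 in_set_conv_nth)
      have "j \<noteq> i" using b j by auto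
      have "bs[i := b] ! i = bs[i := b] ! j" using j assms \<open>j \<noteq> i\<close> by simp
      then have "\<not> distinct (bs[i := b])"
        using j assms \<open>j \<noteq> i\<close> by (metis length_list_update nth_eq_iff_index_eq)
      then show "(v \<bullet> b) * vol (bs[i := b]) = 0" using alternating_form_repeat[OF assms(1)] by simp
    qed
  qed simp
  finally show ?thesis by simp
qed

lemma sum_basis_list:
  assumes "distinct bs" "length bs = k"
  shows "(\<Sum>i<k. f (bs ! i)) = (\<Sum>b\<in>set bs. f b)"
proof -
  have "bij_betw (\<lambda>i. bs ! i) {..<k} (set bs)" using assms by (intro bij_betw_nth) auto
  then show ?thesis by (rule sum.reindex_bij_betw)
qed

lemma length_1_card: "length vs = CARD('n::finite) - 1 \<Longrightarrow> length (v # vs) = CARD('n)"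
  by (simp add: Suc_diff_le card_gt_0_iff)

lemma Suc_card_minus: "Suc (CARD('n::finite) - 1) = CARD('n)"
  using card_gt_0_iff[of "UNIV :: 'n set"] by simp

text \<open>By multilinearity basis lists suffice. On an enumeration of the basis, bringing
  \<open>v\<close> back to position \<open>i\<close> absorbs the sign \<open>(-1)^i\<close> and
  leaves the component of \<open>v\<close> along the vector that stood there; summation over
  \<open>i\<close> gives the value of \<open>\<eta>\<close> on \<open>v\<close>. This is what
  identifies the contraction with a covector as the contraction with its sharp.\<close>

lemma wedge_interior_product:
  fixes vol :: "('n::finite) form"
  assumes vol: "alternating_form CARD('n) vol"
  shows "wedge_covector \<eta> (interior_product v vol) = (\<lambda>vs. blinfun_apply \<eta> v * vol vs)"
proof
  fix vs
  have alt: "alternating_form (CARD('n) - 1) (interior_product v vol)"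
    by (rule alternating_form_interior_product) (simp only: Suc_card_minus vol)
  show "wedge_covector \<eta> (interior_product v vol) vs = blinfun_apply \<eta> v * vol vs"
  proof (cases "length vs = CARD('n)")
    case False
    have "interior_product v vol (omit i vs) = 0" if "i < length vs" for i
      unfolding interior_product_def using False that
      by (intro alternating_form_length[OF vol]) auto
    then show ?thesis using alternating_form_length[OF vol False] by (simp add: wedge_covector_def)
  next
    case True
    let ?\<gamma> = "\<lambda>vs. wedge_covector \<eta> (interior_product v vol) vs - blinfun_apply \<eta> v * vol vs"
    have "?\<gamma> vs = 0"
    proof (rule multilinear_eq_0[OF _ _ True])
      show "multilinear CARD('n) ?\<gamma>"
        using multilinear_wedge[OF alt, of \<eta>] alternating_form_multilinear[OF vol]
        unfolding Suc_card_minus multilinear_def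
        by (auto intro!: linear_compose_sub linear_mult_const)
      fix bs :: "(real^'n) list" assume bs: "set bs \<subseteq> Basis" "length bs = CARD('n)"
      show "?\<gamma> bs = 0"
      proof (cases "distinct bs")
        case False
        then show ?thesis
          using wedge_repeat[OF alt, of bs] alternating_form_repeat[OF vol False] bs(2) by (simp add: Suc_card_minus)
      next
        case d: True
        have t: "(-1) ^ i * blinfun_apply \<eta> (bs ! i) * interior_product v vol (omit i bs)
          = (v \<bullet> (bs ! i)) * blinfun_apply \<eta> (bs ! i) * vol bs" if "i < CARD('n)" for i
        proof -
          have "vol (bs[i := v] ! i # omit i (bs[i := v])) = (-1) ^ i * vol (bs[i := v])"
            by (rule alternating_form_move_front[OF vol]) (use bs that in auto)
          moreover have "omit i (bs[i := v]) = omit i bs" by simp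
          ultimately have "vol (v # omit i bs) = (-1) ^ i * ((v \<bullet> (bs ! i)) * vol bs)"
            using top_form_replace[OF vol d bs that, of v] bs that by simp
          moreover have "((-1)::real) ^ i * (-1) ^ i = 1" by (simp flip: power_mult_distrib)
          ultimately show ?thesis by (simp add: interior_product_def mult_ac)
        qed
        have "wedge_covector \<eta> (interior_product v vol) bs
          = (\<Sum>i<CARD('n). (v \<bullet> (bs ! i)) * blinfun_apply \<eta> (bs ! i) * vol bs)"
          unfolding wedge_covector_def bs(2) by (intro sum.cong refl) (use t in simp)
        also have "\<dots> = (\<Sum>b\<in>Basis. (v \<bullet> b) * blinfun_apply \<eta> b * vol bs)"
          using sum_basis_list[OF d bs(2), of "\<lambda>b. (v \<bullet> b) * blinfun_apply \<eta> b * vol bs"]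
          by (simp add: basis_list[OF d bs])
        also have "\<dots> = blinfun_apply \<eta> v * vol bs"
          using linear_real_expand[OF bounded_linear.linear[OF blinfun.bounded_linear_right], of \<eta> v]
          by (simp add: sum_distrib_right)
        finally show ?thesis by simp
      qed
    qed
    then show ?thesis by simp
  qed
qed

text \<open>A list with one vector less than the dimension misses some basis vector
  \<open>c\<close>; the covector dual to \<open>c\<close>, evaluated on \<open>c # bs\<close>,
  isolates \<open>\<beta> bs\<close>. This is the uniqueness behind
  \<open>covector_contraction\<close>.\<close>

lemma wedge_zero_imp_zero:
  fixes \<beta> :: "('n::finite) form"
  assumes \<beta>: "alternating_form (CARD('n) - 1) \<beta>" and "\<And>\<eta>. wedge_covector \<eta> \<beta> = (\<lambda>_. 0)"
  shows "\<beta> = (\<lambda>_. 0)"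
proof
  fix vs
  show "\<beta> vs = 0"
  proof (cases "length vs = CARD('n) - 1")
    case False
    then show ?thesis by (rule alternating_form_length[OF \<beta>])
  next
    case True
    show ?thesis
    proof (rule multilinear_eq_0[OF alternating_form_multilinear[OF \<beta>] _ True])
      fix bs :: "(real^'n) list" assume bs: "set bs \<subseteq> Basis" "length bs = CARD('n) - 1"
      show "\<beta> bs = 0"
      proof (cases "distinct bs")
        case False
        then show ?thesis by (rule alternating_form_repeat[OF \<beta>])
      next
        case d: True
        have "card (set bs) < card (Basis :: (real^'n) set)"
          using distinct_card[OF d] bs(2) Suc_card_minus[where 'n = 'n] by simp
        then have "set bs \<noteq> Basis" by auto
        then obtain c where c: "c \<in> Basis" "c \<notin> set bs" using bs(1) by blast
        define \<eta> where "\<eta> = blinfun_inner_left c"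
        have eta: "blinfun_apply \<eta> x = x \<bullet> c" for x by (simp add: \<eta>_def)
        have nz: "blinfun_apply \<eta> ((c # bs) ! Suc i) = 0" if "i < length bs" for i
        proof -
          have "bs ! i \<in> set bs" using that by simp
          then have "bs ! i \<in> Basis" "bs ! i \<noteq> c" using bs(1) c by auto
          then show ?thesis using c by (simp add: eta inner_Basis)
        qed
        have "wedge_covector \<eta> \<beta> (c # bs) = (\<Sum>i<Suc (length bs). (-1) ^ i * blinfun_apply \<eta> ((c # bs) ! i) * \<beta> (omit i (c # bs)))"
          by (simp add: wedge_covector_def)
        also have "\<dots> = \<beta> bs"
          unfolding sum.lessThan_Suc_shift using nz c by (simp add: eta inner_Basis)
        finally show ?thesis using assms(2) by simp
      qed
    qed
  qed
qed

text \<open>Putting \<open>v\<close> in the slot of \<open>b\<close> in a frame of nonzero volume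
  reads off its component along \<open>b\<close>. This is the uniqueness behind
  \<open>p_normal\<close>.\<close>

lemma interior_product_inject:
  fixes vol :: "('n::finite) form"
  assumes vol: "alternating_form CARD('n) vol" "vol \<noteq> (\<lambda>_. 0)"
    and eq: "interior_product v vol = interior_product w vol"
  shows "v = w"
proof -
  have "\<exists>bs. set bs \<subseteq> Basis \<and> length bs = CARD('n) \<and> vol bs \<noteq> 0"
  proof (rule ccontr)
    assume "\<not> ?thesis"
    then have "vol vs = 0" if "length vs = CARD('n)" for vs
      using multilinear_eq_0[OF alternating_form_multilinear[OF vol(1)]] that by blast
    then have "vol = (\<lambda>_. 0)" using alternating_form_length[OF vol(1)] by blast
    then show False using vol(2) by blast
  qed
  then obtain bs where bs: "set bs \<subseteq> Basis" "length bs = CARD('n)" "vol bs \<noteq> 0" by blast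
  have d: "distinct bs" using alternating_form_repeat[OF vol(1)] bs(3) by blast
  have "v \<bullet> b = w \<bullet> b" if b: "b \<in> Basis" for b
  proof -
    obtain i where i: "i < CARD('n)" "bs ! i = b" using basis_list[OF d bs(1,2)] b bs(2) by (metis in_set_conv_nth)
    have *: "(x \<bullet> b) * vol bs = (-1) ^ i * vol (x # omit i bs)" for x
    proof -
      have "vol (bs[i := x] ! i # omit i (bs[i := x])) = (-1) ^ i * vol (bs[i := x])"
        by (rule alternating_form_move_front[OF vol(1)]) (use bs i in auto)
      moreover have "omit i (bs[i := x]) = omit i bs" by simp
      ultimately have "vol (x # omit i bs) = (-1) ^ i * ((x \<bullet> b) * vol bs)"
        using top_form_replace[OF vol(1) d bs(1,2) i(1), of x] bs i by simp
      moreover have "((-1)::real) ^ i * (-1) ^ i = 1" by (simp flip: power_mult_distrib)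
      ultimately show ?thesis by (metis mult.assoc mult_1)
    qed
    have "vol (v # omit i bs) = vol (w # omit i bs)" using eq unfolding interior_product_def by metis
    then have "(v \<bullet> b) * vol bs = (w \<bullet> b) * vol bs" using *[of v] *[of w] by simp
    then show ?thesis using bs(3) by simp
  qed
  then show ?thesis by (rule euclidean_eqI)
qed

text \<open>Extended as a derivation, \<open>A\<close> acts on top forms by its trace. On an
  enumeration of the basis only diagonal entries survive; on a list with a repetition the terms of
  the two equal slots are opposite.\<close>

lemma top_form_trace:
  fixes vol :: "('n::finite) form"
  assumes vol: "alternating_form CARD('n) vol" and A: "linear A" and vs: "length vs = CARD('n)"
  shows "(\<Sum>i<CARD('n). vol (vs[i := A (vs ! i)])) = (\<Sum>b\<in>Basis. A b \<bullet> b) * vol vs"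
proof -
  note ml = multilinear_linear[OF alternating_form_multilinear[OF vol]]
  let ?\<gamma> = "\<lambda>vs. (\<Sum>i<CARD('n). vol (vs[i := A (vs ! i)])) - (\<Sum>b\<in>Basis. A b \<bullet> b) * vol vs"
  have "?\<gamma> vs = 0"
  proof (rule multilinear_eq_0[OF _ _ vs])
    show "multilinear CARD('n) ?\<gamma>"
      unfolding multilinear_def
    proof (intro allI impI)
      fix us :: "(real^'n) list" and j assume us: "length us = CARD('n)" and j: "j < CARD('n)"
      have "linear (\<lambda>v. vol (us[j := v, i := A (us[j := v] ! i)]))" if i: "i < CARD('n)" for i
      proof (cases "i = j")
        case True
        then have "(\<lambda>v. vol (us[j := v, i := A (us[j := v] ! i)])) = (\<lambda>v. vol (us[j := v])) \<circ> A"
          using us j by (auto simp: fun_eq_iff)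
        then show ?thesis using linear_compose[OF A ml[OF us j]] by simp
      next
        case False
        then have "(\<lambda>v. vol (us[j := v, i := A (us[j := v] ! i)])) = (\<lambda>v. vol ((us[i := A (us ! i)])[j := v]))"
          by (simp add: fun_eq_iff list_update_swap)
        then show ?thesis using ml[of "us[i := A (us ! i)]" j] us j by simp
      qed
      then show "linear (\<lambda>v. (\<Sum>i<CARD('n). vol (us[j := v, i := A (us[j := v] ! i)])) - (\<Sum>b\<in>Basis. A b \<bullet> b) * vol (us[j := v]))"
        by (intro linear_compose_sub linear_sum_fun linear_mult_const ml us j) auto
    qed
    fix bs :: "(real^'n) list" assume bs: "set bs \<subseteq> Basis" "length bs = CARD('n)"
    show "?\<gamma> bs = 0"
    proof (cases "distinct bs")
      case False
      then obtain a b where ab: "a < b" "b < length bs" "bs ! a = bs ! b"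
        by (auto simp: distinct_conv_nth) (metis linorder_neqE_nat)
      let ?t = "\<lambda>i. vol (bs[i := A (bs ! i)])"
      have "(\<Sum>i<CARD('n). ?t i) = (\<Sum>i\<in>{..<CARD('n)} - {a, b}. ?t i) + (\<Sum>i\<in>{a, b}. ?t i)"
        using ab bs by (intro sum.subset_diff) auto
      also have "(\<Sum>i\<in>{..<CARD('n)} - {a, b}. ?t i) = 0"
      proof (rule sum.neutral, rule ballI)
        fix i assume i: "i \<in> {..<CARD('n)} - {a, b}"
        then have "bs[i := A (bs ! i)] ! a = bs[i := A (bs ! i)] ! b" using ab by auto
        then have "\<not> distinct (bs[i := A (bs ! i)])"
          using ab by (metis length_list_update less_irrefl less_trans nth_eq_iff_index_eq)
        then show "?t i = 0" using alternating_form_repeat[OF vol] by simp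
      qed
      also have "(\<Sum>i\<in>{a, b}. ?t i) = 0"
      proof -
        define us where "us = bs[a := A (bs ! a)]"
        have "us[a := us ! b, b := us ! a] = bs[b := A (bs ! b)]"
          using ab by (intro nth_equalityI) (auto simp: us_def nth_list_update)
        then have "?t b = - ?t a"
          using alternating_form_swap[OF vol, of us a b] ab bs by (simp add: us_def)
        then show ?thesis using ab by simp
      qed
      finally show ?thesis using alternating_form_repeat[OF vol False] by simp
    next
      case d: True
      have "(\<Sum>i<CARD('n). vol (bs[i := A (bs ! i)])) = (\<Sum>i<CARD('n). (A (bs ! i) \<bullet> (bs ! i)) * vol bs)"
        by (intro sum.cong refl top_form_replace[OF vol d bs]) auto
      also have "\<dots> = (\<Sum>b\<in>Basis. A b \<bullet> b) * vol bs"
        using sum_basis_list[OF d bs(2), of "\<lambda>b. A b \<bullet> b"] by (simp add: basis_list[OF d bs] flip: sum_distrib_right)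
      finally show ?thesis by simp
    qed
  qed
  then show ?thesis by simp
qed

text \<open>Any fixed enumeration of the basis; \<open>vol std_frame\<close> then plays the role of
  the density of a volume form in the coordinates.\<close>

definition std_frame :: "(real^'n::finite) list" where
  "std_frame = (SOME bs. distinct bs \<and> set bs = Basis)"

lemma std_frame: "distinct (std_frame :: (real^'n::finite) list)" "set (std_frame :: (real^'n::finite) list) = Basis"
  "length (std_frame :: (real^'n::finite) list) = CARD('n)"
proof -
  have "\<exists>bs. distinct bs \<and> set bs = (Basis :: (real^'n) set)" using finite_distinct_list[of Basis] by auto
  from someI_ex[OF this] show *: "distinct (std_frame :: (real^'n::finite) list)" "set (std_frame :: (real^'n::finite) list) = Basis"
    unfolding std_frame_def by auto
  then show "length (std_frame :: (real^'n::finite) list) = CARD('n)" using distinct_card[OF *(1)] by simp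
qed

text \<open>The permutation of the frame is undone by successive swaps.\<close>

lemma top_form_zero_on_frame:
  fixes \<gamma> :: "('n::finite) form"
  assumes \<gamma>: "alternating_form CARD('n) \<gamma>" and fr: "distinct fr" "set fr = Basis" and z: "\<gamma> fr = 0"
  shows "\<gamma> vs = 0"
proof (cases "length vs = CARD('n)")
  case False
  then show ?thesis by (rule alternating_form_length[OF \<gamma>])
next
  case True
  have len: "length fr = CARD('n)" using distinct_card[OF fr(1)] fr(2) by simp
  have main: "\<gamma> bs = 0" if "j \<le> CARD('n)" "distinct bs" "set bs = Basis" "length bs = CARD('n)"
    "\<And>i. i < CARD('n) - j \<Longrightarrow> bs ! i = fr ! i" for j and bs :: "(real^'n) list"
    using that
  proof (induction j arbitrary: bs)
    case 0
    then have "bs = fr" using len by (intro nth_equalityI) auto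
    then show ?case using z by simp
  next
    case (Suc j)
    define i where "i = CARD('n) - Suc j"
    have i: "i < CARD('n)" "CARD('n) - j = Suc i" using Suc.prems by (auto simp: i_def)
    have "fr ! i \<in> set bs" using fr len Suc.prems i by (metis nth_mem)
    then obtain k where k: "k < CARD('n)" "bs ! k = fr ! i" using Suc.prems by (metis in_set_conv_nth)
    have "k \<ge> i"
    proof (rule ccontr)
      assume "\<not> k \<ge> i"
      then have "bs ! k = fr ! k" using Suc.prems(5)[of k] by (simp add: i_def)
      then show False using k i fr len \<open>\<not> k \<ge> i\<close> by (metis nth_eq_iff_index_eq order_refl)
    qed
    show ?case
    proof (cases "k = i")
      case True
      show ?thesis
      proof (rule Suc.IH)
        show "bs ! i' = fr ! i'" if "i' < CARD('n) - j" for i'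
          using that i k True Suc.prems(5)[of i'] by (cases "i' = i") (auto simp: i_def)
      qed (use Suc.prems in auto)
    next
      case False
      define cs where "cs = bs[i := bs ! k, k := bs ! i]"
      have "\<gamma> cs = 0"
      proof (rule Suc.IH)
        show "cs ! i' = fr ! i'" if "i' < CARD('n) - j" for i'
        proof (cases "i' = i")
          case True
          then show ?thesis using k i False Suc.prems by (simp add: cs_def)
        next
          case ne: False
          then have "i' < i" using that i by simp
          then show ?thesis using Suc.prems(5)[of i'] \<open>k \<ge> i\<close> False by (simp add: cs_def i_def)
        qed
        show "distinct cs" "set cs = Basis" "length cs = CARD('n)"
          using Suc.prems(2-4) i(1) k(1) unfolding cs_def
          by (simp_all only: distinct_swap set_swap length_list_update)
      qed (use Suc.prems in auto)
      moreover have "\<gamma> cs = - \<gamma> bs"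
        unfolding cs_def using i k False Suc.prems by (intro alternating_form_swap[OF \<gamma>]) auto
      ultimately show ?thesis by simp
    qed
  qed
  show ?thesis
  proof (rule multilinear_eq_0[OF alternating_form_multilinear[OF \<gamma>] _ True])
    fix bs :: "(real^'n) list" assume bs: "set bs \<subseteq> Basis" "length bs = CARD('n)"
    show "\<gamma> bs = 0"
    proof (cases "distinct bs")
      case False
      then show ?thesis by (rule alternating_form_repeat[OF \<gamma>])
    next
      case d: True
      show ?thesis by (rule main[of "CARD('n)"]) (use d bs basis_list[OF d bs] in auto)
    qed
  qed
qed

text \<open>Top forms at a point make up a line; the proportionality is cross-multiplied so that it
  also covers a form that vanishes on the frame.\<close>

lemma top_form_proportional:
  fixes \<alpha> vol :: "('n::finite) form"
  assumes "alternating_form CARD('n) \<alpha>" "alternating_form CARD('n) vol"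
  shows "\<alpha> vs * vol std_frame = \<alpha> std_frame * vol vs"
proof -
  have "alternating_form CARD('n) (\<lambda>vs. vol std_frame * \<alpha> vs - \<alpha> std_frame * vol vs)"
    using assms unfolding alternating_form_def by (auto intro!: linear_compose_sub linear_mult_const)
  from top_form_zero_on_frame[OF this std_frame(1,2), of vs] show ?thesis by (simp add: mult_ac)
qed

lemma top_form_frame_nonzero:
  fixes vol :: "('n::finite) form"
  assumes "alternating_form CARD('n) vol" "vol \<noteq> (\<lambda>_. 0)" "distinct fr" "set fr = Basis"
  shows "vol fr \<noteq> 0"
  using top_form_zero_on_frame[OF assms(1,3,4)] assms(2) by blast

text \<open>Leibniz rule for a form with moving arguments. By induction on the list the first
  argument is expanded in the basis, so that the form is only ever differentiated on constant
  vectors.\<close>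

lemma has_derivative_multilinear:
  fixes \<beta> :: "'y::euclidean_space \<Rightarrow> 'v::euclidean_space list \<Rightarrow> real" and fs :: "('y \<Rightarrow> 'v) list"
  assumes S: "open S" "y\<^sub>0 \<in> S" and ml: "\<And>y. y \<in> S \<Longrightarrow> multilinear (length fs) (\<beta> y)"
    and \<beta>: "\<And>vs. length vs = length fs \<Longrightarrow> ((\<lambda>y. \<beta> y vs) has_derivative \<beta>' vs) (at y\<^sub>0)"
    and fs: "\<And>i. i < length fs \<Longrightarrow> ((fs ! i) has_derivative f' i) (at y\<^sub>0)"
  shows "((\<lambda>y. \<beta> y (map (\<lambda>f. f y) fs)) has_derivative
    (\<lambda>h. \<beta>' (map (\<lambda>f. f y\<^sub>0) fs) h + (\<Sum>i<length fs. \<beta> y\<^sub>0 ((map (\<lambda>f. f y\<^sub>0) fs)[i := f' i h])))) (at y\<^sub>0)"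
  using ml \<beta> fs
proof (induction fs arbitrary: \<beta> \<beta>' f')
  case Nil
  then show ?case by simp
next
  case (Cons f fs)
  let ?vs = "map (\<lambda>f. f y\<^sub>0) fs"
  have exp: "\<beta> y (v # rest) = (\<Sum>b\<in>Basis. (v \<bullet> b) * \<beta> y (b # rest))"
    if "y \<in> S" "length rest = length fs" for y v rest
    using multilinear_expand[OF Cons.prems(1)[OF that(1)], of "v # rest" 0 v] that by simp
  have ml': "multilinear (length fs) (\<lambda>vs. \<beta> y (b # vs))" if "y \<in> S" for y b
    unfolding multilinear_def
  proof (intro allI impI)
    fix vs :: "'v list" and i assume "length vs = length fs" "i < length fs"
    then show "linear (\<lambda>v. \<beta> y (b # vs[i := v]))"
      using multilinear_linear[OF Cons.prems(1)[OF that], of "b # vs" "Suc i"] by simp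
  qed
  have d0: "(f has_derivative f' 0) (at y\<^sub>0)" using Cons.prems(3)[of 0] by simp
  have IH: "((\<lambda>y. \<beta> y (b # map (\<lambda>f. f y) fs)) has_derivative
    (\<lambda>h. \<beta>' (b # ?vs) h + (\<Sum>i<length fs. \<beta> y\<^sub>0 (b # ?vs[i := f' (Suc i) h])))) (at y\<^sub>0)" for b
  proof (rule Cons.IH[of "\<lambda>y vs. \<beta> y (b # vs)" "\<lambda>vs. \<beta>' (b # vs)" "\<lambda>i. f' (Suc i)"])
    show "multilinear (length fs) (\<lambda>vs. \<beta> y (b # vs))" if "y \<in> S" for y using ml'[OF that] .
    show "((\<lambda>y. \<beta> y (b # vs)) has_derivative \<beta>' (b # vs)) (at y\<^sub>0)" if "length vs = length fs" for vs
      by (rule Cons.prems(2)) (simp add: that)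
    show "(fs ! i has_derivative f' (Suc i)) (at y\<^sub>0)" if "i < length fs" for i
      using Cons.prems(3)[of "Suc i"] that by simp
  qed
  \<comment> \<open>\<open>\<beta>'\<close> is given only as a family of derivatives; it inherits
    linearity in the first vector through uniqueness of the derivative.\<close>
  have exp': "\<beta>' (v # rest) h = (\<Sum>b\<in>Basis. (v \<bullet> b) * \<beta>' (b # rest) h)" if r: "length rest = length fs" for v rest h
  proof -
    have "((\<lambda>y. \<Sum>b\<in>Basis. (v \<bullet> b) * \<beta> y (b # rest)) has_derivative (\<lambda>h. \<Sum>b\<in>Basis. (v \<bullet> b) * \<beta>' (b # rest) h)) (at y\<^sub>0)"
      by (intro has_derivative_sum has_derivative_mult_right Cons.prems(2)) (use r in simp)
    then have "((\<lambda>y. \<beta> y (v # rest)) has_derivative (\<lambda>h. \<Sum>b\<in>Basis. (v \<bullet> b) * \<beta>' (b # rest) h)) (at y\<^sub>0)"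
      by (rule has_derivative_transform_within_open[OF _ S]) (simp add: exp[OF _ r])
    moreover have "((\<lambda>y. \<beta> y (v # rest)) has_derivative \<beta>' (v # rest)) (at y\<^sub>0)" using Cons.prems(2) r by simp
    ultimately have "(\<lambda>h. \<Sum>b\<in>Basis. (v \<bullet> b) * \<beta>' (b # rest) h) = \<beta>' (v # rest)"
      by (rule has_derivative_unique)
    then show ?thesis by (rule fun_cong[symmetric])
  qed
  have "((\<lambda>y. \<Sum>b\<in>Basis. (f y \<bullet> b) * \<beta> y (b # map (\<lambda>f. f y) fs)) has_derivative
     (\<lambda>h. \<Sum>b\<in>Basis. (f y\<^sub>0 \<bullet> b) * (\<beta>' (b # ?vs) h + (\<Sum>i<length fs. \<beta> y\<^sub>0 (b # ?vs[i := f' (Suc i) h])))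
        + (f' 0 h \<bullet> b) * \<beta> y\<^sub>0 (b # ?vs))) (at y\<^sub>0)"
    by (intro has_derivative_sum has_derivative_mult has_derivative_inner_left d0 IH)
  then have "((\<lambda>y. \<beta> y (f y # map (\<lambda>f. f y) fs)) has_derivative
     (\<lambda>h. \<Sum>b\<in>Basis. (f y\<^sub>0 \<bullet> b) * (\<beta>' (b # ?vs) h + (\<Sum>i<length fs. \<beta> y\<^sub>0 (b # ?vs[i := f' (Suc i) h])))
        + (f' 0 h \<bullet> b) * \<beta> y\<^sub>0 (b # ?vs))) (at y\<^sub>0)"
  proof (rule has_derivative_transform_within_open[OF _ S])
    fix y assume "y \<in> S"
    then show "(\<Sum>b\<in>Basis. (f y \<bullet> b) * \<beta> y (b # map (\<lambda>f. f y) fs)) = \<beta> y (f y # map (\<lambda>f. f y) fs)"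
      by (intro exp[symmetric]) simp_all
  qed
  moreover have "(\<Sum>b\<in>Basis. (f y\<^sub>0 \<bullet> b) * (\<beta>' (b # ?vs) h + (\<Sum>i<length fs. \<beta> y\<^sub>0 (b # ?vs[i := f' (Suc i) h])))
        + (f' 0 h \<bullet> b) * \<beta> y\<^sub>0 (b # ?vs))
     = \<beta>' (f y\<^sub>0 # ?vs) h + (\<Sum>i<length (f # fs). \<beta> y\<^sub>0 ((f y\<^sub>0 # ?vs)[i := f' i h]))" for h
  proof -
    have "(\<Sum>b\<in>Basis. (f y\<^sub>0 \<bullet> b) * (\<beta>' (b # ?vs) h + (\<Sum>i<length fs. \<beta> y\<^sub>0 (b # ?vs[i := f' (Suc i) h])))
        + (f' 0 h \<bullet> b) * \<beta> y\<^sub>0 (b # ?vs)) =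
      (\<Sum>b\<in>Basis. (f y\<^sub>0 \<bullet> b) * \<beta>' (b # ?vs) h) + (\<Sum>b\<in>Basis. \<Sum>i<length fs. (f y\<^sub>0 \<bullet> b) * \<beta> y\<^sub>0 (b # ?vs[i := f' (Suc i) h]))
      + (\<Sum>b\<in>Basis. (f' 0 h \<bullet> b) * \<beta> y\<^sub>0 (b # ?vs))"
      by (simp add: distrib_left sum.distrib sum_distrib_left)
    also have "(\<Sum>b\<in>Basis. (f y\<^sub>0 \<bullet> b) * \<beta>' (b # ?vs) h) = \<beta>' (f y\<^sub>0 # ?vs) h"
      by (rule exp'[symmetric]) simp
    also have "(\<Sum>b\<in>Basis. \<Sum>i<length fs. (f y\<^sub>0 \<bullet> b) * \<beta> y\<^sub>0 (b # ?vs[i := f' (Suc i) h]))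
      = (\<Sum>i<length fs. \<Sum>b\<in>Basis. (f y\<^sub>0 \<bullet> b) * \<beta> y\<^sub>0 (b # ?vs[i := f' (Suc i) h]))" by (rule sum.swap)
    also have "\<dots> = (\<Sum>i<length fs. \<beta> y\<^sub>0 (f y\<^sub>0 # ?vs[i := f' (Suc i) h]))"
      by (intro sum.cong refl exp[symmetric] S(2)) simp
    also have "(\<Sum>b\<in>Basis. (f' 0 h \<bullet> b) * \<beta> y\<^sub>0 (b # ?vs)) = \<beta> y\<^sub>0 (f' 0 h # ?vs)"
      by (rule exp[symmetric]) (use S in simp_all)
    finally show ?thesis by (simp add: sum.lessThan_Suc_shift del: sum.lessThan_Suc)
  qed
  ultimately show ?case by simp
qed

section \<open>Brackets and Lie derivatives under maps\<close>

lemma has_derivative_fd_apply: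
  fixes F :: "'a::euclidean_space \<Rightarrow> 'b::euclidean_space"
  assumes S: "open S" "Ck_on 2 S F" "y\<^sub>0 \<in> S" and X: "X differentiable at y\<^sub>0"
  shows "((\<lambda>y. fd F y (X y)) has_derivative
    (\<lambda>h. fd (\<lambda>y. fd F y h) y\<^sub>0 (X y\<^sub>0) + fd F y\<^sub>0 (fd X y\<^sub>0 h))) (at y\<^sub>0)"
proof -
  have F2: "Ck_on (Suc (Suc 0)) S F" using S by (simp add: numeral_2_eq_2)
  have dF: "F differentiable at y" if "y \<in> S" for y using F2 that by simp
  have ddF: "((\<lambda>y. fd F y b) has_derivative fd (\<lambda>y. fd F y b) y\<^sub>0) (at y\<^sub>0)" for b
    using F2 S(3) by (intro fd_works) simp
  have lin: "fd (\<lambda>y. fd F y v) y\<^sub>0 h = (\<Sum>b\<in>Basis. (v \<bullet> b) *\<^sub>R fd (\<lambda>y. fd F y b) y\<^sub>0 h)" for v h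
  proof -
    have "((\<lambda>y. \<Sum>b\<in>Basis. (v \<bullet> b) *\<^sub>R fd F y b) has_derivative (\<lambda>h. \<Sum>b\<in>Basis. (v \<bullet> b) *\<^sub>R fd (\<lambda>y. fd F y b) y\<^sub>0 h)) (at y\<^sub>0)"
      by (intro has_derivative_sum has_derivative_scaleR_right ddF)
    then have "((\<lambda>y. fd F y v) has_derivative (\<lambda>h. \<Sum>b\<in>Basis. (v \<bullet> b) *\<^sub>R fd (\<lambda>y. fd F y b) y\<^sub>0 h)) (at y\<^sub>0)"
      by (rule has_derivative_transform_within_open[OF _ S(1,3)]) (rule linear_fd_expand[OF dF, symmetric])
    from fd_eq[OF this] show ?thesis by simp
  qed
  have "((\<lambda>y. \<Sum>b\<in>Basis. (X y \<bullet> b) *\<^sub>R fd F y b) has_derivative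
    (\<lambda>h. \<Sum>b\<in>Basis. (X y\<^sub>0 \<bullet> b) *\<^sub>R fd (\<lambda>y. fd F y b) y\<^sub>0 h + (fd X y\<^sub>0 h \<bullet> b) *\<^sub>R fd F y\<^sub>0 b)) (at y\<^sub>0)"
    by (intro has_derivative_sum has_derivative_scaleR has_derivative_inner_left ddF fd_works[OF X])
  then have "((\<lambda>y. fd F y (X y)) has_derivative
    (\<lambda>h. \<Sum>b\<in>Basis. (X y\<^sub>0 \<bullet> b) *\<^sub>R fd (\<lambda>y. fd F y b) y\<^sub>0 h + (fd X y\<^sub>0 h \<bullet> b) *\<^sub>R fd F y\<^sub>0 b)) (at y\<^sub>0)"
    by (rule has_derivative_transform_within_open[OF _ S(1,3)]) (rule linear_fd_expand[OF dF, symmetric])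
  then show ?thesis
  proof (rule has_derivative_eq_rhs, intro ext)
    fix h
    have "(\<Sum>b\<in>Basis. (X y\<^sub>0 \<bullet> b) *\<^sub>R fd (\<lambda>y. fd F y b) y\<^sub>0 h + (fd X y\<^sub>0 h \<bullet> b) *\<^sub>R fd F y\<^sub>0 b)
      = fd (\<lambda>y. fd F y (X y\<^sub>0)) y\<^sub>0 h + fd F y\<^sub>0 (fd X y\<^sub>0 h)"
      unfolding sum.distrib lin[of "X y\<^sub>0"] linear_fd_expand[OF dF[OF S(3)], of "fd X y\<^sub>0 h"] by (rule refl)
    \<comment> \<open>Symmetry moves \<open>h\<close> to the inner slot, the shape in which the
      second-order terms cancel in brackets and Lie derivatives.\<close>
    also have "fd (\<lambda>y. fd F y (X y\<^sub>0)) y\<^sub>0 h = fd (\<lambda>y. fd F y h) y\<^sub>0 (X y\<^sub>0)"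
      by (rule second_derivative_symmetric[OF S])
    finally show "(\<Sum>b\<in>Basis. (X y\<^sub>0 \<bullet> b) *\<^sub>R fd (\<lambda>y. fd F y b) y\<^sub>0 h + (fd X y\<^sub>0 h \<bullet> b) *\<^sub>R fd F y\<^sub>0 b)
      = fd (\<lambda>y. fd F y h) y\<^sub>0 (X y\<^sub>0) + fd F y\<^sub>0 (fd X y\<^sub>0 h)" .
  qed
qed

lemma related_field_derivative:
  fixes F :: "'a::euclidean_space \<Rightarrow> 'b::euclidean_space"
  assumes S: "open S" "Ck_on 2 S F" "y\<^sub>0 \<in> S"
    and X1: "X1 differentiable at y\<^sub>0" and X2: "X2 differentiable at (F y\<^sub>0)"
    and rel: "\<And>y. y \<in> S \<Longrightarrow> X2 (F y) = fd F y (X1 y)"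
  shows "fd X2 (F y\<^sub>0) (fd F y\<^sub>0 h) = fd (\<lambda>y. fd F y h) y\<^sub>0 (X1 y\<^sub>0) + fd F y\<^sub>0 (fd X1 y\<^sub>0 h)"
proof -
  have "Ck_on (Suc 0) S F" using S(2) by (rule Ck_on_lower) simp
  then have dF: "(F has_derivative fd F y\<^sub>0) (at y\<^sub>0)" using S(3) Ck_on_differentiable by blast
  have "((\<lambda>y. X2 (F y)) has_derivative (\<lambda>h. fd (\<lambda>y. fd F y h) y\<^sub>0 (X1 y\<^sub>0) + fd F y\<^sub>0 (fd X1 y\<^sub>0 h))) (at y\<^sub>0)"
    using has_derivative_fd_apply[OF S X1]
    by (rule has_derivative_transform_within_open[OF _ S(1,3)]) (simp add: rel)
  moreover have "((\<lambda>y. X2 (F y)) has_derivative (\<lambda>h. fd X2 (F y\<^sub>0) (fd F y\<^sub>0 h))) (at y\<^sub>0)"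
    by (rule has_derivative_compose[OF dF fd_works[OF X2]])
  ultimately have "(\<lambda>h. fd (\<lambda>y. fd F y h) y\<^sub>0 (X1 y\<^sub>0) + fd F y\<^sub>0 (fd X1 y\<^sub>0 h)) = (\<lambda>h. fd X2 (F y\<^sub>0) (fd F y\<^sub>0 h))"
    by (rule has_derivative_unique)
  then show ?thesis by (rule fun_cong[symmetric])
qed

text \<open>Each half of the bracket produces the second derivative of \<open>F\<close> in the
  directions \<open>X1\<close> and \<open>Y1\<close>; by symmetry these agree and drop out of the
  difference.\<close>

lemma related_field_bracket:
  fixes F :: "'a::euclidean_space \<Rightarrow> 'b::euclidean_space"
  assumes S: "open S" "Ck_on 2 S F" "y\<^sub>0 \<in> S"
    and X: "X1 differentiable at y\<^sub>0" "X2 differentiable at (F y\<^sub>0)" "\<And>y. y \<in> S \<Longrightarrow> X2 (F y) = fd F y (X1 y)"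
    and Y: "Y1 differentiable at y\<^sub>0" "Y2 differentiable at (F y\<^sub>0)" "\<And>y. y \<in> S \<Longrightarrow> Y2 (F y) = fd F y (Y1 y)"
  shows "fd Y2 (F y\<^sub>0) (X2 (F y\<^sub>0)) - fd X2 (F y\<^sub>0) (Y2 (F y\<^sub>0))
    = fd F y\<^sub>0 (fd Y1 y\<^sub>0 (X1 y\<^sub>0) - fd X1 y\<^sub>0 (Y1 y\<^sub>0))"
proof -
  have "Ck_on (Suc 0) S F" using S(2) by (rule Ck_on_lower) simp
  then have "linear (fd F y\<^sub>0)" using S(3) by (auto intro!: linear_frechet_derivative)
  then show ?thesis
    using related_field_derivative[OF S X, of "Y1 y\<^sub>0"] related_field_derivative[OF S Y, of "X1 y\<^sub>0"]
      second_derivative_symmetric[OF S, of "X1 y\<^sub>0" "Y1 y\<^sub>0"] X(3)[OF S(3)] Y(3)[OF S(3)]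
    by (simp add: linear_diff)
qed

text \<open>Euclidean expression of the Lie derivative of a form; the sum comes from the brackets of
  \<open>X\<close> with constant fields.\<close>

definition lie_rep :: "('v::euclidean_space \<Rightarrow> 'v) \<Rightarrow> ('v \<Rightarrow> 'v list \<Rightarrow> real) \<Rightarrow> 'v \<Rightarrow> 'v list \<Rightarrow> real" where
  "lie_rep X \<alpha> y vs = fd (\<lambda>y. \<alpha> y vs) y (X y) + (\<Sum>i<length vs. \<alpha> y (vs[i := fd X y (vs ! i)]))"

text \<open>\<open>\<alpha>1\<close> is the pullback of \<open>\<alpha>2\<close>. Differentiating
  the arguments \<open>fd F y v\<close> gives second derivatives of \<open>F\<close>, which are
  exactly those that \<open>related_field_derivative\<close> puts into the derivative of
  \<open>X2\<close>.\<close>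

lemma lie_rep_natural:
  fixes F :: "'v::euclidean_space \<Rightarrow> 'v"
  assumes S: "open S" "Ck_on 2 S F" "y\<^sub>0 \<in> S"
    and X: "X1 differentiable at y\<^sub>0" "X2 differentiable at (F y\<^sub>0)" "\<And>y. y \<in> S \<Longrightarrow> X2 (F y) = fd F y (X1 y)"
    and \<alpha>: "\<And>y vs. y \<in> S \<Longrightarrow> length vs = k \<Longrightarrow> \<alpha>1 y vs = \<alpha>2 (F y) (map (fd F y) vs)"
    and ml: "\<And>y. y \<in> S \<Longrightarrow> multilinear k (\<alpha>2 (F y))"
    and d\<alpha>: "\<And>vs. length vs = k \<Longrightarrow> (\<lambda>z. \<alpha>2 z vs) differentiable at (F y\<^sub>0)"
    and vs: "length vs = k"
  shows "lie_rep X1 \<alpha>1 y\<^sub>0 vs = lie_rep X2 \<alpha>2 (F y\<^sub>0) (map (fd F y\<^sub>0) vs)"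
proof -
  have F2: "Ck_on (Suc (Suc 0)) S F" using S by (simp add: numeral_2_eq_2)
  then have dF: "(F has_derivative fd F y\<^sub>0) (at y\<^sub>0)" using S(3) Ck_on_differentiable Ck_on_Suc_lower by blast
  let ?ws = "map (fd F y\<^sub>0) vs"
  define fs where "fs = map (\<lambda>v y. fd F y v) vs"
  have fs: "map (\<lambda>f. f y) fs = map (fd F y) vs" "length fs = k" for y using vs by (simp_all add: fs_def)
  have "((\<lambda>y. \<alpha>2 (F y) (map (\<lambda>f. f y) fs)) has_derivative
    (\<lambda>h. fd (\<lambda>z. \<alpha>2 z (map (\<lambda>f. f y\<^sub>0) fs)) (F y\<^sub>0) (fd F y\<^sub>0 h)
      + (\<Sum>i<length fs. \<alpha>2 (F y\<^sub>0) ((map (\<lambda>f. f y\<^sub>0) fs)[i := fd (\<lambda>y. fd F y (vs ! i)) y\<^sub>0 h])))) (at y\<^sub>0)"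
  proof (rule has_derivative_multilinear[OF S(1,3)])
    show "multilinear (length fs) (\<alpha>2 (F y))" if "y \<in> S" for y using ml[OF that] fs by simp
    show "((\<lambda>y. \<alpha>2 (F y) us) has_derivative (\<lambda>h. fd (\<lambda>z. \<alpha>2 z us) (F y\<^sub>0) (fd F y\<^sub>0 h))) (at y\<^sub>0)"
      if "length us = length fs" for us
      using d\<alpha>[of us] that fs by (intro has_derivative_compose[OF dF] fd_works) auto
    show "(fs ! i has_derivative fd (\<lambda>y. fd F y (vs ! i)) y\<^sub>0) (at y\<^sub>0)" if "i < length fs" for i
      using F2 S(3) that fs(2) vs unfolding fs_def by (auto intro!: fd_works)
  qed
  then have "((\<lambda>y. \<alpha>1 y vs) has_derivative
    (\<lambda>h. fd (\<lambda>z. \<alpha>2 z ?ws) (F y\<^sub>0) (fd F y\<^sub>0 h)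
      + (\<Sum>i<k. \<alpha>2 (F y\<^sub>0) (?ws[i := fd (\<lambda>y. fd F y (vs ! i)) y\<^sub>0 h])))) (at y\<^sub>0)"
    unfolding fs by (rule has_derivative_transform_within_open[OF _ S(1,3)]) (simp add: \<alpha>[OF _ vs])
  from fd_eq[OF this] have 1: "fd (\<lambda>y. \<alpha>1 y vs) y\<^sub>0 (X1 y\<^sub>0) = fd (\<lambda>z. \<alpha>2 z ?ws) (F y\<^sub>0) (X2 (F y\<^sub>0))
      + (\<Sum>i<k. \<alpha>2 (F y\<^sub>0) (?ws[i := fd (\<lambda>y. fd F y (vs ! i)) y\<^sub>0 (X1 y\<^sub>0)]))"
    by (simp add: X(3)[OF S(3)])
  have 2: "\<alpha>1 y\<^sub>0 (vs[i := fd X1 y\<^sub>0 (vs ! i)]) = \<alpha>2 (F y\<^sub>0) (?ws[i := fd F y\<^sub>0 (fd X1 y\<^sub>0 (vs ! i))])" if "i < k" for i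
    using \<alpha>[OF S(3), of "vs[i := fd X1 y\<^sub>0 (vs ! i)]"] vs by (simp add: map_update)
  have 3: "\<alpha>2 (F y\<^sub>0) (?ws[i := fd X2 (F y\<^sub>0) (fd F y\<^sub>0 (vs ! i))]) = \<alpha>2 (F y\<^sub>0) (?ws[i := fd (\<lambda>y. fd F y (vs ! i)) y\<^sub>0 (X1 y\<^sub>0)])
     + \<alpha>2 (F y\<^sub>0) (?ws[i := fd F y\<^sub>0 (fd X1 y\<^sub>0 (vs ! i))])" if "i < k" for i
    using linear_add[OF multilinear_linear[OF ml[OF S(3)], of ?ws i]] that vs
      related_field_derivative[OF S X, of "vs ! i"] by simp
  show ?thesis unfolding lie_rep_def 1 using vs
    by (simp add: 2 3 sum.distrib)
qed

text \<open>With the density \<open>\<rho> = vol std_frame\<close> this is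
  \<open>div (\<rho> \<nu>) / \<rho>\<close> after the product rule, the divergence with respect to
  the volume form.\<close>

definition divergence_rep :: "(real^'n::finite \<Rightarrow> 'n form) \<Rightarrow> (real^'n \<Rightarrow> real^'n) \<Rightarrow> real^'n \<Rightarrow> real" where
  "divergence_rep vol \<nu> y = fd (\<lambda>y. vol y std_frame) y (\<nu> y) / vol y std_frame + (\<Sum>b\<in>Basis. fd \<nu> y b \<bullet> b)"

lemma fd_top_form:
  fixes vol :: "real^'n::finite \<Rightarrow> 'n form"
  assumes S: "open S" "y\<^sub>0 \<in> S" and vol: "\<And>y. y \<in> S \<Longrightarrow> alternating_form CARD('n) (vol y)"
    and nz: "vol y\<^sub>0 std_frame \<noteq> 0" and d: "(\<lambda>y. vol y std_frame) differentiable at y\<^sub>0"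
  shows "((\<lambda>y. vol y vs) has_derivative (\<lambda>h. fd (\<lambda>y. vol y std_frame) y\<^sub>0 h * (vol y\<^sub>0 vs / vol y\<^sub>0 std_frame))) (at y\<^sub>0)"
proof -
  have "((\<lambda>y. vol y std_frame * (vol y\<^sub>0 vs / vol y\<^sub>0 std_frame)) has_derivative
      (\<lambda>h. fd (\<lambda>y. vol y std_frame) y\<^sub>0 h * (vol y\<^sub>0 vs / vol y\<^sub>0 std_frame))) (at y\<^sub>0)"
    by (intro has_derivative_mult_left fd_works d)
  then show ?thesis
  proof (rule has_derivative_transform_within_open[OF _ S])
    fix y assume "y \<in> S"
    then show "vol y std_frame * (vol y\<^sub>0 vs / vol y\<^sub>0 std_frame) = vol y vs"
      using top_form_proportional[OF vol[of y] vol[OF S(2)], of vs] nz by (simp add: field_simps)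
  qed
qed

text \<open>The derivative of the density gives the first summand of the divergence, the trace
  identity the second. Through this identity naturality of Lie derivatives becomes invariance of the
  divergence.\<close>

lemma lie_rep_top_form:
  fixes vol :: "real^'n::finite \<Rightarrow> 'n form"
  assumes S: "open S" "y\<^sub>0 \<in> S" and vol: "\<And>y. y \<in> S \<Longrightarrow> alternating_form CARD('n) (vol y)"
    and nz: "vol y\<^sub>0 std_frame \<noteq> 0" and d: "(\<lambda>y. vol y std_frame) differentiable at y\<^sub>0"
    and \<nu>: "\<nu> differentiable at y\<^sub>0" and vs: "length vs = CARD('n)"
  shows "lie_rep \<nu> vol y\<^sub>0 vs = divergence_rep vol \<nu> y\<^sub>0 * vol y\<^sub>0 vs"
proof -
  have "fd (\<lambda>y. vol y vs) y\<^sub>0 (\<nu> y\<^sub>0) = fd (\<lambda>y. vol y std_frame) y\<^sub>0 (\<nu> y\<^sub>0) * (vol y\<^sub>0 vs / vol y\<^sub>0 std_frame)"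
    by (rule fun_cong[OF fd_eq[OF fd_top_form[OF S vol nz d, of vs]]])
  then show ?thesis
    unfolding lie_rep_def vs top_form_trace[OF vol[OF S(2)] linear_frechet_derivative[OF \<nu>] vs]
    by (simp add: divergence_rep_def algebra_simps)
qed

text \<open>The derivative of \<open>f\<close> along \<open>\<nu>\<close> occurs twice with opposite
  signs: in the divergence of \<open>f \<nu>\<close> and in the bracket of \<open>f \<nu>\<close>
  with \<open>\<nu>\<close>. So no derivative of \<open>f\<close> survives, and the integrand of the
  first variation is a function times the area form.\<close>

lemma lie_rep_area_form:
  fixes vol :: "real^'n::finite \<Rightarrow> 'n form" and f :: "real^'n \<Rightarrow> real"
  assumes S: "open S" "y\<^sub>0 \<in> S" and vol: "\<And>y. y \<in> S \<Longrightarrow> alternating_form CARD('n) (vol y)"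
    and nz: "vol y\<^sub>0 std_frame \<noteq> 0" and d: "(\<lambda>y. vol y std_frame) differentiable at y\<^sub>0"
    and \<nu>: "\<nu> differentiable at y\<^sub>0" and f: "f differentiable at y\<^sub>0" and vs: "length vs = CARD('n) - 1"
  shows "lie_rep (\<lambda>y. f y *\<^sub>R \<nu> y) (\<lambda>y vs. vol y (\<nu> y # vs)) y\<^sub>0 vs
    = f y\<^sub>0 * divergence_rep vol \<nu> y\<^sub>0 * vol y\<^sub>0 (\<nu> y\<^sub>0 # vs)"
proof -
  let ?X = "\<lambda>y. f y *\<^sub>R \<nu> y"
  define \<rho>' where "\<rho>' = fd (\<lambda>y. vol y std_frame) y\<^sub>0"
  define \<rho> where "\<rho> = vol y\<^sub>0 std_frame"
  have len: "length (w # vs) = CARD('n)" for w by (rule length_1_card[OF vs])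
  have lin1: "linear (\<lambda>w. vol y\<^sub>0 (w # vs))"
    using multilinear_linear[OF alternating_form_multilinear[OF vol[OF S(2)]] len[of 0], of 0] by simp
  have dX: "(?X has_derivative (\<lambda>h. f y\<^sub>0 *\<^sub>R fd \<nu> y\<^sub>0 h + fd f y\<^sub>0 h *\<^sub>R \<nu> y\<^sub>0)) (at y\<^sub>0)"
    by (intro has_derivative_scaleR fd_works \<nu> f)
  have fdX: "fd ?X y\<^sub>0 h = f y\<^sub>0 *\<^sub>R fd \<nu> y\<^sub>0 h + fd f y\<^sub>0 h *\<^sub>R \<nu> y\<^sub>0" for h
    using fd_eq[OF dX] by simp
  have linX: "linear (fd ?X y\<^sub>0)" unfolding fd_eq[OF dX] using dX by (rule has_derivative_linear)
  have exp: "vol y (w # vs) = (\<Sum>b\<in>Basis. (w \<bullet> b) * vol y (b # vs))" if "y \<in> S" for y w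
    using multilinear_expand[OF alternating_form_multilinear[OF vol[OF that]] len[of w], of 0 w] by simp
  have "((\<lambda>y. \<Sum>b\<in>Basis. (\<nu> y \<bullet> b) * vol y (b # vs)) has_derivative
     (\<lambda>h. \<Sum>b\<in>Basis. (\<nu> y\<^sub>0 \<bullet> b) * (\<rho>' h * (vol y\<^sub>0 (b # vs) / \<rho>)) + (fd \<nu> y\<^sub>0 h \<bullet> b) * vol y\<^sub>0 (b # vs))) (at y\<^sub>0)"
    unfolding \<rho>'_def \<rho>_def
    by (intro has_derivative_sum has_derivative_mult has_derivative_inner_left fd_works[OF \<nu>] fd_top_form[OF S vol nz d])
  then have "((\<lambda>y. vol y (\<nu> y # vs)) has_derivative
     (\<lambda>h. \<Sum>b\<in>Basis. (\<nu> y\<^sub>0 \<bullet> b) * (\<rho>' h * (vol y\<^sub>0 (b # vs) / \<rho>)) + (fd \<nu> y\<^sub>0 h \<bullet> b) * vol y\<^sub>0 (b # vs))) (at y\<^sub>0)"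
    by (rule has_derivative_transform_within_open[OF _ S]) (simp add: exp[symmetric])
  from fd_eq[OF this] have e0: "fd (\<lambda>y. vol y (\<nu> y # vs)) y\<^sub>0 h
     = (\<Sum>b\<in>Basis. (\<rho>' h / \<rho>) * ((\<nu> y\<^sub>0 \<bullet> b) * vol y\<^sub>0 (b # vs))) + (\<Sum>b\<in>Basis. (fd \<nu> y\<^sub>0 h \<bullet> b) * vol y\<^sub>0 (b # vs))" for h
    by (simp add: sum.distrib mult_ac)
  have 1: "fd (\<lambda>y. vol y (\<nu> y # vs)) y\<^sub>0 h = (\<rho>' h / \<rho>) * vol y\<^sub>0 (\<nu> y\<^sub>0 # vs) + vol y\<^sub>0 (fd \<nu> y\<^sub>0 h # vs)" for h
    unfolding exp[OF S(2), of "\<nu> y\<^sub>0"] exp[OF S(2), of "fd \<nu> y\<^sub>0 h"] sum_distrib_left by (rule e0)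
  have shift: "(\<Sum>i<CARD('n). F i) = F 0 + (\<Sum>i<CARD('n) - 1. F (Suc i))" for F :: "nat \<Rightarrow> real"
    by (metis sum.lessThan_Suc_shift Suc_card_minus)
  have tr: "(\<Sum>b\<in>Basis. fd ?X y\<^sub>0 b \<bullet> b) = f y\<^sub>0 * (\<Sum>b\<in>Basis. fd \<nu> y\<^sub>0 b \<bullet> b) + fd f y\<^sub>0 (\<nu> y\<^sub>0)"
  proof -
    have "fd f y\<^sub>0 (\<nu> y\<^sub>0) = (\<Sum>b\<in>Basis. (\<nu> y\<^sub>0 \<bullet> b) *\<^sub>R fd f y\<^sub>0 b)" by (rule linear_fd_expand[OF f])
    then show ?thesis by (simp add: fdX inner_add_left sum.distrib sum_distrib_left mult.commute)
  qed
  have "vol y\<^sub>0 (fd ?X y\<^sub>0 (\<nu> y\<^sub>0) # vs) + (\<Sum>i<CARD('n) - 1. vol y\<^sub>0 (\<nu> y\<^sub>0 # vs[i := fd ?X y\<^sub>0 (vs ! i)]))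
    = (\<Sum>b\<in>Basis. fd ?X y\<^sub>0 b \<bullet> b) * vol y\<^sub>0 (\<nu> y\<^sub>0 # vs)"
    using top_form_trace[OF vol[OF S(2)] linX len[of "\<nu> y\<^sub>0"]]
    unfolding shift by simp
  \<comment> \<open>The trace identity for the list \<open>\<nu> # vs\<close>, with the contribution
    of the first slot moved to the right and expanded.\<close>
  then have 2: "(\<Sum>i<CARD('n) - 1. vol y\<^sub>0 (\<nu> y\<^sub>0 # vs[i := fd ?X y\<^sub>0 (vs ! i)]))
    = (f y\<^sub>0 * (\<Sum>b\<in>Basis. fd \<nu> y\<^sub>0 b \<bullet> b) + fd f y\<^sub>0 (\<nu> y\<^sub>0)) * vol y\<^sub>0 (\<nu> y\<^sub>0 # vs)
      - (f y\<^sub>0 * vol y\<^sub>0 (fd \<nu> y\<^sub>0 (\<nu> y\<^sub>0) # vs) + fd f y\<^sub>0 (\<nu> y\<^sub>0) * vol y\<^sub>0 (\<nu> y\<^sub>0 # vs))"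
    unfolding tr by (simp add: fdX linear_add[OF lin1] linear_scale[OF lin1])
  have lin\<nu>: "linear (fd \<nu> y\<^sub>0)" by (rule linear_frechet_derivative[OF \<nu>])
  have lin\<rho>: "linear \<rho>'" unfolding \<rho>'_def by (rule linear_frechet_derivative[OF d])
  show ?thesis
    unfolding lie_rep_def vs 1 2 divergence_rep_def \<rho>'_def[symmetric] \<rho>_def[symmetric]
      linear_scale[OF lin\<nu>] linear_scale[OF lin\<rho>] linear_scale[OF lin1]
    by (simp add: algebra_simps)
qed

section \<open>Vector fields tangent to a closed set\<close>

text \<open>The condition on \<open>N\<close> says that the ball around \<open>z + N\<close> with \<open>z\<close> on its boundary has no point of \<open>Z\<close> in
  its interior: \<open>N\<close> is a proximal normal of \<open>Z\<close> at \<open>z\<close>.\<close>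

definition tangent_on :: "'a::euclidean_space set \<Rightarrow> 'a set \<Rightarrow> ('a \<Rightarrow> 'a) \<Rightarrow> bool" where
  "tangent_on Z \<Omega> X \<longleftrightarrow>
     (\<forall>z\<in>Z \<inter> \<Omega>. \<forall>N. (\<forall>x\<in>Z. norm N \<le> norm (x - (z + N))) \<longrightarrow> X z \<bullet> N = 0)"

text \<open>Along an Euler polygon of step \<open>h\<close> the squared distance to \<open>Z\<close> grows by at most a factor \<open>1 + O(h)\<close> plus
  \<open>O(h\<^sup>2)\<close> per step, since the first-order term vanishes by tangency. So fine polygons end near \<open>Z\<close>, and no
  flow of \<open>X\<close> is needed.\<close>

lemma euler_polygon_near:
  fixes X :: "'a::euclidean_space \<Rightarrow> 'a"
  assumes Z: "closed Z" and \<Omega>: "open \<Omega>" and X: "Ck_on 2 \<Omega> X" and tan: "tangent_on Z \<Omega> X"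
    and z0: "z\<^sub>0 \<in> Z \<inter> \<Omega>"
  obtains C t\<^sub>0 r where "C > 0" "t\<^sub>0 > 0" "r > 0"
    "\<And>z t. z \<in> Z \<Longrightarrow> z \<in> cball z\<^sub>0 r \<Longrightarrow> \<bar>t\<bar> \<le> t\<^sub>0 \<Longrightarrow>
       \<exists>z'\<in>Z. norm (z' - (z + t *\<^sub>R X z + (t\<^sup>2 / 2) *\<^sub>R fd X z (X z))) \<le> C * \<bar>t\<bar> ^ 3"
proof -
  have X2: "Ck_on (Suc (Suc 0)) \<Omega> X" using X by (simp add: numeral_2_eq_2)
  have X1: "Ck_on (Suc 0) \<Omega> X" using X2 by (rule Ck_on_Suc_lower)
  obtain R where R: "R > 0" "cball z\<^sub>0 R \<subseteq> \<Omega>" using \<Omega> z0 open_contains_cball by blast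
  let ?K = "cball z\<^sub>0 R"
  obtain L where L: "L > 0" "\<And>x v. x \<in> ?K \<Longrightarrow> norm (fd X x v) \<le> L * norm v"
    "\<And>x y. x \<in> ?K \<Longrightarrow> y \<in> ?K \<Longrightarrow> norm (X x - X y) \<le> L * norm (x - y)"
    using C1_lipschitz_compact[OF X1 compact_cball convex_cball R(2)] by blast
  obtain C2 where C2: "C2 > 0"
    "\<And>x y. x \<in> ?K \<Longrightarrow> y \<in> ?K \<Longrightarrow> norm (X y - X x - fd X x (y - x)) \<le> C2 * (norm (y - x))\<^sup>2"
    using C2_taylor_compact[OF X2 compact_cball convex_cball R(2)] by blast
  have "continuous_on ?K X" using Ck_on_continuous[OF X] R(2) continuous_on_subset by blast
  then have "bounded (X ` ?K)" using compact_continuous_image compact_imp_bounded compact_cball by blast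
  then obtain B where B: "B > 0" "\<And>x. x \<in> ?K \<Longrightarrow> norm (X x) \<le> B" by (auto simp: bounded_pos)
  \<comment> \<open>The polygon moves by at most \<open>t\<^sub>0 * B = R / 4\<close>, so from
    \<open>cball z\<^sub>0 (R/4)\<close> it stays in the ball of radius \<open>R/2\<close>.\<close>
  define t\<^sub>0 where "t\<^sub>0 = R / (4 * B)"
  have t0: "t\<^sub>0 > 0" "t\<^sub>0 * B = R / 4" using R B by (auto simp: t\<^sub>0_def)
  define C1 where "C1 = C2 * B\<^sup>2 + L\<^sup>2 * B"
  have C1: "C1 > 0" using C2 B L by (auto simp: C1_def intro!: add_pos_pos)
  have main: "\<exists>z'\<in>Z. norm (z' - (z + t *\<^sub>R X z + (t\<^sup>2 / 2) *\<^sub>R fd X z (X z))) \<le> C1 * \<bar>t\<bar> ^ 3"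
    if z: "z \<in> Z" "z \<in> cball z\<^sub>0 (R/4)" and t: "\<bar>t\<bar> \<le> t\<^sub>0" for z t
  proof -
    define tgt where "tgt = z + t *\<^sub>R X z + (t\<^sup>2 / 2) *\<^sub>R fd X z (X z)"
    \<comment> \<open>\<open>E / n\<close> will bound the squared distance of the endpoint from
      \<open>Z\<close> after \<open>n\<close> steps, and \<open>F / n\<close> the effect of having
      \<open>n (n - 1) / 2\<close> instead of \<open>n^2 / 2\<close> in the second-order
      term.\<close>
    define E where "E = t\<^sup>2 * B\<^sup>2 * exp (2 * L * \<bar>t\<bar>)"
    define F where "F = t\<^sup>2 * (L * B) / 2"
    have zK: "z \<in> ?K" using z R by auto
    have key: "infdist tgt Z \<le> sqrt (E / real n) + C1 * \<bar>t\<bar> ^ 3 + F / real n" if n: "n > 0" for n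
    proof -
      define h where "h = t / real n"
      have hn: "real n * \<bar>h\<bar> = \<bar>t\<bar>" "real n * h = t" using n by (auto simp: h_def)
      define x where "x k = ((\<lambda>x. x + h *\<^sub>R X x) ^^ k) z" for k
      have x0: "x 0 = z" and xS: "x (Suc k) = x k + h *\<^sub>R X (x k)" for k by (simp_all add: x_def)
      have kn: "real k * \<bar>h\<bar> * B \<le> R / 4" if "k \<le> n" for k
      proof -
        have "real k * \<bar>h\<bar> \<le> real n * \<bar>h\<bar>" using that by (intro mult_right_mono) auto
        also have "\<dots> \<le> t\<^sub>0" using hn t by simp
        finally have "real k * \<bar>h\<bar> * B \<le> t\<^sub>0 * B" using B by (intro mult_right_mono) auto
        then show ?thesis using t0 by simp
      qed
      have inK: "x k \<in> cball z\<^sub>0 (R/2)" if "norm (x k - z) \<le> real k * \<bar>h\<bar> * B" "k \<le> n" for k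
      proof -
        have "dist z\<^sub>0 (x k) \<le> dist z\<^sub>0 z + norm (x k - z)"
          using dist_triangle[of z\<^sub>0 "x k" z] by (simp add: dist_norm norm_minus_commute)
        also have "\<dots> \<le> R/4 + R/4"
          using z order_trans[OF that(1) kn[OF that(2)]] by (intro add_mono) auto
        finally show ?thesis by simp
      qed
      have half: "cball z\<^sub>0 (R/2) \<subseteq> ?K" using R by auto
      have xb: "norm (x k - z) \<le> real k * \<bar>h\<bar> * B" if "k \<le> n" for k
        using that
      proof (induction k)
        case 0
        then show ?case by (simp add: x0)
      next
        case (Suc k)
        then have IH: "norm (x k - z) \<le> real k * \<bar>h\<bar> * B" by simp
        then have "x k \<in> ?K" using inK half Suc.prems by (meson Suc_leD subsetD)
        then have "norm (h *\<^sub>R X (x k)) \<le> \<bar>h\<bar> * B" using B by (simp add: mult_left_mono)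
        moreover have "norm (x (Suc k) - z) \<le> norm (x k - z) + norm (h *\<^sub>R X (x k))"
          using norm_triangle_ineq[of "x k - z" "h *\<^sub>R X (x k)"] by (simp add: xS algebra_simps)
        ultimately show ?case using IH by (simp add: algebra_simps)
      qed
      have xK: "x k \<in> ?K" if "k \<le> n" for k using inK[OF xb[OF that] that] half by auto
      define a where "a = 1 + 2 * \<bar>h\<bar> * L"
      have a: "a \<ge> 1" using L by (simp add: a_def)
      have dist1: "(infdist (x k) Z)\<^sup>2 \<le> real k * (h\<^sup>2 * B\<^sup>2) * a ^ k" if "k \<le> n" for k
        using that
      proof (induction k)
        case 0
        then show ?case using z by (simp add: x0)
      next
        case (Suc k)
        then have k: "k \<le> n" by simp
        obtain y where y: "y \<in> Z" "infdist (x k) Z = dist (x k) y"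
          using infdist_attains_inf[OF Z] z by blast
        define N where "N = x k - y"
        have dy: "norm N \<le> norm (x k - u)" if "u \<in> Z" for u
          using infdist_le[OF that, of "x k"] y by (simp add: N_def dist_norm)
        have "norm N \<le> R/4" using dy[OF z(1)] xb[OF k] kn[OF k] by simp
        then have "dist z\<^sub>0 y \<le> R"
          using inK[OF xb[OF k] k] dist_triangle[of z\<^sub>0 y "x k"] R by (simp add: N_def dist_norm)
        then have yK: "y \<in> ?K" by simp
        have "norm N \<le> norm (u - (y + N))" if "u \<in> Z" for u
          using dy[OF that] by (simp add: N_def norm_minus_commute)
        \<comment> \<open>\<open>N\<close> is a proximal normal at the nearest point
          \<open>y\<close>: no point of \<open>Z\<close> is closer to \<open>x k = y + N\<close>
          than \<open>y\<close>.\<close>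
        then have orth: "X y \<bullet> N = 0" using tan yK R(2) y(1) unfolding tangent_on_def by blast
        have "N \<bullet> X (x k) = N \<bullet> (X (x k) - X y)" using orth by (simp add: inner_diff_right inner_commute)
        then have "\<bar>N \<bullet> X (x k)\<bar> \<le> norm N * norm (X (x k) - X y)" using Cauchy_Schwarz_ineq2 by metis
        also have "\<dots> \<le> norm N * (L * norm N)"
          using L(3)[OF xK[OF k] yK] by (intro mult_left_mono) (auto simp: N_def)
        finally have ip: "\<bar>N \<bullet> X (x k)\<bar> \<le> L * (norm N)\<^sup>2" by (simp add: power2_eq_square mult_ac)
        have "2 * h * (N \<bullet> X (x k)) \<le> 2 * \<bar>h\<bar> * \<bar>N \<bullet> X (x k)\<bar>"
          by (metis abs_ge_self abs_mult abs_numeral)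
        also have "\<dots> \<le> 2 * \<bar>h\<bar> * (L * (norm N)\<^sup>2)" using ip by (intro mult_left_mono) auto
        finally have ip': "2 * h * (N \<bullet> X (x k)) \<le> 2 * \<bar>h\<bar> * L * (norm N)\<^sup>2" by simp
        have "infdist (x (Suc k)) Z \<le> norm (N + h *\<^sub>R X (x k))"
          using infdist_le[OF y(1), of "x (Suc k)"] by (simp add: N_def dist_norm xS algebra_simps)
        then have "(infdist (x (Suc k)) Z)\<^sup>2 \<le> (norm (N + h *\<^sub>R X (x k)))\<^sup>2"
          by (intro power_mono) (auto simp: infdist_nonneg)
        also have "\<dots> = (norm N)\<^sup>2 + 2 * h * (N \<bullet> X (x k)) + h\<^sup>2 * (norm (X (x k)))\<^sup>2"
          unfolding power2_norm_eq_inner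
          by (simp add: inner_add_left inner_add_right inner_commute power2_eq_square algebra_simps)
        also have "\<dots> \<le> (norm N)\<^sup>2 + 2 * \<bar>h\<bar> * L * (norm N)\<^sup>2 + h\<^sup>2 * B\<^sup>2"
          using ip' B xK[OF k] by (intro add_mono mult_left_mono power_mono) auto
        also have "\<dots> = a * (infdist (x k) Z)\<^sup>2 + h\<^sup>2 * B\<^sup>2"
          by (simp add: a_def y N_def dist_norm algebra_simps)
        also have "\<dots> \<le> a * (real k * (h\<^sup>2 * B\<^sup>2) * a ^ k) + h\<^sup>2 * B\<^sup>2 * a ^ Suc k"
        proof (intro add_mono mult_left_mono)
          show "(infdist (x k) Z)\<^sup>2 \<le> real k * (h\<^sup>2 * B\<^sup>2) * a ^ k" using Suc.IH k by simp
          have "1 \<le> a ^ Suc k" using a by (rule one_le_power)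
          then have "h\<^sup>2 * B\<^sup>2 * 1 \<le> h\<^sup>2 * B\<^sup>2 * a ^ Suc k" by (rule mult_left_mono) simp
          then show "h\<^sup>2 * B\<^sup>2 \<le> h\<^sup>2 * B\<^sup>2 * a ^ Suc k" by simp
        qed (use a in auto)
        also have "\<dots> = real (Suc k) * (h\<^sup>2 * B\<^sup>2) * a ^ Suc k" by (simp add: algebra_simps)
        finally show ?case .
      qed
      have "a ^ n \<le> exp (2 * \<bar>h\<bar> * L) ^ n"
        using a exp_ge_add_one_self[of "2 * \<bar>h\<bar> * L"] by (intro power_mono) (auto simp: a_def)
      also have "\<dots> = exp (2 * L * \<bar>t\<bar>)" unfolding exp_of_nat_mult[symmetric] hn(1)[symmetric] by (simp add: mult_ac)
      finally have an: "a ^ n \<le> exp (2 * L * \<bar>t\<bar>)" .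
      have "(infdist (x n) Z)\<^sup>2 \<le> real n * (h\<^sup>2 * B\<^sup>2) * exp (2 * L * \<bar>t\<bar>)"
        by (rule order_trans[OF dist1[OF order_refl] mult_left_mono[OF an]]) simp
      also have "\<dots> = E / real n" using n by (simp add: E_def h_def power2_eq_square)
      finally have i1: "infdist (x n) Z \<le> sqrt (E / real n)" by (rule real_le_rsqrt)
      have f: "norm (x k - z - (real k * h) *\<^sub>R X z) \<le> L * B * (h\<^sup>2 * (real k)\<^sup>2)" if "k \<le> n" for k
        using that
      proof (induction k)
        case 0
        then show ?case by (simp add: x0)
      next
        case (Suc k)
        then have k: "k \<le> n" by simp
        have "x (Suc k) - z - (real (Suc k) * h) *\<^sub>R X z = (x k - z - (real k * h) *\<^sub>R X z) + h *\<^sub>R (X (x k) - X z)"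
          by (simp add: xS algebra_simps)
        then have "norm (x (Suc k) - z - (real (Suc k) * h) *\<^sub>R X z) \<le>
          norm (x k - z - (real k * h) *\<^sub>R X z) + \<bar>h\<bar> * norm (X (x k) - X z)"
          by (metis norm_scaleR norm_triangle_ineq)
        also have "\<dots> \<le> L * B * (h\<^sup>2 * (real k)\<^sup>2) + \<bar>h\<bar> * (L * (real k * \<bar>h\<bar> * B))"
        proof (intro add_mono mult_left_mono)
          have "norm (X (x k) - X z) \<le> L * norm (x k - z)" using L(3)[OF xK[OF k] zK] .
          also have "\<dots> \<le> L * (real k * \<bar>h\<bar> * B)" using xb[OF k] L by (intro mult_left_mono) auto
          finally show "norm (X (x k) - X z) \<le> L * (real k * \<bar>h\<bar> * B)" .
        qed (use Suc k in auto)
        also have "\<dots> = L * B * (h\<^sup>2 * ((real k)\<^sup>2 + real k))"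
          by (simp add: algebra_simps power2_eq_square)
        also have "\<dots> \<le> L * B * (h\<^sup>2 * (real (Suc k))\<^sup>2)"
          using L B by (intro mult_left_mono) (auto simp: power2_eq_square algebra_simps)
        finally show ?case .
      qed
      have lin: "linear (fd X z)" using X1 zK R(2) by (auto intro!: linear_frechet_derivative)
      \<comment> \<open>\<open>k (k - 1) / 2\<close> is the sum of all \<open>j < k\<close>: step
        \<open>j\<close> evaluates \<open>X\<close> at a point displaced by about
        \<open>j h X z\<close>. At \<open>k = n\<close> the coefficient falls short of
        \<open>t^2 / 2\<close> by \<open>t^2 / (2 n)\<close>.\<close>
      have e: "norm (x k - (z + (real k * h) *\<^sub>R X z + (h\<^sup>2 * (real k * (real k - 1)) / 2) *\<^sub>R fd X z (X z)))
         \<le> C1 * (\<bar>h\<bar> ^ 3 * (real k) ^ 3)" (is "norm (?e k) \<le> _") if "k \<le> n" for k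
        using that
      proof (induction k)
        case 0
        then show ?case by (simp add: x0)
      next
        case (Suc k)
        then have k: "k \<le> n" by simp
        have "?e (Suc k) = ?e k + h *\<^sub>R (X (x k) - X z - fd X z (x k - z)) + h *\<^sub>R fd X z (x k - z - (real k * h) *\<^sub>R X z)"
        proof -
          have "h\<^sup>2 * (real (Suc k) * (real (Suc k) - 1)) / 2 = h\<^sup>2 * (real k * (real k - 1)) / 2 + h * (real k * h)"
            by (simp add: power2_eq_square field_simps)
          then have 1: "(h\<^sup>2 * (real (Suc k) * (real (Suc k) - 1)) / 2) *\<^sub>R fd X z (X z)
            = (h\<^sup>2 * (real k * (real k - 1)) / 2) *\<^sub>R fd X z (X z) + (h * (real k * h)) *\<^sub>R fd X z (X z)"
            by (simp only: scaleR_add_left)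
          have 2: "(real (Suc k) * h) *\<^sub>R X z = (real k * h) *\<^sub>R X z + h *\<^sub>R X z"
            by (simp add: algebra_simps)
          have 3: "fd X z (x k - z - (real k * h) *\<^sub>R X z) = fd X z (x k - z) - (real k * h) *\<^sub>R fd X z (X z)"
            by (simp only: linear_diff[OF lin, of "x k - z"] linear_scale[OF lin])
          show ?thesis unfolding 1 2 3 xS by (simp only: scaleR_diff_right scaleR_scaleR) simp
        qed
        then have "norm (?e (Suc k)) \<le> norm (?e k) + \<bar>h\<bar> * norm (X (x k) - X z - fd X z (x k - z))
           + \<bar>h\<bar> * norm (fd X z (x k - z - (real k * h) *\<^sub>R X z))"
          using norm_triangle_ineq[of "?e k + h *\<^sub>R (X (x k) - X z - fd X z (x k - z))" "h *\<^sub>R fd X z (x k - z - (real k * h) *\<^sub>R X z)"]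
            norm_triangle_ineq[of "?e k" "h *\<^sub>R (X (x k) - X z - fd X z (x k - z))"]
          by (simp only: norm_scaleR)
        also have "\<dots> \<le> C1 * (\<bar>h\<bar> ^ 3 * (real k) ^ 3) + \<bar>h\<bar> * (C2 * (real k * \<bar>h\<bar> * B)\<^sup>2)
           + \<bar>h\<bar> * (L * (L * B * (h\<^sup>2 * (real k)\<^sup>2)))"
        proof (intro add_mono mult_left_mono)
          have "norm (X (x k) - X z - fd X z (x k - z)) \<le> C2 * (norm (x k - z))\<^sup>2" using C2(2)[OF zK xK[OF k]] .
          also have "\<dots> \<le> C2 * (real k * \<bar>h\<bar> * B)\<^sup>2" using xb[OF k] C2 by (intro mult_left_mono power_mono) auto
          finally show "norm (X (x k) - X z - fd X z (x k - z)) \<le> C2 * (real k * \<bar>h\<bar> * B)\<^sup>2" .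
          have "norm (fd X z (x k - z - (real k * h) *\<^sub>R X z)) \<le> L * norm (x k - z - (real k * h) *\<^sub>R X z)"
            using L(2)[OF zK] .
          also have "\<dots> \<le> L * (L * B * (h\<^sup>2 * (real k)\<^sup>2))" using f[OF k] L by (intro mult_left_mono) auto
          finally show "norm (fd X z (x k - z - (real k * h) *\<^sub>R X z)) \<le> L * (L * B * (h\<^sup>2 * (real k)\<^sup>2))" .
        qed (use Suc.IH k in auto)
        also have "\<dots> = C1 * (\<bar>h\<bar> ^ 3 * ((real k) ^ 3 + (real k)\<^sup>2))"
        proof -
          have "h\<^sup>2 = \<bar>h\<bar> * \<bar>h\<bar>" by (simp add: power2_eq_square)
          then show ?thesis by (simp add: C1_def algebra_simps power2_eq_square power3_eq_cube)
        qed
        also have "\<dots> \<le> C1 * (\<bar>h\<bar> ^ 3 * (real (Suc k)) ^ 3)"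
        proof (intro mult_left_mono)
          show "(real k) ^ 3 + (real k)\<^sup>2 \<le> (real (Suc k)) ^ 3"
            by (simp add: power2_eq_square power3_eq_cube algebra_simps)
        qed (use C1 in auto)
        finally show ?case .
      qed
      have "norm (x n - (z + t *\<^sub>R X z + (h\<^sup>2 * (real n * (real n - 1)) / 2) *\<^sub>R fd X z (X z))) \<le> C1 * \<bar>t\<bar> ^ 3"
        using e[of n] hn by (simp add: power_mult_distrib[symmetric] mult.commute)
      moreover have "(z + t *\<^sub>R X z + (h\<^sup>2 * (real n * (real n - 1)) / 2) *\<^sub>R fd X z (X z))
         = tgt - (t\<^sup>2 / (2 * real n)) *\<^sub>R fd X z (X z)"
      proof -
        have "h\<^sup>2 * (real n * (real n - 1)) / 2 = t\<^sup>2 / 2 - t\<^sup>2 / (2 * real n)"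
          using n by (simp add: h_def field_simps power2_eq_square)
        then show ?thesis unfolding tgt_def by (simp only: scaleR_diff_left) simp
      qed
      ultimately have "norm (x n - (tgt - (t\<^sup>2 / (2 * real n)) *\<^sub>R fd X z (X z))) \<le> C1 * \<bar>t\<bar> ^ 3"
        by (simp only:)
      then have "norm (x n - tgt + (t\<^sup>2 / (2 * real n)) *\<^sub>R fd X z (X z)) \<le> C1 * \<bar>t\<bar> ^ 3"
        by (simp only: diff_diff_eq2 diff_add_eq)
      moreover have "norm ((t\<^sup>2 / (2 * real n)) *\<^sub>R fd X z (X z)) \<le> F / real n"
      proof -
        have "norm (fd X z (X z)) \<le> L * norm (X z)" by (rule L(2)[OF zK])
        also have "\<dots> \<le> L * B" using B(2)[OF zK] L by (intro mult_left_mono) auto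
        finally have "norm ((t\<^sup>2 / (2 * real n)) *\<^sub>R fd X z (X z)) \<le> (t\<^sup>2 / (2 * real n)) * (L * B)"
          by (simp add: mult_left_mono divide_right_mono)
        then show ?thesis by (simp add: F_def field_simps)
      qed
      ultimately have "norm (x n - tgt) \<le> C1 * \<bar>t\<bar> ^ 3 + F / real n"
        using norm_triangle_ineq4[of "x n - tgt + (t\<^sup>2 / (2 * real n)) *\<^sub>R fd X z (X z)" "(t\<^sup>2 / (2 * real n)) *\<^sub>R fd X z (X z)"]
        by simp
      then show ?thesis
        using infdist_triangle[of tgt Z "x n"] i1 by (simp add: dist_norm norm_minus_commute)
    qed
    \<comment> \<open>The target does not depend on \<open>n\<close>; as \<open>n\<close> grows only
      the cubic term remains.\<close>
    have "infdist tgt Z \<le> C1 * \<bar>t\<bar> ^ 3"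
    proof (rule LIMSEQ_le_const)
      have i: "(\<lambda>n. inverse (real (Suc n))) \<longlonglongrightarrow> 0" by (rule LIMSEQ_inverse_real_of_nat)
      have "(\<lambda>n. sqrt (E * inverse (real (Suc n))) + C1 * \<bar>t\<bar> ^ 3 + F * inverse (real (Suc n))) \<longlonglongrightarrow> sqrt (E * 0) + C1 * \<bar>t\<bar> ^ 3 + F * 0"
        by (intro tendsto_intros i)
      then show "(\<lambda>n. sqrt (E * inverse (real (Suc n))) + C1 * \<bar>t\<bar> ^ 3 + F * inverse (real (Suc n))) \<longlonglongrightarrow> C1 * \<bar>t\<bar> ^ 3"
        by simp
      have "infdist tgt Z \<le> sqrt (E * inverse (real (Suc n))) + C1 * \<bar>t\<bar> ^ 3 + F * inverse (real (Suc n))" for n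
        using key[of "Suc n"] by (simp add: divide_inverse)
      then show "\<exists>N. \<forall>n\<ge>N. infdist tgt Z \<le> sqrt (E * inverse (real (Suc n))) + C1 * \<bar>t\<bar> ^ 3 + F * inverse (real (Suc n))"
        by blast
    qed
    moreover obtain y where "y \<in> Z" "infdist tgt Z = dist tgt y" using infdist_attains_inf[OF Z] z by blast
    ultimately show ?thesis by (auto simp: tgt_def[symmetric] dist_norm norm_minus_commute intro!: bexI[of _ y])
  qed
  show ?thesis by (rule that[of C1 t\<^sub>0 "R/4"]) (use main C1 t0 R in auto)
qed

text \<open>A curve in \<open>Z\<close> is followed through its expansion
  \<open>z\<^sub>0 + t p + t^2 q\<close> at 0. Moving on from \<open>z t\<close> along
  \<open>\<sigma> X\<close> for time \<open>t\<close> adds \<open>\<sigma> X z\<^sub>0\<close> to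
  \<open>p\<close>. Since \<open>X\<close> is evaluated at the displaced point, it adds
  \<open>\<sigma> fd X z\<^sub>0 p\<close> to \<open>q\<close>, besides the second-order term of
  \<open>X\<close> itself, which is even in \<open>\<sigma>\<close>.\<close>

lemma tangent_curve_step:
  fixes X :: "'a::euclidean_space \<Rightarrow> 'a"
  assumes Z: "closed Z" and \<Omega>: "open \<Omega>" and X: "Ck_on 2 \<Omega> X" and tan: "tangent_on Z \<Omega> X"
    and z0: "z\<^sub>0 \<in> Z \<inter> \<Omega>" and \<sigma>: "\<sigma> = 1 \<or> \<sigma> = -1"
    and zZ: "\<forall>\<^sub>F t in at_right 0. z t \<in> Z"
    and lim: "((\<lambda>t. inverse (t\<^sup>2) *\<^sub>R (z t - z\<^sub>0 - t *\<^sub>R p)) \<longlongrightarrow> q) (at_right 0)"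
  shows "\<exists>z'. (\<forall>\<^sub>F t in at_right 0. z' t \<in> Z) \<and>
    ((\<lambda>t. inverse (t\<^sup>2) *\<^sub>R (z' t - z\<^sub>0 - t *\<^sub>R (p + \<sigma> *\<^sub>R X z\<^sub>0))) \<longlongrightarrow>
      q + \<sigma> *\<^sub>R fd X z\<^sub>0 p + (1/2) *\<^sub>R fd X z\<^sub>0 (X z\<^sub>0)) (at_right 0)"
proof -
  obtain C t\<^sub>0 r where C: "C > 0" "t\<^sub>0 > 0" "r > 0"
    "\<And>z t. z \<in> Z \<Longrightarrow> z \<in> cball z\<^sub>0 r \<Longrightarrow> \<bar>t\<bar> \<le> t\<^sub>0 \<Longrightarrow>
       \<exists>z'\<in>Z. norm (z' - (z + t *\<^sub>R X z + (t\<^sup>2 / 2) *\<^sub>R fd X z (X z))) \<le> C * \<bar>t\<bar> ^ 3"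
    using euler_polygon_near[OF Z \<Omega> X tan z0] by blast
  have X2: "Ck_on (Suc (Suc 0)) \<Omega> X" using X by (simp add: numeral_2_eq_2)
  have t_lim: "((\<lambda>t::real. t) \<longlongrightarrow> 0) (at_right 0)" by (rule tendsto_ident_at)
  have pos: "\<forall>\<^sub>F t in at_right 0. (0::real) < t" by (simp add: eventually_at_right_less)
  have quot: "((\<lambda>t. inverse t *\<^sub>R (z t - z\<^sub>0)) \<longlongrightarrow> p) (at_right 0)"
  proof -
    have "((\<lambda>t. t *\<^sub>R (inverse (t\<^sup>2) *\<^sub>R (z t - z\<^sub>0 - t *\<^sub>R p)) + p) \<longlongrightarrow> 0 *\<^sub>R q + p) (at_right 0)"
      by (intro tendsto_intros t_lim lim)
    moreover have "\<forall>\<^sub>F t in at_right 0. t *\<^sub>R (inverse (t\<^sup>2) *\<^sub>R (z t - z\<^sub>0 - t *\<^sub>R p)) + p = inverse t *\<^sub>R (z t - z\<^sub>0)"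
      using pos
    proof eventually_elim
      case (elim t)
      then have s: "t * inverse (t\<^sup>2) = inverse t" by (simp add: power2_eq_square)
      show ?case unfolding scaleR_scaleR s using elim by (simp add: scaleR_diff_right)
    qed
    ultimately have "((\<lambda>t. inverse t *\<^sub>R (z t - z\<^sub>0)) \<longlongrightarrow> 0 *\<^sub>R q + p) (at_right 0)"
      by (rule Lim_transform_eventually)
    then show ?thesis by simp
  qed
  have zlim: "(z \<longlongrightarrow> z\<^sub>0) (at_right 0)"
  proof -
    have "((\<lambda>t. t *\<^sub>R (inverse t *\<^sub>R (z t - z\<^sub>0)) + z\<^sub>0) \<longlongrightarrow> 0 *\<^sub>R p + z\<^sub>0) (at_right 0)"
      by (intro tendsto_intros t_lim quot)
    moreover have "\<forall>\<^sub>F t in at_right 0. t *\<^sub>R (inverse t *\<^sub>R (z t - z\<^sub>0)) + z\<^sub>0 = z t"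
      using pos by eventually_elim simp
    ultimately have "(z \<longlongrightarrow> 0 *\<^sub>R p + z\<^sub>0) (at_right 0)" by (rule Lim_transform_eventually)
    then show ?thesis by simp
  qed
  obtain R where R: "R > 0" "cball z\<^sub>0 R \<subseteq> \<Omega>" using \<Omega> z0 open_contains_cball by blast
  obtain C2 where C2: "C2 > 0"
    "\<And>x y. x \<in> cball z\<^sub>0 R \<Longrightarrow> y \<in> cball z\<^sub>0 R \<Longrightarrow> norm (X y - X x - fd X x (y - x)) \<le> C2 * (norm (y - x))\<^sup>2"
    using C2_taylor_compact[OF X2 compact_cball convex_cball R(2)] by blast
  have lin: "linear (fd X z\<^sub>0)" using X2 z0 by (auto intro!: linear_frechet_derivative)
  have bl: "bounded_linear (fd X z\<^sub>0)" using lin by (simp add: linear_conv_bounded_linear)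
  have near: "\<forall>\<^sub>F t in at_right 0. z t \<in> cball z\<^sub>0 e" if "e > 0" for e
    using tendstoD[OF zlim that] by eventually_elim (simp add: dist_commute)
  have dq: "((\<lambda>t. inverse t *\<^sub>R (X (z t) - X z\<^sub>0)) \<longlongrightarrow> fd X z\<^sub>0 p) (at_right 0)"
  proof -
    have "((\<lambda>t. inverse t *\<^sub>R (X (z t) - X z\<^sub>0 - fd X z\<^sub>0 (z t - z\<^sub>0))) \<longlongrightarrow> 0) (at_right 0)"
    proof (rule Lim_null_comparison)
      show "\<forall>\<^sub>F t in at_right 0. norm (inverse t *\<^sub>R (X (z t) - X z\<^sub>0 - fd X z\<^sub>0 (z t - z\<^sub>0)))
         \<le> C2 * norm (z t - z\<^sub>0) * norm (inverse t *\<^sub>R (z t - z\<^sub>0))"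
        using near[OF R(1)] pos
      proof eventually_elim
        case (elim t)
        have "norm (X (z t) - X z\<^sub>0 - fd X z\<^sub>0 (z t - z\<^sub>0)) \<le> C2 * (norm (z t - z\<^sub>0))\<^sup>2"
          using C2(2)[of z\<^sub>0 "z t"] elim R by simp
        then have "inverse t * norm (X (z t) - X z\<^sub>0 - fd X z\<^sub>0 (z t - z\<^sub>0)) \<le> inverse t * (C2 * (norm (z t - z\<^sub>0))\<^sup>2)"
          using elim by (intro mult_left_mono) auto
        then show ?case using elim by (simp add: power2_eq_square mult_ac)
      qed
      have "((\<lambda>t. C2 * norm (z t - z\<^sub>0) * norm (inverse t *\<^sub>R (z t - z\<^sub>0))) \<longlongrightarrow> C2 * norm (z\<^sub>0 - z\<^sub>0) * norm p) (at_right 0)"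
        by (intro tendsto_intros zlim quot)
      then show "((\<lambda>t. C2 * norm (z t - z\<^sub>0) * norm (inverse t *\<^sub>R (z t - z\<^sub>0))) \<longlongrightarrow> 0) (at_right 0)" by simp
    qed
    from tendsto_add[OF this bounded_linear.tendsto[OF bl quot]]
    have "((\<lambda>t. inverse t *\<^sub>R (X (z t) - X z\<^sub>0 - fd X z\<^sub>0 (z t - z\<^sub>0)) + fd X z\<^sub>0 (inverse t *\<^sub>R (z t - z\<^sub>0)))
      \<longlongrightarrow> 0 + fd X z\<^sub>0 p) (at_right 0)" .
    moreover have "inverse t *\<^sub>R (X (z t) - X z\<^sub>0 - fd X z\<^sub>0 (z t - z\<^sub>0)) + fd X z\<^sub>0 (inverse t *\<^sub>R (z t - z\<^sub>0))
      = inverse t *\<^sub>R (X (z t) - X z\<^sub>0)" for t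
      unfolding linear_scale[OF lin] scaleR_add_right[symmetric] by simp
    ultimately show ?thesis by simp
  qed
  have d2: "((\<lambda>t. fd X (z t) (X (z t))) \<longlongrightarrow> fd X z\<^sub>0 (X z\<^sub>0)) (at_right 0)"
  proof -
    have "Ck_on (Suc 0) \<Omega> (\<lambda>y. fd X y (X y))"
      using Ck_on_fd[OF \<Omega> X2 Ck_on_Suc_lower[OF X2]] .
    then have "isCont (\<lambda>y. fd X y (X y)) z\<^sub>0"
      using Ck_on_continuous continuous_on_eq_continuous_at[OF \<Omega>] z0 by blast
    from isCont_tendsto_compose[OF this zlim] show ?thesis .
  qed
  have ex: "\<forall>\<^sub>F t in at_right 0. \<exists>z'. z' \<in> Z \<and> norm (z' - (z t + (\<sigma> * t) *\<^sub>R X (z t) + (t\<^sup>2 / 2) *\<^sub>R fd X (z t) (X (z t)))) \<le> C * t ^ 3"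
    using near[OF C(3)] pos zZ eventually_at_right_real[OF C(2)]
  proof eventually_elim
    case (elim t)
    have "\<bar>\<sigma> * t\<bar> = t" "(\<sigma> * t)\<^sup>2 = t\<^sup>2" using \<sigma> elim by (auto simp: abs_mult)
    then show ?case using C(4)[of "z t" "\<sigma> * t"] elim by auto
  qed
  \<comment> \<open>Chosen separately for each \<open>t\<close>; only the expansion at 0 is
    tracked.\<close>
  define z' where "z' t = (SOME z'. z' \<in> Z \<and> norm (z' - (z t + (\<sigma> * t) *\<^sub>R X (z t) + (t\<^sup>2 / 2) *\<^sub>R fd X (z t) (X (z t)))) \<le> C * t ^ 3)" for t
  have z': "\<forall>\<^sub>F t in at_right 0. z' t \<in> Z \<and> norm (z' t - (z t + (\<sigma> * t) *\<^sub>R X (z t) + (t\<^sup>2 / 2) *\<^sub>R fd X (z t) (X (z t)))) \<le> C * t ^ 3"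
    using ex by eventually_elim (unfold z'_def, rule someI_ex)
  define e where "e t = inverse (t\<^sup>2) *\<^sub>R (z' t - (z t + (\<sigma> * t) *\<^sub>R X (z t) + (t\<^sup>2 / 2) *\<^sub>R fd X (z t) (X (z t))))" for t
  have e0: "(e \<longlongrightarrow> 0) (at_right 0)"
  proof (rule Lim_null_comparison)
    show "\<forall>\<^sub>F t in at_right 0. norm (e t) \<le> C * t"
      using z' pos
    proof eventually_elim
      case (elim t)
      then have "inverse (t\<^sup>2) * norm (z' t - (z t + (\<sigma> * t) *\<^sub>R X (z t) + (t\<^sup>2 / 2) *\<^sub>R fd X (z t) (X (z t)))) \<le> inverse (t\<^sup>2) * (C * t ^ 3)"
        by (intro mult_left_mono) auto
      also have "inverse (t\<^sup>2) * (C * t ^ 3) = C * t"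
        using elim by (simp add: power2_eq_square power3_eq_cube field_simps)
      finally show ?case by (simp add: e_def)
    qed
    have "((\<lambda>t. C * t) \<longlongrightarrow> C * 0) (at_right 0)" by (intro tendsto_intros t_lim)
    then show "((\<lambda>t. C * t) \<longlongrightarrow> 0) (at_right 0)" by simp
  qed
  have "((\<lambda>t. inverse (t\<^sup>2) *\<^sub>R (z t - z\<^sub>0 - t *\<^sub>R p) + \<sigma> *\<^sub>R (inverse t *\<^sub>R (X (z t) - X z\<^sub>0)) + (1/2) *\<^sub>R fd X (z t) (X (z t)) + e t)
     \<longlongrightarrow> q + \<sigma> *\<^sub>R fd X z\<^sub>0 p + (1/2) *\<^sub>R fd X z\<^sub>0 (X z\<^sub>0) + 0) (at_right 0)"
    by (intro tendsto_intros lim dq d2 e0)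
  moreover have "\<forall>\<^sub>F t in at_right 0. inverse (t\<^sup>2) *\<^sub>R (z t - z\<^sub>0 - t *\<^sub>R p) + \<sigma> *\<^sub>R (inverse t *\<^sub>R (X (z t) - X z\<^sub>0)) + (1/2) *\<^sub>R fd X (z t) (X (z t)) + e t
     = inverse (t\<^sup>2) *\<^sub>R (z' t - z\<^sub>0 - t *\<^sub>R (p + \<sigma> *\<^sub>R X z\<^sub>0))"
    using pos
  proof eventually_elim
    case (elim t)
    have 1: "inverse t = inverse (t\<^sup>2) * t" "1/2 = inverse (t\<^sup>2) * (t\<^sup>2/2)" using elim by (auto simp: power2_eq_square field_simps)
    have "inverse (t\<^sup>2) *\<^sub>R (z t - z\<^sub>0 - t *\<^sub>R p) + \<sigma> *\<^sub>R ((inverse (t\<^sup>2) * t) *\<^sub>R (X (z t) - X z\<^sub>0)) + (inverse (t\<^sup>2) * (t\<^sup>2/2)) *\<^sub>R fd X (z t) (X (z t)) + e t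
      = inverse (t\<^sup>2) *\<^sub>R ((z t - z\<^sub>0 - t *\<^sub>R p) + (\<sigma> * t) *\<^sub>R (X (z t) - X z\<^sub>0) + (t\<^sup>2/2) *\<^sub>R fd X (z t) (X (z t))
        + (z' t - (z t + (\<sigma> * t) *\<^sub>R X (z t) + (t\<^sup>2 / 2) *\<^sub>R fd X (z t) (X (z t)))))"
      by (simp only: e_def scaleR_add_right scaleR_scaleR) (simp only: mult_ac)
    also have "\<dots> = inverse (t\<^sup>2) *\<^sub>R (z' t - z\<^sub>0 - t *\<^sub>R (p + \<sigma> *\<^sub>R X z\<^sub>0))"
      by (rule arg_cong[where f = "\<lambda>v. inverse (t\<^sup>2) *\<^sub>R v"]) (simp add: algebra_simps)
    finally show ?case unfolding 1[symmetric] .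
  qed
  ultimately have "((\<lambda>t. inverse (t\<^sup>2) *\<^sub>R (z' t - z\<^sub>0 - t *\<^sub>R (p + \<sigma> *\<^sub>R X z\<^sub>0))) \<longlongrightarrow>
      q + \<sigma> *\<^sub>R fd X z\<^sub>0 p + (1/2) *\<^sub>R fd X z\<^sub>0 (X z\<^sub>0)) (at_right 0)"
    using tendsto_cong by force
  moreover have "\<forall>\<^sub>F t in at_right 0. z' t \<in> Z" using z' by eventually_elim simp
  ultimately show ?thesis by blast
qed

text \<open>Moving along \<open>X\<close>, \<open>Y\<close>, \<open>-X\<close>, \<open>-Y\<close> for time \<open>t\<close> each leads to points of \<open>Z\<close> at
  \<open>z\<^sub>0 + t\<^sup>2 [X, Y] + o(t\<^sup>2)\<close>.\<close>

lemma tangent_bracket_le: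
  fixes X Y :: "'a::euclidean_space \<Rightarrow> 'a"
  assumes Z: "closed Z" and \<Omega>: "open \<Omega>" and X: "Ck_on 2 \<Omega> X" and Y: "Ck_on 2 \<Omega> Y"
    and tX: "tangent_on Z \<Omega> X" and tY: "tangent_on Z \<Omega> Y" and z0: "z\<^sub>0 \<in> Z \<inter> \<Omega>"
    and N: "\<And>x. x \<in> Z \<Longrightarrow> norm N \<le> norm (x - (z\<^sub>0 + N))"
  shows "(fd Y z\<^sub>0 (X z\<^sub>0) - fd X z\<^sub>0 (Y z\<^sub>0)) \<bullet> N \<le> 0"
proof -
  define a b where "a = X z\<^sub>0" and "b = Y z\<^sub>0"
  have lX: "linear (fd X z\<^sub>0)" and lY: "linear (fd Y z\<^sub>0)"
    using X Y z0 by (auto intro!: linear_frechet_derivative simp: numeral_2_eq_2)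
  note zero = linear_0[OF lX] linear_0[OF lY]
  have i: "\<forall>\<^sub>F t in at_right (0::real). z\<^sub>0 \<in> Z" using z0 by simp
  have "((\<lambda>t. inverse (t\<^sup>2) *\<^sub>R (z\<^sub>0 - z\<^sub>0 - t *\<^sub>R 0)) \<longlongrightarrow> 0) (at_right 0)" by simp
  from tangent_curve_step[OF Z \<Omega> X tX z0 _ i this, of 1]
  obtain z1 where z1: "\<forall>\<^sub>F t in at_right 0. z1 t \<in> Z"
    "((\<lambda>t. inverse (t\<^sup>2) *\<^sub>R (z1 t - z\<^sub>0 - t *\<^sub>R a)) \<longlongrightarrow> (1/2) *\<^sub>R fd X z\<^sub>0 a) (at_right 0)"
    using zero by (auto simp: a_def)
  from tangent_curve_step[OF Z \<Omega> Y tY z0 _ z1, of 1]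
  obtain z2 where z2: "\<forall>\<^sub>F t in at_right 0. z2 t \<in> Z"
    "((\<lambda>t. inverse (t\<^sup>2) *\<^sub>R (z2 t - z\<^sub>0 - t *\<^sub>R (a + b))) \<longlongrightarrow>
       (1/2) *\<^sub>R fd X z\<^sub>0 a + fd Y z\<^sub>0 a + (1/2) *\<^sub>R fd Y z\<^sub>0 b) (at_right 0)"
    by (auto simp: b_def)
  from tangent_curve_step[OF Z \<Omega> X tX z0 _ z2, of "-1"]
  obtain z3 where z3: "\<forall>\<^sub>F t in at_right 0. z3 t \<in> Z"
    "((\<lambda>t. inverse (t\<^sup>2) *\<^sub>R (z3 t - z\<^sub>0 - t *\<^sub>R b)) \<longlongrightarrow>
       (1/2) *\<^sub>R fd X z\<^sub>0 a + fd Y z\<^sub>0 a + (1/2) *\<^sub>R fd Y z\<^sub>0 b - fd X z\<^sub>0 (a + b) + (1/2) *\<^sub>R fd X z\<^sub>0 a) (at_right 0)"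
    by (auto simp: a_def)
  from tangent_curve_step[OF Z \<Omega> Y tY z0 _ z3, of "-1"]
  obtain z4 where z4: "\<forall>\<^sub>F t in at_right 0. z4 t \<in> Z"
    "((\<lambda>t. inverse (t\<^sup>2) *\<^sub>R (z4 t - z\<^sub>0)) \<longlongrightarrow>
       (1/2) *\<^sub>R fd X z\<^sub>0 a + fd Y z\<^sub>0 a + (1/2) *\<^sub>R fd Y z\<^sub>0 b - fd X z\<^sub>0 (a + b) + (1/2) *\<^sub>R fd X z\<^sub>0 a
        - fd Y z\<^sub>0 b + (1/2) *\<^sub>R fd Y z\<^sub>0 b) (at_right 0)"
    by (auto simp: b_def)
  define W where "W = fd Y z\<^sub>0 a - fd X z\<^sub>0 b"
  have half: "(1/2) *\<^sub>R v + (1/2) *\<^sub>R v = v" for v :: 'a by (simp flip: scaleR_add_left)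
  have "(1/2) *\<^sub>R fd X z\<^sub>0 a + fd Y z\<^sub>0 a + (1/2) *\<^sub>R fd Y z\<^sub>0 b - fd X z\<^sub>0 (a + b) + (1/2) *\<^sub>R fd X z\<^sub>0 a
        - fd Y z\<^sub>0 b + (1/2) *\<^sub>R fd Y z\<^sub>0 b = 
       ((1/2) *\<^sub>R fd X z\<^sub>0 a + (1/2) *\<^sub>R fd X z\<^sub>0 a) + ((1/2) *\<^sub>R fd Y z\<^sub>0 b + (1/2) *\<^sub>R fd Y z\<^sub>0 b)
       + fd Y z\<^sub>0 a - (fd X z\<^sub>0 a + fd X z\<^sub>0 b) - fd Y z\<^sub>0 b"
    by (simp only: linear_add[OF lX] add_ac diff_conv_add_uminus minus_add_distrib)
  also have "\<dots> = W" unfolding half W_def by simp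
  finally have lim: "((\<lambda>t. inverse (t\<^sup>2) *\<^sub>R (z4 t - z\<^sub>0)) \<longlongrightarrow> W) (at_right 0)" using z4(2) by simp
  have t_lim: "((\<lambda>t::real. t) \<longlongrightarrow> 0) (at_right 0)" by (rule tendsto_ident_at)
  let ?w = "\<lambda>t. inverse (t\<^sup>2) *\<^sub>R (z4 t - z\<^sub>0)"
  \<comment> \<open>For \<open>z\<^sub>0 + d\<close> in \<open>Z\<close> the ball condition says
    \<open>2 (d \<bullet> N) \<le> d \<bullet> d\<close>. Here \<open>d\<close> is of order
    \<open>t^2\<close>, so after division by \<open>t^2\<close> the right-hand side tends to
    0.\<close>
  have "2 * (W \<bullet> N) \<le> 0\<^sup>2 * (norm W)\<^sup>2"
  proof (rule tendsto_le)
    show "((\<lambda>t. t\<^sup>2 * (norm (?w t))\<^sup>2) \<longlongrightarrow> 0\<^sup>2 * (norm W)\<^sup>2) (at_right 0)"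
      by (intro tendsto_intros t_lim lim)
    show "((\<lambda>t. 2 * (?w t \<bullet> N)) \<longlongrightarrow> 2 * (W \<bullet> N)) (at_right 0)"
      by (intro tendsto_intros lim)
    show "\<forall>\<^sub>F t in at_right 0. 2 * (?w t \<bullet> N) \<le> t\<^sup>2 * (norm (?w t))\<^sup>2"
      using z4(1) eventually_at_right_less[of 0]
    proof eventually_elim
      case (elim t)
      define d where "d = z4 t - z\<^sub>0"
      have "norm N \<le> norm (d - N)" using N[OF elim(1)] by (simp add: d_def algebra_simps)
      then have "(norm N)\<^sup>2 \<le> (norm (d - N))\<^sup>2" by (rule power_mono) simp
      then have "2 * (d \<bullet> N) \<le> d \<bullet> d"
        by (simp add: power2_norm_eq_inner inner_diff_left inner_diff_right inner_commute)
      then have "inverse (t\<^sup>2) * (2 * (d \<bullet> N)) \<le> inverse (t\<^sup>2) * (d \<bullet> d)" by (rule mult_left_mono) simp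
      moreover have "t\<^sup>2 * (norm (inverse (t\<^sup>2) *\<^sub>R d))\<^sup>2 = inverse (t\<^sup>2) * (d \<bullet> d)"
        using elim unfolding power2_norm_eq_inner[symmetric] norm_scaleR
        by (simp add: power2_eq_square field_simps)
      ultimately show ?case by (simp add: d_def[symmetric])
    qed
  qed simp
  then show ?thesis by (simp add: W_def a_def b_def)
qed

text \<open>Exchanging the two fields reverses the sign of the bracket, so the one-sided estimate
  gives equality.\<close>

lemma tangent_on_bracket:
  fixes X Y :: "'a::euclidean_space \<Rightarrow> 'a"
  assumes "closed Z" "open \<Omega>" "Ck_on 2 \<Omega> X" "Ck_on 2 \<Omega> Y" "tangent_on Z \<Omega> X" "tangent_on Z \<Omega> Y"
  shows "tangent_on Z \<Omega> (\<lambda>z. fd Y z (X z) - fd X z (Y z))"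
  unfolding tangent_on_def
proof (intro ballI allI impI)
  fix z N assume "z \<in> Z \<inter> \<Omega>" "\<forall>x\<in>Z. norm N \<le> norm (x - (z + N))"
  then show "(fd Y z (X z) - fd X z (Y z)) \<bullet> N = 0"
    using tangent_bracket_le[OF assms, of z N] tangent_bracket_le[OF assms(1,2,4,3,6,5), of z N]
    by (simp add: inner_diff_left)
qed

section \<open>The strong maximum principle for degenerate quasilinear operators\<close>

definition gradient :: "('a::euclidean_space \<Rightarrow> real) \<Rightarrow> 'a \<Rightarrow> 'a" where
  "gradient u y = (\<Sum>b\<in>Basis. fd u y b *\<^sub>R b)"

lemma gradient_inner:
  assumes "u differentiable at y"
  shows "gradient u y \<bullet> h = fd u y h"
proof -
  have "gradient u y \<bullet> h = (\<Sum>b\<in>Basis. (h \<bullet> b) *\<^sub>R fd u y b)"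
    by (simp add: gradient_def inner_sum_left inner_commute[of h] mult.commute)
  also have "\<dots> = fd u y h" by (rule linear_fd_expand[OF assms, symmetric])
  finally show ?thesis .
qed

lemma has_derivative_gradient:
  assumes "u differentiable at y"
  shows "(u has_derivative (\<lambda>h. gradient u y \<bullet> h)) (at y)"
  by (rule has_derivative_eq_rhs[OF fd_works[OF assms]]) (simp add: fun_eq_iff gradient_inner[OF assms])

lemma Ck_on_gradient: "open S \<Longrightarrow> Ck_on (Suc k) S u \<Longrightarrow> Ck_on k S (gradient u)"
  unfolding gradient_def by (intro Ck_on_sum Ck_on_scaleR Ck_on_const Ck_on_fd)

lemma smooth_on_gradient: "open S \<Longrightarrow> smooth_on S u \<Longrightarrow> smooth_on S (gradient u)"
  by (simp add: smooth_on_def Ck_on_gradient)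

text \<open>The form is nonnegative at \<open>x + t b\<close> for every \<open>t\<close>. This is
  the discriminant inequality if the leading coefficient is positive; otherwise the linear term has
  to vanish.\<close>

lemma psd_cauchy_schwarz:
  fixes G :: "'a::euclidean_space \<Rightarrow> 'a"
  assumes lin: "linear G" and sym: "\<And>x y. G x \<bullet> y = G y \<bullet> x" and psd: "\<And>x. G x \<bullet> x \<ge> 0"
  shows "(G b \<bullet> x)\<^sup>2 \<le> (G b \<bullet> b) * (G x \<bullet> x)"
proof -
  have exp: "0 \<le> G x \<bullet> x + 2 * t * (G b \<bullet> x) + t\<^sup>2 * (G b \<bullet> b)" for t
  proof -
    have "G (x + t *\<^sub>R b) \<bullet> (x + t *\<^sub>R b) = G x \<bullet> x + 2 * t * (G b \<bullet> x) + t\<^sup>2 * (G b \<bullet> b)"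
      by (simp add: linear_add[OF lin] linear_scale[OF lin] inner_add_left inner_add_right sym[of x b]
          power2_eq_square algebra_simps)
    then show ?thesis using psd[of "x + t *\<^sub>R b"] by simp
  qed
  show ?thesis
  proof (cases "G b \<bullet> b = 0")
    case True
    have "G b \<bullet> x = 0"
    proof (rule ccontr)
      assume ne: "G b \<bullet> x \<noteq> 0"
      \<comment> \<open>At this parameter the expression would take the value -1.\<close>
      have "2 * (- (G x \<bullet> x + 1) / (2 * (G b \<bullet> x))) * (G b \<bullet> x) = - (G x \<bullet> x + 1)"
        using ne by simp
      then show False using exp[of "- (G x \<bullet> x + 1) / (2 * (G b \<bullet> x))"] True by simp
    qed
    then show ?thesis using True by simp
  next
    case False
    then have pos: "G b \<bullet> b > 0" using psd[of b] by linarith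
    have "0 \<le> G x \<bullet> x - (G b \<bullet> x)\<^sup>2 / (G b \<bullet> b)"
      using exp[of "- (G b \<bullet> x) / (G b \<bullet> b)"] False by (simp add: power2_eq_square field_simps)
    then show ?thesis using pos by (simp add: field_simps)
  qed
qed

text \<open>Lagrange reduction, eliminating one basis vector at a time.\<close>

lemma psd_sum_of_squares:
  fixes G :: "'a::euclidean_space \<Rightarrow> 'a"
  assumes "linear G" "\<And>x y. G x \<bullet> y = G y \<bullet> x" "\<And>x. G x \<bullet> x \<ge> 0" "finite B"
  shows "\<exists>l G'. linear G' \<and> (\<forall>x y. G' x \<bullet> y = G' y \<bullet> x) \<and> (\<forall>x. G' x \<bullet> x \<ge> 0) \<and>
    (\<forall>b\<in>B. G' b = 0) \<and> (\<forall>x. G x = (\<Sum>b\<in>B. (l b \<bullet> x) *\<^sub>R l b) + G' x)"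
  using assms(4)
proof (induction B rule: finite_induct)
  case empty
  then show ?case using assms by (intro exI[of _ "\<lambda>_. 0"] exI[of _ G]) auto
next
  case (insert b B)
  from insert.IH obtain l G' where IH: "linear G' \<and> (\<forall>x y. G' x \<bullet> y = G' y \<bullet> x) \<and> (\<forall>x. G' x \<bullet> x \<ge> 0) \<and>
    (\<forall>b\<in>B. G' b = 0) \<and> (\<forall>x. G x = (\<Sum>b\<in>B. (l b \<bullet> x) *\<^sub>R l b) + G' x)"
    by blast
  have G': "linear G'" "\<And>x y. G' x \<bullet> y = G' y \<bullet> x" "\<And>x. G' x \<bullet> x \<ge> 0"
    "\<And>b. b \<in> B \<Longrightarrow> G' b = 0" "\<And>x. G x = (\<Sum>b\<in>B. (l b \<bullet> x) *\<^sub>R l b) + G' x"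
    using IH by blast+
  note cs = psd_cauchy_schwarz[OF G'(1-3)]
  \<comment> \<open>If \<open>G' b \<bullet> b\<close> is 0, then \<open>G' b\<close> is 0 by
    Cauchy-Schwarz and there is nothing to subtract; hence the default 0.\<close>
  define s where "s = (if G' b \<bullet> b = 0 then 0 else inverse (G' b \<bullet> b))"
  define m where "m = sqrt s *\<^sub>R G' b"
  define G'' where "G'' x = G' x - (m \<bullet> x) *\<^sub>R m" for x
  have s0: "s \<ge> 0" using G'(3)[of b] by (simp add: s_def)
  have mm: "(m \<bullet> x) *\<^sub>R m = (s * (G' b \<bullet> x)) *\<^sub>R G' b" for x
  proof -
    have "sqrt s * sqrt s = s" using s0 by simp
    moreover have "sqrt s * (G' b \<bullet> x) * sqrt s = (sqrt s * sqrt s) * (G' b \<bullet> x)" by (simp only: mult_ac)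
    ultimately have "sqrt s * (G' b \<bullet> x) * sqrt s = s * (G' b \<bullet> x)" by (simp only:)
    then show ?thesis by (simp add: m_def)
  qed
  have lin: "linear G''"
    unfolding G''_def by (intro linear_compose_sub G'(1) linearI) (simp_all add: inner_add_right scaleR_add_left)
  have sym: "G'' x \<bullet> y = G'' y \<bullet> x" for x y
    by (simp add: G''_def inner_diff_left G'(2)[of x y])
  have psd: "G'' x \<bullet> x \<ge> 0" for x
  proof (cases "G' b \<bullet> b = 0")
    case True
    then show ?thesis using G'(3) by (simp add: G''_def mm s_def)
  next
    case False
    then have "G' b \<bullet> b > 0" using G'(3)[of b] by linarith
    then show ?thesis using cs[of b x]
      by (simp add: G''_def mm s_def inner_diff_left power2_eq_square field_simps)
  qed
  have z: "G'' b = 0"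
  proof (cases "G' b \<bullet> b = 0")
    case True
    then have "G' b \<bullet> G' b = 0" using cs[of b "G' b"] by simp
    then show ?thesis by (simp add: G''_def m_def)
  next
    case False
    then show ?thesis by (simp add: G''_def mm s_def)
  qed
  have z': "G'' c = 0" if "c \<in> B" for c
    using G'(4)[OF that] G'(2)[of b c] by (simp add: G''_def mm)
  define l' where "l' = l(b := m)"
  have "G x = (\<Sum>c\<in>insert b B. (l' c \<bullet> x) *\<^sub>R l' c) + G'' x" for x
  proof -
    have "(\<Sum>c\<in>B. (l' c \<bullet> x) *\<^sub>R l' c) = (\<Sum>c\<in>B. (l c \<bullet> x) *\<^sub>R l c)"
      using insert by (intro sum.cong) (auto simp: l'_def)
    then show ?thesis using insert G'(5)[of x] by (simp add: l'_def G''_def)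
  qed
  then show ?case using lin sym psd z z' by (intro exI[of _ l'] exI[of _ G'']) auto
qed

text \<open>Writing \<open>G\<close> as a sum of maps \<open>(l \<bullet> x) l\<close> turns the
  trace of \<open>G P\<close> into a sum of values \<open>P l \<bullet> l\<close>. In the barrier
  argument \<open>G\<close> is the principal part and \<open>P\<close> the Hessian at a
  minimum.\<close>

lemma trace_psd_nonneg:
  fixes G P :: "'a::euclidean_space \<Rightarrow> 'a"
  assumes "linear G" "\<And>x y. G x \<bullet> y = G y \<bullet> x" "\<And>x. G x \<bullet> x \<ge> 0"
    and P: "linear P" "\<And>x. P x \<bullet> x \<ge> 0"
  shows "(\<Sum>b\<in>Basis. G (P b) \<bullet> b) \<ge> 0"
proof -
  from psd_sum_of_squares[OF assms(1-3) finite_Basis]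
  obtain l :: "'a \<Rightarrow> 'a" and G' where lG': "linear G' \<and> (\<forall>x y. G' x \<bullet> y = G' y \<bullet> x) \<and> (\<forall>x. G' x \<bullet> x \<ge> 0) \<and>
    (\<forall>b\<in>Basis. G' b = 0) \<and> (\<forall>x. G x = (\<Sum>b\<in>Basis. (l b \<bullet> x) *\<^sub>R l b) + G' x)"
    by blast
  have G': "linear G'" "\<And>b. b \<in> Basis \<Longrightarrow> G' b = 0"
    "\<And>x. G x = (\<Sum>b\<in>Basis. (l b \<bullet> x) *\<^sub>R l b) + G' x"
    using lG' by blast+
  have "G' x = 0" for x
  proof -
    have "G' (\<Sum>b\<in>Basis. (x \<bullet> b) *\<^sub>R b) = 0"
      using G' by (simp add: linear_sum[OF G'(1)] linear_scale[OF G'(1)])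
    then show ?thesis by (simp add: euclidean_representation)
  qed
  then have G: "G x = (\<Sum>b\<in>Basis. (l b \<bullet> x) *\<^sub>R l b)" for x using G' by simp
  have "(\<Sum>b\<in>Basis. G (P b) \<bullet> b) = (\<Sum>b\<in>Basis. \<Sum>c\<in>Basis. (l c \<bullet> P b) * (l c \<bullet> b))"
    by (simp add: G inner_sum_left)
  also have "\<dots> = (\<Sum>c\<in>Basis. \<Sum>b\<in>Basis. (l c \<bullet> P b) * (l c \<bullet> b))" by (rule sum.swap)
  also have "\<dots> = (\<Sum>c\<in>Basis. P (l c) \<bullet> l c)"
  proof (rule sum.cong[OF refl])
    fix c
    have "P (l c) = P (\<Sum>b\<in>Basis. (l c \<bullet> b) *\<^sub>R b)" by (simp add: euclidean_representation)
    also have "\<dots> = (\<Sum>b\<in>Basis. (l c \<bullet> b) *\<^sub>R P b)" by (simp add: linear_sum[OF P(1)] linear_scale[OF P(1)])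
    finally have e: "P (l c) = (\<Sum>b\<in>Basis. (l c \<bullet> b) *\<^sub>R P b)" .
    show "(\<Sum>b\<in>Basis. (l c \<bullet> P b) * (l c \<bullet> b)) = P (l c) \<bullet> l c"
      unfolding e inner_sum_left inner_scaleR_left
      by (rule sum.cong[OF refl]) (simp add: inner_commute mult.commute)
  qed
  also have "\<dots> \<ge> 0" by (intro sum_nonneg P)
  finally show ?thesis .
qed

lemma second_order_minimum:
  fixes f :: "'a::euclidean_space \<Rightarrow> real"
  assumes "open S" "x \<in> S" "\<And>y. y \<in> S \<Longrightarrow> (f has_derivative (\<lambda>h. g y \<bullet> h)) (at y)"
    and "(g has_derivative g') (at x)" "\<And>y. y \<in> S \<Longrightarrow> f x \<le> f y"
  shows "g x = 0" "g' l \<bullet> l \<ge> 0"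
proof -
  have "(\<lambda>h. g x \<bullet> h) = (\<lambda>h. 0)"
    using differential_zero_maxmin[OF assms(2,1) assms(3)[OF assms(2)]] assms(5) by blast
  then have "g x \<bullet> g x = 0" by metis
  then show gx: "g x = 0" by simp
  show "g' l \<bullet> l \<ge> 0"
  proof (rule ccontr)
    assume neg: "\<not> g' l \<bullet> l \<ge> 0"
    have lin: "((\<lambda>t. x + t *\<^sub>R l) has_derivative (\<lambda>h. h *\<^sub>R l)) (at t)" for t :: real
      by (auto intro!: derivative_eq_intros)
    have "((\<lambda>t. g (x + t *\<^sub>R l)) has_derivative (\<lambda>h. g' (h *\<^sub>R l))) (at 0)"
      by (rule has_derivative_compose[OF lin]) (use assms(4) in simp)
    then have "((\<lambda>t. g (x + t *\<^sub>R l) \<bullet> l) has_derivative (\<lambda>h. g' (h *\<^sub>R l) \<bullet> l)) (at 0)"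
      by (rule has_derivative_inner_left)
    then have "((\<lambda>t. g (x + t *\<^sub>R l) \<bullet> l) has_real_derivative g' l \<bullet> l) (at 0)"
      unfolding has_field_derivative_def
      by (rule has_derivative_eq_rhs) (simp add: fun_eq_iff linear_scale[OF has_derivative_linear[OF assms(4)]])
    from DERIV_neg_dec_right[OF this] neg obtain d where d: "d > 0"
      "\<And>h. h > 0 \<Longrightarrow> h < d \<Longrightarrow> g (x + h *\<^sub>R l) \<bullet> l < 0"
      using gx by auto
    obtain e where e: "e > 0" "ball x e \<subseteq> S" using assms(1,2) openE by blast
    \<comment> \<open>Up to this parameter the segment stays in \<open>S\<close> and the slope is
      negative, so \<open>f\<close> would fall below its minimum.\<close>
    define t where "t = min (d / 2) (e / (2 * (norm l + 1)))"
    have n: "norm l + 1 > 0" using norm_ge_zero[of l] by linarith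
    have t: "t > 0" "t < d" using d(1) e(1) n by (auto simp: t_def)
    have inS: "x + s *\<^sub>R l \<in> S" if "0 \<le> s" "s \<le> t" for s
    proof -
      have "s * norm l \<le> t * norm l" using that by (intro mult_right_mono) auto
      also have "\<dots> \<le> (e / (2 * (norm l + 1))) * norm l" by (intro mult_right_mono) (auto simp: t_def)
      also have "\<dots> < e"
      proof -
        have "0 < e * norm l + e * 2" using e(1) by (intro add_nonneg_pos) auto
        then show ?thesis using n by (simp add: field_simps)
      qed
      finally show ?thesis using e(2) that by (auto simp: subset_iff dist_norm)
    qed
    have "((\<lambda>t. f (x + t *\<^sub>R l)) has_real_derivative g (x + s *\<^sub>R l) \<bullet> l) (at s)" if "0 \<le> s" "s \<le> t" for s
    proof -
      have "((\<lambda>t. f (x + t *\<^sub>R l)) has_derivative (\<lambda>h. g (x + s *\<^sub>R l) \<bullet> (h *\<^sub>R l))) (at s)"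
        by (rule has_derivative_compose[OF lin assms(3)[OF inS[OF that]]])
      then show ?thesis unfolding has_field_derivative_def
        by (rule has_derivative_eq_rhs) (simp add: fun_eq_iff)
    qed
    then obtain s where s: "0 < s" "s < t" "f (x + t *\<^sub>R l) - f (x + 0 *\<^sub>R l) = (t - 0) * (g (x + s *\<^sub>R l) \<bullet> l)"
      using MVT2[OF t(1), of "\<lambda>t. f (x + t *\<^sub>R l)" "\<lambda>s. g (x + s *\<^sub>R l) \<bullet> l"] by auto
    have "(t - 0) * (g (x + s *\<^sub>R l) \<bullet> l) < 0" using d(2)[of s] s t by (simp add: mult_pos_neg)
    then show False using s(3) assms(5)[OF inS[of t]] t by simp
  qed
qed

text \<open>If \<open>\<beta>\<close> is the gradient of the logarithm of a density, this is the
  divergence of the field \<open>J (y, gradient u y)\<close> with respect to that density.\<close>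

definition quasilinear_op ::
  "('a \<times> 'a \<Rightarrow> 'a) \<Rightarrow> ('a \<Rightarrow> 'a) \<Rightarrow> ('a::euclidean_space \<Rightarrow> real) \<Rightarrow> 'a \<Rightarrow> real" where
  "quasilinear_op J \<beta> u y =
     (\<Sum>b\<in>Basis. fd (\<lambda>y. J (y, gradient u y)) y b \<bullet> b) + \<beta> y \<bullet> J (y, gradient u y)"

lemma quasilinear_op_expand:
  assumes "open D" "Ck_on 2 D u" "Ck_on 2 W J" "y \<in> D" "(y, gradient u y) \<in> W"
  shows "quasilinear_op J \<beta> u y = (\<Sum>b\<in>Basis. fd J (y, gradient u y) (b, fd (gradient u) y b) \<bullet> b)
    + \<beta> y \<bullet> J (y, gradient u y)"
proof -
  have "Ck_on (Suc 0) D (gradient u)"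
    using Ck_on_gradient[OF assms(1), of "Suc 0" u] assms(2) by (simp add: numeral_2_eq_2)
  then have g: "(gradient u has_derivative fd (gradient u) y) (at y)" using assms(4) Ck_on_differentiable by blast
  have "Ck_on (Suc (Suc 0)) W J" using assms(3) by (simp add: numeral_2_eq_2)
  then have J: "(J has_derivative fd J (y, gradient u y)) (at (y, gradient u y))" using assms(5) Ck_on_differentiable by blast
  have "((\<lambda>y. (y, gradient u y)) has_derivative (\<lambda>h. (h, fd (gradient u) y h))) (at y)"
    by (intro has_derivative_Pair has_derivative_ident g)
  from fd_eq[OF has_derivative_compose[OF this J]] show ?thesis by (simp add: quasilinear_op_def)
qed

lemma norm_Pair_0: "norm (0, v) = norm v" by (simp add: norm_Pair)

text \<open>Otherwise the principal part is positive in the direction \<open>c - z\<close>, and an exponential barrier centred at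
  \<open>c\<close> leads to an interior minimum of \<open>v - u\<close> minus a multiple of the barrier, where the second-order
  condition fails.\<close>

lemma strong_maximum_hopf:
  fixes u v :: "'a::euclidean_space \<Rightarrow> real"
  assumes D: "open D" "Ck_on 2 D u" "Ck_on 2 D v" and W: "open W" "Ck_on 2 W J"
    and inW: "\<And>y. y \<in> D \<Longrightarrow> (y, gradient u y) \<in> W" "\<And>y. y \<in> D \<Longrightarrow> (y, gradient v y) \<in> W"
    and \<beta>: "continuous_on D \<beta>"
    and le: "\<And>y. y \<in> D \<Longrightarrow> quasilinear_op J \<beta> v y \<le> quasilinear_op J \<beta> u y"
    and ge: "\<And>y. y \<in> D \<Longrightarrow> u y \<le> v y"
    and z: "z \<in> D" "v z = u z" "c \<noteq> z"
    and strict: "\<And>y. y \<in> D \<Longrightarrow> norm (y - c) \<le> norm (z - c) \<Longrightarrow> y \<noteq> z \<Longrightarrow> u y < v y"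
    and sym: "\<And>x \<eta> \<zeta>. x \<in> W \<Longrightarrow> fd J x (0, \<eta>) \<bullet> \<zeta> = fd J x (0, \<zeta>) \<bullet> \<eta>"
    and psd: "\<And>x \<eta>. x \<in> W \<Longrightarrow> fd J x (0, \<eta>) \<bullet> \<eta> \<ge> 0"
  shows "fd J (z, gradient v z) (0, c - z) \<bullet> (c - z) = 0"
proof (rule ccontr)
  assume ne: "\<not> ?thesis"
  have u2: "Ck_on (Suc (Suc 0)) D u" and v2: "Ck_on (Suc (Suc 0)) D v" and J2: "Ck_on (Suc (Suc 0)) W J"
    using D W by (simp_all add: numeral_2_eq_2)
  have du: "(u has_derivative (\<lambda>h. gradient u y \<bullet> h)) (at y)" and dv: "(v has_derivative (\<lambda>h. gradient v y \<bullet> h)) (at y)"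
    if "y \<in> D" for y
    using that u2 v2 by (auto intro!: has_derivative_gradient)
  have gu1: "Ck_on (Suc 0) D (gradient u)" and gv1: "Ck_on (Suc 0) D (gradient v)"
    using Ck_on_gradient[OF D(1)] u2 v2 by blast+
  have dgu: "(gradient u has_derivative fd (gradient u) y) (at y)" and dgv: "(gradient v has_derivative fd (gradient v) y) (at y)"
    if "y \<in> D" for y using gu1 gv1 that Ck_on_differentiable by blast+
  have linJ: "linear (fd J x)" if "x \<in> W" for x using J2 that by (auto intro!: linear_frechet_derivative)
  \<comment> \<open>The contact point is a minimum of \<open>v - u\<close>. So near \<open>z\<close>
    both gradients are close to one momentum \<open>p\<close>, around which the constants for
    \<open>J\<close> are uniform.\<close>
  have gz: "gradient u z = gradient v z"
  proof -
    have "(\<lambda>h. (gradient v z - gradient u z) \<bullet> h) = (\<lambda>h. 0)"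
    proof (rule differential_zero_maxmin[OF z(1) D(1)])
      show "((\<lambda>y. v y - u y) has_derivative (\<lambda>h. (gradient v z - gradient u z) \<bullet> h)) (at z)"
        using has_derivative_diff[OF dv[OF z(1)] du[OF z(1)]] by (simp add: inner_diff_left)
      show "(\<forall>y\<in>D. v y - u y \<le> v z - u z) \<or> (\<forall>y\<in>D. v z - u z \<le> v y - u y)" using ge z by auto
    qed
    then have "(gradient v z - gradient u z) \<bullet> (gradient v z - gradient u z) = 0" by metis
    then show ?thesis by simp
  qed
  define p where "p = gradient v z"
  obtain \<rho> where \<rho>: "\<rho> > 0" "cball (z, p) \<rho> \<subseteq> W"
    using open_contains_cball W(1) inW(2)[OF z(1)] unfolding p_def by blast
  let ?K = "cball (z, p) \<rho>"
  obtain L where L: "L > 0" "\<And>x w. x \<in> ?K \<Longrightarrow> norm (fd J x w) \<le> L * norm w"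
    "\<And>x y. x \<in> ?K \<Longrightarrow> y \<in> ?K \<Longrightarrow> norm (J x - J y) \<le> L * norm (x - y)"
    using C1_lipschitz_compact[OF Ck_on_Suc_lower[OF J2] compact_cball convex_cball \<rho>(2)] by blast
  obtain CJ where CJ: "CJ > 0" "\<And>x y w. x \<in> ?K \<Longrightarrow> y \<in> ?K \<Longrightarrow> norm (fd J x w - fd J y w) \<le> CJ * norm (x - y) * norm w"
    using C2_derivative_lipschitz_compact[OF J2 compact_cball convex_cball \<rho>(2)] by blast
  \<comment> \<open>The principal part in the direction of the centre \<open>c\<close>; its value at
    \<open>z\<close> is the one assumed to be nonzero.\<close>
  define a where "a y = fd J (y, gradient v y) (0, c - y) \<bullet> (c - y)" for y
  define \<alpha> where "\<alpha> = a z / 2"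
  have \<alpha>: "\<alpha> > 0" using ne psd[OF inW(2)[OF z(1)]] by (simp add: \<alpha>_def a_def) (metis order_le_less)
  have cgu: "continuous_on D (gradient u)" and cgv: "continuous_on D (gradient v)"
    using gu1 gv1 Ck_on_continuous by blast+
  have conta: "continuous_on D a"
  proof -
    have 1: "continuous_on D (\<lambda>y. (y, gradient v y))" by (intro continuous_intros cgv)
    have 2: "continuous_on W (\<lambda>x. fd J x (0, b))" for b
      using J2 Ck_on_continuous unfolding Ck_on.simps(2)[of "Suc 0"] by blast
    have 3: "continuous_on D (\<lambda>y. fd J (y, gradient v y) (0, b))" for b
      by (rule continuous_on_compose2[OF 2 1]) (use inW in auto)
    have 4: "fd J (y, gradient v y) (0, c - y) = (\<Sum>b\<in>Basis. ((c - y) \<bullet> b) *\<^sub>R fd J (y, gradient v y) (0, b))"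
      if "y \<in> D" for y
    proof -
      have l: "linear (\<lambda>\<eta>. fd J (y, gradient v y) (0, \<eta>))"
        using linJ[OF inW(2)[OF that]] by (simp add: linear_iff) (metis add_Pair scaleR_Pair add.right_neutral scaleR_zero_right)
      have "fd J (y, gradient v y) (0, c - y) = fd J (y, gradient v y) (0, \<Sum>b\<in>Basis. ((c - y) \<bullet> b) *\<^sub>R b)"
        by (simp add: euclidean_representation)
      also have "\<dots> = (\<Sum>b\<in>Basis. ((c - y) \<bullet> b) *\<^sub>R fd J (y, gradient v y) (0, b))"
        by (simp only: linear_sum[OF l] linear_scale[OF l])
      finally show ?thesis .
    qed
    have "continuous_on D (\<lambda>y. (\<Sum>b\<in>Basis. ((c - y) \<bullet> b) *\<^sub>R fd J (y, gradient v y) (0, b)) \<bullet> (c - y))"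
      by (intro continuous_intros 3)
    then show ?thesis unfolding a_def by (rule continuous_on_eq) (simp add: 4)
  qed
  have ev: "\<forall>\<^sub>F y in nhds z. y \<in> D \<and> (y, gradient u y) \<in> ball (z, p) \<rho> \<and> (y, gradient v y) \<in> ball (z, p) \<rho> \<and> a y > \<alpha>"
  proof (intro eventually_conj)
    show "\<forall>\<^sub>F y in nhds z. y \<in> D" using D(1) z(1) by (rule eventually_nhds_in_open)
    have "continuous (at z) (\<lambda>y. (y, gradient u y))" "continuous (at z) (\<lambda>y. (y, gradient v y))" "continuous (at z) a"
      using cgu cgv conta continuous_on_eq_continuous_at[OF D(1)] z(1) by (auto intro!: continuous_intros)
    then have lims: "((\<lambda>y. (y, gradient u y)) \<longlongrightarrow> (z, p)) (nhds z)" "((\<lambda>y. (y, gradient v y)) \<longlongrightarrow> (z, p)) (nhds z)"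
      "(a \<longlongrightarrow> a z) (nhds z)"
      using gz by (simp_all add: isCont_def p_def tendsto_nhds_iff)
    show "\<forall>\<^sub>F y in nhds z. (y, gradient u y) \<in> ball (z, p) \<rho>" "\<forall>\<^sub>F y in nhds z. (y, gradient v y) \<in> ball (z, p) \<rho>"
      using topological_tendstoD[OF lims(1) open_ball] topological_tendstoD[OF lims(2) open_ball] \<rho>(1) by auto
    show "\<forall>\<^sub>F y in nhds z. a y > \<alpha>" by (rule order_tendstoD(1)[OF lims(3)]) (use \<alpha> in \<open>simp add: \<alpha>_def\<close>)
  qed
  then obtain r' where r': "r' > 0" "\<And>y. dist y z < r' \<Longrightarrow> y \<in> D \<and> (y, gradient u y) \<in> ball (z, p) \<rho> \<and> (y, gradient v y) \<in> ball (z, p) \<rho> \<and> a y > \<alpha>"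
    unfolding eventually_nhds_metric by blast
  define r where "r = r' / 2"
  have r: "r > 0" using r' by (simp add: r_def)
  let ?B = "cball z r"
  have inB: "y \<in> D" "(y, gradient u y) \<in> ?K" "(y, gradient v y) \<in> ?K" "a y > \<alpha>" if "y \<in> ?B" for y
    using r'(2)[of y] that r'(1) by (auto simp: r_def dist_commute less_imp_le)
  have BD: "?B \<subseteq> D" using inB by blast
  obtain M where M: "M > 0" "\<And>y w. y \<in> ?B \<Longrightarrow> norm (fd (gradient u) y w) \<le> M * norm w"
    "\<And>x y. x \<in> ?B \<Longrightarrow> y \<in> ?B \<Longrightarrow> norm (gradient u x - gradient u y) \<le> M * norm (x - y)"
    using C1_lipschitz_compact[OF gu1 compact_cball convex_cball BD] by blast
  have "bounded (\<beta> ` ?B)"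
    by (rule compact_imp_bounded[OF compact_continuous_image[OF continuous_on_subset[OF \<beta> BD] compact_cball]])
  then obtain M\<beta> where M\<beta>: "M\<beta> > 0" "\<And>y. y \<in> ?B \<Longrightarrow> norm (\<beta> y) \<le> M\<beta>" by (auto simp: bounded_pos)
  define n where "n = real DIM('a)"
  \<comment> \<open>\<open>C\<close> bounds the change of the operator per unit of momentum with the
    Hessian of \<open>u\<close> kept fixed; \<open>T\<close> bounds the trace of the principal
    part.\<close>
  define C where "C = n * (CJ * (1 + M)) + M\<beta> * L"
  define T where "T = n * L"
  define R where "R = norm (z - c)"
  have R: "R > 0" using z by (simp add: R_def)
  have n: "n > 0" by (simp add: n_def)
  have C0: "C > 0" unfolding C_def
    using n CJ(1) M(1) M\<beta>(1) L(1) by (intro add_pos_pos mult_pos_pos) auto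
  have T0: "T > 0" unfolding T_def using n L(1) by (intro mult_pos_pos)
  \<comment> \<open>Makes \<open>2 * \<alpha> * k\<close> exceed \<open>T + C * (R + r)\<close> by
    exactly 1, so that the term of order \<open>k^2\<close> in the Hessian of the barrier outweighs
    all errors with a surplus of \<open>2 k \<epsilon> E\<close>.\<close>
  define k where "k = (T + C * (R + r) + 1) / (2 * \<alpha>)"
  have "T + C * (R + r) + 1 > 0" using C0 T0 R r by (intro add_pos_pos mult_pos_pos) auto
  then have k: "k > 0" using \<alpha> by (simp add: k_def)
  define E where "E y = exp (- k * ((y - c) \<bullet> (y - c)))" for y
  \<comment> \<open>Zero on the sphere about \<open>c\<close> through \<open>z\<close>, positive
    inside and negative outside.\<close>
  define h where "h y = E y - exp (- k * R\<^sup>2)" for y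
  define gh where "gh y = (- (2 * k * E y)) *\<^sub>R (y - c)" for y
  define Dgh where "Dgh y \<eta> = (4 * k\<^sup>2 * E y * ((y - c) \<bullet> \<eta>)) *\<^sub>R (y - c) - (2 * k * E y) *\<^sub>R \<eta>" for y \<eta>
  have dE: "(E has_derivative (\<lambda>\<eta>. gh y \<bullet> \<eta>)) (at y)" for y
    unfolding E_def gh_def
    by (rule derivative_eq_intros refl)+ (simp add: fun_eq_iff inner_commute algebra_simps)
  have dh: "(h has_derivative (\<lambda>\<eta>. gh y \<bullet> \<eta>)) (at y)" for y
    unfolding h_def using has_derivative_diff[OF dE has_derivative_const] by simp
  have dgh: "(gh has_derivative Dgh y) (at y)" for y
    unfolding gh_def
    by (rule derivative_eq_intros dE refl)+
      (simp add: fun_eq_iff Dgh_def gh_def power2_eq_square algebra_simps)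
  have "compact (sphere z r \<inter> cball c R)" by (intro compact_Int_closed) auto
  \<comment> \<open>Inside the closed ball about \<open>c\<close> the only contact point is
    \<open>z\<close>, the centre of the small sphere; so on this compact piece \<open>v - u\<close>
    has a positive lower bound.\<close>
  have "\<exists>\<delta>>0. \<forall>y\<in>sphere z r \<inter> cball c R. \<delta> \<le> v y - u y"
  proof (cases "sphere z r \<inter> cball c R = {}")
    case True
    then show ?thesis by (intro exI[of _ 1]) auto
  next
    case False
    have "continuous_on (sphere z r \<inter> cball c R) (\<lambda>y. v y - u y)"
    proof -
      have sub: "sphere z r \<inter> cball c R \<subseteq> D" using BD by auto
      show ?thesis
        by (intro continuous_on_diff continuous_on_subset[OF Ck_on_continuous[OF D(2)] sub]
            continuous_on_subset[OF Ck_on_continuous[OF D(3)] sub])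
    qed
    from continuous_attains_inf[OF \<open>compact (sphere z r \<inter> cball c R)\<close> False this]
    obtain y0 where y0: "y0 \<in> sphere z r \<inter> cball c R" "\<forall>y\<in>sphere z r \<inter> cball c R. v y0 - u y0 \<le> v y - u y" by blast
    have "u y0 < v y0"
      using y0(1) r BD by (intro strict) (auto simp: R_def dist_norm norm_minus_commute subset_iff)
    then show ?thesis using y0(2) by (intro exI[of _ "v y0 - u y0"]) auto
  qed
  then obtain \<delta> where \<delta>: "\<delta> > 0" "\<And>y. y \<in> sphere z r \<inter> cball c R \<Longrightarrow> \<delta> \<le> v y - u y" by blast
  \<comment> \<open>As \<open>h < 1\<close>, this multiple of the barrier stays below
    \<open>\<delta>\<close> on that piece; on the rest of the small sphere \<open>h\<close> is
    negative. Hence \<open>w\<close> is positive there, while \<open>w z = 0\<close>, and the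
    minimum is interior.\<close>
  define \<epsilon> where "\<epsilon> = \<delta> / 2"
  have \<epsilon>: "\<epsilon> > 0" using \<delta> by (simp add: \<epsilon>_def)
  define w where "w y = v y - u y - \<epsilon> * h y" for y
  have h1: "h y < 1" for y
  proof -
    have "E y \<le> 1" using k by (simp add: E_def)
    moreover have "exp (- k * R\<^sup>2) > 0" by simp
    ultimately show ?thesis unfolding h_def by linarith
  qed
  have "continuous_on ?B w"
  proof -
    have "continuous_on ?B h" by (rule has_derivative_continuous_on) (rule has_derivative_at_withinI[OF dh])
    then show ?thesis unfolding w_def
      using Ck_on_continuous[OF D(2)] Ck_on_continuous[OF D(3)] BD
      by (intro continuous_intros) (auto intro: continuous_on_subset)
  qed
  then obtain y where y: "y \<in> ?B" "\<And>x. x \<in> ?B \<Longrightarrow> w y \<le> w x"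
    using continuous_attains_inf[OF compact_cball, of z r w] r by auto
  have "h z = 0" by (simp add: h_def E_def R_def power2_norm_eq_inner)
  then have wz: "w z = 0" using z by (simp add: w_def)
  then have wy: "w y \<le> 0" using y(2)[of z] r by simp
  have yint: "y \<in> ball z r"
  proof (rule ccontr)
    assume "y \<notin> ball z r"
    then have ys: "y \<in> sphere z r" using y(1) by auto
    have "w y > 0"
    proof (cases "y \<in> cball c R")
      case True
      then have "\<delta> \<le> v y - u y" using \<delta>(2) ys by blast
      moreover have "\<epsilon> * h y < \<epsilon> * 1" using h1 \<epsilon> by (intro mult_strict_left_mono) auto
      ultimately show ?thesis using \<delta>(1) \<epsilon>_def unfolding w_def by linarith
    next
      case False
      then have "R < norm (y - c)" by (simp add: dist_norm norm_minus_commute)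
      then have "R\<^sup>2 < (norm (y - c))\<^sup>2" using R by (intro power_strict_mono) auto
      then have "- k * (norm (y - c))\<^sup>2 < - k * R\<^sup>2" using k by simp
      then have "h y < 0" by (simp add: h_def E_def power2_norm_eq_inner)
      then have "\<epsilon> * h y < 0" using \<epsilon> by (simp add: mult_pos_neg)
      then show ?thesis using ge[of y] y(1) BD by (auto simp: w_def subset_iff)
    qed
    then show False using wy by simp
  qed
  define gw where "gw x = gradient v x - gradient u x - \<epsilon> *\<^sub>R gh x" for x
  have dw: "(w has_derivative (\<lambda>\<eta>. gw x \<bullet> \<eta>)) (at x)" if "x \<in> ball z r" for x
  proof -
    have "x \<in> D" using that BD by auto
    from has_derivative_diff[OF has_derivative_diff[OF dv[OF this] du[OF this]] has_derivative_mult_right[OF dh, of \<epsilon>]]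
    show ?thesis unfolding w_def gw_def by (simp add: inner_diff_left)
  qed
  have yD: "y \<in> D" using y(1) BD by auto
  define P where "P \<eta> = fd (gradient v) y \<eta> - fd (gradient u) y \<eta> - \<epsilon> *\<^sub>R Dgh y \<eta>" for \<eta>
  have dgw: "(gw has_derivative P) (at y)"
    unfolding gw_def P_def
    by (intro has_derivative_diff dgv[OF yD] dgu[OF yD] has_derivative_scaleR_right dgh)
  have min: "gw y = 0" "P l \<bullet> l \<ge> 0" for l
    using second_order_minimum[OF open_ball yint dw dgw] y(2) by auto
  have linP: "linear P" using dgw by (rule has_derivative_linear)
  define q q' where "q = gradient u y" and "q' = gradient v y"
  have qW: "(y, q) \<in> W" "(y, q') \<in> W" "(y, q) \<in> ?K" "(y, q') \<in> ?K"
    using inB[OF y(1)] inW[OF yD] by (auto simp: q_def q'_def)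
  have qq: "q' - q = \<epsilon> *\<^sub>R gh y" using min(1) by (simp add: gw_def q_def q'_def)
  define G where "G \<eta> = fd J (y, q') (0, \<eta>)" for \<eta>
  have linG: "linear G"
    unfolding G_def using linJ[OF qW(2)] by (simp add: linear_iff) (metis add_Pair scaleR_Pair add.right_neutral scaleR_zero_right)
  have trP: "(\<Sum>b\<in>Basis. G (P b) \<bullet> b) \<ge> 0"
    by (rule trace_psd_nonneg[OF linG _ _ linP min(2)]) (use sym psd qW(2) in \<open>auto simp: G_def\<close>)
  \<comment> \<open>The Hessian of \<open>v\<close> is that of \<open>u\<close>, plus the positive
    semidefinite \<open>P\<close>, plus \<open>\<epsilon>\<close> times that of the barrier.\<close>
  have splitJ: "fd J (y, q') (b, fd (gradient v) y b) = fd J (y, q') (b, fd (gradient u) y b) + G (P b) + \<epsilon> *\<^sub>R G (Dgh y b)" for b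
  proof -
    have "fd (gradient v) y b = fd (gradient u) y b + P b + \<epsilon> *\<^sub>R Dgh y b" by (simp add: P_def)
    then have "(b, fd (gradient v) y b) = (b, fd (gradient u) y b) + (0, P b + \<epsilon> *\<^sub>R Dgh y b)" by simp
    then have "fd J (y, q') (b, fd (gradient v) y b) = fd J (y, q') (b, fd (gradient u) y b) + G (P b + \<epsilon> *\<^sub>R Dgh y b)"
      unfolding G_def by (metis linear_add[OF linJ[OF qW(2)]])
    then show ?thesis by (simp add: linear_add[OF linG] linear_scale[OF linG])
  qed
  have nb: "norm (b, fd (gradient u) y b) \<le> 1 + M" if "b \<in> Basis" for b
    using norm_Pair_le[of b "fd (gradient u) y b"] M(2)[OF y(1), of b] that by simp
  define N where "N = norm (q' - q)"
  \<comment> \<open>Exchanging the momenta \<open>q\<close> and \<open>q'\<close> costs a multiple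
    of \<open>N\<close>, which is at most of order \<open>\<epsilon> k E\<close> and so one power of
    \<open>k\<close> below the gain from the barrier.\<close>
  have J1: "(\<Sum>b\<in>Basis. fd J (y, q') (b, fd (gradient u) y b) \<bullet> b) - (\<Sum>b\<in>Basis. fd J (y, q) (b, fd (gradient u) y b) \<bullet> b) \<ge> - (n * (CJ * (1 + M))) * N"
  proof -
    have "(\<Sum>b\<in>Basis. fd J (y, q) (b, fd (gradient u) y b) \<bullet> b) - (\<Sum>b\<in>Basis. fd J (y, q') (b, fd (gradient u) y b) \<bullet> b)
      = (\<Sum>b\<in>Basis. (fd J (y, q) (b, fd (gradient u) y b) - fd J (y, q') (b, fd (gradient u) y b)) \<bullet> b)"
      by (simp add: sum_subtractf inner_diff_left)
    also have "\<dots> \<le> (\<Sum>b\<in>(Basis :: 'a set). CJ * (1 + M) * N)"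
    proof (rule sum_mono)
      fix b :: 'a assume b: "b \<in> Basis"
      have "(fd J (y, q) (b, fd (gradient u) y b) - fd J (y, q') (b, fd (gradient u) y b)) \<bullet> b
         \<le> norm (fd J (y, q) (b, fd (gradient u) y b) - fd J (y, q') (b, fd (gradient u) y b))"
        using Basis_le_norm[OF b] abs_le_D1 by blast
      also have "\<dots> \<le> CJ * norm ((y, q) - (y, q')) * norm (b, fd (gradient u) y b)" using CJ(2) qW by blast
      also have "\<dots> \<le> CJ * N * (1 + M)"
        using CJ(1) nb[OF b] by (auto simp: N_def norm_Pair_0 norm_minus_commute intro!: mult_left_mono)
      finally show "(fd J (y, q) (b, fd (gradient u) y b) - fd J (y, q') (b, fd (gradient u) y b)) \<bullet> b \<le> CJ * (1 + M) * N"
        by (simp add: mult_ac)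
    qed
    also have "\<dots> = (n * (CJ * (1 + M))) * N" by (simp add: n_def)
    finally show ?thesis by simp
  qed
  have J2': "\<beta> y \<bullet> J (y, q') - \<beta> y \<bullet> J (y, q) \<ge> - (M\<beta> * L) * N"
  proof -
    have "\<beta> y \<bullet> J (y, q) - \<beta> y \<bullet> J (y, q') \<le> norm (\<beta> y) * norm (J (y, q) - J (y, q'))"
      unfolding inner_diff_right[symmetric] by (rule norm_cauchy_schwarz)
    also have "\<dots> \<le> M\<beta> * (L * norm ((y, q) - (y, q')))"
      using M\<beta>(1) by (intro mult_mono M\<beta>(2)[OF y(1)] L(3) qW) auto
    also have "\<dots> = (M\<beta> * L) * N" by (simp add: N_def norm_Pair_0 norm_minus_commute)
    finally show ?thesis by simp
  qed
  have tr: "(\<Sum>b\<in>Basis. G (Dgh y b) \<bullet> b) \<ge> E y * (4 * k\<^sup>2 * \<alpha> - 2 * k * T)"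
  proof -
    have "(\<Sum>b\<in>Basis. G (Dgh y b) \<bullet> b)
       = (\<Sum>b\<in>Basis. (4 * k\<^sup>2 * E y) * (((y - c) \<bullet> b) * (G (y - c) \<bullet> b)) - (2 * k * E y) * (G b \<bullet> b))"
      by (simp add: Dgh_def linear_diff[OF linG] linear_scale[OF linG] inner_diff_left mult_ac)
    also have "\<dots> = (4 * k\<^sup>2 * E y) * (\<Sum>b\<in>Basis. ((y - c) \<bullet> b) * (G (y - c) \<bullet> b)) - (2 * k * E y) * (\<Sum>b\<in>Basis. G b \<bullet> b)"
      by (simp only: sum_subtractf sum_distrib_left)
    also have "(\<Sum>b\<in>Basis. ((y - c) \<bullet> b) * (G (y - c) \<bullet> b)) = (y - c) \<bullet> G (y - c)"
      by (rule euclidean_inner[symmetric])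
    also have "(y - c) \<bullet> G (y - c) = a y"
    proof -
      have "G (c - y) = - G (y - c)" using linear_neg[OF linG, of "y - c"] by simp
      then show ?thesis by (simp add: a_def G_def q'_def inner_commute[of "y - c"] inner_diff_right)
    qed
    finally have 1: "(\<Sum>b\<in>Basis. G (Dgh y b) \<bullet> b) = (4 * k\<^sup>2 * E y) * a y - (2 * k * E y) * (\<Sum>b\<in>Basis. G b \<bullet> b)" .
    have "(\<Sum>b\<in>Basis. G b \<bullet> b) \<le> (\<Sum>b\<in>(Basis::'a set). L)"
    proof (rule sum_mono)
      fix b :: 'a assume b: "b \<in> Basis"
      have "G b \<bullet> b \<le> norm (G b)" using Basis_le_norm[OF b] abs_le_D1 by blast
      also have "\<dots> \<le> L" using L(2)[OF qW(4), of "(0, b)"] b by (simp add: G_def norm_Pair_0)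
      finally show "G b \<bullet> b \<le> L" .
    qed
    then have 2: "(\<Sum>b\<in>Basis. G b \<bullet> b) \<le> T" by (simp add: T_def n_def)
    have E: "E y > 0" by (simp add: E_def)
    have "(4 * k\<^sup>2 * E y) * \<alpha> \<le> (4 * k\<^sup>2 * E y) * a y" using inB(4)[OF y(1)] E by (intro mult_left_mono) auto
    moreover have "(2 * k * E y) * (\<Sum>b\<in>Basis. G b \<bullet> b) \<le> (2 * k * E y) * T" using 2 E k by (intro mult_left_mono) auto
    ultimately show ?thesis using 1 by (simp add: algebra_simps)
  qed
  have N: "N \<le> \<epsilon> * (2 * k * E y * (R + r))"
  proof -
    have "norm (y - c) \<le> R + r"
      using norm_triangle_ineq[of "y - z" "z - c"] y(1) by (simp add: R_def dist_norm norm_minus_commute)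
    moreover have "N = \<epsilon> * (2 * k * E y * norm (y - c))"
      using \<epsilon> k by (simp add: N_def qq gh_def abs_mult E_def)
    ultimately show ?thesis using \<epsilon> k by (simp add: E_def mult_left_mono)
  qed
  have "quasilinear_op J \<beta> v y - quasilinear_op J \<beta> u y = 
     ((\<Sum>b\<in>Basis. fd J (y, q') (b, fd (gradient u) y b) \<bullet> b) - (\<Sum>b\<in>Basis. fd J (y, q) (b, fd (gradient u) y b) \<bullet> b))
     + (\<Sum>b\<in>Basis. G (P b) \<bullet> b) + \<epsilon> * (\<Sum>b\<in>Basis. G (Dgh y b) \<bullet> b) + (\<beta> y \<bullet> J (y, q') - \<beta> y \<bullet> J (y, q))"
    unfolding quasilinear_op_expand[OF D(1,2) W(2) yD inW(1)[OF yD]] quasilinear_op_expand[OF D(1,3) W(2) yD inW(2)[OF yD]]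
      q_def[symmetric] q'_def[symmetric] splitJ
    by (simp add: inner_add_left sum.distrib sum_distrib_left)
  also have "\<dots> \<ge> - C * N + \<epsilon> * (E y * (4 * k\<^sup>2 * \<alpha> - 2 * k * T))"
    using J1 J2' trP mult_left_mono[OF tr, of \<epsilon>] \<epsilon> by (simp add: C_def algebra_simps)
  finally have low: "quasilinear_op J \<beta> v y - quasilinear_op J \<beta> u y \<ge> - C * N + \<epsilon> * (E y * (4 * k\<^sup>2 * \<alpha> - 2 * k * T))" .
  have "C * N \<le> C * (\<epsilon> * (2 * k * E y * (R + r)))" using N C0 by (intro mult_left_mono) auto
  moreover have "4 * k\<^sup>2 * \<alpha> = 2 * k * (T + C * (R + r) + 1)" 
  proof -
    have "2 * \<alpha> * k = T + C * (R + r) + 1" using \<alpha> by (simp add: k_def)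
    then show ?thesis by (simp add: power2_eq_square flip: \<open>2 * \<alpha> * k = _\<close>)
  qed
  ultimately have "- C * N + \<epsilon> * (E y * (4 * k\<^sup>2 * \<alpha> - 2 * k * T)) \<ge> \<epsilon> * E y * (2 * k)"
    by (simp add: algebra_simps)
  moreover have "\<epsilon> * E y * (2 * k) > 0" using \<epsilon> k by (simp add: E_def)
  ultimately show False using low le[OF yD] by linarith
qed

section \<open>Manifolds in a chart\<close>

locale charted_manifold =
  fixes A :: "('a::t2_space, 'n::finite) chart set"
  assumes manifold: "smooth_manifold A"
begin

lemma chart_at: "chart_at A x \<in> A" "x \<in> fst (chart_at A x)"
proof -
  have "\<exists>c. c \<in> A \<and> x \<in> fst c" using manifold unfolding smooth_manifold_def by blast
  from someI_ex[OF this] show "chart_at A x \<in> A" "x \<in> fst (chart_at A x)"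
    unfolding chart_at_def by auto
qed

lemma atlas_is_chart: "c \<in> A \<Longrightarrow> is_chart A c"
  using manifold unfolding smooth_manifold_def by blast

lemma chart_props:
  assumes "is_chart A c"
  shows "open (fst c)" "open (snd c ` fst c)" "continuous_on (fst c) (snd c)" "continuous_on (snd c ` fst c) (cinv c)"
    "x \<in> fst c \<Longrightarrow> cinv c (snd c x) = x" "y \<in> snd c ` fst c \<Longrightarrow> snd c (cinv c y) = y"
    "y \<in> snd c ` fst c \<Longrightarrow> cinv c y \<in> fst c"
  using assms unfolding is_chart_def homeomorphism_def by auto

lemma chart_image_open:
  assumes "is_chart A c" "open W"
  shows "open (snd c ` (fst c \<inter> W))"
proof -
  have "snd c ` (fst c \<inter> W) = (snd c ` fst c) \<inter> cinv c -` W"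
    using chart_props[OF assms(1)] by (auto simp: image_iff)
  then show ?thesis
    using continuous_open_preimage[OF chart_props(4)[OF assms(1)] chart_props(2)[OF assms(1)] assms(2)]
    by (simp add: vimage_def Int_def)
qed

lemma chart_image_open_subset: "is_chart A c \<Longrightarrow> open W \<Longrightarrow> W \<subseteq> fst c \<Longrightarrow> open (snd c ` W)"
  using chart_image_open[of c W] by (simp add: inf_absorb2)

text \<open>\<open>is_chart\<close> compares a chart with members of \<open>A\<close> only. This
  symmetric relation also covers a chart paired with itself, so a single composition rule serves all
  changes of components.\<close>

definition compat :: "('a, 'n) chart \<Rightarrow> ('a, 'n) chart \<Rightarrow> bool" where
  "compat c d \<longleftrightarrow> is_chart A c \<and> is_chart A d \<and> smooth_on (snd c ` (fst c \<inter> fst d)) (snd d \<circ> cinv c) \<and>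
     smooth_on (snd d ` (fst c \<inter> fst d)) (snd c \<circ> cinv d)"

lemma compat_chart_atlas: "is_chart A c \<Longrightarrow> d \<in> A \<Longrightarrow> compat c d"
  using atlas_is_chart by (auto simp: compat_def is_chart_def)

lemma compat_sym: "compat c d \<Longrightarrow> compat d c"
  by (auto simp: compat_def Int_commute)

lemma compat_atlas_chart: "is_chart A c \<Longrightarrow> d \<in> A \<Longrightarrow> compat d c"
  using compat_chart_atlas compat_sym by blast

lemma compat_refl: "is_chart A c \<Longrightarrow> compat c c"
proof -
  assume c: "is_chart A c"
  have "smooth_on (snd c ` fst c) (snd c \<circ> cinv c)"
    using smooth_on_cong[OF chart_props(2)[OF c], of "\<lambda>y. y" "snd c \<circ> cinv c"] chart_props(6)[OF c] smooth_on_id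
    by auto
  then show ?thesis using c by (simp add: compat_def)
qed

lemma transition_has_derivative:
  assumes "compat c d" "x \<in> fst c" "x \<in> fst d"
  shows "((snd d \<circ> cinv c) has_derivative tchange c d x) (at (snd c x))"
proof -
  have "smooth_on (snd c ` (fst c \<inter> fst d)) (snd d \<circ> cinv c)" using assms by (simp add: compat_def)
  from smooth_on_has_derivative[OF this] have "((snd d \<circ> cinv c) has_derivative fd (snd d \<circ> cinv c) (snd c x)) (at (snd c x))"
    using assms by blast
  moreover have "tchange c d x = fd (snd d \<circ> cinv c) (snd c x)" by (rule ext) (simp add: tchange_def)
  ultimately show ?thesis by simp
qed

lemma tchange_linear: "compat c d \<Longrightarrow> x \<in> fst c \<Longrightarrow> x \<in> fst d \<Longrightarrow> linear (tchange c d x)"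
  using transition_has_derivative has_derivative_linear by blast

lemma tchange_compose:
  assumes "compat c d" "compat d e" "compat c e" "x \<in> fst c" "x \<in> fst d" "x \<in> fst e"
  shows "tchange d e x (tchange c d x v) = tchange c e x v"
proof -
  have c: "is_chart A c" "is_chart A d" using assms by (auto simp: compat_def)
  have e: "(snd d \<circ> cinv c) (snd c x) = snd d x" using chart_props(5)[OF c(1) assms(4)] by simp
  have "((\<lambda>y. (snd e \<circ> cinv d) ((snd d \<circ> cinv c) y)) has_derivative (\<lambda>v. tchange d e x (tchange c d x v))) (at (snd c x))"
    by (rule has_derivative_compose[OF transition_has_derivative[OF assms(1,4,5)]])
      (simp only: e, rule transition_has_derivative[OF assms(2,5,6)])
  then have "((snd e \<circ> cinv c) has_derivative (\<lambda>v. tchange d e x (tchange c d x v))) (at (snd c x))"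
  proof (rule has_derivative_transform_within_open[OF _ chart_image_open[OF c(1) chart_props(1)[OF c(2)]]])
    show "snd c x \<in> snd c ` (fst c \<inter> fst d)" using assms by blast
    show "(snd e \<circ> cinv d) ((snd d \<circ> cinv c) y) = (snd e \<circ> cinv c) y" if "y \<in> snd c ` (fst c \<inter> fst d)" for y
      using that chart_props(5)[OF c(1)] chart_props(5)[OF c(2)] by auto
  qed
  from has_derivative_unique[OF this transition_has_derivative[OF assms(3,4,6)]] show ?thesis by (rule fun_cong)
qed

lemma tchange_refl:
  assumes "is_chart A c" "x \<in> fst c"
  shows "tchange c c x v = v"
proof -
  have "((\<lambda>y. y) has_derivative (\<lambda>v. v)) (at (snd c x))" by (rule has_derivative_ident)
  then have "((snd c \<circ> cinv c) has_derivative (\<lambda>v. v)) (at (snd c x))"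
    by (rule has_derivative_transform_within_open[OF _ chart_props(2)[OF assms(1)]])
      (use assms chart_props(6)[OF assms(1)] in auto)
  from has_derivative_unique[OF this transition_has_derivative[OF compat_refl[OF assms(1)] assms(2,2)]]
  show ?thesis by (metis (no_types))
qed

text \<open>Components in the chart \<open>c\<close> of a tangent vector at \<open>x\<close>, and the inverse operation.\<close>

abbreviation comps :: "('a, 'n) chart \<Rightarrow> 'a \<Rightarrow> real^'n \<Rightarrow> real^'n" where
  "comps c x \<equiv> tchange (chart_at A x) c x"

abbreviation vec_of :: "('a, 'n) chart \<Rightarrow> 'a \<Rightarrow> real^'n \<Rightarrow> real^'n" where
  "vec_of c x \<equiv> tchange c (chart_at A x) x"

lemma comps_linear: "is_chart A c \<Longrightarrow> x \<in> fst c \<Longrightarrow> linear (comps c x)"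
  using tchange_linear[OF compat_atlas_chart] chart_at by blast

lemma vec_of_linear: "is_chart A c \<Longrightarrow> x \<in> fst c \<Longrightarrow> linear (vec_of c x)"
  using tchange_linear[OF compat_chart_atlas] chart_at by blast

lemma comps_vec_of [simp]:
  assumes "is_chart A c" "x \<in> fst c"
  shows "comps c x (vec_of c x v) = v"
  using tchange_compose[OF compat_chart_atlas[OF assms(1) chart_at(1)] compat_atlas_chart[OF assms(1) chart_at(1)]
      compat_refl[OF assms(1)] assms(2) chart_at(2) assms(2)] tchange_refl[OF assms] by simp

lemma vec_of_comps [simp]:
  assumes "is_chart A c" "x \<in> fst c"
  shows "vec_of c x (comps c x v) = v"
  using tchange_compose[OF compat_atlas_chart[OF assms(1) chart_at(1)] compat_chart_atlas[OF assms(1) chart_at(1)]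
      compat_refl[OF atlas_is_chart[OF chart_at(1)]] chart_at(2) assms(2) chart_at(2)]
    tchange_refl[OF atlas_is_chart[OF chart_at(1)] chart_at(2)] by simp

lemma comps_change:
  assumes "is_chart A c" "d \<in> A" "x \<in> fst c" "x \<in> fst d"
  shows "tchange c d x (comps c x v) = comps d x v" "tchange d c x (comps d x v) = comps c x v"
    "vec_of d x (tchange c d x w) = vec_of c x w" "vec_of c x (tchange d c x w) = vec_of d x w"
  by (rule tchange_compose; use assms chart_at compat_chart_atlas compat_atlas_chart atlas_is_chart in blast)+

lemma smooth_fun_chart:
  assumes "is_chart A c" "open W" "smooth_fun A W f"
  shows "smooth_on (snd c ` (fst c \<inter> W)) (f \<circ> cinv c)"
proof (rule smooth_on_local[OF chart_image_open[OF assms(1,2)]])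
  fix y assume "y \<in> snd c ` (fst c \<inter> W)"
  then obtain x where x: "x \<in> fst c" "x \<in> W" "y = snd c x" by auto
  define d where "d = chart_at A x"
  have d: "d \<in> A" "x \<in> fst d" "is_chart A d" using chart_at atlas_is_chart by (auto simp: d_def)
  define T where "T = snd c ` (fst c \<inter> (fst d \<inter> W))"
  have oT: "open T" unfolding T_def using chart_image_open[OF assms(1)] chart_props(1)[OF d(3)] assms(2) by blast
  have oD: "open (snd d ` (fst d \<inter> W))" using chart_image_open[OF d(3) assms(2)] .
  have "smooth_on T (\<lambda>y. (f \<circ> cinv d) ((snd d \<circ> cinv c) y))"
  proof (rule smooth_on_compose[OF oT oD])
    have "smooth_on (snd c ` (fst c \<inter> fst d)) (snd d \<circ> cinv c)"
      using compat_chart_atlas[OF assms(1) d(1)] by (simp add: compat_def)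
    then show "smooth_on T (snd d \<circ> cinv c)" by (rule smooth_on_subset) (auto simp: T_def)
    show "smooth_on (snd d ` (fst d \<inter> W)) (f \<circ> cinv d)" using assms(3) d(1) unfolding smooth_fun_def by blast
    show "(snd d \<circ> cinv c) y \<in> snd d ` (fst d \<inter> W)" if "y \<in> T" for y
      using that chart_props(5)[OF assms(1)] unfolding T_def by auto
  qed
  moreover have "(f \<circ> cinv d) ((snd d \<circ> cinv c) y) = (f \<circ> cinv c) y" if "y \<in> T" for y
    using that chart_props(5)[OF assms(1)] chart_props(5)[OF d(3)] unfolding T_def by auto
  ultimately have "smooth_on T (f \<circ> cinv c)" using smooth_on_cong[OF oT, of "\<lambda>y. (f \<circ> cinv d) ((snd d \<circ> cinv c) y)"] by blast
  then have "smooth_on (snd c ` (fst c \<inter> W) \<inter> T) (f \<circ> cinv c)" by (rule smooth_on_subset) simp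
  moreover have "y \<in> T" using x d by (auto simp: T_def)
  ultimately show "\<exists>T. open T \<and> y \<in> T \<and> smooth_on (snd c ` (fst c \<inter> W) \<inter> T) (f \<circ> cinv c)" using oT by blast
qed

lemma smooth_funI_chart:
  assumes "is_chart A c" "open W" "W \<subseteq> fst c" "smooth_on (snd c ` W) (f \<circ> cinv c)"
  shows "smooth_fun A W f"
  unfolding smooth_fun_def
proof
  fix d assume d: "d \<in> A"
  note dc = atlas_is_chart[OF d]
  have o1: "open (snd d ` (fst d \<inter> W))" using chart_image_open[OF dc assms(2)] .
  have o2: "open (snd c ` W)" using chart_image_open_subset assms by blast
  have "smooth_on (snd d ` (fst d \<inter> W)) (\<lambda>y. (f \<circ> cinv c) ((snd c \<circ> cinv d) y))"
  proof (rule smooth_on_compose[OF o1 o2 _ assms(4)])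
    have "snd d ` (fst d \<inter> W) \<subseteq> snd d ` (fst c \<inter> fst d)" using assms(3) by blast
    moreover have "smooth_on (snd d ` (fst c \<inter> fst d)) (snd c \<circ> cinv d)"
      using compat_chart_atlas[OF assms(1) d] by (simp add: compat_def)
    ultimately show "smooth_on (snd d ` (fst d \<inter> W)) (snd c \<circ> cinv d)" by (rule smooth_on_subset[rotated])
    show "(snd c \<circ> cinv d) y \<in> snd c ` W" if "y \<in> snd d ` (fst d \<inter> W)" for y
      using that chart_props(5)[OF dc] by auto
  qed
  moreover have "(f \<circ> cinv c) ((snd c \<circ> cinv d) y) = (f \<circ> cinv d) y" if "y \<in> snd d ` (fst d \<inter> W)" for y
    using that chart_props(5)[OF dc] chart_props(5)[OF assms(1)] assms(3) by auto
  ultimately show "smooth_on (snd d ` (fst d \<inter> W)) (f \<circ> cinv d)"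
    using smooth_on_cong[OF o1, of "\<lambda>y. (f \<circ> cinv c) ((snd c \<circ> cinv d) y)"] by blast
qed

section \<open>Covectors and differentials in a chart\<close>

lemma linear_blinfun: "linear f \<Longrightarrow> blinfun_apply (Blinfun f) = f" for f :: "real^'n \<Rightarrow> real"
  by (simp add: bounded_linear_Blinfun_apply linear_conv_bounded_linear)

text \<open>The covector with components \<open>q\<close> in \<open>c\<close>, which allows
  covectors at different points to be compared.\<close>

definition cov :: "('a, 'n) chart \<Rightarrow> 'a \<Rightarrow> real^'n \<Rightarrow> 'n covector" where
  "cov c x q = Blinfun (\<lambda>v. q \<bullet> comps c x v)"

lemma cov_apply:
  assumes "is_chart A c" "x \<in> fst c"
  shows "blinfun_apply (cov c x q) v = q \<bullet> comps c x v"
proof -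
  have "linear (\<lambda>v. q \<bullet> comps c x v)"
    using comps_linear[OF assms] by (simp add: linear_iff inner_add_right)
  then show ?thesis by (simp add: cov_def linear_blinfun)
qed

lemma cov_linear:
  assumes "is_chart A c" "x \<in> fst c"
  shows "linear (cov c x)"
  by (rule linearI; rule blinfun_eqI) (simp_all add: cov_apply[OF assms] inner_add_left blinfun.add_left blinfun.scaleR_left)

lemma cov_surj:
  assumes "is_chart A c" "x \<in> fst c"
  obtains q where "w = cov c x q"
proof -
  define q where "q = (\<Sum>b\<in>Basis. blinfun_apply w (vec_of c x b) *\<^sub>R b)"
  have "w = cov c x q"
  proof (rule blinfun_eqI)
    fix v
    define u where "u = comps c x v"
    have v: "v = vec_of c x u" using assms by (simp add: u_def)
    have "linear (\<lambda>u. blinfun_apply w (vec_of c x u))"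
      using vec_of_linear[OF assms] by (simp add: linear_iff blinfun.add_right blinfun.scaleR_right)
    from linear_real_expand[OF this, of u] have "blinfun_apply w v = (\<Sum>b\<in>Basis. (u \<bullet> b) * blinfun_apply w (vec_of c x b))"
      by (simp add: v)
    also have "\<dots> = q \<bullet> u" by (simp add: q_def inner_sum_left inner_commute[of u] mult.commute)
    finally show "blinfun_apply w v = blinfun_apply (cov c x q) v" by (simp add: cov_apply[OF assms] u_def)
  qed
  then show ?thesis by (rule that)
qed

lemma differentiable_in_chart_at:
  assumes "is_chart A c" "x \<in> fst c" "(f \<circ> cinv c) differentiable (at (snd c x))"
  shows "((f \<circ> cinv (chart_at A x)) has_derivative (\<lambda>v. fd (f \<circ> cinv c) (snd c x) (comps c x v))) (at (snd (chart_at A x) x))"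
proof -
  define d where "d = chart_at A x"
  have d: "d \<in> A" "x \<in> fst d" "is_chart A d" using chart_at atlas_is_chart by (auto simp: d_def)
  have e: "(snd c \<circ> cinv d) (snd d x) = snd c x" using chart_props(5)[OF d(3,2)] by simp
  have "((\<lambda>y. (f \<circ> cinv c) ((snd c \<circ> cinv d) y)) has_derivative (\<lambda>v. fd (f \<circ> cinv c) (snd c x) (tchange d c x v))) (at (snd d x))"
    by (rule has_derivative_compose[OF transition_has_derivative[OF compat_atlas_chart[OF assms(1) d(1)] d(2) assms(2)]])
      (simp only: e, rule fd_works[OF assms(3)])
  then have "((f \<circ> cinv d) has_derivative (\<lambda>v. fd (f \<circ> cinv c) (snd c x) (tchange d c x v))) (at (snd d x))"
  proof (rule has_derivative_transform_within_open[OF _ chart_image_open[OF d(3) chart_props(1)[OF assms(1)]]])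
    show "snd d x \<in> snd d ` (fst d \<inter> fst c)" using assms d by blast
    show "(f \<circ> cinv c) ((snd c \<circ> cinv d) y) = (f \<circ> cinv d) y" if "y \<in> snd d ` (fst d \<inter> fst c)" for y
      using that chart_props(5)[OF d(3)] chart_props(5)[OF assms(1)] by auto
  qed
  then show ?thesis by (simp add: d_def)
qed

lemma differential_chart:
  assumes "is_chart A c" "x \<in> fst c" "(f \<circ> cinv c) differentiable (at (snd c x))"
  shows "differential A f x = cov c x (gradient (f \<circ> cinv c) (snd c x))"
proof (rule blinfun_eqI)
  fix v
  note d = differentiable_in_chart_at[OF assms]
  have "blinfun_apply (differential A f x) v = fd (f \<circ> cinv c) (snd c x) (comps c x v)"
    unfolding differential_def fd_eq[OF d] linear_blinfun[OF has_derivative_linear[OF d]] ..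
  then show "blinfun_apply (differential A f x) v = blinfun_apply (cov c x (gradient (f \<circ> cinv c) (snd c x))) v"
    by (simp add: cov_apply[OF assms(1,2)] gradient_inner[OF assms(3)])
qed

lemma inner_axis_1: "axis i (1::real) \<bullet> v = v $ i"
  by (simp add: inner_axis' )

lemma differential_coordinate:
  assumes "is_chart A c" "x \<in> fst c"
  shows "differential A (\<lambda>y. snd c y $ i) x = cov c x (axis i 1)"
proof -
  have "((\<lambda>y::real^'n. y $ i) has_derivative (\<lambda>v. v $ i)) (at (snd c x))"
    by (rule bounded_linear_imp_has_derivative[OF bounded_linear_vec_nth])
  then have d: "((\<lambda>y. snd c y $ i) \<circ> cinv c has_derivative (\<lambda>v. v $ i)) (at (snd c x))"
    by (rule has_derivative_transform_within_open[OF _ chart_props(2)[OF assms(1)]])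
      (use assms chart_props(6)[OF assms(1)] in auto)
  then have diff: "((\<lambda>y. snd c y $ i) \<circ> cinv c) differentiable (at (snd c x))" by (auto simp: differentiable_def)
  have "gradient ((\<lambda>y. snd c y $ i) \<circ> cinv c) (snd c x) = axis i 1"
    by (rule vector_eq_ldot[THEN iffD1]) (simp add: inner_commute[of _ "gradient _ _"] gradient_inner[OF diff] fd_eq[OF d]
      inner_commute[of _ "axis i 1"] inner_axis_1)
  then show ?thesis using differential_chart[OF assms diff] by simp
qed

section \<open>Vector fields, brackets and Lie derivatives in one fixed chart\<close>

lemma vector_rep_apply: "vector_rep A c X y = comps c (cinv c y) (X (cinv c y))"
  by (simp add: vector_rep_def)

lemma vector_rep_transition:
  assumes "is_chart A c" "d \<in> A" "y \<in> snd d ` (fst d \<inter> fst c)"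
  shows "vector_rep A c X ((snd c \<circ> cinv d) y) = fd (snd c \<circ> cinv d) y (vector_rep A d X y)"
proof -
  obtain x where x: "x \<in> fst d" "x \<in> fst c" "y = snd d x" using assms(3) by auto
  have dc: "is_chart A d" using assms(2) by (rule atlas_is_chart)
  have i: "cinv d y = x" "cinv c (snd c x) = x" using x chart_props(5)[OF dc] chart_props(5)[OF assms(1)] by auto
  have "tchange d c x v = fd (snd c \<circ> cinv d) y v" for v by (simp add: tchange_def x)
  then show ?thesis using comps_change(2)[OF assms(1,2) x(2,1)] i by (simp add: vector_rep_apply)
qed

lemma vector_rep_differentiable_at:
  assumes "is_chart A c" "x \<in> fst c" "vector_rep A c X differentiable (at (snd c x))"
  shows "vector_rep A (chart_at A x) X differentiable (at (snd (chart_at A x) x))"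
proof -
  define d where "d = chart_at A x"
  have d: "d \<in> A" "x \<in> fst d" "is_chart A d" using chart_at atlas_is_chart by (auto simp: d_def)
  define S where "S = snd c ` (fst c \<inter> fst d)"
  have S: "open S" "snd c x \<in> S" using chart_image_open[OF assms(1) chart_props(1)[OF d(3)]] assms(2) d by (auto simp: S_def)
  have sm: "smooth_on S (snd d \<circ> cinv c)" using compat_chart_atlas[OF assms(1) d(1)] by (simp add: compat_def S_def)
  from has_derivative_fd_apply[OF S(1) smooth_on_Ck[OF sm] S(2) assms(3)]
  obtain D where D: "((\<lambda>y. fd (snd d \<circ> cinv c) y (vector_rep A c X y)) has_derivative D) (at (snd c x))" by blast
  have e: "(snd c \<circ> cinv d) (snd d x) = snd c x" using chart_props(5)[OF d(3,2)] by simp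
  have "((\<lambda>y. fd (snd d \<circ> cinv c) ((snd c \<circ> cinv d) y) (vector_rep A c X ((snd c \<circ> cinv d) y))) has_derivative
     (\<lambda>v. D (tchange d c x v))) (at (snd d x))"
    by (rule has_derivative_compose[OF transition_has_derivative[OF compat_atlas_chart[OF assms(1) d(1)] d(2) assms(2)]])
      (simp only: e, rule D)
  then have "(vector_rep A d X has_derivative (\<lambda>v. D (tchange d c x v))) (at (snd d x))"
  proof (rule has_derivative_transform_within_open[OF _ chart_image_open[OF d(3) chart_props(1)[OF assms(1)]]])
    show "snd d x \<in> snd d ` (fst d \<inter> fst c)" using assms d by blast
    fix y assume "y \<in> snd d ` (fst d \<inter> fst c)"
    then obtain z where z: "z \<in> fst d" "z \<in> fst c" "y = snd d z" by auto
    have i: "cinv d y = z" "cinv c (snd c z) = z" using z chart_props(5)[OF d(3)] chart_props(5)[OF assms(1)] by auto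
    have "tchange c d z v = fd (snd d \<circ> cinv c) (snd c z) v" for v by (simp add: tchange_def)
    then show "fd (snd d \<circ> cinv c) ((snd c \<circ> cinv d) y) (vector_rep A c X ((snd c \<circ> cinv d) y)) = vector_rep A d X y"
      using comps_change(1)[OF assms(1) d(1) z(2,1)] i by (simp add: vector_rep_apply)
  qed
  then show ?thesis by (auto simp: d_def differentiable_def)
qed

text \<open>The change from the preferred chart at \<open>x\<close> to \<open>c\<close>, in the form
  in which the naturality lemmas expect their map \<open>F\<close>.\<close>

lemma transition_set:
  assumes "is_chart A c" "x \<in> fst c"
  defines "d \<equiv> chart_at A x"
  shows "open (snd d ` (fst d \<inter> fst c))" "Ck_on 2 (snd d ` (fst d \<inter> fst c)) (snd c \<circ> cinv d)"
    "snd d x \<in> snd d ` (fst d \<inter> fst c)" "(snd c \<circ> cinv d) (snd d x) = snd c x"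
    "fd (snd c \<circ> cinv d) (snd d x) = comps c x"
proof -
  have d: "d \<in> A" "x \<in> fst d" "is_chart A d" using chart_at atlas_is_chart by (auto simp: d_def)
  show "open (snd d ` (fst d \<inter> fst c))" using chart_image_open[OF d(3) chart_props(1)[OF assms(1)]] .
  show "Ck_on 2 (snd d ` (fst d \<inter> fst c)) (snd c \<circ> cinv d)"
    using compat_atlas_chart[OF assms(1) d(1)] smooth_on_Ck by (auto simp: compat_def)
  show "snd d x \<in> snd d ` (fst d \<inter> fst c)" using assms d by blast
  show "(snd c \<circ> cinv d) (snd d x) = snd c x" using chart_props(5)[OF d(3,2)] by simp
  show "fd (snd c \<circ> cinv d) (snd d x) = comps c x" by (rule ext) (simp add: tchange_def d_def)
qed

text \<open>\<open>lie_bracket\<close> is computed at each point in the preferred chart of that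
  point, which varies from point to point. Naturality under the transition gives the usual formula
  in one chart, where brackets can be iterated.\<close>

lemma lie_bracket_chart:
  assumes "is_chart A c" "x \<in> fst c"
    and "vector_rep A c X differentiable (at (snd c x))" "vector_rep A c Y differentiable (at (snd c x))"
  shows "comps c x (lie_bracket A X Y x) =
    fd (vector_rep A c Y) (snd c x) (vector_rep A c X (snd c x)) - fd (vector_rep A c X) (snd c x) (vector_rep A c Y (snd c x))"
proof -
  define d where "d = chart_at A x"
  have d: "d \<in> A" "x \<in> fst d" "is_chart A d" using chart_at atlas_is_chart by (auto simp: d_def)
  note t = transition_set[OF assms(1,2), folded d_def]
  have own: "vector_rep A d Z (snd d x) = Z x" for Z
    using chart_props(5)[OF d(3,2)] tchange_refl[OF d(3,2)] by (simp add: vector_rep_apply d_def)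
  have "fd (vector_rep A c Y) (snd c x) (vector_rep A c X (snd c x)) - fd (vector_rep A c X) (snd c x) (vector_rep A c Y (snd c x))
    = tchange d c x (fd (vector_rep A d Y) (snd d x) (vector_rep A d X (snd d x)) - fd (vector_rep A d X) (snd d x) (vector_rep A d Y (snd d x)))"
    unfolding t(4)[symmetric] t(5)[symmetric]
  proof (rule related_field_bracket[OF t(1-3)])
    show "vector_rep A d X differentiable at (snd d x)" "vector_rep A d Y differentiable at (snd d x)"
      unfolding d_def by (rule vector_rep_differentiable_at[OF assms(1,2)]; fact)+
    show "vector_rep A c X differentiable at ((snd c \<circ> cinv d) (snd d x))" "vector_rep A c Y differentiable at ((snd c \<circ> cinv d) (snd d x))"
      unfolding t(4) by fact+
  qed (rule vector_rep_transition[OF assms(1) d(1)], assumption)+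
  then show ?thesis by (simp add: lie_bracket_def Let_def own d_def[symmetric])
qed

lemma form_rep_transition:
  assumes "is_chart A c" "d \<in> A" "y \<in> snd d ` (fst d \<inter> fst c)"
  shows "form_rep A d \<alpha> y vs = form_rep A c \<alpha> ((snd c \<circ> cinv d) y) (map (fd (snd c \<circ> cinv d) y) vs)"
proof -
  obtain x where x: "x \<in> fst d" "x \<in> fst c" "y = snd d x" using assms(3) by auto
  have dc: "is_chart A d" using assms(2) by (rule atlas_is_chart)
  have i: "cinv d y = x" "cinv c (snd c x) = x" using x chart_props(5)[OF dc] chart_props(5)[OF assms(1)] by auto
  have "tchange d c x v = fd (snd c \<circ> cinv d) y v" for v by (simp add: tchange_def x)
  then show ?thesis using comps_change(4)[OF assms(1,2) x(2,1)] i by (simp add: form_rep_def comp_def flip: x(3))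
qed

lemma multilinear_map:
  fixes L :: "'c::euclidean_space \<Rightarrow> 'b::euclidean_space"
  assumes "multilinear k \<alpha>" "linear L"
  shows "multilinear k (\<lambda>vs. \<alpha> (map L vs))"
  unfolding multilinear_def
proof (intro allI impI)
  fix vs :: "'c list" and i assume "length vs = k" "i < k"
  then show "linear (\<lambda>v. \<alpha> (map L (vs[i := v])))"
    using linear_compose[OF assms(2) multilinear_linear[OF assms(1), of "map L vs" i]] by (simp add: map_update o_def)
qed

text \<open>The same passage to one chart: the two coordinate expressions of the form are pullbacks
  of each other under the transition.\<close>

lemma lie_derivative_chart:
  assumes "is_chart A c" "x \<in> fst c"
    and X: "vector_rep A c X differentiable (at (snd c x))"
    and \<alpha>: "\<And>z. z \<in> fst c \<Longrightarrow> multilinear k (\<alpha> z)"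
    and d\<alpha>: "\<And>vs. length vs = k \<Longrightarrow> (\<lambda>y. form_rep A c \<alpha> y vs) differentiable (at (snd c x))"
    and vs: "length vs = k"
  shows "lie_derivative A X \<alpha> x vs = lie_rep (vector_rep A c X) (form_rep A c \<alpha>) (snd c x) (map (comps c x) vs)"
proof -
  define d where "d = chart_at A x"
  have d: "d \<in> A" "x \<in> fst d" "is_chart A d" using chart_at atlas_is_chart by (auto simp: d_def)
  note t = transition_set[OF assms(1,2), folded d_def]
  have i: "cinv d (snd d x) = x" using chart_props(5)[OF d(3,2)] .
  have own: "vector_rep A d X (snd d x) = X x"
    using i tchange_refl[OF d(3,2)] by (simp add: vector_rep_apply d_def)
  have own': "form_rep A d \<alpha> (snd d x) us = \<alpha> x us" for us
  proof -
    have "map (tchange d d x) us = us" by (rule map_idI) (rule tchange_refl[OF d(3,2)])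
    then show ?thesis by (simp add: form_rep_def i d_def[symmetric])
  qed
  have "lie_derivative A X \<alpha> x vs = lie_rep (vector_rep A d X) (form_rep A d \<alpha>) (snd d x) vs"
    by (simp add: lie_derivative_def lie_rep_def Let_def d_def[symmetric] own own')
  also have "\<dots> = lie_rep (vector_rep A c X) (form_rep A c \<alpha>) ((snd c \<circ> cinv d) (snd d x)) (map (fd (snd c \<circ> cinv d) (snd d x)) vs)"
  proof (rule lie_rep_natural[OF t(1-3) _ _ _ _ _ _ vs])
    show "vector_rep A d X differentiable at (snd d x)"
      unfolding d_def by (rule vector_rep_differentiable_at[OF assms(1,2) X])
    show "vector_rep A c X differentiable at ((snd c \<circ> cinv d) (snd d x))" unfolding t(4) by fact
    show "vector_rep A c X ((snd c \<circ> cinv d) y) = fd (snd c \<circ> cinv d) y (vector_rep A d X y)" if "y \<in> snd d ` (fst d \<inter> fst c)" for y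
      by (rule vector_rep_transition[OF assms(1) d(1) that])
    show "form_rep A d \<alpha> y us = form_rep A c \<alpha> ((snd c \<circ> cinv d) y) (map (fd (snd c \<circ> cinv d) y) us)"
      if "y \<in> snd d ` (fst d \<inter> fst c)" for y us
      by (rule form_rep_transition[OF assms(1) d(1) that])
    show "(\<lambda>z. form_rep A c \<alpha> z us) differentiable at ((snd c \<circ> cinv d) (snd d x))" if "length us = k" for us
      unfolding t(4) by (rule d\<alpha>[OF that])
    show "multilinear k (form_rep A c \<alpha> ((snd c \<circ> cinv d) y))" if y: "y \<in> snd d ` (fst d \<inter> fst c)" for y
    proof -
      obtain z where z: "z \<in> fst d" "z \<in> fst c" "y = snd d z" using y by auto
      have e: "cinv c ((snd c \<circ> cinv d) y) = z" using z chart_props(5)[OF d(3)] chart_props(5)[OF assms(1)] by auto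
      show ?thesis unfolding form_rep_def e
        by (rule multilinear_map[OF \<alpha>[OF z(2)] vec_of_linear[OF assms(1) z(2)]])
    qed
  qed
  finally have "lie_derivative A X \<alpha> x vs = lie_rep (vector_rep A c X) (form_rep A c \<alpha>) (snd c x) (map (tchange d c x) vs)"
    unfolding t(4,5) .
  then show ?thesis unfolding d_def .
qed

end

section \<open>Subriemannian geometry in a chart\<close>

lemma psd_operator_sym_zero:
  fixes G :: "'a::euclidean_space \<Rightarrow> 'a"
  assumes "linear G" "\<And>x y. G x \<bullet> y = G y \<bullet> x" "\<And>x. G x \<bullet> x \<ge> 0" "G b \<bullet> b = 0"
  shows "G b = 0"
  using psd_cauchy_schwarz[OF assms(1-3), of b "G b"] assms(4) by simp

locale subriemannian_manifold = charted_manifold A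
  for A :: "('a::t2_space, 'n::finite) chart set" +
  fixes g :: "('a, 'n) cometric" and vol :: "'a \<Rightarrow> 'n form"
  assumes subriem: "subriemannian A g" and volume: "volume_form A vol"
begin

lemma cometric:
  "bilinear (g x)" "g x w e = g x e w" "0 \<le> g x w w"
  using subriem unfolding subriemannian_def by auto

definition cometric_rep :: "('a, 'n) chart \<Rightarrow> real^'n \<Rightarrow> real^'n \<Rightarrow> real^'n \<Rightarrow> real" where
  "cometric_rep c y q r = g (cinv c y) (cov c (cinv c y) q) (cov c (cinv c y) r)"

text \<open>The matrix of the cometric in \<open>c\<close> applied to \<open>r\<close>: the map from
  covectors to vectors in components.\<close>

definition sharp_rep :: "('a, 'n) chart \<Rightarrow> real^'n \<Rightarrow> real^'n \<Rightarrow> real^'n" where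
  "sharp_rep c y r = (\<Sum>a\<in>Basis. cometric_rep c y a r *\<^sub>R a)"

lemma cometric_rep_linear:
  assumes "is_chart A c" "y \<in> snd c ` fst c"
  shows "linear (\<lambda>q. cometric_rep c y q r)" "linear (\<lambda>r. cometric_rep c y q r)"
proof -
  note l = cov_linear[OF assms(1) chart_props(7)[OF assms]]
  show "linear (\<lambda>q. cometric_rep c y q r)" "linear (\<lambda>r. cometric_rep c y q r)"
    unfolding cometric_rep_def
    using cometric(1)[of "cinv c y"] l by (auto simp: bilinear_def linear_iff)
qed

lemma sharp_rep_inner:
  assumes "is_chart A c" "y \<in> snd c ` fst c"
  shows "sharp_rep c y r \<bullet> q = cometric_rep c y q r"
proof -
  have "cometric_rep c y q r = (\<Sum>b\<in>Basis. (q \<bullet> b) * cometric_rep c y b r)"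
    by (rule linear_real_expand[OF cometric_rep_linear(1)[OF assms]])
  then show ?thesis by (simp add: sharp_rep_def inner_sum_left inner_commute[of q] mult.commute)
qed

lemma sharp_rep_operator:
  assumes "is_chart A c" "y \<in> snd c ` fst c"
  shows "linear (sharp_rep c y)" "sharp_rep c y q \<bullet> r = sharp_rep c y r \<bullet> q" "sharp_rep c y q \<bullet> q \<ge> 0"
proof -
  show "linear (sharp_rep c y)"
    using cometric_rep_linear(2)[OF assms]
    by (simp add: linear_iff sharp_rep_def scaleR_add_left sum.distrib scaleR_sum_right)
  show "sharp_rep c y q \<bullet> r = sharp_rep c y r \<bullet> q" "sharp_rep c y q \<bullet> q \<ge> 0"
    using cometric by (auto simp: sharp_rep_inner[OF assms] cometric_rep_def)
qed

lemma sharp_eqI: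
  assumes "\<And>w. blinfun_apply w v = g x w \<eta>"
  shows "sharp g x \<eta> = v"
  unfolding sharp_def
proof (rule the_equality)
  show "\<forall>w. blinfun_apply w v = g x w \<eta>" using assms by simp
  fix u assume u: "\<forall>w. blinfun_apply w u = g x w \<eta>"
  show "u = v"
  proof (rule euclidean_eqI)
    fix b :: "real^'n"
    have "blinfun_apply (blinfun_inner_left b) u = blinfun_apply (blinfun_inner_left b) v" using u assms by metis
    then show "u \<bullet> b = v \<bullet> b" by simp
  qed
qed

lemma sharp_cov:
  assumes "is_chart A c" "x \<in> fst c"
  shows "sharp g x (cov c x q) = vec_of c x (sharp_rep c (snd c x) q)"
proof (rule sharp_eqI)
  fix w
  obtain r where r: "w = cov c x r" by (rule cov_surj[OF assms])
  have i: "cinv c (snd c x) = x" "snd c x \<in> snd c ` fst c" using chart_props(5)[OF assms] assms by auto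
  have "blinfun_apply w (vec_of c x (sharp_rep c (snd c x) q)) = sharp_rep c (snd c x) q \<bullet> r"
    using assms by (simp add: r cov_apply[OF assms] inner_commute)
  also have "\<dots> = g x w (cov c x q)" by (simp add: sharp_rep_inner[OF assms(1) i(2)] cometric_rep_def i r)
  finally show "blinfun_apply w (vec_of c x (sharp_rep c (snd c x) q)) = g x w (cov c x q)" .
qed

lemma sharp_apply: "blinfun_apply w (sharp g x \<eta>) = g x w \<eta>"
proof -
  define c where "c = chart_at A x"
  have c: "is_chart A c" "x \<in> fst c" using chart_at atlas_is_chart by (auto simp: c_def)
  obtain r q where r: "w = cov c x r" "\<eta> = cov c x q" using cov_surj[OF c] by metis
  have i: "cinv c (snd c x) = x" "snd c x \<in> snd c ` fst c" using chart_props(5)[OF c] c by auto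
  have "blinfun_apply w (vec_of c x (sharp_rep c (snd c x) q)) = sharp_rep c (snd c x) q \<bullet> r"
    using c by (simp add: r cov_apply[OF c] inner_commute)
  also have "\<dots> = g x w \<eta>" by (simp add: sharp_rep_inner[OF c(1) i(2)] cometric_rep_def i r)
  finally show ?thesis using sharp_cov[OF c, of q] r by simp
qed

lemma sharp_scale: "sharp g x (k *\<^sub>R w) = k *\<^sub>R sharp g x w"
  by (rule sharp_eqI) (use cometric(1)[of x] in \<open>simp add: blinfun.scaleR_right sharp_apply bilinear_def linear_iff\<close>)

lemma horizontal_chart:
  assumes "is_chart A c" "x \<in> fst c"
  shows "horizontal g x = vec_of c x ` range (sharp_rep c (snd c x))"
proof -
  have "range (sharp g x) = range (\<lambda>q. sharp g x (cov c x q))"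
    using cov_surj[OF assms] by (auto simp: image_iff) metis
  then show ?thesis by (auto simp: horizontal_def sharp_cov[OF assms])
qed

lemma cometric_rep_smooth:
  assumes "c \<in> A" "a \<in> Basis" "b \<in> Basis"
  shows "smooth_on (snd c ` fst c) (\<lambda>y. cometric_rep c y a b)"
proof -
  note c = atlas_is_chart[OF assms(1)]
  obtain i j where ij: "a = axis i 1" "b = axis j 1" using assms(2,3) by (auto simp: Basis_vec_def)
  have "smooth_fun A (fst c) (\<lambda>x. g x (differential A (\<lambda>y. snd c y $ i) x) (differential A (\<lambda>y. snd c y $ j) x))"
    using subriem assms(1) unfolding subriemannian_def by blast
  from smooth_fun_chart[OF c chart_props(1)[OF c] this]
  have "smooth_on (snd c ` fst c) ((\<lambda>x. g x (differential A (\<lambda>y. snd c y $ i) x) (differential A (\<lambda>y. snd c y $ j) x)) \<circ> cinv c)" by simp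
  moreover have "((\<lambda>x. g x (differential A (\<lambda>y. snd c y $ i) x) (differential A (\<lambda>y. snd c y $ j) x)) \<circ> cinv c) y
    = cometric_rep c y a b" if "y \<in> snd c ` fst c" for y
    using chart_props(7)[OF c that] by (simp add: differential_coordinate[OF c] cometric_rep_def ij)
  ultimately show ?thesis
    using smooth_on_cong[OF chart_props(2)[OF c], of "_ \<circ> cinv c" "\<lambda>y. cometric_rep c y a b"] by blast
qed

lemma sharp_rep_expand:
  assumes "is_chart A c" "y \<in> snd c ` fst c"
  shows "sharp_rep c y r = (\<Sum>a\<in>Basis. (\<Sum>b\<in>Basis. (r \<bullet> b) * cometric_rep c y a b) *\<^sub>R a)"
  unfolding sharp_rep_def
  by (intro sum.cong refl) (simp add: linear_real_expand[OF cometric_rep_linear(2)[OF assms], symmetric])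

lemma sharp_rep_smooth:
  fixes Y Q :: "'b::euclidean_space \<Rightarrow> real^'n"
  assumes "c \<in> A" "open S" "smooth_on S Y" "smooth_on S Q" "\<And>s. s \<in> S \<Longrightarrow> Y s \<in> snd c ` fst c"
  shows "smooth_on S (\<lambda>s. sharp_rep c (Y s) (Q s))"
proof -
  note c = atlas_is_chart[OF assms(1)]
  have "smooth_on S (\<lambda>s. cometric_rep c (Y s) a b)" if "a \<in> Basis" "b \<in> Basis" for a b
    by (rule smooth_on_compose[OF assms(2) chart_props(2)[OF c] assms(3) cometric_rep_smooth[OF assms(1) that] assms(5)])
  then have "smooth_on S (\<lambda>s. \<Sum>a\<in>Basis. (\<Sum>b\<in>Basis. (Q s \<bullet> b) * cometric_rep c (Y s) a b) *\<^sub>R a)"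
    by (intro smooth_on_sum smooth_on_scaleR smooth_on_mult smooth_on_inner smooth_on_const assms)
  then show ?thesis
    using smooth_on_cong[OF assms(2), of "\<lambda>s. sharp_rep c (Y s) (Q s)"] sharp_rep_expand[OF c assms(5)] by simp
qed

text \<open>At \<open>q = du\<close> this is \<open>|du|\<^sub>*\<^sup>p\<^sup>-\<^sup>1 G(du)\<close>, the vector field \<open>\<nu>\<^sub>p\<close> in the chart.\<close>

definition flux :: "('a, 'n) chart \<Rightarrow> real \<Rightarrow> (real^'n) \<times> (real^'n) \<Rightarrow> real^'n" where
  "flux c p = (\<lambda>(y, q). (sharp_rep c y q \<bullet> q) powr ((p - 1) / 2) *\<^sub>R sharp_rep c y q)"

definition flux_dom :: "('a, 'n) chart \<Rightarrow> ((real^'n) \<times> (real^'n)) set" where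
  "flux_dom c = {(y, q). y \<in> snd c ` fst c \<and> sharp_rep c y q \<bullet> q > 0}"

lemma flux_smooth:
  assumes "c \<in> A"
  shows "open (flux_dom c)" "smooth_on (flux_dom c) (flux c p)"
proof -
  note c = atlas_is_chart[OF assms]
  let ?T = "(snd c ` fst c) \<times> (UNIV :: (real^'n) set)"
  have oT: "open ?T" using chart_props(2)[OF c] by (intro open_Times) auto
  have fs: "smooth_on T fst" "smooth_on T snd" for T :: "((real^'n) \<times> (real^'n)) set"
    by (intro smooth_on_linear bounded_linear_fst bounded_linear_snd)+
  have s1: "smooth_on ?T (\<lambda>s. sharp_rep c (fst s) (snd s))"
    by (rule sharp_rep_smooth[OF assms oT fs]) auto
  have s2: "smooth_on ?T (\<lambda>s. sharp_rep c (fst s) (snd s) \<bullet> snd s)"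
    by (rule smooth_on_inner[OF oT s1 fs(2)])
  have eq: "flux_dom c = ?T \<inter> (\<lambda>s. sharp_rep c (fst s) (snd s) \<bullet> snd s) -` {0<..}"
    by (auto simp: flux_dom_def)
  show o: "open (flux_dom c)"
    unfolding eq by (rule continuous_open_preimage[OF smooth_on_continuous[OF s2] oT]) simp
  have sub: "flux_dom c \<subseteq> ?T" by (auto simp: flux_dom_def)
  have "smooth_on (flux_dom c) (\<lambda>s. (sharp_rep c (fst s) (snd s) \<bullet> snd s) powr ((p - 1) / 2) *\<^sub>R sharp_rep c (fst s) (snd s))"
    by (intro smooth_on_scaleR smooth_on_powr o smooth_on_subset[OF s1 sub] smooth_on_subset[OF s2 sub]) (auto simp: flux_dom_def)
  then show "smooth_on (flux_dom c) (flux c p)" by (simp add: flux_def case_prod_unfold)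
qed

lemma flux_momentum_derivative:
  assumes "c \<in> A" "(y, q) \<in> flux_dom c"
  defines "s \<equiv> sharp_rep c y q \<bullet> q"
  shows "fd (flux c p) (y, q) (0, \<eta>) =
    s powr ((p - 1) / 2) *\<^sub>R (sharp_rep c y \<eta> + ((p - 1) * (sharp_rep c y q \<bullet> \<eta>) / s) *\<^sub>R sharp_rep c y q)"
proof -
  note c = atlas_is_chart[OF assms(1)]
  have y: "y \<in> snd c ` fst c" and s: "s > 0" using assms(2) by (auto simp: flux_dom_def s_def)
  note op = sharp_rep_operator[OF c y]
  have bl: "bounded_linear (sharp_rep c y)" using op(1) by (simp add: linear_conv_bounded_linear)
  have dG: "(sharp_rep c y has_derivative sharp_rep c y) (at q)" by (rule bounded_linear_imp_has_derivative[OF bl])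
  have ds: "((\<lambda>q. sharp_rep c y q \<bullet> q) has_derivative (\<lambda>\<eta>. 2 * (sharp_rep c y q \<bullet> \<eta>))) (at q)"
    by (rule has_derivative_eq_rhs[OF has_derivative_inner[OF dG has_derivative_ident]])
      (simp add: fun_eq_iff op(2)[of _ q])
  have "((\<lambda>x. x powr ((p - 1) / 2)) has_real_derivative ((p - 1) / 2) * s powr ((p - 1) / 2 - 1)) (at s)"
    using s by (auto intro!: derivative_eq_intros)
  then have dp: "((\<lambda>x. x powr ((p - 1) / 2)) has_derivative (\<lambda>h. ((p - 1) / 2) * s powr ((p - 1) / 2 - 1) * h)) (at (sharp_rep c y q \<bullet> q))"
    unfolding has_field_derivative_def s_def by (rule has_derivative_eq_rhs) (simp add: fun_eq_iff)
  from has_derivative_scaleR[OF has_derivative_compose[OF ds dp] dG]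
  have 1: "((\<lambda>q. flux c p (y, q)) has_derivative (\<lambda>\<eta>. s powr ((p - 1) / 2) *\<^sub>R sharp_rep c y \<eta>
      + (((p - 1) / 2) * s powr ((p - 1) / 2 - 1) * (2 * (sharp_rep c y q \<bullet> \<eta>))) *\<^sub>R sharp_rep c y q)) (at q)"
    by (simp add: flux_def s_def)
  have "(flux c p has_derivative fd (flux c p) (y, q)) (at (y, q))"
    using smooth_on_has_derivative[OF flux_smooth(2)[OF assms(1)] assms(2)] .
  moreover have "((\<lambda>q. (y, q)) has_derivative (\<lambda>\<eta>. (0, \<eta>))) (at q)"
    by (intro has_derivative_Pair has_derivative_const has_derivative_ident)
  ultimately have 2: "((\<lambda>q. flux c p (y, q)) has_derivative (\<lambda>\<eta>. fd (flux c p) (y, q) (0, \<eta>))) (at q)"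
    using has_derivative_compose[of "\<lambda>q. (y, q)" _ q UNIV "flux c p"] by simp
  have "s powr ((p - 1) / 2 - 1) = s powr ((p - 1) / 2) / s" using s by (simp add: powr_diff)
  then show ?thesis
    using fun_cong[OF has_derivative_unique[OF 2 1], of \<eta>] by (simp add: scaleR_add_right mult_ac)
qed

text \<open>Up to a positive factor the quadratic form is the defect in the Cauchy-Schwarz
  inequality for \<open>q\<close> and \<open>\<eta>\<close>, plus \<open>p\<close> times the square
  of their product over \<open>s\<close>. If it vanishes, the equality case makes the images of
  \<open>\<eta>\<close> and \<open>q\<close> proportional, so a horizontal \<open>X\<close>
  annihilated by \<open>q\<close> is orthogonal to \<open>\<eta>\<close>. The restriction to such
  \<open>X\<close> is genuine: for \<open>p = 0\<close> the direction \<open>q\<close> is always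
  null.\<close>

lemma flux_ellipticity:
  assumes "c \<in> A" "x \<in> flux_dom c" "p \<ge> 0"
  shows "fd (flux c p) x (0, \<eta>) \<bullet> \<zeta> = fd (flux c p) x (0, \<zeta>) \<bullet> \<eta>" "fd (flux c p) x (0, \<eta>) \<bullet> \<eta> \<ge> 0"
    "fd (flux c p) x (0, \<eta>) \<bullet> \<eta> = 0 \<Longrightarrow> X \<in> range (sharp_rep c (fst x)) \<Longrightarrow> snd x \<bullet> X = 0 \<Longrightarrow> X \<bullet> \<eta> = 0"
proof -
  obtain y q where x: "x = (y, q)" by (cases x)
  note c = atlas_is_chart[OF assms(1)]
  define s where "s = sharp_rep c y q \<bullet> q"
  have y: "y \<in> snd c ` fst c" and s: "s > 0" using assms(2) by (auto simp: flux_dom_def s_def x)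
  note op = sharp_rep_operator[OF c y]
  note cs = psd_cauchy_schwarz[OF op]
  let ?G = "sharp_rep c y"
  note d = flux_momentum_derivative[OF assms(1) assms(2)[unfolded x], of p, folded s_def]
  show "fd (flux c p) x (0, \<eta>) \<bullet> \<zeta> = fd (flux c p) x (0, \<zeta>) \<bullet> \<eta>"
    unfolding x d by (simp add: inner_add_left op(2)[of \<eta> \<zeta>] mult_ac)
  have A: "fd (flux c p) x (0, \<eta>) \<bullet> \<eta> = s powr ((p - 1) / 2) * ((?G \<eta> \<bullet> \<eta> - (?G q \<bullet> \<eta>)\<^sup>2 / s) + p * ((?G q \<bullet> \<eta>)\<^sup>2 / s))" 
    unfolding x d by (simp add: inner_add_left power2_eq_square algebra_simps diff_divide_distrib add_divide_distrib)
  have n1: "?G \<eta> \<bullet> \<eta> - (?G q \<bullet> \<eta>)\<^sup>2 / s \<ge> 0" using cs[of q \<eta>] s by (simp add: s_def field_simps)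
  have n2: "p * ((?G q \<bullet> \<eta>)\<^sup>2 / s) \<ge> 0" using assms(3) s by simp
  show "fd (flux c p) x (0, \<eta>) \<bullet> \<eta> \<ge> 0" unfolding A by (rule mult_nonneg_nonneg[OF powr_ge_zero add_nonneg_nonneg[OF n1 n2]])
  assume "fd (flux c p) x (0, \<eta>) \<bullet> \<eta> = 0" and X: "X \<in> range (sharp_rep c (fst x))" "snd x \<bullet> X = 0"
  then have e: "?G \<eta> \<bullet> \<eta> = (?G q \<bullet> \<eta>)\<^sup>2 / s" using n1 n2 s unfolding A by (simp add: powr_gt_zero)
  define k where "k = (?G q \<bullet> \<eta>) / s"
  \<comment> \<open>What is left of \<open>\<eta>\<close> after removing its part along
    \<open>q\<close>; in the equality case the form vanishes on it, so \<open>?G\<close> kills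
    it.\<close>
  define M where "M = \<eta> - k *\<^sub>R q"
  have "?G M \<bullet> M = ?G \<eta> \<bullet> \<eta> - 2 * k * (?G q \<bullet> \<eta>) + k\<^sup>2 * s"
    unfolding M_def s_def
    by (simp add: linear_diff[OF op(1)] linear_scale[OF op(1)] inner_diff_left inner_diff_right op(2)[of \<eta> q]
        power2_eq_square algebra_simps)
  also have "\<dots> = 0" unfolding e using s by (simp add: k_def power2_eq_square field_simps)
  finally have "?G M = 0" by (rule psd_operator_sym_zero[OF op])
  then have GN: "?G \<eta> = k *\<^sub>R ?G q" by (simp add: M_def linear_diff[OF op(1)] linear_scale[OF op(1)])
  obtain r where r: "X = ?G r" using X(1) x by auto
  have "?G q \<bullet> r = 0" using X(2) op(2)[of q r] by (simp add: r x inner_commute)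
  then show "X \<bullet> \<eta> = 0" by (simp add: r op(2)[of r \<eta>] GN)
qed

section \<open>The volume form and the p-area form in a chart\<close>

lemma vol_alternating: "alternating_form CARD('n) (vol x)" "vol x \<noteq> (\<lambda>_. 0)"
  using volume unfolding volume_form_def by auto

abbreviation vol_rep :: "('a, 'n) chart \<Rightarrow> real^'n \<Rightarrow> 'n form" where
  "vol_rep c \<equiv> form_rep A c vol"

lemma alternating_form_map:
  fixes \<alpha> :: "'n form" and L :: "real^'n \<Rightarrow> real^'n"
  assumes "alternating_form k \<alpha>" "linear L"
  shows "alternating_form k (\<lambda>vs. \<alpha> (map L vs))"
  unfolding alternating_form_def
proof (intro conjI allI impI)
  fix vs :: "(real^'n) list" and i assume "length vs = k" "i < k"
  then show "linear (\<lambda>v. \<alpha> (map L (vs[i := v])))"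
    using multilinear_map[OF alternating_form_multilinear[OF assms(1)] assms(2)] by (simp add: multilinear_def)
next
  fix vs :: "(real^'n) list" assume "\<not> distinct vs"
  then have "\<not> distinct (map L vs)" by (auto simp: distinct_map)
  then show "\<alpha> (map L vs) = 0" by (rule alternating_form_repeat[OF assms(1)])
next
  fix vs :: "(real^'n) list" assume "length vs \<noteq> k"
  then show "\<alpha> (map L vs) = 0" by (intro alternating_form_length[OF assms(1)]) simp
qed

lemma vol_rep_alternating:
  assumes "is_chart A c" "y \<in> snd c ` fst c"
  shows "alternating_form CARD('n) (vol_rep c y)" "vol_rep c y std_frame \<noteq> 0"
    "distinct fr \<Longrightarrow> set fr = Basis \<Longrightarrow> vol_rep c y fr \<noteq> 0"
proof -
  define x where "x = cinv c y"
  have x: "x \<in> fst c" using chart_props(7)[OF assms] by (simp add: x_def)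
  have e: "vol_rep c y = (\<lambda>vs. vol x (map (vec_of c x) vs))" by (simp add: fun_eq_iff form_rep_def x_def)
  show alt: "alternating_form CARD('n) (vol_rep c y)"
    unfolding e by (rule alternating_form_map[OF vol_alternating(1) vec_of_linear[OF assms(1) x]])
  have "vol_rep c y \<noteq> (\<lambda>_. 0)"
  proof
    assume z: "vol_rep c y = (\<lambda>_. 0)"
    have "vol x vs = 0" for vs
    proof -
      have "map (vec_of c x) (map (comps c x) vs) = vs" using vec_of_comps[OF assms(1) x] by (simp add: map_idI)
      then show ?thesis using fun_cong[OF z, of "map (comps c x) vs"] unfolding e by metis
    qed
    then show False using vol_alternating(2)[of x] by blast
  qed
  then show nz: "distinct fr \<Longrightarrow> set fr = Basis \<Longrightarrow> vol_rep c y fr \<noteq> 0" for fr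
    by (rule top_form_frame_nonzero[OF alt])
  then show "vol_rep c y std_frame \<noteq> 0" using std_frame by blast
qed

lemma vol_rep_smooth:
  assumes "c \<in> A"
  shows "smooth_on (snd c ` fst c) (\<lambda>y. vol_rep c y std_frame)"
proof -
  note c = atlas_is_chart[OF assms]
  \<comment> \<open>Smoothness of a form is given on coordinate vectors listed by indices; these are
    the indices that produce \<open>std_frame\<close>.\<close>
  define js where "js = map (\<lambda>b::real^'n. SOME i. b = axis i 1) std_frame"
  have "\<exists>i. b = axis i 1" if "b \<in> set (std_frame :: (real^'n) list)" for b :: "real^'n"
    using that std_frame(2)[where ?'n = 'n] by (auto simp: Basis_vec_def)
  then have "(axis (SOME i. b = axis i 1) 1 :: real^'n) = b" if "b \<in> set (std_frame :: (real^'n) list)" for b :: "real^'n"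
    using someI_ex[of "\<lambda>i. b = axis i 1"] that by metis
  then have frame: "map (\<lambda>i. axis i 1) js = (std_frame :: (real^'n) list)"
    unfolding js_def map_map by (intro map_idI) simp
  have "smooth_fun A (fst c \<inter> UNIV) (\<lambda>x. vol x (map (\<lambda>i. coord_vector A c i x) js))"
    using volume assms unfolding volume_form_def smooth_form_def by blast
  from smooth_fun_chart[OF c _ this] chart_props(1)[OF c]
  have "smooth_on (snd c ` fst c) ((\<lambda>x. vol x (map (\<lambda>i. coord_vector A c i x) js)) \<circ> cinv c)" by simp
  moreover have "(\<lambda>x. vol x (map (\<lambda>i. coord_vector A c i x) js)) \<circ> cinv c = (\<lambda>y. vol_rep c y std_frame)"
    by (simp add: fun_eq_iff form_rep_def coord_vector_def o_def flip: frame)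
  ultimately show ?thesis by simp
qed

text \<open>Existence is the identity for the wedge with a contraction, uniqueness the nondegeneracy
  of the wedge. A degenerate cometric does no harm, since it enters only through the sharp of
  \<open>w\<close>.\<close>

lemma contraction_eq: "covector_contraction g vol x w = interior_product (sharp g x w) (vol x)"
  unfolding covector_contraction_def
proof (rule the_equality)
  have alt: "alternating_form (CARD('n) - 1) (interior_product (sharp g x w) (vol x))"
    by (rule alternating_form_interior_product) (simp only: Suc_card_minus vol_alternating)
  have w: "wedge_covector \<eta> (interior_product (sharp g x w) (vol x)) = (\<lambda>vs. g x \<eta> w * vol x vs)" for \<eta>
    by (simp add: wedge_interior_product[OF vol_alternating(1)] sharp_apply)
  show "alternating_form (CARD('n) - 1) (interior_product (sharp g x w) (vol x)) \<and>
    (\<forall>\<eta>. wedge_covector \<eta> (interior_product (sharp g x w) (vol x)) = (\<lambda>vs. g x \<eta> w * vol x vs))"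
    using alt w by blast
  fix \<beta> assume \<beta>: "alternating_form (CARD('n) - 1) \<beta> \<and> (\<forall>\<eta>. wedge_covector \<eta> \<beta> = (\<lambda>vs. g x \<eta> w * vol x vs))"
  define \<gamma> where "\<gamma> = (\<lambda>vs. \<beta> vs - interior_product (sharp g x w) (vol x) vs)"
  have "\<gamma> = (\<lambda>_. 0)"
  proof (rule wedge_zero_imp_zero)
    show "alternating_form (CARD('n) - 1) \<gamma>"
      using \<beta> alt unfolding \<gamma>_def alternating_form_def by (auto intro!: linear_compose_sub)
    fix \<eta> :: "'n covector"
    have "wedge_covector \<eta> \<gamma> vs = wedge_covector \<eta> \<beta> vs - wedge_covector \<eta> (interior_product (sharp g x w) (vol x)) vs" for vs
      by (simp add: wedge_covector_def \<gamma>_def right_diff_distrib sum_subtractf)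
    then show "wedge_covector \<eta> \<gamma> = (\<lambda>_. 0)" using \<beta> w by (simp add: fun_eq_iff)
  qed
  then show "\<beta> = interior_product (sharp g x w) (vol x)" by (auto simp: \<gamma>_def fun_eq_iff)
qed

text \<open>Identifies \<open>\<nu>\<^sub>p\<close> with the sharp of the differential, scaled by
  the power \<open>p - 1\<close> of its length, and so removes both definite descriptions.\<close>

lemma area_form_eq:
  defines "N \<equiv> \<lambda>p \<phi> x. (1 / conorm g x (differential A \<phi> x) powr (1 - p)) *\<^sub>R sharp g x (differential A \<phi> x)"
  shows "p_area_form A g vol p \<phi> x = interior_product (N p \<phi> x) (vol x)" "p_normal A g vol p \<phi> x = N p \<phi> x"
proof -
  show 1: "p_area_form A g vol p \<phi> x = interior_product (N p \<phi> x) (vol x)"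
    by (simp add: p_area_form_def contraction_eq sharp_scale N_def)
  show "p_normal A g vol p \<phi> x = N p \<phi> x"
    unfolding p_normal_def 1
  proof (rule the_equality)
    show "v = N p \<phi> x" if "interior_product v (vol x) = interior_product (N p \<phi> x) (vol x)" for v
      by (rule interior_product_inject[OF vol_alternating that])
  qed (rule refl)
qed

lemma area_form_normal: "p_area_form A g vol p \<phi> x vs = vol x (p_normal A g vol p \<phi> x # vs)"
  by (simp add: area_form_eq interior_product_def)

lemma conorm_chart:
  assumes "is_chart A c" "x \<in> fst c" "(\<phi> \<circ> cinv c) differentiable (at (snd c x))"
  defines "q \<equiv> gradient (\<phi> \<circ> cinv c) (snd c x)"
  shows "conorm g x (differential A \<phi> x) = sqrt (sharp_rep c (snd c x) q \<bullet> q)"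
    "conorm g x (differential A \<phi> x) \<noteq> 0 \<longleftrightarrow> (snd c x, q) \<in> flux_dom c"
proof -
  have y: "snd c x \<in> snd c ` fst c" "cinv c (snd c x) = x" using assms(2) chart_props(5)[OF assms(1,2)] by auto
  show 1: "conorm g x (differential A \<phi> x) = sqrt (sharp_rep c (snd c x) q \<bullet> q)"
    unfolding conorm_def differential_chart[OF assms(1-3)] q_def[symmetric] sharp_rep_inner[OF assms(1) y(1)]
    by (simp add: cometric_rep_def y)
  show "conorm g x (differential A \<phi> x) \<noteq> 0 \<longleftrightarrow> (snd c x, q) \<in> flux_dom c"
    unfolding 1 flux_dom_def using y(1) sharp_rep_operator(3)[OF assms(1) y(1), of q] by auto
qed

lemma normal_rep:
  assumes "is_chart A c" "x \<in> fst c" "(\<phi> \<circ> cinv c) differentiable (at (snd c x))"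
    and "conorm g x (differential A \<phi> x) \<noteq> 0"
  shows "vector_rep A c (p_normal A g vol p \<phi>) (snd c x) = flux c p (snd c x, gradient (\<phi> \<circ> cinv c) (snd c x))"
proof -
  define q where "q = gradient (\<phi> \<circ> cinv c) (snd c x)"
  note cn = conorm_chart[OF assms(1-3), folded q_def]
  define s where "s = sharp_rep c (snd c x) q \<bullet> q"
  have s: "s > 0" using assms(4) cn(2) by (simp add: flux_dom_def s_def)
  have i: "cinv c (snd c x) = x" using chart_props(5)[OF assms(1,2)] .
  have "1 / sqrt s powr (1 - p) = s powr ((p - 1) / 2)"
  proof -
    have "sqrt s powr (1 - p) = s powr ((1 - p) / 2)" using s by (simp add: powr_half_sqrt[symmetric] powr_powr)
    also have "\<dots> = inverse (s powr ((p - 1) / 2))" using powr_minus[of s "(p - 1) / 2"] by (simp add: minus_divide_left)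
    finally show ?thesis using s by (simp add: inverse_eq_divide)
  qed
  moreover have "sharp g x (differential A \<phi> x) = vec_of c x (sharp_rep c (snd c x) q)"
    unfolding differential_chart[OF assms(1-3)] q_def[symmetric] by (rule sharp_cov[OF assms(1,2)])
  ultimately have "p_normal A g vol p \<phi> x = s powr ((p - 1) / 2) *\<^sub>R vec_of c x (sharp_rep c (snd c x) q)"
    unfolding area_form_eq(2) cn(1) s_def[symmetric] by simp
  then show ?thesis
    using linear_scale[OF comps_linear[OF assms(1,2)]] assms(1,2)
    by (simp add: vector_rep_apply i flux_def q_def[symmetric] s_def)
qed

text \<open>The function \<open>H\<close> with \<open>d(dv) = H dv_M\<close>, written as the
  divergence of \<open>\<nu>\<^sub>p\<close> with respect to the volume form.\<close>

definition curvature_rep :: "('a, 'n) chart \<Rightarrow> real \<Rightarrow> (real^'n \<Rightarrow> real) \<Rightarrow> real^'n \<Rightarrow> real" where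
  "curvature_rep c p u = divergence_rep (vol_rep c) (\<lambda>y. flux c p (y, gradient u y))"

lemma curvature_rep_quasilinear:
  assumes "c \<in> A" "y \<in> snd c ` fst c"
  shows "curvature_rep c p u y =
    quasilinear_op (flux c p) (\<lambda>y. (1 / vol_rep c y std_frame) *\<^sub>R gradient (\<lambda>y. vol_rep c y std_frame) y) u y"
  using gradient_inner[OF smooth_on_differentiable[OF vol_rep_smooth[OF assms(1)] assms(2)]]
  by (simp add: curvature_rep_def divergence_rep_def quasilinear_op_def)

text \<open>The integrand of the first variation is computed in a chart, where the contraction of
  the volume with the flux represents the area form. Comparison with the definition of the mean
  curvature singles out \<open>curvature_rep\<close> as the candidate for \<open>H\<close>.\<close>

lemma lie_derivative_area_form:
  assumes c: "c \<in> A" and W: "open W" "W \<subseteq> fst c" "x \<in> W"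
    and \<phi>: "smooth_on (snd c ` W) (\<phi> \<circ> cinv c)"
    and reg: "\<And>z. z \<in> W \<Longrightarrow> conorm g z (differential A \<phi> z) \<noteq> 0"
    and f: "(f \<circ> cinv c) differentiable (at (snd c x))" and vs: "length vs = CARD('n) - 1"
  shows "lie_derivative A (\<lambda>x. f x *\<^sub>R p_normal A g vol p \<phi> x) (p_area_form A g vol p \<phi>) x vs
    = f x * curvature_rep c p (\<phi> \<circ> cinv c) (snd c x) * p_area_form A g vol p \<phi> x vs"
proof -
  note ch = atlas_is_chart[OF c]
  define u where "u = \<phi> \<circ> cinv c"
  define y where "y = snd c x"
  define D where "D = snd c ` W"
  define \<nu> where "\<nu> = (\<lambda>y. flux c p (y, gradient u y))"
  define N where "N = p_normal A g vol p \<phi>"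
  have xc: "x \<in> fst c" using W by blast
  have D: "open D" "y \<in> D" "D \<subseteq> snd c ` fst c" using chart_image_open_subset[OF ch W(1,2)] W by (auto simp: D_def y_def)
  have inW: "cinv c z \<in> W" "cinv c z \<in> fst c" "snd c (cinv c z) = z" if "z \<in> D" for z
    using that W(2) chart_props(5)[OF ch] unfolding D_def by auto
  have du: "u differentiable at z" if "z \<in> D" for z
    using smooth_on_differentiable[OF \<phi>] that unfolding u_def D_def by blast
  have gD: "(z, gradient u z) \<in> flux_dom c" if "z \<in> D" for z
    using conorm_chart(2)[OF ch inW(2)[OF that], of \<phi>] reg[OF inW(1)[OF that]] du[OF that] inW(3)[OF that] by (simp add: u_def)
  have Nrep: "vector_rep A c N z = \<nu> z" if "z \<in> D" for z
    using normal_rep[OF ch inW(2)[OF that], of \<phi> p] reg[OF inW(1)[OF that]] du[OF that] inW(3)[OF that]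
    by (simp add: u_def N_def \<nu>_def)
  have sm\<nu>: "smooth_on D \<nu>"
    unfolding \<nu>_def
    by (rule smooth_on_compose[OF D(1) flux_smooth(1)[OF c] _ flux_smooth(2)[OF c] gD])
      (use \<phi> in \<open>auto intro!: smooth_on_Pair D(1) smooth_on_id smooth_on_gradient simp: u_def D_def[symmetric]\<close>)
  have d\<nu>: "\<nu> differentiable at y" by (rule smooth_on_differentiable[OF sm\<nu> D(2)])
  let ?f = "f \<circ> cinv c"
  have df: "?f differentiable at y" using f by (simp add: y_def)
  have Xrep: "vector_rep A c (\<lambda>x. f x *\<^sub>R N x) z = ?f z *\<^sub>R \<nu> z" if "z \<in> D" for z
    using Nrep[OF that] linear_scale[OF comps_linear[OF ch inW(2)[OF that]]] by (simp add: vector_rep_apply)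
  have dX': "(\<lambda>z. ?f z *\<^sub>R \<nu> z) differentiable at y"
    using has_derivative_scaleR[OF fd_works[OF df] fd_works[OF d\<nu>]] by (rule differentiableI)
  have dX: "vector_rep A c (\<lambda>x. f x *\<^sub>R N x) differentiable at y"
    by (rule differentiable_transform_open(1)[OF D(1,2) _ dX']) (rule Xrep[symmetric])
  have fdX: "fd (\<lambda>z. ?f z *\<^sub>R \<nu> z) y = fd (vector_rep A c (\<lambda>x. f x *\<^sub>R N x)) y"
    by (rule differentiable_transform_open(2)[OF D(1,2) _ dX']) (rule Xrep[symmetric])
  have arep: "form_rep A c (p_area_form A g vol p \<phi>) z us = vol_rep c z (\<nu> z # us)" if "z \<in> D" for z us
  proof -
    have "vec_of c (cinv c z) (\<nu> z) = N (cinv c z)"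
      using Nrep[OF that] inW(2)[OF that] ch by (simp add: vector_rep_apply flip: Nrep[OF that])
    then show ?thesis by (simp add: form_rep_def area_form_normal N_def)
  qed
  have vol1: "alternating_form CARD('n) (vol_rep c z)" if "z \<in> D" for z
    using vol_rep_alternating(1)[OF ch] D(3) that by blast
  have vol2: "vol_rep c y std_frame \<noteq> 0" using vol_rep_alternating(2)[OF ch] D by blast
  have vol3: "(\<lambda>y. vol_rep c y std_frame) differentiable at y"
    using smooth_on_differentiable[OF vol_rep_smooth[OF c]] D by blast
  \<comment> \<open>The moving argument is expanded in the basis; on constant vectors the derivative
    of the volume form is known.\<close>
  have dar': "(\<lambda>z. vol_rep c z (\<nu> z # us)) differentiable at y" if us: "length us = CARD('n) - 1" for us
  proof -
    have len: "length (v # us) = CARD('n)" for v by (rule length_1_card[OF us])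
    have "((\<lambda>z. \<Sum>b\<in>Basis. (\<nu> z \<bullet> b) * vol_rep c z (b # us)) has_derivative
        (\<lambda>h. \<Sum>b\<in>Basis. (\<nu> y \<bullet> b) * (fd (\<lambda>y. vol_rep c y std_frame) y h * (vol_rep c y (b # us) / vol_rep c y std_frame))
           + (fd \<nu> y h \<bullet> b) * vol_rep c y (b # us))) (at y)"
      by (intro has_derivative_sum has_derivative_mult has_derivative_inner_left fd_works[OF d\<nu>]
          fd_top_form[OF D(1,2) vol1 vol2 vol3])
    then have "(\<lambda>z. \<Sum>b\<in>Basis. (\<nu> z \<bullet> b) * vol_rep c z (b # us)) differentiable at y"
      by (rule differentiableI)
    then show ?thesis
    proof (rule differentiable_transform_open(1)[OF D(1,2), rotated])
      fix z assume z: "z \<in> D"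
      show "(\<Sum>b\<in>Basis. (\<nu> z \<bullet> b) * vol_rep c z (b # us)) = vol_rep c z (\<nu> z # us)"
        using multilinear_expand[OF alternating_form_multilinear[OF vol1[OF z]] len[of 0], of 0 "\<nu> z"] by simp
    qed
  qed
  have dar: "(\<lambda>z. form_rep A c (p_area_form A g vol p \<phi>) z us) differentiable at y"
    if "length us = CARD('n) - 1" for us
    by (rule differentiable_transform_open(1)[OF D(1,2) _ dar'[OF that]]) (rule arep[symmetric])
  have fdar: "fd (\<lambda>z. vol_rep c z (\<nu> z # us)) y = fd (\<lambda>z. form_rep A c (p_area_form A g vol p \<phi>) z us) y"
    if "length us = CARD('n) - 1" for us
    by (rule differentiable_transform_open(2)[OF D(1,2) _ dar'[OF that]]) (rule arep[symmetric])
  define us where "us = map (comps c x) vs"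
  have us: "length us = CARD('n) - 1" using vs by (simp add: us_def)
  have "lie_derivative A (\<lambda>x. f x *\<^sub>R N x) (p_area_form A g vol p \<phi>) x vs
    = lie_rep (vector_rep A c (\<lambda>x. f x *\<^sub>R N x)) (form_rep A c (p_area_form A g vol p \<phi>)) y us"
    unfolding y_def us_def
  proof (rule lie_derivative_chart[OF ch xc _ _ _ vs])
    show "vector_rep A c (\<lambda>x. f x *\<^sub>R N x) differentiable at (snd c x)" using dX by (simp add: y_def)
    show "multilinear (CARD('n) - 1) (p_area_form A g vol p \<phi> z)" for z
      unfolding area_form_eq(1)
      by (rule alternating_form_multilinear, rule alternating_form_interior_product) (simp only: Suc_card_minus vol_alternating)
    show "(\<lambda>y. form_rep A c (p_area_form A g vol p \<phi>) y us) differentiable at (snd c x)" if "length us = CARD('n) - 1" for us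
      using dar[OF that] by (simp add: y_def)
  qed
  also have "\<dots> = lie_rep (\<lambda>z. ?f z *\<^sub>R \<nu> z) (\<lambda>z us. vol_rep c z (\<nu> z # us)) y us"
    unfolding lie_rep_def fdX fdar[OF us] using Xrep[OF D(2)] arep[OF D(2)] by simp
  also have "\<dots> = ?f y * divergence_rep (vol_rep c) \<nu> y * vol_rep c y (\<nu> y # us)"
    by (rule lie_rep_area_form[OF D(1,2) vol1 vol2 vol3 d\<nu> df us])
  also have "vol_rep c y (\<nu> y # us) = form_rep A c (p_area_form A g vol p \<phi>) y us" using arep[OF D(2)] by simp
  also have "\<dots> = p_area_form A g vol p \<phi> x vs"
  proof -
    have "map (vec_of c x) us = vs" unfolding us_def using vec_of_comps[OF ch xc] by (simp add: map_idI)
    then show ?thesis using chart_props(5)[OF ch xc] by (simp add: form_rep_def y_def)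
  qed
  finally show ?thesis
    using chart_props(5)[OF ch xc] by (simp add: N_def curvature_rep_def \<nu>_def u_def y_def)
qed

end

section \<open>Test functions and slice charts\<close>

text \<open>\<open>exp (-1/x)\<close> continued by 0, with powers of \<open>1/x\<close> as factors
  so that the family is closed under differentiation up to linear combinations.\<close>

definition flat_exp :: "nat \<Rightarrow> real \<Rightarrow> real" where
  "flat_exp k x = (if x > 0 then exp (- (1 / x)) * (1 / x) ^ k else 0)"

lemma flat_exp_has_derivative:
  "(flat_exp k has_real_derivative flat_exp (k + 2) x - real k * flat_exp (k + 1) x) (at x)"
proof -
  consider "x > 0" | "x < 0" | "x = 0" by linarith
  then show ?thesis
  proof cases
    case 1
    have "((\<lambda>x. exp (- (1 / x)) * (1 / x) ^ k) has_real_derivative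
        (exp (- (1 / x)) * (1 / x\<^sup>2)) * (1 / x) ^ k + (real k * (1 / x) ^ (k - 1) * (- (1 / x\<^sup>2))) * exp (- (1 / x))) (at x)"
      using 1 by (auto intro!: derivative_eq_intros simp: power2_eq_square)
    moreover have "(exp (- (1 / x)) * (1 / x\<^sup>2)) * (1 / x) ^ k + (real k * (1 / x) ^ (k - 1) * (- (1 / x\<^sup>2))) * exp (- (1 / x))
       = flat_exp (k + 2) x - real k * flat_exp (k + 1) x"
      using 1 by (cases k) (simp_all add: flat_exp_def power2_eq_square power_divide algebra_simps)
    ultimately have "((\<lambda>x. exp (- (1 / x)) * (1 / x) ^ k) has_real_derivative flat_exp (k + 2) x - real k * flat_exp (k + 1) x) (at x)"
      by simp
    then show ?thesis
      by (rule has_field_derivative_transform_within_open[where S = "{0<..}"]) (use 1 in \<open>auto simp: flat_exp_def\<close>)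
  next
    case 2
    have "((\<lambda>x. 0) has_real_derivative 0) (at x)" by simp
    then have "(flat_exp k has_real_derivative 0) (at x)"
      by (rule has_field_derivative_transform_within_open[where S = "{..<0}"]) (use 2 in \<open>auto simp: flat_exp_def\<close>)
    then show ?thesis using 2 by (simp add: flat_exp_def)
  next
    case 3
    \<comment> \<open>The difference quotient at 0; on the right, \<open>x = 1/t\<close> turns it
      into \<open>x^(k+1) / exp x\<close>.\<close>
    have "((\<lambda>t. flat_exp k t / t) \<longlongrightarrow> 0) (at 0)"
    proof (rule filterlim_split_at)
      show "((\<lambda>t. flat_exp k t / t) \<longlongrightarrow> 0) (at_left 0)"
        by (rule tendsto_eventually) (auto simp: eventually_at_filter flat_exp_def)
      have "((\<lambda>t. (inverse t) ^ (k + 1) / exp (inverse t)) \<longlongrightarrow> (0::real)) (at_right 0)"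
        by (rule filterlim_compose[OF tendsto_power_div_exp_0 filterlim_inverse_at_top_right])
      moreover have "\<forall>\<^sub>F t in at_right (0::real). (inverse t) ^ (k + 1) / exp (inverse t) = flat_exp k t / t"
        using eventually_at_right_less[of 0]
        by eventually_elim (simp add: flat_exp_def exp_minus inverse_eq_divide divide_simps)
      ultimately show "((\<lambda>t. flat_exp k t / t) \<longlongrightarrow> 0) (at_right 0)" by (rule Lim_transform_eventually)
    qed
    then show ?thesis using 3 by (simp add: has_field_derivative_iff flat_exp_def)
  qed
qed

lemma flat_exp_Ck: "Ck_on j UNIV (flat_exp k)"
proof (induction j arbitrary: k)
  case 0
  have "continuous (at x) (flat_exp k)" for x using flat_exp_has_derivative DERIV_isCont by blast
  then show ?case by (simp add: continuous_at_imp_continuous_on)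
next
  case (Suc j)
  show ?case
    by (rule Ck_on_real_SucI[OF open_UNIV flat_exp_has_derivative])
      (intro Ck_on_diff Ck_on_mult open_UNIV Ck_on_const Suc)
qed

abbreviation "bump \<equiv> flat_exp 0"

lemma bump: "smooth_on UNIV bump" "bump x > 0 \<longleftrightarrow> x > 0" "bump x \<ge> 0" "x \<le> 0 \<Longrightarrow> bump x = 0"
  by (auto simp: smooth_on_def flat_exp_Ck flat_exp_def)

lemma smooth_bump: "smooth_on UNIV f \<Longrightarrow> smooth_on UNIV (\<lambda>x. bump (f x))"
  by (rule smooth_on_compose[OF open_UNIV open_UNIV _ bump(1)]) auto

text \<open>\<open>f\<close> becomes the test function and \<open>\<rho>\<close> a partition of
  unity with a single member: \<open>\<rho>\<close> has to be 1 wherever \<open>f\<close> is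
  nonzero.\<close>

lemma bump_and_cutoff:
  fixes z\<^sub>0 :: "'a::euclidean_space"
  assumes "0 < s" "s < t"
  obtains f \<rho> :: "'a \<Rightarrow> real"
  where "smooth_on UNIV f" "smooth_on UNIV \<rho>" "\<And>z. f z \<ge> 0" "\<And>z. f z \<noteq> 0 \<longleftrightarrow> z \<in> ball z\<^sub>0 s"
    "\<And>z. z \<in> ball z\<^sub>0 s \<Longrightarrow> \<rho> z = 1" "\<And>z. z \<notin> cball z\<^sub>0 t \<Longrightarrow> \<rho> z = 0"
proof
  define n where "n z = (z - z\<^sub>0) \<bullet> (z - z\<^sub>0)" for z
  have n: "n z = (dist z\<^sub>0 z)\<^sup>2" for z 
    unfolding n_def dist_norm norm_minus_commute[of z\<^sub>0 z] power2_norm_eq_inner ..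
  have sn: "smooth_on UNIV n" unfolding n_def by (intro smooth_on_intros open_UNIV)
  \<comment> \<open>The usual quotient: \<open>a\<close> is positive inside radius \<open>t\<close>,
    \<open>b\<close> outside radius \<open>s\<close>, and their sum never vanishes.\<close>
  define a where "a z = bump (t\<^sup>2 - n z)" for z
  define b where "b z = bump (n z - s\<^sup>2)" for z
  have st: "s\<^sup>2 < t\<^sup>2" using assms by (simp add: power_strict_mono)
  have pos: "a z + b z > 0" for z
  proof (cases "n z < t\<^sup>2")
    case True
    then show ?thesis using bump(2)[of "t\<^sup>2 - n z"] bump(3)[of "n z - s\<^sup>2"] unfolding a_def b_def by linarith
  next
    case False
    then show ?thesis using bump(2)[of "n z - s\<^sup>2"] bump(3)[of "t\<^sup>2 - n z"] st unfolding a_def b_def by linarith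
  qed
  have sab: "smooth_on UNIV a" "smooth_on UNIV b"
    unfolding a_def b_def by (intro smooth_bump smooth_on_intros open_UNIV sn)+
  show "smooth_on UNIV (\<lambda>z. bump (s\<^sup>2 - n z))" by (intro smooth_bump smooth_on_intros open_UNIV sn)
  show "smooth_on UNIV (\<lambda>z. a z / (a z + b z))"
    using pos by (intro smooth_on_divide smooth_on_add open_UNIV sab) (simp add: less_imp_neq[symmetric])
  show "bump (s\<^sup>2 - n z) \<ge> 0" for z by (rule bump(3))
  show "bump (s\<^sup>2 - n z) \<noteq> 0 \<longleftrightarrow> z \<in> ball z\<^sub>0 s" for z
  proof -
    have "bump (s\<^sup>2 - n z) \<noteq> 0 \<longleftrightarrow> n z < s\<^sup>2" using bump(2)[of "s\<^sup>2 - n z"] bump(3)[of "s\<^sup>2 - n z"] by linarith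
    also have "\<dots> \<longleftrightarrow> dist z\<^sub>0 z < s" 
      unfolding n using assms power2_less_imp_less[of "dist z\<^sub>0 z" s] power_strict_mono[of "dist z\<^sub>0 z" s 2] by auto
    finally show ?thesis by simp
  qed
  show "a z / (a z + b z) = 1" if "z \<in> ball z\<^sub>0 s" for z
  proof -
    have "n z \<le> s\<^sup>2" using that unfolding n by (intro power_mono) auto
    then have "b z = 0" using bump(4) by (simp add: b_def)
    then show ?thesis using pos[of z] by simp
  qed
  show "a z / (a z + b z) = 0" if "z \<notin> cball z\<^sub>0 t" for z
  proof -
    have "t\<^sup>2 \<le> n z" using that assms unfolding n by (intro power_mono) auto
    then show ?thesis using bump(4) by (simp add: a_def)
  qed
qed

text \<open>A coordinate change that turns \<open>{u = 0}\<close> into a coordinate hyperplane.\<close>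

definition replace_coord :: "(real^'n::finite \<Rightarrow> real) \<Rightarrow> 'n \<Rightarrow> real^'n \<Rightarrow> real^'n" where
  "replace_coord u i y = y + (u y - y $ i) *\<^sub>R axis i 1"

lemma replace_coord_component: "replace_coord u i y $ i = u y"
  by (simp add: replace_coord_def)

text \<open>The inverse function theorem for this particular map. A nonzero partial derivative gives
  injectivity along the coordinate \<open>i\<close>, invariance of domain an open image and a
  continuous inverse, and the derivative of the inverse is explicit.\<close>

lemma replace_coord_inverse:
  fixes u :: "real^'n::finite \<Rightarrow> real"
  assumes D: "open D" "smooth_on D u" "y\<^sub>0 \<in> D" and nz: "fd u y\<^sub>0 (axis i 1) \<noteq> 0"
  obtains r G where "r > 0" "ball y\<^sub>0 r \<subseteq> D" "smooth_on (ball y\<^sub>0 r) (replace_coord u i)"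
    "open (replace_coord u i ` ball y\<^sub>0 r)" "homeomorphism (ball y\<^sub>0 r) (replace_coord u i ` ball y\<^sub>0 r) (replace_coord u i) G"
    "smooth_on (replace_coord u i ` ball y\<^sub>0 r) G"
proof -
  let ?e = "axis i 1 :: real^'n" and ?F = "replace_coord u i"
  have "continuous_on D (\<lambda>y. fd u y ?e)"
    by (rule smooth_on_continuous[OF smooth_on_fd[OF D(1,2) smooth_on_const]])
  then have "continuous (at y\<^sub>0) (\<lambda>y. fd u y ?e)" using D continuous_on_eq_continuous_at by blast
  then have "((\<lambda>y. fd u y ?e * fd u y\<^sub>0 ?e) \<longlongrightarrow> fd u y\<^sub>0 ?e * fd u y\<^sub>0 ?e) (nhds y\<^sub>0)"
    by (intro tendsto_intros) (simp add: isCont_def tendsto_nhds_iff)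
  moreover have "fd u y\<^sub>0 ?e * fd u y\<^sub>0 ?e > 0" using nz by (metis not_real_square_gt_zero)
  ultimately have "\<forall>\<^sub>F y in nhds y\<^sub>0. fd u y ?e * fd u y\<^sub>0 ?e > 0" by (rule order_tendstoD(1))
  moreover have "\<forall>\<^sub>F y in nhds y\<^sub>0. y \<in> D" using D by (intro eventually_nhds_in_open)
  ultimately have "\<forall>\<^sub>F y in nhds y\<^sub>0. y \<in> D \<and> fd u y ?e * fd u y\<^sub>0 ?e > 0" by eventually_elim simp
  then obtain r where r: "r > 0" "\<And>y. dist y y\<^sub>0 < r \<Longrightarrow> y \<in> D \<and> fd u y ?e * fd u y\<^sub>0 ?e > 0"
    unfolding eventually_nhds_metric by blast
  let ?B = "ball y\<^sub>0 r"
  have B: "y \<in> D" "fd u y ?e * fd u y\<^sub>0 ?e > 0" "fd u y ?e \<noteq> 0" if "y \<in> ?B" for y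
    using r(2)[of y] that by (auto simp: dist_commute)
  have BD: "?B \<subseteq> D" using B by blast
  have su: "smooth_on ?B u" using D(2) BD by (rule smooth_on_subset)
  have sF: "smooth_on ?B ?F"
    unfolding replace_coord_def
    by (intro smooth_on_add smooth_on_scaleR smooth_on_diff open_ball smooth_on_id su smooth_on_const
        smooth_on_linear bounded_linear_vec_nth)
  have dF: "(?F has_derivative (\<lambda>h. h + (fd u y h - h $ i) *\<^sub>R ?e)) (at y)" if "y \<in> ?B" for y
    unfolding replace_coord_def
    by (intro has_derivative_add has_derivative_ident has_derivative_scaleR_left has_derivative_diff
        smooth_on_has_derivative[OF su that] bounded_linear_imp_has_derivative[OF bounded_linear_vec_nth])
  \<comment> \<open>Points with the same image differ only in the coordinate \<open>i\<close> and
    have the same \<open>u\<close>; by the mean value theorem the partial derivative would vanish in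
    between.\<close>
  have inj: "inj_on ?F ?B"
  proof (rule inj_onI, rule ccontr)
    fix x y assume xy: "x \<in> ?B" "y \<in> ?B" "?F x = ?F y" "x \<noteq> y"
    have uxy: "u x = u y" using xy(3) replace_coord_component by metis
    define t where "t = y $ i - x $ i"
    have "y - x = t *\<^sub>R ?e" using xy(3) uxy by (simp add: replace_coord_def t_def algebra_simps)
    then have y: "y = x + t *\<^sub>R ?e" by (simp add: algebra_simps)
    have t: "t \<noteq> 0" using xy(4) y by auto
    have inB: "x + (s * t) *\<^sub>R ?e \<in> ?B" if "0 \<le> s" "s \<le> 1" for s
    proof -
      have "x + (s * t) *\<^sub>R ?e = (1 - s) *\<^sub>R x + s *\<^sub>R y" by (simp add: y algebra_simps)
      then show ?thesis using convexD[OF convex_ball xy(1,2), of "1 - s" s] that by simp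
    qed
    have "((\<lambda>s. u (x + (s * t) *\<^sub>R ?e)) has_real_derivative t * fd u (x + (s * t) *\<^sub>R ?e) ?e) (at s)" if "0 \<le> s" "s \<le> 1" for s
    proof -
      have "((\<lambda>s. x + (s * t) *\<^sub>R ?e) has_derivative (\<lambda>h. (h * t) *\<^sub>R ?e)) (at s)"
        by (auto intro!: derivative_eq_intros)
      from has_derivative_compose[OF this, of u, OF smooth_on_has_derivative[OF su inB[OF that]]] show ?thesis
        unfolding has_field_derivative_def by (rule has_derivative_eq_rhs)
          (simp add: fun_eq_iff linear_scale[OF has_derivative_linear[OF smooth_on_has_derivative[OF su inB[OF that]]]])
    qed
    then obtain s where s: "0 < s" "s < 1" "u (x + (1 * t) *\<^sub>R ?e) - u (x + (0 * t) *\<^sub>R ?e) = (1 - 0) * (t * fd u (x + (s * t) *\<^sub>R ?e) ?e)"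
      using MVT2[of 0 1 "\<lambda>s. u (x + (s * t) *\<^sub>R ?e)" "\<lambda>s. t * fd u (x + (s * t) *\<^sub>R ?e) ?e"] by auto
    then have "t * fd u (x + (s * t) *\<^sub>R ?e) ?e = 0" using uxy y by simp
    then show False using t B(3)[OF inB[of s]] s by simp
  qed
  have contF: "continuous_on ?B ?F" by (rule smooth_on_continuous[OF sF])
  have openV: "open (?F ` ?B)" by (rule invariance_of_domain[OF contF open_ball inj])
  let ?V = "?F ` ?B"
  obtain G where G: "homeomorphism ?B ?V ?F G"
    using invariance_of_domain_homeomorphism[OF open_ball contF _ inj] by auto
  have GV: "G z \<in> ?B" "?F (G z) = z" if "z \<in> ?V" for z using G that unfolding homeomorphism_def by auto
  have GF: "G (?F y) = y" if "y \<in> ?B" for y using G that unfolding homeomorphism_def by auto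
  \<comment> \<open>The solution of the linear equation for the derivative: all coordinates except
    \<open>i\<close> are those of \<open>k\<close>, and coordinate \<open>i\<close> is determined by
    the condition that \<open>fd u\<close> takes the value \<open>k $ i\<close>.\<close>
  define G' where "G' z k = k + ((k $ i - fd u (G z) (k - (k $ i) *\<^sub>R ?e)) / fd u (G z) ?e - k $ i) *\<^sub>R ?e" for z k
  have dG: "(G has_derivative G' z) (at z)" if z: "z \<in> ?V" for z
  proof (rule has_derivative_inverse_strong_x[OF open_ball GV(1)[OF z] contF GF dF[OF GV(1)[OF z]] _ GV(2)[OF z]])
    have nz: "fd u (G z) ?e \<noteq> 0" using B(3)[OF GV(1)[OF z]] .
    have lin: "linear (fd u (G z))" using smooth_on_has_derivative[OF su GV(1)[OF z]] has_derivative_linear by blast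
    show "(\<lambda>h. h + (fd u (G z) h - h $ i) *\<^sub>R ?e) \<circ> G' z = id"
    proof (rule ext)
      fix k
      define c where "c = (k $ i - fd u (G z) (k - (k $ i) *\<^sub>R ?e)) / fd u (G z) ?e - k $ i"
      have "c * fd u (G z) ?e = k $ i - fd u (G z) k"
        using nz by (simp add: c_def linear_diff[OF lin] linear_scale[OF lin] field_simps)
      then have "fd u (G z) (k + c *\<^sub>R ?e) = k $ i" by (simp add: linear_add[OF lin] linear_scale[OF lin])
      then show "((\<lambda>h. h + (fd u (G z) h - h $ i) *\<^sub>R ?e) \<circ> G' z) k = id k"
        by (simp add: G'_def flip: c_def scaleR_add_left)
    qed
  qed
  \<comment> \<open>The derivative of \<open>G\<close> is a smooth expression in \<open>G\<close>
    itself, so each class C^k lifts to the next.\<close>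
  have "Ck_on k ?V G" for k
  proof (induction k)
    case 0
    then show ?case using G by (simp add: homeomorphism_def)
  next
    case (Suc k)
    have fdu: "Ck_on k ?V (\<lambda>z. fd u (G z) v)" for v
    proof (rule Ck_on_compose[OF openV open_ball Suc])
      show "Ck_on k ?B (\<lambda>y. fd u y v)" by (rule smooth_on_Ck[OF smooth_on_fd[OF open_ball su smooth_on_const]])
    qed (rule GV(1))
    show ?case
    proof (rule Ck_on_SucI[OF openV dG])
      show "Ck_on k ?V (\<lambda>z. G' z v)" for v
        unfolding G'_def
        by (intro Ck_on_add Ck_on_scaleR Ck_on_diff Ck_on_divide openV Ck_on_const fdu) (rule B(3)[OF GV(1)])
    qed
  qed
  then have "smooth_on ?V G" by (simp add: smooth_on_def)
  then show ?thesis using that[of r G] r(1) BD sF openV G by blast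
qed

section \<open>Slice charts and extension by zero\<close>

context charted_manifold
begin

text \<open>With \<open>replace_coord\<close> as \<open>F\<close> this produces a slice chart for a
  regular zero set.\<close>

lemma chart_compose:
  assumes c: "is_chart A c" and B: "open B" "B \<subseteq> snd c ` fst c" and F: "smooth_on B F" "open (F ` B)"
    and G: "homeomorphism B (F ` B) F G" "smooth_on (F ` B) G"
  defines "e \<equiv> (cinv c ` B, F \<circ> snd c)"
  shows "is_chart A e" "snd e ` fst e = F ` B" "\<And>z. z \<in> F ` B \<Longrightarrow> cinv e z = cinv c (G z)" "fst e \<subseteq> fst c"
    "\<And>x. x \<in> fst e \<longleftrightarrow> x \<in> fst c \<and> snd c x \<in> B"
proof -
  note ch = chart_props[OF c]
  have GF: "G (F y) = y" if "y \<in> B" for y using G(1) that unfolding homeomorphism_def by auto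
  have FG: "F (G z) = z" "G z \<in> B" if "z \<in> F ` B" for z using GF that by auto
  have fst_e: "x \<in> fst e \<longleftrightarrow> x \<in> fst c \<and> snd c x \<in> B" for x
  proof
    assume "x \<in> fst e"
    then obtain y where "y \<in> B" "x = cinv c y" by (auto simp: e_def)
    then show "x \<in> fst c \<and> snd c x \<in> B" using B(2) ch(6,7) by auto
  next
    assume x: "x \<in> fst c \<and> snd c x \<in> B"
    then have "x = cinv c (snd c x)" using ch(5) by simp
    then show "x \<in> fst e" using x by (auto simp: e_def)
  qed
  show "\<And>x. x \<in> fst e \<longleftrightarrow> x \<in> fst c \<and> snd c x \<in> B" by (rule fst_e)
  show sub: "fst e \<subseteq> fst c" using fst_e by auto
  have opene: "open (fst e)"
  proof -
    have "fst e = fst c \<inter> snd c -` B" using fst_e by auto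
    then show ?thesis using continuous_open_preimage[OF ch(3) ch(1) B(1)] by (simp add: vimage_def Int_def)
  qed
  show img: "snd e ` fst e = F ` B"
  proof -
    have "snd c ` cinv c ` B = B" using B(2) ch(6) by (force simp: image_iff)
    then show ?thesis by (simp add: e_def flip: image_image image_comp)
  qed
  have inj: "inj_on (snd e) (fst e)"
    by (rule inj_on_inverseI[where g = "\<lambda>z. cinv c (G z)"]) (auto simp: e_def GF ch(6)[OF subsetD[OF B(2)]])
  have inv_e: "cinv e (snd e x) = x" if "x \<in> fst e" for x
    unfolding cinv_def using inv_into_f_f[OF inj that] .
  show ce: "cinv e z = cinv c (G z)" if "z \<in> F ` B" for z
  proof -
    have m: "cinv c (G z) \<in> fst e" using FG(2)[OF that] by (auto simp: e_def)
    have "snd e (cinv c (G z)) = z" using FG[OF that] ch(6) B(2) by (auto simp: e_def)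
    then show ?thesis using inv_e[OF m] by simp
  qed
  have conte: "continuous_on (fst e) (snd e)"
  proof -
    have "continuous_on (fst e) (\<lambda>x. F (snd c x))"
      by (rule continuous_on_compose2[OF smooth_on_continuous[OF F(1)] continuous_on_subset[OF ch(3) sub]])
        (use fst_e in auto)
    then show ?thesis by (simp add: e_def o_def)
  qed
  have "continuous_on (F ` B) (\<lambda>z. cinv c (G z))"
    by (rule continuous_on_compose2[OF ch(4) smooth_on_continuous[OF G(2)]]) (use FG(2) B(2) in auto)
  then have continv: "continuous_on (F ` B) (cinv e)" by (rule continuous_on_eq) (simp add: ce)
  have homeo: "homeomorphism (fst e) (snd e ` fst e) (snd e) (cinv e)"
    unfolding homeomorphism_def
  proof (intro conjI ballI)
    show "snd e (cinv e z) = z" if "z \<in> snd e ` fst e" for z using that inv_e by auto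
    show "cinv e ` snd e ` fst e = fst e" using inv_e by force
  qed (use conte continv inv_e img in auto)
  have trans: "smooth_on (snd e ` (fst e \<inter> fst d)) (snd d \<circ> cinv e)" "smooth_on (snd d ` (fst e \<inter> fst d)) (snd e \<circ> cinv d)"
    if d: "d \<in> A" for d
  proof -
    note dc = atlas_is_chart[OF d]
    note cd = compat_chart_atlas[OF c d, unfolded compat_def]
    have o0: "open (snd c ` (fst e \<inter> fst d))"
      using sub opene chart_props(1)[OF dc] by (intro chart_image_open_subset[OF c]) auto
    have sn: "snd e x = F (snd c x)" for x by (simp add: e_def)
    have eq: "snd e ` (fst e \<inter> fst d) = F ` B \<inter> G -` (snd c ` (fst e \<inter> fst d))"
    proof (intro set_eqI iffI)
      fix z assume "z \<in> snd e ` (fst e \<inter> fst d)"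
      then obtain x where x: "x \<in> fst e" "x \<in> fst d" "z = F (snd c x)" by (auto simp: sn)
      then show "z \<in> F ` B \<inter> G -` (snd c ` (fst e \<inter> fst d))" using fst_e GF by auto
    next
      fix z assume z: "z \<in> F ` B \<inter> G -` (snd c ` (fst e \<inter> fst d))"
      then obtain x where x: "x \<in> fst e" "x \<in> fst d" "G z = snd c x" by auto
      have "snd e x = F (G z)" by (simp add: sn x(3))
      then have "z = snd e x" using FG(1)[of z] z by simp
      then show "z \<in> snd e ` (fst e \<inter> fst d)" using x by auto
    qed
    have o1: "open (snd e ` (fst e \<inter> fst d))"
      using continuous_open_preimage[OF smooth_on_continuous[OF G(2)] F(2) o0] unfolding eq by (simp add: vimage_def Int_def)
    have "smooth_on (snd e ` (fst e \<inter> fst d)) (\<lambda>z. (snd d \<circ> cinv c) (G z))"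
    proof (rule smooth_on_compose[OF o1 o0, where f = G and g = "snd d \<circ> cinv c"])
      show "smooth_on (snd e ` (fst e \<inter> fst d)) G" using G(2) by (rule smooth_on_subset) (auto simp: eq)
      show "smooth_on (snd c ` (fst e \<inter> fst d)) (snd d \<circ> cinv c)"
        using cd sub by (elim conjE) (erule smooth_on_subset, blast)
      show "G z \<in> snd c ` (fst e \<inter> fst d)" if "z \<in> snd e ` (fst e \<inter> fst d)" for z using that eq by blast
    qed
    then show "smooth_on (snd e ` (fst e \<inter> fst d)) (snd d \<circ> cinv e)"
      using smooth_on_cong[OF o1, of "\<lambda>z. (snd d \<circ> cinv c) (G z)" "snd d \<circ> cinv e"] ce eq by auto
    have o2: "open (snd d ` (fst e \<inter> fst d))" using chart_image_open[OF dc opene] by (simp add: Int_commute)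
    have "smooth_on (snd d ` (fst e \<inter> fst d)) (\<lambda>y. F ((snd c \<circ> cinv d) y))"
    proof (rule smooth_on_compose[OF o2 B(1) _ F(1)])
      show "smooth_on (snd d ` (fst e \<inter> fst d)) (snd c \<circ> cinv d)"
        using cd sub by (elim conjE) (erule smooth_on_subset, blast)
      show "(snd c \<circ> cinv d) y \<in> B" if "y \<in> snd d ` (fst e \<inter> fst d)" for y
        using that fst_e chart_props(5)[OF dc] by auto
    qed
    then show "smooth_on (snd d ` (fst e \<inter> fst d)) (snd e \<circ> cinv d)" by (simp add: e_def o_def)
  qed
  show "is_chart A e"
    unfolding is_chart_def using opene homeo trans F(2) img by auto
qed

text \<open>The part of the chart over the closed ball is compact, hence closed in a Hausdorff
  space; so \<open>fst e\<close> and its complement form an open cover, and on each of the two sets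
  smoothness is evident.\<close>

lemma smooth_fun_extend_zero:
  assumes e: "is_chart A e" and s: "cball z\<^sub>0 s \<subseteq> snd e ` fst e"
    and b: "smooth_on UNIV b" "\<And>z. z \<notin> cball z\<^sub>0 s \<Longrightarrow> b z = 0"
  defines "f \<equiv> \<lambda>x. if x \<in> fst e then b (snd e x) else 0"
  shows "smooth_fun A UNIV f" "compact (closure {x. f x \<noteq> 0})" "closure {x. f x \<noteq> 0} \<subseteq> cinv e ` cball z\<^sub>0 s"
    "cinv e ` cball z\<^sub>0 s \<subseteq> fst e"
proof -
  note ch = chart_props[OF e]
  let ?K = "cinv e ` cball z\<^sub>0 s"
  have K: "compact ?K" using compact_continuous_image[OF continuous_on_subset[OF ch(4) s] compact_cball] .
  have sub: "{x. f x \<noteq> 0} \<subseteq> ?K"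
  proof
    fix x assume "x \<in> {x. f x \<noteq> 0}"
    then have x: "x \<in> fst e" "b (snd e x) \<noteq> 0" by (auto simp: f_def split: if_splits)
    then have "snd e x \<in> cball z\<^sub>0 s" using b(2) by blast
    then show "x \<in> ?K" using ch(5)[OF x(1)] by (metis imageI)
  qed
  show cl: "closure {x. f x \<noteq> 0} \<subseteq> ?K" using sub compact_imp_closed[OF K] closure_minimal by blast
  show "compact (closure {x. f x \<noteq> 0})"
    using compact_Int_closed[OF K closed_closure, of "{x. f x \<noteq> 0}"] cl by (simp add: inf_absorb2)
  show KX: "?K \<subseteq> fst e" using s ch(7) by blast
  show "smooth_fun A UNIV f"
    unfolding smooth_fun_def
  proof
    fix d assume d: "d \<in> A"
    note dc = atlas_is_chart[OF d]
    have o: "open (snd d ` (fst d \<inter> UNIV))" using chart_props(2)[OF dc] by simp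
    show "smooth_on (snd d ` (fst d \<inter> UNIV)) (f \<circ> cinv d)"
    proof (rule smooth_on_local[OF o])
      fix y assume "y \<in> snd d ` (fst d \<inter> UNIV)"
      then obtain x where x: "x \<in> fst d" "y = snd d x" by auto
      show "\<exists>T. open T \<and> y \<in> T \<and> smooth_on (snd d ` (fst d \<inter> UNIV) \<inter> T) (f \<circ> cinv d)"
      proof (cases "x \<in> fst e")
        case True
        define T where "T = snd d ` (fst d \<inter> fst e)"
        have oT: "open T" unfolding T_def by (rule chart_image_open[OF dc ch(1)])
        have "smooth_on T (\<lambda>y. b ((snd e \<circ> cinv d) y))"
        proof (rule smooth_on_compose[OF oT open_UNIV _ b(1)])
          show "smooth_on T (snd e \<circ> cinv d)"
            using compat_atlas_chart[OF e d] by (simp add: compat_def T_def)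
        qed simp
        moreover have "b ((snd e \<circ> cinv d) y) = (f \<circ> cinv d) y" if "y \<in> T" for y
          using that chart_props(5)[OF dc] by (auto simp: T_def f_def)
        ultimately have "smooth_on T (f \<circ> cinv d)"
          using smooth_on_cong[OF oT, of "\<lambda>y. b ((snd e \<circ> cinv d) y)" "f \<circ> cinv d"] by blast
        then have "smooth_on (snd d ` (fst d \<inter> UNIV) \<inter> T) (f \<circ> cinv d)" by (rule smooth_on_subset) simp
        moreover have "y \<in> T" using x True by (auto simp: T_def)
        ultimately show ?thesis using oT by blast
      next
        case False
        define T where "T = snd d ` (fst d \<inter> (- ?K))"
        have oT: "open T" unfolding T_def
          by (rule chart_image_open[OF dc]) (use compact_imp_closed[OF K] in auto)
        have "smooth_on T (\<lambda>y. 0 :: real)" by (rule smooth_on_const)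
        moreover have "0 = (f \<circ> cinv d) y" if "y \<in> T" for y
          using that chart_props(5)[OF dc] sub by (auto simp: T_def)
        ultimately have "smooth_on T (f \<circ> cinv d)" using smooth_on_cong[OF oT, of "\<lambda>y. 0"] by blast
        then have "smooth_on (snd d ` (fst d \<inter> UNIV) \<inter> T) (f \<circ> cinv d)" by (rule smooth_on_subset) simp
        moreover have "y \<in> T" using x False KX by (auto simp: T_def)
        ultimately show ?thesis using oT by blast
      qed
    qed
  qed
qed

end

section \<open>The first variation formula determines the mean curvature\<close>

text \<open>The point of the hyperplane at which \<open>slice_integrand\<close> evaluates its
  form.\<close>

definition slice_point :: "'n::finite \<Rightarrow> ('n \<Rightarrow> real) \<Rightarrow> real^'n" where
  "slice_point i y = (\<chi> j. if j = i then 0 else y j)"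

lemma slice_point_measurable: "slice_point i \<in> borel_measurable (Pi\<^sub>M (- {i}) (\<lambda>_. lborel))"
  unfolding borel_measurable_euclidean_space[of "slice_point i"]
proof
  fix b :: "real^'a" assume "b \<in> Basis"
  then obtain j where b: "b = axis j 1" by (auto simp: Basis_vec_def)
  show "(\<lambda>y. slice_point i y \<bullet> b) \<in> borel_measurable (Pi\<^sub>M (- {i}) (\<lambda>_. lborel))"
  proof (cases "j = i")
    case True
    then show ?thesis by (simp add: b inner_axis slice_point_def)
  next
    case False
    then have "(\<lambda>y. y j) \<in> measurable (Pi\<^sub>M (- {i}) (\<lambda>_. lborel)) (lborel :: real measure)"
      by (intro measurable_component_singleton) simp
    then show ?thesis using False by (simp add: b inner_axis slice_point_def)
  qed
qed

text \<open>Finite mass makes bounded functions on the box integrable; positive mass prevents a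
  function that is positive there from having integral 0. In dimension one the box is a single point
  of mass 1.\<close>

lemma slice_box:
  fixes i :: "'n::finite" and z\<^sub>0 :: "real^'n"
  assumes "0 < t"
  defines "M \<equiv> Pi\<^sub>M (- {i}) (\<lambda>_. lborel)"
    and "Q \<equiv> Pi\<^sub>E (- {i}) (\<lambda>j. {z\<^sub>0 $ j - t .. z\<^sub>0 $ j + t})"
  shows "Q \<in> sets M" "emeasure M Q < \<infinity>" "emeasure M Q > 0"
proof -
  interpret product_sigma_finite "\<lambda>_::'n. lborel :: real measure" by standard
  show "Q \<in> sets M" unfolding M_def Q_def by (intro sets_PiM_I_finite) auto
  have "emeasure M Q = (\<Prod>j\<in>- {i}. emeasure lborel {z\<^sub>0 $ j - t .. z\<^sub>0 $ j + t})"
    unfolding M_def Q_def by (rule emeasure_PiM) auto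
  also have "\<dots> = ennreal ((2 * t) ^ card (- {i}))" using assms(1) by (simp add: ennreal_power)
  finally show "emeasure M Q < \<infinity>" "emeasure M Q > 0" using assms(1) by (auto simp: ennreal_zero_less_top)
qed

text \<open>Continuity is stated on the hyperplane only, because the mean curvature is continuous
  only along the hypersurface. The indicator of the compact slice gives measurability.\<close>

lemma slice_integrable:
  fixes h :: "real^'n::finite \<Rightarrow> real"
  assumes "0 < t" and h: "continuous_on (cball z\<^sub>0 t \<inter> {z. z $ i = 0}) h" and z: "\<And>z. z \<notin> cball z\<^sub>0 t \<Longrightarrow> h z = 0"
  shows "integrable (Pi\<^sub>M (- {i}) (\<lambda>_. lborel)) (\<lambda>y. h (slice_point i y))"
proof -
  let ?M = "Pi\<^sub>M (- {i}) (\<lambda>_. lborel :: real measure)" and ?C = "cball z\<^sub>0 t \<inter> {z. z $ i = 0}"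
  have cl: "closed {z::real^'n. z $ i = 0}"
    by (intro closed_Collect_eq continuous_intros)
  then have C: "compact ?C" by (intro compact_Int_closed) auto
  then have Cb: "?C \<in> sets borel" by (simp add: borel_closed compact_imp_closed)
  have "bounded (h ` ?C)" using compact_continuous_image[OF h C] compact_imp_bounded by blast
  then obtain B where "\<forall>x\<in>h ` ?C. norm x \<le> B" unfolding bounded_iff by blast
  then have B: "\<And>z. z \<in> ?C \<Longrightarrow> norm (h z) \<le> B" by blast
  have "(\<lambda>z. indicator ?C z *\<^sub>R h z) \<in> borel_measurable borel"
    by (rule borel_measurable_continuous_on_indicator[OF Cb h])
  from measurable_compose[OF slice_point_measurable this]
  have "(\<lambda>y. indicator ?C (slice_point i y) *\<^sub>R h (slice_point i y)) \<in> borel_measurable ?M" .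
  moreover have "indicator ?C (slice_point i y) *\<^sub>R h (slice_point i y) = h (slice_point i y)" for y
    using z[of "slice_point i y"] by (auto simp: indicator_def slice_point_def)
  ultimately have m: "(\<lambda>y. h (slice_point i y)) \<in> borel_measurable ?M" by (simp only:)
  show ?thesis
  proof (rule integrableI_bounded_set[OF slice_box(1)[OF assms(1), of i z\<^sub>0] m slice_box(2)[OF assms(1)]])
    show "AE y in ?M. y \<in> Pi\<^sub>E (- {i}) (\<lambda>j. {z\<^sub>0 $ j - t .. z\<^sub>0 $ j + t}) \<longrightarrow> norm (h (slice_point i y)) \<le> max B 0"
    proof (intro AE_I2 impI)
      fix y
      show "norm (h (slice_point i y)) \<le> max B 0"
      proof (cases "slice_point i y \<in> cball z\<^sub>0 t")
        case True
        then show ?thesis using B[of "slice_point i y"] by (auto simp: slice_point_def)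
      qed (simp add: z)
    qed
    show "AE y in ?M. y \<notin> Pi\<^sub>E (- {i}) (\<lambda>j. {z\<^sub>0 $ j - t .. z\<^sub>0 $ j + t}) \<longrightarrow> h (slice_point i y) = 0"
    proof (intro AE_I2 impI)
      fix y assume y: "y \<in> space ?M" "y \<notin> Pi\<^sub>E (- {i}) (\<lambda>j. {z\<^sub>0 $ j - t .. z\<^sub>0 $ j + t})"
      have "slice_point i y \<notin> cball z\<^sub>0 t"
      proof
        assume "slice_point i y \<in> cball z\<^sub>0 t"
        then have "\<bar>(slice_point i y - z\<^sub>0) $ j\<bar> \<le> t" for j
          using component_le_norm_cart[of "slice_point i y - z\<^sub>0" j] by (simp add: dist_norm norm_minus_commute)
        then have b: "\<bar>(if j = i then 0 else y j) - z\<^sub>0 $ j\<bar> \<le> t" for j by (simp add: slice_point_def)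
        have "y j \<in> {z\<^sub>0 $ j - t .. z\<^sub>0 $ j + t}" if "j \<in> - {i}" for j
          using b[of j] that by (simp add: abs_le_iff)
        then show False using y by (auto simp: space_PiM PiE_iff)
      qed
      then show "h (slice_point i y) = 0" by (rule z)
    qed
  qed
qed

lemma slice_integral_zero:
  fixes h :: "real^'n::finite \<Rightarrow> real"
  assumes int: "integrable (Pi\<^sub>M (- {i}) (\<lambda>_. lborel)) (\<lambda>y. h (slice_point i y))"
    and nonneg: "\<And>z. z $ i = 0 \<Longrightarrow> h z \<ge> 0" and zero: "(LINT y|Pi\<^sub>M (- {i}) (\<lambda>_. lborel). h (slice_point i y)) = 0"
    and z0: "z\<^sub>0 $ i = 0" and pos: "0 < s" "\<And>z. z $ i = 0 \<Longrightarrow> z \<in> ball z\<^sub>0 s \<Longrightarrow> h z > 0"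
  shows False
proof -
  let ?M = "Pi\<^sub>M (- {i}) (\<lambda>_. lborel :: real measure)"
  have P: "slice_point i y $ i = 0" for y by (simp add: slice_point_def)
  have ae: "AE y in ?M. h (slice_point i y) = 0"
    using zero integral_nonneg_eq_0_iff_AE[OF int] nonneg[OF P] by simp
  \<comment> \<open>The box of half-width \<open>t\<close> fits into the ball, as its coordinate
    differences sum to at most \<open>s / 2\<close>.\<close>
  define t where "t = s / (2 * real CARD('n))"
  have t: "t > 0" using pos(1) by (simp add: t_def)
  let ?Q = "Pi\<^sub>E (- {i}) (\<lambda>j. {z\<^sub>0 $ j - t .. z\<^sub>0 $ j + t})"
  have "AE y in ?M. y \<notin> ?Q"
    using ae
  proof eventually_elim
    case (elim y)
    show ?case
    proof
      assume y: "y \<in> ?Q"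
      have "norm (slice_point i y - z\<^sub>0) \<le> (\<Sum>j\<in>UNIV. \<bar>(slice_point i y - z\<^sub>0) $ j\<bar>)" by (rule norm_le_l1_cart)
      also have "\<dots> \<le> (\<Sum>j\<in>(UNIV::'n set). t)"
      proof (rule sum_mono)
        fix j
        show "\<bar>(slice_point i y - z\<^sub>0) $ j\<bar> \<le> t"
        proof (cases "j = i")
          case True
          then show ?thesis using z0 t by (simp add: slice_point_def)
        next
          case False
          then have "y j \<in> {z\<^sub>0 $ j - t .. z\<^sub>0 $ j + t}" using y by (auto simp: PiE_iff)
          then show ?thesis using False by (simp add: slice_point_def abs_le_iff)
        qed
      qed
      also have "\<dots> < s" using pos(1) by (simp add: t_def)
      finally have "slice_point i y \<in> ball z\<^sub>0 s" by (simp add: dist_norm norm_minus_commute)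
      then show False using pos(2)[OF P] elim by fastforce
    qed
  qed
  then have "emeasure ?M ?Q = 0"
    using AE_iff_null_sets[OF slice_box(1)[OF t, of i z\<^sub>0]] by (simp add: null_setsD1)
  then show False using slice_box(3)[OF t, of i z\<^sub>0] by simp
qed

section \<open>Pointwise curvature from the variational definition\<close>

context subriemannian_manifold
begin

lemma area_form_alternating: "alternating_form (CARD('n) - 1) (p_area_form A g vol p \<phi> x)"
  unfolding area_form_eq(1)
  by (rule alternating_form_interior_product) (simp only: Suc_card_minus vol_alternating)

lemma regular_chart:
  assumes c: "c \<in> A" and U: "open U" "smooth_fun A U \<phi>"
  defines "u \<equiv> \<phi> \<circ> cinv c"
    and "R \<equiv> {y \<in> snd c ` (fst c \<inter> U). (y, gradient (\<phi> \<circ> cinv c) y) \<in> flux_dom c}"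
  shows "open R" "smooth_on (snd c ` (fst c \<inter> U)) u" "R \<subseteq> snd c ` (fst c \<inter> U)"
    "\<And>x. x \<in> fst c \<Longrightarrow> x \<in> regular_set A g \<phi> U \<longleftrightarrow> snd c x \<in> R"
    "smooth_on R (\<lambda>y. flux c p (y, gradient u y))" "smooth_on R (curvature_rep c p u)"
proof -
  note ch = atlas_is_chart[OF c]
  define D where "D = snd c ` (fst c \<inter> U)"
  have D: "open D" unfolding D_def by (rule chart_image_open[OF ch U(1)])
  have RD: "R \<subseteq> D" by (auto simp: R_def D_def)
  then show "R \<subseteq> snd c ` (fst c \<inter> U)" by (simp add: D_def)
  show su0: "smooth_on (snd c ` (fst c \<inter> U)) u" unfolding u_def by (rule smooth_fun_chart[OF ch U])
  then have su: "smooth_on D u" by (simp add: D_def)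
  have sp: "smooth_on D (\<lambda>y. (y, gradient u y))" by (intro smooth_on_Pair D smooth_on_id smooth_on_gradient su)
  have R: "R = D \<inter> (\<lambda>y. (y, gradient u y)) -` flux_dom c" by (auto simp: R_def D_def u_def)
  show oR: "open R" unfolding R
    by (rule continuous_open_preimage[OF smooth_on_continuous[OF sp] D flux_smooth(1)[OF c]])
  show "x \<in> regular_set A g \<phi> U \<longleftrightarrow> snd c x \<in> R" if x: "x \<in> fst c" for x
  proof (cases "x \<in> U")
    case True
    then have "snd c x \<in> D" using x by (auto simp: D_def)
    then have d: "u differentiable at (snd c x)" by (rule smooth_on_differentiable[OF su])
    show ?thesis
      using conorm_chart(2)[OF ch x, of \<phi>] d True \<open>snd c x \<in> D\<close> by (simp add: regular_set_def R u_def)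
  next
    case False
    have "snd c x \<notin> D"
    proof
      assume "snd c x \<in> D"
      then obtain x' where "x' \<in> fst c" "x' \<in> U" "snd c x = snd c x'" by (auto simp: D_def)
      then have "x = x'" using chart_props(5)[OF ch] x by metis
      then show False using False \<open>x' \<in> U\<close> by simp
    qed
    then show ?thesis using False RD by (auto simp: regular_set_def)
  qed
  show s\<nu>: "smooth_on R (\<lambda>y. flux c p (y, gradient u y))"
    by (rule smooth_on_compose[OF oR flux_smooth(1)[OF c] smooth_on_subset[OF sp RD] flux_smooth(2)[OF c]])
      (auto simp: R)
  have vs: "smooth_on R (\<lambda>y. vol_rep c y std_frame)"
    using vol_rep_smooth[OF c] by (rule smooth_on_subset) (use RD in \<open>auto simp: D_def\<close>)
  have nz: "vol_rep c y std_frame \<noteq> 0" if "y \<in> R" for y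
    using vol_rep_alternating(2)[OF ch] that RD by (auto simp: D_def)
  have e: "curvature_rep c p u = (\<lambda>y. fd (\<lambda>y. vol_rep c y std_frame) y (flux c p (y, gradient u y)) / vol_rep c y std_frame
      + (\<Sum>b\<in>Basis. fd (\<lambda>y. flux c p (y, gradient u y)) y b \<bullet> b))"
    by (simp add: fun_eq_iff curvature_rep_def divergence_rep_def)
  show "smooth_on R (curvature_rep c p u)"
    unfolding e
    by (intro smooth_on_add smooth_on_divide smooth_on_sum smooth_on_inner smooth_on_fd oR s\<nu> vs nz smooth_on_const)
qed

lemma regular_set_open:
  assumes "open U" "smooth_fun A U \<phi>"
  shows "open (regular_set A g \<phi> U)"
proof (subst open_subopen, intro ballI)
  fix x assume x: "x \<in> regular_set A g \<phi> U"
  define c where "c = chart_at A x"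
  have c: "c \<in> A" "x \<in> fst c" "is_chart A c" using chart_at atlas_is_chart by (auto simp: c_def)
  note rc = regular_chart[OF c(1) assms]
  define T where "T = fst c \<inter> snd c -` {y \<in> snd c ` (fst c \<inter> U). (y, gradient (\<phi> \<circ> cinv c) y) \<in> flux_dom c}"
  have "open T"
    unfolding T_def by (rule continuous_open_preimage[OF chart_props(3,1)[OF c(3)] rc(1)])
  moreover have "x \<in> T" "T \<subseteq> regular_set A g \<phi> U" using rc(4) c x unfolding T_def by blast+
  ultimately show "\<exists>T. open T \<and> x \<in> T \<and> T \<subseteq> regular_set A g \<phi> U" by blast
qed

lemma lie_derivative_regular:
  assumes c: "c \<in> A" "x \<in> fst c" and U: "open U" "smooth_fun A U \<phi>" and x: "x \<in> regular_set A g \<phi> U"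
    and f: "smooth_fun A UNIV f" and vs: "length vs = CARD('n) - 1"
  shows "lie_derivative A (\<lambda>x. f x *\<^sub>R p_normal A g vol p \<phi> x) (p_area_form A g vol p \<phi>) x vs
    = f x * curvature_rep c p (\<phi> \<circ> cinv c) (snd c x) * p_area_form A g vol p \<phi> x vs"
proof (rule lie_derivative_area_form[where W = "fst c \<inter> regular_set A g \<phi> U"])
  note ch = atlas_is_chart[OF c(1)]
  show "open (fst c \<inter> regular_set A g \<phi> U)" using regular_set_open[OF U] chart_props(1)[OF ch] by blast
  show "smooth_on (snd c ` (fst c \<inter> regular_set A g \<phi> U)) (\<phi> \<circ> cinv c)"
    using smooth_fun_chart[OF ch U] by (rule smooth_on_subset) (auto simp: regular_set_def)
  show "(f \<circ> cinv c) differentiable at (snd c x)"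
    using smooth_on_differentiable[OF smooth_fun_chart[OF ch open_UNIV f]] c by simp
qed (use assms in \<open>auto simp: regular_set_def\<close>)

text \<open>\<open>has_form_integral\<close> asks the cutoffs to sum to 1 wherever the form is
  nonzero; this confines the Lie derivative to the set where \<open>f\<close> is nonzero. On lists
  of the wrong length all terms are 0 by the convention for forms.\<close>

lemma lie_derivative_vanishes:
  assumes U: "open U" "smooth_fun A U \<phi>" and x: "x \<in> regular_set A g \<phi> U"
    and f: "smooth_fun A UNIV f" "f x = 0"
  shows "lie_derivative A (\<lambda>x. f x *\<^sub>R p_normal A g vol p \<phi> x) (p_area_form A g vol p \<phi>) x = (\<lambda>_. 0)"
proof
  fix vs
  show "lie_derivative A (\<lambda>x. f x *\<^sub>R p_normal A g vol p \<phi> x) (p_area_form A g vol p \<phi>) x vs = 0"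
  proof (cases "length vs = CARD('n) - 1")
    case True
    then show ?thesis using lie_derivative_regular[OF chart_at U x f(1) True] f(2) by simp
  next
    case False
    then have "form_rep A (chart_at A x) (p_area_form A g vol p \<phi>) y vs = 0" for y
      unfolding form_rep_def by (intro alternating_form_length[OF area_form_alternating]) simp
    moreover have "p_area_form A g vol p \<phi> x (vs[i := v]) = 0" for i v
      using False by (intro alternating_form_length[OF area_form_alternating]) simp
    ultimately show ?thesis by (simp add: lie_derivative_def Let_def)
  qed
qed

text \<open>If the two values differ at \<open>q\<close>, continuity keeps the sign of the
  difference along the hypersurface near \<open>q\<close>, and a bump there makes the two integrals
  differ. As the first variation formula only speaks of integrals that exist, both are constructed
  in one slice chart.\<close>

lemma mean_curvature_formula:
  assumes c: "c \<in> A" "q \<in> fst c" and U: "open U" "smooth_fun A U \<phi>"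
    and q: "q \<in> regular_set A g \<phi> U" "\<phi> q = 0" and H: "p_mean_curvature A g vol U p \<phi> H"
  shows "H q = curvature_rep c p (\<phi> \<circ> cinv c) (snd c q)"
proof (rule ccontr)
  note ch = atlas_is_chart[OF c(1)]
  define u where "u = \<phi> \<circ> cinv c"
  define R where "R = {y \<in> snd c ` (fst c \<inter> U). (y, gradient u y) \<in> flux_dom c}"
  note rc = regular_chart[OF c(1) U, folded u_def, folded R_def]
  define \<omega> where "\<omega> = p_area_form A g vol p \<phi>"
  define N where "N = p_normal A g vol p \<phi>"
  define K where "K x = curvature_rep c p u (snd c x)" for x
  define \<nu> where "\<nu> y = flux c p (y, gradient u y)" for y
  define \<Sigma> where "\<Sigma> = regular_set A g \<phi> {x\<in>U. \<phi> x = 0}"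
  have \<Sigma>: "x \<in> \<Sigma> \<longleftrightarrow> x \<in> regular_set A g \<phi> U \<and> \<phi> x = 0" for x by (auto simp: \<Sigma>_def regular_set_def)
  assume "H q \<noteq> curvature_rep c p (\<phi> \<circ> cinv c) (snd c q)"
  then have ne: "K q - H q \<noteq> 0" by (simp add: K_def u_def)
  define y\<^sub>0 where "y\<^sub>0 = snd c q"
  have y0: "y\<^sub>0 \<in> R" using rc(4)[OF c(2)] q by (simp add: y\<^sub>0_def)
  have su: "smooth_on R u" using rc(2,3) by (rule smooth_on_subset)
  \<comment> \<open>A vanishing differential would have length 0, contrary to regularity.\<close>
  have "\<exists>i. fd u y\<^sub>0 (axis i 1) \<noteq> 0"
  proof (rule ccontr)
    assume "\<not> ?thesis"
    then have "gradient u y\<^sub>0 = 0" by (auto simp: gradient_def Basis_vec_def intro!: sum.neutral)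
    moreover have "sharp_rep c y\<^sub>0 0 = 0"
      using sharp_rep_operator(1)[OF ch] y0 rc(3) linear_0 by blast
    ultimately show False using y0 by (auto simp: R_def flux_dom_def)
  qed
  then obtain i where i: "fd u y\<^sub>0 (axis i 1) \<noteq> 0" by blast
  obtain r G where rG: "r > 0" "ball y\<^sub>0 r \<subseteq> R" "smooth_on (ball y\<^sub>0 r) (replace_coord u i)"
    "open (replace_coord u i ` ball y\<^sub>0 r)" "homeomorphism (ball y\<^sub>0 r) (replace_coord u i ` ball y\<^sub>0 r) (replace_coord u i) G"
    "smooth_on (replace_coord u i ` ball y\<^sub>0 r) G"
    by (rule replace_coord_inverse[OF rc(1) su y0 i])
  define B where "B = ball y\<^sub>0 r"
  define F where "F = replace_coord u i"
  define V where "V = F ` B"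
  note rG' = rG[folded B_def F_def, folded V_def]
  have B: "open B" "B \<subseteq> snd c ` fst c" using rG'(2) rc(3) by (auto simp: B_def)
  define e where "e = (cinv c ` B, F \<circ> snd c)"
  note ce = chart_compose[OF ch B rG'(3) _ _ _, folded e_def, folded V_def, OF rG'(4) rG'(5) rG'(6)]
  note che = ce(1)
  have GV: "G z \<in> B" "F (G z) = z" if "z \<in> V" for z using rG'(5) that unfolding homeomorphism_def by auto
  have xV: "cinv e z \<in> fst e" "cinv e z \<in> fst c" "snd c (cinv e z) = G z" "snd e (cinv e z) = z" "cinv e z \<in> regular_set A g \<phi> U"
    if "z \<in> V" for z
  proof -
    show 1: "cinv e z \<in> fst e" using chart_props(7)[OF che] ce(2) that by simp
    then show 2: "cinv e z \<in> fst c" using ce(4) by blast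
    show 3: "snd c (cinv e z) = G z" using ce(3)[OF that] chart_props(6)[OF ch] GV(1)[OF that] B(2) by auto
    show "snd e (cinv e z) = z" using chart_props(6)[OF che] ce(2) that by simp
    show "cinv e z \<in> regular_set A g \<phi> U" using rc(4)[OF 2] 3 GV(1)[OF that] rG'(2) by auto
  qed
  have ereg: "x \<in> regular_set A g \<phi> U" "snd e x $ i = \<phi> x" if "x \<in> fst e" for x
  proof -
    have xc: "x \<in> fst c" "snd c x \<in> B" using ce(5) that by auto
    then show "x \<in> regular_set A g \<phi> U" using rc(4)[OF xc(1)] rG'(2) by auto
    show "snd e x $ i = \<phi> x"
      using chart_props(5)[OF ch xc(1)] by (simp add: e_def F_def replace_coord_component u_def)
  qed
  have slice: "slice_chart A \<Sigma> e i" unfolding slice_chart_def using che ereg \<Sigma> by auto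
  have qe: "q \<in> fst e" using ce(5) c(2) rG(1) by (simp add: B_def y\<^sub>0_def)
  define z\<^sub>0 where "z\<^sub>0 = snd e q"
  have z0: "z\<^sub>0 \<in> V" "z\<^sub>0 $ i = 0" "cinv e z\<^sub>0 = q"
    using ce(2) qe ereg(2)[OF qe] q(2) chart_props(5)[OF che qe] by (auto simp: z\<^sub>0_def)
  let ?P = "{z::real^'n. z $ i = 0}"
  have contK: "continuous_on V (\<lambda>z. K (cinv e z))"
  proof -
    have "continuous_on V (\<lambda>z. curvature_rep c p u (G z))"
      by (rule continuous_on_compose2[OF smooth_on_continuous[OF rc(6)] smooth_on_continuous[OF rG'(6)]])
        (use GV(1) rG'(2) in auto)
    then show ?thesis by (rule continuous_on_eq) (simp add: K_def xV)
  qed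
  have H': "continuous_on \<Sigma> H"
    "\<And>f I J. smooth_fun A UNIV f \<Longrightarrow> compact (closure {x. f x \<noteq> 0}) \<Longrightarrow> closure {x. f x \<noteq> 0} \<subseteq> regular_set A g \<phi> U \<Longrightarrow>
       has_form_integral A \<Sigma> \<omega> (lie_derivative A (\<lambda>x. f x *\<^sub>R N x) \<omega>) I \<Longrightarrow>
       has_form_integral A \<Sigma> \<omega> (\<lambda>x vs. f x * H x * \<omega> x vs) J \<Longrightarrow> I = J"
    using H unfolding p_mean_curvature_def Let_def \<Sigma>_def[symmetric] \<omega>_def[symmetric] N_def[symmetric] by blast+
  have contH: "continuous_on (V \<inter> ?P) (\<lambda>z. H (cinv e z))"
  proof (rule continuous_on_compose2[OF H'(1)])
    show "continuous_on (V \<inter> ?P) (cinv e)"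
      using continuous_on_subset[OF chart_props(4)[OF che]] ce(2) by auto
    show "cinv e ` (V \<inter> ?P) \<subseteq> \<Sigma>" using \<Sigma> xV ereg(2) by fastforce
  qed
  \<comment> \<open>The sign makes the discrepancy \<open>\<delta>\<close> positive at
    \<open>z\<^sub>0\<close>, so both cases are treated at once.\<close>
  define \<sigma> where "\<sigma> = sgn (K q - H q)"
  define \<delta> where "\<delta> z = \<sigma> * (K (cinv e z) - H (cinv e z))" for z
  have "continuous_on (V \<inter> ?P) \<delta>"
    unfolding \<delta>_def by (intro continuous_intros contH continuous_on_subset[OF contK]) auto
  \<comment> \<open>Positivity of \<open>\<delta>\<close> spreads only to a relatively open part of
    the slice, since \<open>H\<close> is continuous along the hypersurface alone.\<close>
  from this[unfolded continuous_on_open_invariant, rule_format, of "{0<..}"]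
  obtain T where T: "open T" "T \<inter> (V \<inter> ?P) = \<delta> -` {0<..} \<inter> (V \<inter> ?P)" by auto
  have "\<delta> z\<^sub>0 > 0" using ne by (simp add: \<delta>_def z0 \<sigma>_def sgn_mult_self_eq abs_sgn[symmetric] mult.commute)
  then have "z\<^sub>0 \<in> T \<inter> V" using T(2) z0 by auto
  then obtain \<epsilon> where \<epsilon>: "\<epsilon> > 0" "ball z\<^sub>0 \<epsilon> \<subseteq> T \<inter> V" using T(1) rG'(4) openE open_Int by metis
  have \<delta>pos: "\<delta> z > 0" if "z \<in> ball z\<^sub>0 \<epsilon>" "z $ i = 0" for z
  proof -
    have "z \<in> T \<inter> (V \<inter> ?P)" using \<epsilon>(2) that by auto
    then have "z \<in> \<delta> -` {0<..}" unfolding T(2) by blast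
    then show ?thesis by simp
  qed
  define s t where "s = \<epsilon> / 3" and "t = \<epsilon> / 2"
  have st: "0 < s" "s < t" "t < \<epsilon>" using \<epsilon>(1) by (auto simp: s_def t_def)
  have tV: "cball z\<^sub>0 t \<subseteq> V" "ball z\<^sub>0 s \<subseteq> cball z\<^sub>0 t" "ball z\<^sub>0 s \<subseteq> ball z\<^sub>0 \<epsilon>"
    using \<epsilon>(2) st by auto
  obtain f0 \<rho>0 :: "real^'n \<Rightarrow> real" where b: "smooth_on UNIV f0" "smooth_on UNIV \<rho>0" "\<And>z. f0 z \<ge> 0"
    "\<And>z. f0 z \<noteq> 0 \<longleftrightarrow> z \<in> ball z\<^sub>0 s" "\<And>z. z \<in> ball z\<^sub>0 s \<Longrightarrow> \<rho>0 z = 1" "\<And>z. z \<notin> cball z\<^sub>0 t \<Longrightarrow> \<rho>0 z = 0"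
    by (rule bump_and_cutoff[OF st(1,2), of z\<^sub>0], rule that) assumption+
  have f0out: "f0 z = 0" if "z \<notin> cball z\<^sub>0 t" for z using b(4)[of z] tV(2) that by blast
  have te: "cball z\<^sub>0 t \<subseteq> snd e ` fst e" using tV(1) ce(2) by simp
  define f where "f x = (if x \<in> fst e then f0 (snd e x) else 0)" for x
  define \<rho> where "\<rho> x = (if x \<in> fst e then \<rho>0 (snd e x) else 0)" for x
  note fe = smooth_fun_extend_zero[OF che te b(1) f0out, folded f_def]
  note re = smooth_fun_extend_zero[OF che te b(2,6), folded \<rho>_def]
  have \<rho>1: "\<rho> x = 1" if "f x \<noteq> 0" for x
    using that b(4,5) by (auto simp: f_def \<rho>_def split: if_splits)
  \<comment> \<open>The same choice as inside \<open>slice_integrand\<close>, so that the frames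
    agree literally.\<close>
  define js where "js = (SOME js. distinct js \<and> set js = - {i})"
  have "\<exists>js. distinct js \<and> set js = - {i}" using finite_distinct_list[of "- {i}"] by auto
  from someI_ex[OF this] have js: "distinct js" "set js = - {i}" unfolding js_def by auto
  have ljs: "length js = CARD('n) - 1" using distinct_card[OF js(1)] js(2) by (simp add: Compl_eq_Diff_UNIV)
  define frame where "frame x = map (\<lambda>j. coord_vector A e j x) js" for x
  define \<theta> where "\<theta> z = \<omega> (cinv e z) (frame (cinv e z))" for z
  have Nrep: "vector_rep A c N (G z) = \<nu> (G z)" if "z \<in> V" for z
  proof -
    have "u differentiable at (G z)" using smooth_on_differentiable[OF su] GV(1)[OF that] rG'(2) by blast
    then show ?thesis
      using normal_rep[OF ch xV(2)[OF that], of \<phi> p] xV(3,5)[OF that]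
      by (simp add: u_def N_def \<nu>_def regular_set_def)
  qed
  have cG: "cinv c (G z) = cinv e z" if "z \<in> V" for z using ce(3)[OF that] by simp
  have \<theta>rep: "\<theta> z = vol_rep c (G z) (\<nu> (G z) # map (\<lambda>j. fd G z (axis j 1)) js)" if z: "z \<in> V" for z
  proof -
    let ?x = "cinv e z"
    have n: "N ?x = vec_of c ?x (\<nu> (G z))"
      using Nrep[OF z] xV(2)[OF z] ch by (simp add: vector_rep_apply cG[OF z] flip: Nrep[OF z])
    have "tchange e c ?x w = fd G z w" for w
    proof -
      have "fd (snd c \<circ> cinv e) z = fd G z"
      proof (rule differentiable_transform_open(2)[OF rG'(4) z, symmetric])
        show "G differentiable at z" by (rule smooth_on_differentiable[OF rG'(6) z])
        show "G z = (snd c \<circ> cinv e) z" if "z \<in> V" for z using xV(3)[OF that] by simp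
      qed
      then show ?thesis by (simp add: tchange_def xV(4)[OF z])
    qed
    then have "vec_of e ?x w = vec_of c ?x (fd G z w)" for w
      using comps_change(3)[OF che c(1) xV(1,2)[OF z], of w] by simp
    then have "frame ?x = map (vec_of c ?x) (map (\<lambda>j. fd G z (axis j 1)) js)"
      by (simp add: frame_def coord_vector_def)
    then show ?thesis
      unfolding \<theta>_def \<omega>_def area_form_normal N_def[symmetric] n form_rep_def cG[OF z] by simp
  qed
  have cont\<theta>: "continuous_on V \<theta>"
  proof -
    define fs where "fs = (\<lambda>z. \<nu> (G z)) # map (\<lambda>j z. fd G z (axis j 1)) js"
    have lfs: "length fs = CARD('n)" unfolding fs_def by (rule length_1_card) (simp add: ljs)
    have GR: "G z \<in> R" "G z \<in> snd c ` fst c" if "z \<in> V" for z using GV(1)[OF that] rG'(2) B(2) by auto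
    have "continuous (at z) (\<lambda>z. vol_rep c (G z) (map (\<lambda>f. f z) fs))" if z: "z \<in> V" for z
    proof -
      have dG: "(G has_derivative fd G z) (at z)" by (rule smooth_on_has_derivative[OF rG'(6) z])
      have s1: "smooth_on V (\<lambda>z. \<nu> (G z))"
        unfolding \<nu>_def by (rule smooth_on_compose[OF rG'(4) rc(1) rG'(6) rc(5) GR(1)])
      have dfs: "(fs ! k has_derivative fd (fs ! k) z) (at z)" if "k < length fs" for k
      proof (cases k)
        case 0
        then show ?thesis using smooth_on_has_derivative[OF s1 z] by (simp add: fs_def)
      next
        case (Suc k')
        then have "fs ! k = (\<lambda>z. fd G z (axis (js ! k') 1))" using that by (simp add: fs_def)
        then show ?thesis using smooth_on_has_derivative[OF smooth_on_fd[OF rG'(4,6) smooth_on_const] z] by simp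
      qed
      have "((\<lambda>z. vol_rep c (G z) (map (\<lambda>f. f z) fs)) has_derivative
        (\<lambda>h. (\<lambda>vs h. fd (\<lambda>y. vol_rep c y std_frame) (G z) (fd G z h) * (vol_rep c (G z) vs / vol_rep c (G z) std_frame)) (map (\<lambda>f. f z) fs) h
           + (\<Sum>k<length fs. vol_rep c (G z) ((map (\<lambda>f. f z) fs)[k := fd (fs ! k) z h])))) (at z)"
      proof (rule has_derivative_multilinear[OF rG'(4) z _ _ dfs])
        show "multilinear (length fs) (vol_rep c (G z))" if "z \<in> V" for z
          unfolding lfs by (rule alternating_form_multilinear[OF vol_rep_alternating(1)[OF ch GR(2)[OF that]]])
        show "((\<lambda>z. vol_rep c (G z) vs) has_derivative (\<lambda>h. fd (\<lambda>y. vol_rep c y std_frame) (G z) (fd G z h) * (vol_rep c (G z) vs / vol_rep c (G z) std_frame))) (at z)" for vs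
        proof (rule has_derivative_compose[OF dG])
          show "((\<lambda>y. vol_rep c y vs) has_derivative (\<lambda>h. fd (\<lambda>y. vol_rep c y std_frame) (G z) h * (vol_rep c (G z) vs / vol_rep c (G z) std_frame))) (at (G z))"
            by (rule fd_top_form[OF chart_props(2)[OF ch] GR(2)[OF z] vol_rep_alternating(1)[OF ch] vol_rep_alternating(2)[OF ch GR(2)[OF z]]
                  smooth_on_differentiable[OF vol_rep_smooth[OF c(1)] GR(2)[OF z]]])
        qed
      qed
      then show ?thesis by (rule has_derivative_continuous)
    qed
    then have "continuous_on V (\<lambda>z. vol_rep c (G z) (map (\<lambda>f. f z) fs))" by (rule continuous_at_imp_continuous_on[rule_format])
    then show ?thesis by (rule continuous_on_eq) (simp add: \<theta>rep fs_def o_def)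
  qed
  \<comment> \<open>\<open>\<theta>\<close> is the volume of the normal followed by the frame of the
    slice, so it is nonzero once the normal leaves the slice. Its coordinate \<open>i\<close> is the
    value of \<open>d\<phi>\<close> on the normal, that is, the length of \<open>d\<phi>\<close> to
    the power \<open>p + 1\<close>.\<close>
  have \<theta>nz: "\<theta> z \<noteq> 0" if z: "z \<in> V" for z
  proof -
    let ?x = "cinv e z"
    define w where "w = comps e ?x (N ?x)"
    define bs where "bs = axis i (1::real) # map (\<lambda>j. axis j 1) js"
    have inj: "inj_on (\<lambda>j. axis j (1::real) :: real^'n) UNIV" by (simp add: inj_on_def axis_eq_axis)
    have "distinct (map (\<lambda>j. axis j (1::real) :: real^'n) (i # js))"
      using js inj_on_subset[OF inj] by (subst distinct_map) simp
    then have "distinct bs" by (simp add: bs_def)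
    moreover have "set bs = Basis"
    proof -
      have "set bs = (\<lambda>j. axis j 1) ` insert i (set js)" by (simp add: bs_def)
      also have "insert i (set js) = UNIV" using js(2) by auto
      also have "range (\<lambda>j. axis j 1) = (Basis :: (real^'n) set)" by (auto simp: Basis_vec_def)
      finally show ?thesis .
    qed
    ultimately have bs: "distinct bs" "set bs = (Basis :: (real^'n) set)" by auto
    have lbs: "length bs = CARD('n)" using distinct_card[OF bs(1)] bs(2) by simp
    have zV: "z \<in> snd e ` fst e" using z ce(2) by simp
    have "\<theta> z = vol_rep e z (bs[0 := w])"
    proof -
      have "map (vec_of e ?x) (bs[0 := w]) = N ?x # frame ?x"
        using vec_of_comps[OF che xV(1)[OF z]] by (simp add: bs_def w_def frame_def coord_vector_def)
      then show ?thesis unfolding \<theta>_def \<omega>_def area_form_normal form_rep_def N_def[symmetric] by simp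
    qed
    also have "\<dots> = (w \<bullet> axis i 1) * vol_rep e z bs"
      using top_form_replace[OF vol_rep_alternating(1)[OF che zV] bs(1) eq_refl[OF bs(2)] lbs, of 0 w] by (simp add: bs_def)
    finally have 1: "\<theta> z = (w \<bullet> axis i 1) * vol_rep e z bs" .
    have "vol_rep e z bs \<noteq> 0" by (rule vol_rep_alternating(3)[OF che zV bs])
    moreover have "w \<bullet> axis i 1 \<noteq> 0"
    proof -
      have Gz: "G z \<in> B" by (rule GV(1)[OF z])
      have dux: "(\<phi> \<circ> cinv c) differentiable (at (snd c ?x))"
        using smooth_on_differentiable[OF su] Gz rG'(2) xV(3)[OF z] by (auto simp: u_def)
      have eq: "((\<lambda>y. snd e y $ i) \<circ> cinv c) y = (\<phi> \<circ> cinv c) y" if "y \<in> B" for y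
      proof -
        have "cinv c y \<in> fst e" using that by (auto simp: e_def)
        then show ?thesis using ereg(2) by simp
      qed
      have Bx: "snd c ?x \<in> B" using Gz xV(3)[OF z] by simp
      note tr = differentiable_transform_open[OF B(1) Bx eq[symmetric] dux]
      have "differential A (\<lambda>y. snd e y $ i) ?x = differential A \<phi> ?x"
      proof -
        have "differential A (\<lambda>y. snd e y $ i) ?x = cov c ?x (gradient ((\<lambda>y. snd e y $ i) \<circ> cinv c) (snd c ?x))"
          by (rule differential_chart[OF ch xV(2)[OF z] tr(1)])
        also have "gradient ((\<lambda>y. snd e y $ i) \<circ> cinv c) (snd c ?x) = gradient (\<phi> \<circ> cinv c) (snd c ?x)"
          by (simp only: gradient_def tr(2))
        also have "cov c ?x (gradient (\<phi> \<circ> cinv c) (snd c ?x)) = differential A \<phi> ?x"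
          by (rule differential_chart[OF ch xV(2)[OF z] dux, symmetric])
        finally show ?thesis .
      qed
      then have "w \<bullet> axis i 1 = blinfun_apply (differential A \<phi> ?x) (N ?x)"
        using differential_coordinate[OF che xV(1)[OF z], of i] cov_apply[OF che xV(1)[OF z], of "axis i 1" "N ?x"]
        by (simp add: w_def inner_commute)
      also have "\<dots> = (1 / conorm g ?x (differential A \<phi> ?x) powr (1 - p)) * g ?x (differential A \<phi> ?x) (differential A \<phi> ?x)"
        by (simp add: N_def area_form_eq(2) blinfun.scaleR_right sharp_apply)
      also have "\<dots> \<noteq> 0"
        using xV(5)[OF z] by (auto simp: regular_set_def conorm_def)
      finally show ?thesis .
    qed
    ultimately show ?thesis using 1 by simp
  qed
  \<comment> \<open>The slice integrand with coefficient \<open>\<kappa>\<close> after the cutoff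
    has become 1 and \<open>sgn\<close> has produced an absolute value; it is used for
    \<open>K\<close> and for \<open>H\<close>.\<close>
  define \<Phi> where "\<Phi> \<kappa> z = f0 z * \<kappa> (cinv e z) * \<bar>\<theta> z\<bar>" for \<kappa> :: "'a \<Rightarrow> real" and z
  have int\<Phi>: "integrable (Pi\<^sub>M (- {i}) (\<lambda>_. lborel)) (\<lambda>y. \<Phi> \<kappa> (slice_point i y))"
    if "continuous_on (V \<inter> ?P) (\<lambda>z. \<kappa> (cinv e z))" for \<kappa>
  proof (rule slice_integrable[where t = t and z\<^sub>0 = z\<^sub>0])
    show "0 < t" using st by simp
    show "\<Phi> \<kappa> z = 0" if "z \<notin> cball z\<^sub>0 t" for z using f0out[OF that] by (simp add: \<Phi>_def)
    show "continuous_on (cball z\<^sub>0 t \<inter> ?P) (\<Phi> \<kappa>)"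
      unfolding \<Phi>_def
      by (intro continuous_intros continuous_on_subset[OF that] continuous_on_subset[OF cont\<theta>]
          continuous_on_subset[OF smooth_on_continuous[OF b(1)]]) (use tV in auto)
  qed
  have form_int: "has_form_integral A \<Sigma> \<omega> \<alpha> (LINT y|Pi\<^sub>M (- {i}) (\<lambda>_. lborel). \<Phi> \<kappa> (slice_point i y))"
    if cont: "continuous_on (V \<inter> ?P) (\<lambda>z. \<kappa> (cinv e z))"
      and val: "\<And>z. z \<in> V \<Longrightarrow> \<alpha> (cinv e z) (frame (cinv e z)) = f (cinv e z) * \<kappa> (cinv e z) * \<theta> z"
      and supp: "\<And>x. x \<in> \<Sigma> \<Longrightarrow> \<alpha> x \<noteq> (\<lambda>_. 0) \<Longrightarrow> f x \<noteq> 0" for \<alpha> \<kappa>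
  proof -
    have "slice_integrand A \<omega> \<alpha> e i \<rho> y = \<Phi> \<kappa> (slice_point i y)" for y
    proof -
      let ?z = "slice_point i y"
      have "slice_integrand A \<omega> \<alpha> e i \<rho> y = (if ?z \<in> V then \<rho> (cinv e ?z) * sgn (\<theta> ?z) * \<alpha> (cinv e ?z) (frame (cinv e ?z)) else 0)"
        unfolding slice_integrand_def Let_def slice_point_def[symmetric] js_def[symmetric] frame_def[symmetric] \<theta>_def ce(2) ..
      also have "\<dots> = \<Phi> \<kappa> ?z"
      proof (cases "?z \<in> V")
        case True
        have fz: "f (cinv e ?z) = f0 ?z" using xV(1,4)[OF True] by (simp add: f_def)
        have "sgn (\<theta> ?z) * (f0 ?z * \<kappa> (cinv e ?z) * \<theta> ?z) = f0 ?z * \<kappa> (cinv e ?z) * \<bar>\<theta> ?z\<bar>"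
          by (simp add: abs_sgn mult_ac)
        moreover have "\<rho> (cinv e ?z) = 1 \<or> f0 ?z = 0" using \<rho>1[of "cinv e ?z"] fz by auto
        ultimately show ?thesis using True val[OF True] fz by (auto simp: \<Phi>_def)
      next
        case False
        then have "f0 ?z = 0" using f0out tV(1) by blast
        then show ?thesis using False by (simp add: \<Phi>_def)
      qed
      finally show ?thesis .
    qed
    then have hb: "has_bochner_integral (Pi\<^sub>M (- {i}) (\<lambda>_. lborel)) (slice_integrand A \<omega> \<alpha> e i \<rho>) (LINT y|Pi\<^sub>M (- {i}) (\<lambda>_. lborel). \<Phi> \<kappa> (slice_point i y))"
      using has_bochner_integral_integrable[OF int\<Phi>[OF cont]] by (simp cong: has_bochner_integral_cong)
    show ?thesis
      unfolding has_form_integral_def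
      by (rule exI[of _ 1], rule exI[of _ "\<lambda>_. e"], rule exI[of _ "\<lambda>_. i"], rule exI[of _ "\<lambda>_. \<rho>"],
          rule exI[of _ "\<lambda>_. LINT y|Pi\<^sub>M (- {i}) (\<lambda>_. lborel). \<Phi> \<kappa> (slice_point i y)"])
        (use slice re hb supp \<rho>1 in auto)
  qed
  have lenfr: "length (frame x) = CARD('n) - 1" for x by (simp add: frame_def ljs)
  have contK': "continuous_on (V \<inter> ?P) (\<lambda>z. K (cinv e z))" by (rule continuous_on_subset[OF contK]) simp
  have I: "has_form_integral A \<Sigma> \<omega> (lie_derivative A (\<lambda>x. f x *\<^sub>R N x) \<omega>) (LINT y|Pi\<^sub>M (- {i}) (\<lambda>_. lborel). \<Phi> K (slice_point i y))"
  proof (rule form_int[OF contK'])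
    show "lie_derivative A (\<lambda>x. f x *\<^sub>R N x) \<omega> (cinv e z) (frame (cinv e z)) = f (cinv e z) * K (cinv e z) * \<theta> z" if "z \<in> V" for z
      using lie_derivative_regular[OF c(1) xV(2)[OF that] U xV(5)[OF that] fe(1) lenfr]
      by (simp add: N_def \<omega>_def K_def u_def \<theta>_def)
    show "f x \<noteq> 0" if "x \<in> \<Sigma>" "lie_derivative A (\<lambda>x. f x *\<^sub>R N x) \<omega> x \<noteq> (\<lambda>_. 0)" for x
      using lie_derivative_vanishes[OF U _ fe(1), of x] that \<Sigma> by (auto simp: N_def \<omega>_def)
  qed
  have J: "has_form_integral A \<Sigma> \<omega> (\<lambda>x vs. f x * H x * \<omega> x vs) (LINT y|Pi\<^sub>M (- {i}) (\<lambda>_. lborel). \<Phi> H (slice_point i y))"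
    by (rule form_int[OF contH]) (auto simp: \<theta>_def)
  have eq: "(LINT y|Pi\<^sub>M (- {i}) (\<lambda>_. lborel). \<Phi> K (slice_point i y)) = (LINT y|Pi\<^sub>M (- {i}) (\<lambda>_. lborel). \<Phi> H (slice_point i y))"
  proof (rule H'(2)[OF fe(1,2) _ I J])
    show "closure {x. f x \<noteq> 0} \<subseteq> regular_set A g \<phi> U"
    proof
      fix x assume "x \<in> closure {x. f x \<noteq> 0}"
      then have "x \<in> fst e" using fe(3,4) by blast
      then show "x \<in> regular_set A g \<phi> U" by (rule ereg(1))
    qed
  qed
  \<comment> \<open>The signed difference of the two integrands: nonnegative on the slice, positive
    near \<open>z\<^sub>0\<close>, with integral 0.\<close>
  define h where "h z = \<sigma> * (\<Phi> K z - \<Phi> H z)" for z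
  have hz: "h z = f0 z * \<delta> z * \<bar>\<theta> z\<bar>" for z by (simp add: h_def \<Phi>_def \<delta>_def algebra_simps)
  have hpos: "h z > 0" if "z $ i = 0" "z \<in> ball z\<^sub>0 s" for z
  proof -
    have "z \<in> V" using that(2) tV by blast
    then show ?thesis
      using \<delta>pos[of z] b(3)[of z] b(4)[of z] \<theta>nz[of z] that tV(3) unfolding hz by (auto intro!: mult_pos_pos)
  qed
  show False
  proof (rule slice_integral_zero[where h = h and i = i and z\<^sub>0 = z\<^sub>0 and s = s])
    show "integrable (Pi\<^sub>M (- {i}) (\<lambda>_. lborel)) (\<lambda>y. h (slice_point i y))"
      unfolding h_def by (intro integrable_mult_right Bochner_Integration.integrable_diff int\<Phi> contK' contH)
    show "(LINT y|Pi\<^sub>M (- {i}) (\<lambda>_. lborel). h (slice_point i y)) = 0"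
      unfolding h_def
      by (simp add: Bochner_Integration.integral_diff[OF int\<Phi>[OF contK'] int\<Phi>[OF contH]] eq)
    show "h z \<ge> 0" if "z $ i = 0" for z
    proof (cases "z \<in> ball z\<^sub>0 s")
      case True
      then show ?thesis using hpos[OF that] by simp
    next
      case False
      then have "f0 z = 0" using b(4) by blast
      then show ?thesis by (simp add: hz)
    qed
  qed (use z0 st hpos in auto)
qed

end

section \<open>Isometries and the contact set\<close>

context charted_manifold
begin

lemma tangent_map_chart:
  assumes c: "is_chart A c" and W: "open W" "x \<in> W" "W \<subseteq> fst c" "\<And>z. z \<in> W \<Longrightarrow> F z \<in> fst c"
    and F: "(\<lambda>y. snd c (F (cinv c y))) differentiable (at (snd c x))"
  shows "tangent_map A F x v = vec_of c (F x) (fd (\<lambda>y. snd c (F (cinv c y))) (snd c x) (comps c x v))"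
proof -
  define d where "d = chart_at A x"
  define k where "k = chart_at A (F x)"
  have d: "d \<in> A" "x \<in> fst d" "is_chart A d" using chart_at atlas_is_chart by (auto simp: d_def)
  have k: "k \<in> A" "F x \<in> fst k" "is_chart A k" using chart_at atlas_is_chart by (auto simp: k_def)
  have xc: "x \<in> fst c" "F x \<in> fst c" using W by auto
  let ?f = "\<lambda>y. snd c (F (cinv c y))"
  have id: "cinv d (snd d x) = x" "cinv c (snd c x) = x" using chart_props(5)[OF d(3,2)] chart_props(5)[OF c xc(1)] by auto
  have "((\<lambda>y. ?f ((snd c \<circ> cinv d) y)) has_derivative (\<lambda>v. fd ?f (snd c x) (tchange d c x v))) (at (snd d x))"
    by (rule has_derivative_compose[OF transition_has_derivative[OF compat_atlas_chart[OF c d(1)] d(2) xc(1)]])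
      (simp add: id fd_works[OF F])
  then have 1: "((\<lambda>y. snd c (F (cinv d y))) has_derivative (\<lambda>v. fd ?f (snd c x) (tchange d c x v))) (at (snd d x))"
  proof (rule has_derivative_transform_within_open[OF _ chart_image_open[OF d(3) chart_props(1)[OF c]]])
    show "snd d x \<in> snd d ` (fst d \<inter> fst c)" using d xc by blast
    show "?f ((snd c \<circ> cinv d) y) = snd c (F (cinv d y))" if "y \<in> snd d ` (fst d \<inter> fst c)" for y
      using that chart_props(5)[OF d(3)] chart_props(5)[OF c] by auto
  qed
  have "((\<lambda>y. (snd k \<circ> cinv c) (snd c (F (cinv d y)))) has_derivative
      (\<lambda>v. tchange c k (F x) (fd ?f (snd c x) (tchange d c x v)))) (at (snd d x))"
    by (rule has_derivative_compose[OF 1])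
      (simp only: id, rule transition_has_derivative[OF compat_chart_atlas[OF c k(1)] xc(2) k(2)])
  then have "((snd k \<circ> F \<circ> cinv d) has_derivative (\<lambda>v. tchange c k (F x) (fd ?f (snd c x) (tchange d c x v)))) (at (snd d x))"
  proof (rule has_derivative_transform_within_open[OF _ chart_image_open[OF d(3) W(1)]])
    show "snd d x \<in> snd d ` (fst d \<inter> W)" using d W by blast
    show "(snd k \<circ> cinv c) (snd c (F (cinv d y))) = (snd k \<circ> F \<circ> cinv d) y" if "y \<in> snd d ` (fst d \<inter> W)" for y
      using that chart_props(5)[OF d(3)] chart_props(5)[OF c] W(4) by auto
  qed
  from fd_eq[OF this] show ?thesis
    unfolding tangent_map_def d_def[symmetric] k_def[symmetric] by simp
qed

end

lemma adjoint_inner: "linear f \<Longrightarrow> adjoint f r \<bullet> h = r \<bullet> f h"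
  for f :: "'a::euclidean_space \<Rightarrow> 'b::euclidean_space"
  using adjoint_works[of f h r] by (simp add: inner_commute)

section \<open>Isometries in a chart, and tangency to the contact set\<close>

context subriemannian_manifold
begin

text \<open>In the components of one chart, pulling back a covector is the adjoint of the derivative
  \<open>L\<close>; the preferred charts at \<open>x\<close> and \<open>F x\<close> cancel.\<close>

lemma isometry_rep:
  assumes c: "is_chart A c" and W: "open W" "x \<in> W" "W \<subseteq> fst c" "\<And>z. z \<in> W \<Longrightarrow> F z \<in> fst c"
    and F: "(\<lambda>y. snd c (F (cinv c y))) differentiable (at (snd c x))"
    and iso: "\<And>w e. g x (pullback_covector A F x w) (pullback_covector A F x e) = g (F x) w e"
    and vp: "\<And>vs. vol (F x) (map (tangent_map A F x) vs) = vol x vs"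
  defines "L \<equiv> fd (\<lambda>y. snd c (F (cinv c y))) (snd c x)"
  shows "cometric_rep c (snd c (F x)) r s = cometric_rep c (snd c x) (adjoint L r) (adjoint L s)"
    "vol_rep c (snd c (F x)) (map L vs) = vol_rep c (snd c x) vs"
proof -
  have xc: "x \<in> fst c" "F x \<in> fst c" using W by auto
  note i = chart_props(5)[OF c xc(1)] chart_props(5)[OF c xc(2)]
  have lin: "linear L" unfolding L_def by (rule linear_frechet_derivative[OF F])
  note tm = tangent_map_chart[OF c W F, folded L_def]
  have "pullback_covector A F x (cov c (F x) r) = cov c x (adjoint L r)" for r
  proof -
    have "(\<lambda>v. blinfun_apply (cov c (F x) r) (tangent_map A F x v)) = (\<lambda>v. adjoint L r \<bullet> comps c x v)"
      using c xc by (simp add: fun_eq_iff tm cov_apply adjoint_inner[OF lin])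
    then show ?thesis by (simp add: pullback_covector_def cov_def)
  qed
  then show "cometric_rep c (snd c (F x)) r s = cometric_rep c (snd c x) (adjoint L r) (adjoint L s)"
    using iso[of "cov c (F x) r" "cov c (F x) s"] by (simp add: cometric_rep_def i)
  have "map (vec_of c (F x)) (map L vs) = map (tangent_map A F x) (map (vec_of c x) vs)"
    using c xc by (simp add: tm)
  then show "vol_rep c (snd c (F x)) (map L vs) = vol_rep c (snd c x) vs"
    unfolding form_rep_def i using vp[of "map (vec_of c x) vs"] by (simp only:)
qed

text \<open>The constant \<open>a\<close> disappears from the differential, so \<open>du\<close> is
  invariant under \<open>F\<close>. As the cometric is preserved, the flux field is related to
  itself by \<open>F\<close>; as the volume is preserved, its divergence is invariant, by naturality
  of the Lie derivative of the volume form.\<close>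

lemma curvature_rep_natural:
  assumes c: "c \<in> A" and U: "open U" "smooth_fun A U \<phi>"
  defines "u \<equiv> \<phi> \<circ> cinv c"
    and "R \<equiv> {y \<in> snd c ` (fst c \<inter> U). (y, gradient (\<phi> \<circ> cinv c) y) \<in> flux_dom c}"
  assumes S: "open S" "smooth_on S F" "S \<subseteq> R" "\<And>y. y \<in> S \<Longrightarrow> F y \<in> R"
    and iso: "\<And>y r s. y \<in> S \<Longrightarrow> cometric_rep c (F y) r s = cometric_rep c y (adjoint (fd F y) r) (adjoint (fd F y) s)"
    and vp: "\<And>y vs. y \<in> S \<Longrightarrow> vol_rep c (F y) (map (fd F y) vs) = vol_rep c y vs"
    and shift: "\<And>y. y \<in> S \<Longrightarrow> u (F y) = u y - a" and y: "y \<in> S"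
  shows "curvature_rep c p u (F y) = curvature_rep c p u y"
proof -
  note ch = atlas_is_chart[OF c]
  note rc = regular_chart[OF c U, folded u_def, folded R_def[folded u_def]]
  have Ru: "R = {y \<in> snd c ` (fst c \<inter> U). (y, gradient u y) \<in> flux_dom c}" by (simp add: R_def u_def)
  note rc = regular_chart[OF c U, folded u_def, folded Ru]
  define \<nu> where "\<nu> y = flux c p (y, gradient u y)" for y
  have RD: "z \<in> snd c ` fst c" if "z \<in> R" for z using rc(3) that by blast
  have su: "smooth_on R u" using rc(2,3) by (rule smooth_on_subset)
  have du: "u differentiable at z" if "z \<in> R" for z by (rule smooth_on_differentiable[OF su that])
  have dF: "(F has_derivative fd F z) (at z)" if "z \<in> S" for z by (rule smooth_on_has_derivative[OF S(2) that])
  have lF: "linear (fd F z)" if "z \<in> S" for z using dF[OF that] by (rule has_derivative_linear)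
  have grad: "gradient u z = adjoint (fd F z) (gradient u (F z))" if z: "z \<in> S" for z
  proof (rule vector_eq_ldot[THEN iffD1], rule allI)
    fix h
    have "((\<lambda>z. u (F z)) has_derivative (\<lambda>h. fd u (F z) (fd F z h))) (at z)"
      by (rule has_derivative_compose[OF dF[OF z] fd_works[OF du[OF S(4)[OF z]]]])
    moreover have "((\<lambda>z. u (F z)) has_derivative fd u z) (at z)"
    proof (rule has_derivative_transform_within_open[OF _ S(1) z])
      have "z \<in> R" using z S(3) by blast
      then show "((\<lambda>z. u z - a) has_derivative fd u z) (at z)"
        using has_derivative_diff[OF fd_works[OF du] has_derivative_const, of z a] by simp
    qed (simp add: shift)
    ultimately have "(\<lambda>h. fd u (F z) (fd F z h)) = fd u z" by (rule has_derivative_unique)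
    then have "fd u (F z) (fd F z h) = fd u z h" by (rule fun_cong)
    moreover have "gradient u z \<bullet> h = fd u z h" using du S(3) z by (intro gradient_inner) blast
    moreover have "gradient u (F z) \<bullet> fd F z h = fd u (F z) (fd F z h)" by (rule gradient_inner[OF du[OF S(4)[OF z]]])
    ultimately show "h \<bullet> gradient u z = h \<bullet> adjoint (fd F z) (gradient u (F z))"
      by (simp add: adjoint_inner[OF lF[OF z]] inner_commute[of h])
  qed
  have rel: "\<nu> (F z) = fd F z (\<nu> z)" if z: "z \<in> S" for z
  proof (rule vector_eq_ldot[THEN iffD1], rule allI)
    fix r
    have D: "z \<in> snd c ` fst c" "F z \<in> snd c ` fst c" using RD S z by blast+
    define q where "q = gradient u (F z)"
    have gz: "gradient u z = adjoint (fd F z) q" using grad[OF z] by (simp add: q_def)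
    have s: "sharp_rep c (F z) q \<bullet> q = sharp_rep c z (gradient u z) \<bullet> gradient u z"
      by (simp add: sharp_rep_inner[OF ch D(1)] sharp_rep_inner[OF ch D(2)] iso[OF z] gz)
    have "r \<bullet> fd F z (sharp_rep c z (gradient u z)) = adjoint (fd F z) r \<bullet> sharp_rep c z (gradient u z)"
      by (simp add: adjoint_inner[OF lF[OF z]])
    also have "\<dots> = sharp_rep c z (gradient u z) \<bullet> adjoint (fd F z) r" by (rule inner_commute)
    also have "\<dots> = sharp_rep c (F z) q \<bullet> r"
      by (simp add: sharp_rep_inner[OF ch D(1)] sharp_rep_inner[OF ch D(2)] iso[OF z] gz)
    finally have "r \<bullet> fd F z (sharp_rep c z (gradient u z)) = r \<bullet> sharp_rep c (F z) q" by (simp add: inner_commute)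
    then show "r \<bullet> \<nu> (F z) = r \<bullet> fd F z (\<nu> z)"
      by (simp add: \<nu>_def flux_def linear_scale[OF lF[OF z]] s flip: q_def)
  qed
  have s\<nu>: "\<nu> differentiable at z" if "z \<in> R" for z
    using smooth_on_differentiable[OF rc(5) that] unfolding \<nu>_def by simp
  have yR: "y \<in> R" "F y \<in> R" using y S by auto
  have vd: "(\<lambda>z. vol_rep c z vs) differentiable at z" if "z \<in> R" for z vs
    using fd_top_form[OF chart_props(2)[OF ch] RD[OF that] vol_rep_alternating(1)[OF ch] vol_rep_alternating(2)[OF ch RD[OF that]]
        smooth_on_differentiable[OF vol_rep_smooth[OF c] RD[OF that]]] by (rule differentiableI)
  have top: "lie_rep \<nu> (vol_rep c) z vs = divergence_rep (vol_rep c) \<nu> z * vol_rep c z vs"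
    if "z \<in> R" "length vs = CARD('n)" for z vs
    by (rule lie_rep_top_form[OF chart_props(2)[OF ch] RD[OF that(1)] vol_rep_alternating(1)[OF ch]
        vol_rep_alternating(2)[OF ch RD[OF that(1)]] smooth_on_differentiable[OF vol_rep_smooth[OF c] RD[OF that(1)]]
        s\<nu>[OF that(1)] that(2)])
  have "lie_rep \<nu> (vol_rep c) y std_frame = lie_rep \<nu> (vol_rep c) (F y) (map (fd F y) std_frame)"
  proof (rule lie_rep_natural[OF S(1) smooth_on_Ck[OF S(2)] y s\<nu>[OF yR(1)] s\<nu>[OF yR(2)] rel _ _ vd[OF yR(2)] std_frame(3)])
    show "vol_rep c z vs = vol_rep c (F z) (map (fd F z) vs)" if "z \<in> S" for z vs using vp[OF that] by simp
    show "multilinear CARD('n) (vol_rep c (F z))" if "z \<in> S" for z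
      by (rule alternating_form_multilinear[OF vol_rep_alternating(1)[OF ch RD[OF S(4)[OF that]]]])
  qed
  then have "divergence_rep (vol_rep c) \<nu> y * vol_rep c y std_frame = divergence_rep (vol_rep c) \<nu> (F y) * vol_rep c (F y) (map (fd F y) std_frame)"
    using top[OF yR(1) std_frame(3)] top[OF yR(2), of "map (fd F y) std_frame"] std_frame(3)[where ?'n = 'n] by simp
  then have "divergence_rep (vol_rep c) \<nu> y = divergence_rep (vol_rep c) \<nu> (F y)"
    using vp[OF y] vol_rep_alternating(2)[OF ch RD[OF yR(1)]] by simp
  then show ?thesis unfolding curvature_rep_def \<nu>_def[abs_def] by simp
qed

text \<open>The Hopf argument makes the principal part vanish in the direction \<open>N\<close>; by
  \<open>flux_ellipticity\<close> a horizontal vector annihilated by \<open>dv\<close> is then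
  orthogonal to \<open>N\<close>.\<close>

lemma contact_set_tangent:
  assumes c: "c \<in> A" and p: "p \<ge> 0" and D: "open D" "D \<subseteq> snd c ` fst c" "smooth_on D u" "smooth_on D v"
    and reg: "\<And>y. y \<in> D \<Longrightarrow> (y, gradient u y) \<in> flux_dom c" "\<And>y. y \<in> D \<Longrightarrow> (y, gradient v y) \<in> flux_dom c"
    and le: "\<And>y. y \<in> D \<Longrightarrow> curvature_rep c p v y \<le> curvature_rep c p u y"
    and ge: "\<And>y. y \<in> D \<Longrightarrow> u y \<le> v y"
    and Z: "\<And>y. y \<in> D \<Longrightarrow> y \<in> Z \<longleftrightarrow> v y = u y" and \<Omega>: "\<Omega> \<subseteq> D"
    and X: "\<And>y. y \<in> \<Omega> \<Longrightarrow> X y \<in> range (sharp_rep c y)" "\<And>y. y \<in> \<Omega> \<Longrightarrow> gradient v y \<bullet> X y = 0"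
  shows "tangent_on Z \<Omega> X"
  unfolding tangent_on_def
proof (intro ballI allI impI)
  fix z N assume z: "z \<in> Z \<inter> \<Omega>" and N: "\<forall>x\<in>Z. norm N \<le> norm (x - (z + N))"
  note ch = atlas_is_chart[OF c]
  show "X z \<bullet> N = 0"
  proof (cases "N = 0")
    case False
    \<comment> \<open>Half the radius: the closed ball about \<open>c'\<close> meets the sphere
      about \<open>z + N\<close> only in \<open>z\<close>, so it contains no other contact
      point.\<close>
    define c' where "c' = z + (1/2) *\<^sub>R N"
    define \<beta> where "\<beta> = (\<lambda>y. (1 / vol_rep c y std_frame) *\<^sub>R gradient (\<lambda>y. vol_rep c y std_frame) y)"
    have zD: "z \<in> D" using z \<Omega> by blast
    have "fd (flux c p) (z, gradient v z) (0, c' - z) \<bullet> (c' - z) = 0"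
    proof (rule strong_maximum_hopf[OF D(1) smooth_on_Ck[OF D(3)] smooth_on_Ck[OF D(4)] flux_smooth(1)[OF c]
          smooth_on_Ck[OF flux_smooth(2)[OF c]] reg, where \<beta> = \<beta>])
      have vs: "smooth_on D (\<lambda>y. vol_rep c y std_frame)" using vol_rep_smooth[OF c] D(2) by (rule smooth_on_subset)
      have nz: "vol_rep c y std_frame \<noteq> 0" if "y \<in> D" for y using vol_rep_alternating(2)[OF ch] that D(2) by blast
      show "continuous_on D \<beta>"
        unfolding \<beta>_def
        by (intro smooth_on_continuous smooth_on_scaleR smooth_on_divide smooth_on_gradient smooth_on_const D(1) vs nz)
      show "quasilinear_op (flux c p) \<beta> v y \<le> quasilinear_op (flux c p) \<beta> u y" if "y \<in> D" for y
      proof -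
        have "y \<in> snd c ` fst c" using D(2) that by blast
        then show ?thesis using le[OF that] curvature_rep_quasilinear[OF c] unfolding \<beta>_def by simp
      qed
      show "u y < v y" if y: "y \<in> D" "norm (y - c') \<le> norm (z - c')" "y \<noteq> z" for y
      proof (rule ccontr)
        assume "\<not> u y < v y"
        then have "y \<in> Z" using ge[OF y(1)] Z[OF y(1)] by simp
        then have "norm N \<le> norm (y - (z + N))" using N by blast
        define d where "d = y - z"
        have 1: "norm N \<le> norm (d - N)" using \<open>norm N \<le> _\<close> by (simp add: d_def algebra_simps)
        have 2: "norm (d - (1/2) *\<^sub>R N) \<le> norm ((1/2) *\<^sub>R N)"
          using y(2) by (simp add: d_def c'_def algebra_simps)
        from power_mono[OF 1, of 2] have "2 * (d \<bullet> N) \<le> d \<bullet> d"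
          by (simp add: power2_norm_eq_inner inner_diff_left inner_diff_right inner_commute)
        moreover from power_mono[OF 2, of 2] have "d \<bullet> d \<le> d \<bullet> N"
          unfolding power2_norm_eq_inner by (simp add: inner_diff_left inner_diff_right inner_commute)
        ultimately have "d \<bullet> d \<le> 0" by linarith
        then have "d = 0" by (metis inner_ge_zero inner_eq_zero_iff order_antisym)
        then show False using y(3) by (simp add: d_def)
      qed
      show "v z = u z" using Z[OF zD] z by simp
      show "c' \<noteq> z" using False by (simp add: c'_def)
      show "u y \<le> v y" if "y \<in> D" for y by (rule ge[OF that])
      show "z \<in> D" by (rule zD)
      show "fd (flux c p) x (0, \<eta>) \<bullet> \<zeta> = fd (flux c p) x (0, \<zeta>) \<bullet> \<eta>" if "x \<in> flux_dom c" for x \<eta> \<zeta>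
        by (rule flux_ellipticity(1)[OF c that p])
      show "0 \<le> fd (flux c p) x (0, \<eta>) \<bullet> \<eta>" if "x \<in> flux_dom c" for x \<eta>
        by (rule flux_ellipticity(2)[OF c that p])
    qed
    from flux_ellipticity(3)[OF c reg(2)[OF zD] p this, of "X z"] X z
    have "X z \<bullet> (c' - z) = 0" by auto
    then show ?thesis by (simp add: c'_def)
  qed simp
qed

end

text \<open>Functionals dual to the vectors at \<open>y\<^sub>0\<close> are nearly dual at nearby
  points. A relation there bounds each coefficient by \<open>\<epsilon>\<close> times the sum of
  their absolute values, so that sum is at most \<open>r * \<epsilon>\<close> times itself.\<close>

lemma independent_near:
  fixes X :: "nat \<Rightarrow> 'a::euclidean_space \<Rightarrow> 'b::euclidean_space"
  assumes cont: "\<And>k. k < r \<Longrightarrow> continuous (at y\<^sub>0) (X k)"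
    and ind: "\<And>a. (\<Sum>k<r. a k *\<^sub>R X k y\<^sub>0) = 0 \<Longrightarrow> \<forall>k<r. a k = 0"
  shows "\<forall>\<^sub>F y in nhds y\<^sub>0. \<forall>a. (\<Sum>k<r. a k *\<^sub>R X k y) = 0 \<longrightarrow> (\<forall>k<r. a k = 0)"
proof -
  let ?x = "\<lambda>k. X k y\<^sub>0"
  have inj: "inj_on ?x {..<r}"
  proof (rule inj_onI, rule ccontr)
    fix j k assume jk: "j \<in> {..<r}" "k \<in> {..<r}" "?x j = ?x k" "j \<noteq> k"
    let ?a = "\<lambda>i. (if i = j then 1 else 0) - (if i = k then 1 else 0 :: real)"
    have "(\<Sum>i<r. ?a i *\<^sub>R ?x i) = (\<Sum>i<r. if i = j then ?x i else 0) - (\<Sum>i<r. if i = k then ?x i else 0)"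
      unfolding sum_subtractf[symmetric] by (intro sum.cong) (auto simp: scaleR_diff_left)
    also have "\<dots> = 0" using jk by simp
    finally show False using ind[of ?a] jk by auto
  qed
  have "independent (?x ` {..<r})"
  proof (rule independent_if_scalars_zero)
    fix f x assume f: "(\<Sum>x\<in>?x ` {..<r}. f x *\<^sub>R x) = 0" and "x \<in> ?x ` {..<r}"
    then show "f x = 0" using ind[of "\<lambda>k. f (?x k)"] by (auto simp: sum.reindex[OF inj])
  qed simp
  have "\<exists>f. linear f \<and> (\<forall>k<r. f (?x k) = (if k = j then 1 else (0::real)))" for j
  proof -
    define h where "h = (\<lambda>x. if the_inv_into {..<r} ?x x = j then 1 else (0::real))"
    from linear_independent_extend[OF \<open>independent _\<close>, of h]
    obtain f where f: "linear f" "\<forall>x\<in>?x ` {..<r}. f x = h x" by (elim exE conjE)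
    have "f (?x k) = (if k = j then 1 else 0)" if "k < r" for k
      using f(2) that the_inv_into_f_f[OF inj, of k] by (simp add: h_def)
    then show ?thesis using f(1) by (intro exI[of _ f]) simp
  qed
  then have "\<forall>j. \<exists>f. linear f \<and> (\<forall>k<r. f (?x k) = (if k = j then 1 else (0::real)))" by blast
  from choice[OF this] obtain f where f': "\<forall>j. linear (f j) \<and> (\<forall>k<r. f j (?x k) = (if k = j then 1 else (0::real)))" by blast
  have f: "linear (f j)" "k < r \<Longrightarrow> f j (?x k) = (if k = j then 1 else (0::real))" for j k
    using f' by blast+
  \<comment> \<open>Chosen for \<open>r * \<epsilon> < 1\<close>; adding 1 covers
    \<open>r = 0\<close>.\<close>
  define \<epsilon> where "\<epsilon> = 1 / (real r + 1)"
  have \<epsilon>: "\<epsilon> > 0" "real r * \<epsilon> < 1" by (auto simp: \<epsilon>_def)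
  have "\<forall>\<^sub>F y in nhds y\<^sub>0. \<forall>j\<in>{..<r}. \<forall>k\<in>{..<r}. dist (f j (X k y)) (f j (?x k)) < \<epsilon>"
  proof (intro eventually_ball_finite ballI)
    fix j k assume "j \<in> {..<r}" "k \<in> {..<r}"
    have bl: "bounded_linear (f j)" using f(1) by (simp add: linear_conv_bounded_linear)
    have "(X k \<longlongrightarrow> ?x k) (nhds y\<^sub>0)" using cont[of k] \<open>k \<in> _\<close> by (simp add: isCont_def tendsto_nhds_iff)
    from tendstoD[OF bounded_linear.tendsto[OF bl this] \<epsilon>(1)]
    show "\<forall>\<^sub>F y in nhds y\<^sub>0. dist (f j (X k y)) (f j (?x k)) < \<epsilon>" .
  qed auto
  then show ?thesis
  proof eventually_elim
    case (elim y)
    show ?case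
    proof (intro allI impI)
      fix a :: "nat \<Rightarrow> real" and k assume z: "(\<Sum>k<r. a k *\<^sub>R X k y) = 0" and k: "k < r"
      have aj: "\<bar>a j\<bar> \<le> (\<Sum>k<r. \<epsilon> * \<bar>a k\<bar>)" if j: "j < r" for j
      proof -
        have "0 = f j (\<Sum>k<r. a k *\<^sub>R X k y)" using z linear_0[OF f(1)] by simp
        also have "\<dots> = (\<Sum>k<r. a k * f j (X k y))" by (simp add: linear_sum[OF f(1)] linear_scale[OF f(1)])
        also have "\<dots> = (\<Sum>k<r. a k * (f j (X k y) - f j (?x k))) + (\<Sum>k<r. a k * f j (?x k))"
          by (simp add: right_diff_distrib sum_subtractf)
        also have "(\<Sum>k<r. a k * f j (?x k)) = (\<Sum>k<r. if k = j then a k else 0)"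
          by (intro sum.cong) (auto simp: f(2))
        also have "\<dots> = a j" using j by simp
        finally have "\<bar>a j\<bar> = \<bar>\<Sum>k<r. a k * (f j (X k y) - f j (?x k))\<bar>" by linarith
        also have "\<dots> \<le> (\<Sum>k<r. \<bar>a k * (f j (X k y) - f j (?x k))\<bar>)" by (rule sum_abs)
        also have "\<dots> \<le> (\<Sum>k<r. \<epsilon> * \<bar>a k\<bar>)"
        proof (rule sum_mono)
          fix k assume "k \<in> {..<r}"
          then have "\<bar>f j (X k y) - f j (?x k)\<bar> \<le> \<epsilon>" using elim j by (auto simp: dist_real_def less_imp_le)
          then show "\<bar>a k * (f j (X k y) - f j (?x k))\<bar> \<le> \<epsilon> * \<bar>a k\<bar>"
            unfolding abs_mult mult.commute[of \<epsilon>] by (rule mult_left_mono) simp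
        qed
        finally show ?thesis .
      qed
      define S where "S = (\<Sum>k<r. \<bar>a k\<bar>)"
      have "S \<le> (\<Sum>j<r. \<epsilon> * S)" unfolding S_def sum_distrib_left by (rule sum_mono) (use aj in auto)
      then have "S \<le> (real r * \<epsilon>) * S" by simp
      moreover have "S \<ge> 0" unfolding S_def by (rule sum_nonneg) simp
      ultimately have "S = 0" using \<epsilon>(2) by (metis mult_le_cancel_right1 not_le order_antisym)
      then show "a k = 0" using k unfolding S_def by (subst (asm) sum_nonneg_eq_0_iff) auto
    qed
  qed
qed

text \<open>Every element of the range differs by a multiple of \<open>G q\<close> from one
  orthogonal to \<open>q\<close>, so these have codimension at most one. Preimages
  \<open>\<eta>\<close> are recorded because later \<open>G\<close> varies with the point while
  \<open>\<eta>\<close> stays constant.\<close>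

lemma constrained_basis:
  fixes G :: "'a::euclidean_space \<Rightarrow> 'a"
  assumes G: "linear G" and q: "G q \<bullet> q \<noteq> 0" and r: "r < dim (range G)"
  shows "\<exists>\<eta>::nat \<Rightarrow> 'a. (\<forall>k<r. G (\<eta> k) \<bullet> q = 0) \<and> (\<forall>a. (\<Sum>k<r. a k *\<^sub>R G (\<eta> k)) = 0 \<longrightarrow> (\<forall>k<r. a k = 0))"
proof -
  define H where "H = {x \<in> range G. x \<bullet> q = 0}"
  have "range G \<subseteq> span (insert (G q) H)"
  proof
    fix x assume x: "x \<in> range G"
    then obtain w where w: "x = G w" by blast
    define t where "t = (x \<bullet> q) / (G q \<bullet> q)"
    have "x - t *\<^sub>R G q = G (w - t *\<^sub>R q)" by (simp add: w linear_diff[OF G] linear_scale[OF G])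
    moreover have "(x - t *\<^sub>R G q) \<bullet> q = 0" using q by (simp add: inner_diff_left t_def)
    ultimately have "x - t *\<^sub>R G q \<in> H" by (simp add: H_def)
    then have "x - t *\<^sub>R G q + t *\<^sub>R G q \<in> span (insert (G q) H)"
      by (intro span_add span_scale span_base) auto
    then show "x \<in> span (insert (G q) H)" by simp
  qed
  then have "dim (range G) \<le> dim (insert (G q) H)" by (metis dim_span dim_subset)
  also have "\<dots> \<le> Suc (dim H)" by (simp add: dim_insert)
  finally have "r \<le> dim H" using r by simp
  obtain B where B: "B \<subseteq> H" "independent B" "card B = dim H" using basis_exists by metis
  have fB: "finite B" using B(2) by (rule independent_imp_finite)
  obtain x where x: "bij_betw x {0..<card B} B" using ex_bij_betw_nat_finite[OF fB] by blast
  have xk: "x k \<in> B" if "k < r" for k using x that \<open>r \<le> dim H\<close> B(3) by (auto simp: bij_betw_def)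
  have "\<forall>k. \<exists>\<eta>. k < r \<longrightarrow> x k = G \<eta>" using xk B(1) by (auto simp: H_def)
  then obtain \<eta> where \<eta>: "\<And>k. k < r \<Longrightarrow> x k = G (\<eta> k)" by metis
  have "inj_on x {0..<card B}" using x by (rule bij_betw_imp_inj_on)
  then have inj: "inj_on x {..<r}" by (rule inj_on_subset) (use \<open>r \<le> dim H\<close> B(3) in auto)
  have ind: "independent (x ` {..<r})" using B(2) by (rule independent_mono) (use xk in auto)
  have "a k = 0" if z: "(\<Sum>k<r. a k *\<^sub>R G (\<eta> k)) = 0" and k: "k < r" for a k
  proof -
    define f where "f y = a (the_inv_into {..<r} x y)" for y
    have f: "f (x j) = a j" if "j < r" for j using the_inv_into_f_f[OF inj, of j] that by (simp add: f_def)
    have "(\<Sum>y\<in>x ` {..<r}. f y *\<^sub>R y) = (\<Sum>k<r. f (x k) *\<^sub>R x k)" by (simp add: sum.reindex[OF inj])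
    also have "\<dots> = (\<Sum>k<r. a k *\<^sub>R G (\<eta> k))"
      by (intro sum.cong refl) (simp add: f flip: \<eta>)
    finally have "(\<Sum>y\<in>x ` {..<r}. f y *\<^sub>R y) = 0" using z by simp
    from independentD[OF ind _ _ this, of "x k"] k have "f (x k) = 0" by simp
    then show "a k = 0" using f[OF k] by simp
  qed
  moreover have "G (\<eta> k) \<bullet> q = 0" if "k < r" for k using xk[OF that] B(1) \<eta>[OF that] by (auto simp: H_def)
  ultimately show ?thesis by blast
qed

text \<open>A point off \<open>Z\<close> and a nearest point of \<open>Z\<close> yield a nonzero
  proximal normal. The radius is halved so that the nearest point still lies in the ball where such
  normals are excluded.\<close>

lemma no_normals_imp_ball:
  fixes Z :: "'a::euclidean_space set"
  assumes Z: "closed Z" "y\<^sub>0 \<in> Z"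
    and no: "\<And>z N. z \<in> Z \<Longrightarrow> z \<in> ball y\<^sub>0 R \<Longrightarrow> \<forall>x\<in>Z. norm N \<le> norm (x - (z + N)) \<Longrightarrow> N = 0"
  shows "ball y\<^sub>0 (R / 2) \<subseteq> Z"
proof
  fix y assume y: "y \<in> ball y\<^sub>0 (R / 2)"
  obtain z where z: "z \<in> Z" "\<And>x. x \<in> Z \<Longrightarrow> dist y z \<le> dist y x"
    using distance_attains_inf[OF Z(1), of y] Z(2) by blast
  have "dist y\<^sub>0 z \<le> dist y\<^sub>0 y + dist y z" by (rule dist_triangle)
  also have "\<dots> < R" using z(2)[OF Z(2)] y by (simp add: dist_commute)
  finally have "z \<in> ball y\<^sub>0 R" by simp
  moreover have "\<forall>x\<in>Z. norm (y - z) \<le> norm (x - (z + (y - z)))"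
    using z(2) by (simp add: dist_norm norm_minus_commute[of y])
  ultimately have "y - z = 0" using no[OF z(1)] by blast
  then show "y \<in> Z" using z(1) by simp
qed

text \<open>\<open>q\<close> is orthogonal to \<open>S\<close> but not to \<open>T\<close>, so
  \<open>T\<close> supplies the one dimension that \<open>S\<close> may lack; \<open>N\<close> is
  orthogonal to a spanning set and hence to itself.\<close>

lemma complement_normal_zero:
  fixes S :: "'a::euclidean_space set"
  assumes S: "DIM('a) \<le> Suc (dim S)" "\<And>x. x \<in> S \<Longrightarrow> x \<bullet> N = 0" "\<And>x. x \<in> S \<Longrightarrow> x \<bullet> q = 0"
    and T: "T \<bullet> N = 0" "T \<bullet> q \<noteq> 0"
  shows "N = 0"
proof -
  have "orthogonal q x" if "x \<in> span S" for x
    by (rule orthogonal_to_span[OF that]) (simp add: orthogonal_def inner_commute[of q] S(3))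
  then have "T \<notin> span S" using T(2) by (auto simp: orthogonal_def inner_commute[of q])
  then have "dim (insert T S) = Suc (dim S)" by (simp add: dim_insert)
  then have "dim (insert T S) = DIM('a)" using S(1) dim_subset_UNIV[of "insert T S"] by simp
  then have "span (insert T S) = UNIV" by (simp add: dim_eq_full)
  then have "N \<in> span (insert T S)" by simp
  moreover have "orthogonal N x" if "x \<in> insert T S" for x
    using that S(2) T(1) by (auto simp: orthogonal_def inner_commute[of N])
  ultimately have "orthogonal N N" using orthogonal_to_span by blast
  then show ?thesis by (simp add: orthogonal_def)
qed

section \<open>The Lie module in a chart\<close>

context charted_manifold
begin

lemma smooth_vector_fieldI_chart:
  assumes c: "is_chart A c" and V: "open V" "V \<subseteq> fst c" and X: "smooth_on (snd c ` V) (vector_rep A c X)"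
  shows "smooth_vector_field A V X"
  unfolding smooth_vector_field_def
proof (intro ballI allI)
  fix d i assume d: "d \<in> A"
  note dc = atlas_is_chart[OF d]
  let ?W = "fst d \<inter> V"
  have W: "open ?W" "?W \<subseteq> fst c" using V chart_props(1)[OF dc] by auto
  have oS: "open (snd c ` ?W)" by (rule chart_image_open_subset[OF c W])
  have T: "smooth_on (snd c ` ?W) (snd d \<circ> cinv c)"
    using compat_chart_atlas[OF c d] V(2) unfolding compat_def by (elim conjE) (rule smooth_on_subset, auto)
  have X': "smooth_on (snd c ` ?W) (vector_rep A c X)" using X by (rule smooth_on_subset) auto
  have "smooth_on (snd c ` ?W) (\<lambda>y. fd (snd d \<circ> cinv c) y (vector_rep A c X y) \<bullet> axis i 1)"
    by (rule smooth_on_inner[OF oS smooth_on_fd[OF oS T X'] smooth_on_const])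
  then have "smooth_on (snd c ` ?W) ((\<lambda>x. blinfun_apply (differential A (\<lambda>y. snd d y $ i) x) (X x)) \<circ> cinv c)"
  proof (rule smooth_on_transform[OF oS])
    fix y assume y: "y \<in> snd c ` ?W"
    obtain x where x: "x \<in> fst d" "x \<in> fst c" "y = snd c x" using y V(2) by blast
    have i: "cinv c y = x" using x chart_props(5)[OF c x(2)] by simp
    have "fd (snd d \<circ> cinv c) y (vector_rep A c X y) = tchange c d x (comps c x (X x))"
      by (simp add: tchange_def vector_rep_apply i x(3)[symmetric])
    also have "\<dots> = comps d x (X x)" by (rule comps_change(1)[OF c d x(2,1)])
    finally show "((\<lambda>x. blinfun_apply (differential A (\<lambda>y. snd d y $ i) x) (X x)) \<circ> cinv c) y =
        fd (snd d \<circ> cinv c) y (vector_rep A c X y) \<bullet> axis i 1"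
      by (simp add: i differential_coordinate[OF dc x(1)] cov_apply[OF dc x(1)] inner_commute)
  qed
  from smooth_funI_chart[OF c W this]
  show "smooth_fun A ?W (\<lambda>x. blinfun_apply (differential A (\<lambda>y. snd d y $ i) x) (X x))" .
qed

text \<open>Induction over the module. Smoothness is carried along because the bracket step asks for
  it, and the kernel of \<open>dv\<close> for the sake of the final dimension count.\<close>

lemma lie_module_tangent:
  assumes c: "c \<in> A" and \<Omega>: "open \<Omega>" "\<Omega> \<subseteq> snd c ` fst c" and Z: "closed Z" and v: "smooth_on \<Omega> v"
    and X: "\<And>k. k < r \<Longrightarrow> smooth_on \<Omega> (vector_rep A c (X k))" "\<And>k. k < r \<Longrightarrow> tangent_on Z \<Omega> (vector_rep A c (X k))"
      "\<And>k y. k < r \<Longrightarrow> y \<in> \<Omega> \<Longrightarrow> gradient v y \<bullet> vector_rep A c (X k) y = 0"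
    and Y: "Y \<in> lie_module A (cinv c ` \<Omega>) r X"
  shows "smooth_on \<Omega> (vector_rep A c Y) \<and> tangent_on Z \<Omega> (vector_rep A c Y) \<and>
    (\<forall>y\<in>\<Omega>. gradient v y \<bullet> vector_rep A c Y y = 0)"
proof -
  note ch = atlas_is_chart[OF c]
  have lin: "linear (comps c (cinv c y))" if "y \<in> \<Omega>" for y using comps_linear[OF ch chart_props(7)[OF ch]] \<Omega>(2) that by blast
  have tcong: "tangent_on Z \<Omega> F'" if "tangent_on Z \<Omega> F" "\<And>y. y \<in> \<Omega> \<Longrightarrow> F' y = F y" for F F' :: "real^'n \<Rightarrow> real^'n"
    using that unfolding tangent_on_def by auto
  have V: "open (cinv c ` \<Omega>)" "cinv c ` \<Omega> \<subseteq> fst c" "snd c ` cinv c ` \<Omega> = \<Omega>"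
  proof -
    have "cinv c ` \<Omega> = fst c \<inter> snd c -` \<Omega>" using chart_props[OF ch] \<Omega>(2) by (auto simp: image_iff) (metis subsetD)+
    then show "open (cinv c ` \<Omega>)" using continuous_open_preimage[OF chart_props(3,1)[OF ch] \<Omega>(1)] by simp
    show "cinv c ` \<Omega> \<subseteq> fst c" using chart_props(7)[OF ch] \<Omega>(2) by blast
    show "snd c ` cinv c ` \<Omega> = \<Omega>" using chart_props(6)[OF ch] \<Omega>(2) by (force simp: image_iff)
  qed
  from Y show ?thesis
  proof induction
    case (generator i)
    then show ?case using X by blast
  next
    case zero
    have e: "vector_rep A c (\<lambda>_. 0) y = 0" if "y \<in> \<Omega>" for y using linear_0[OF lin[OF that]] by (simp add: vector_rep_apply)
    have "smooth_on \<Omega> (vector_rep A c (\<lambda>_. 0))" by (rule smooth_on_transform[OF \<Omega>(1) smooth_on_const]) (rule e)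
    moreover have "tangent_on Z \<Omega> (vector_rep A c (\<lambda>_. 0))"
      by (rule tcong[of "\<lambda>_. 0"]) (auto simp: tangent_on_def e)
    ultimately show ?case by (simp add: e)
  next
    case (add Y1 Y2)
    have e: "vector_rep A c (\<lambda>x. Y1 x + Y2 x) y = vector_rep A c Y1 y + vector_rep A c Y2 y" if "y \<in> \<Omega>" for y
      using linear_add[OF lin[OF that]] by (simp add: vector_rep_apply)
    have "smooth_on \<Omega> (\<lambda>y. vector_rep A c Y1 y + vector_rep A c Y2 y)"
      by (rule smooth_on_add[OF \<Omega>(1)]) (use add.IH in auto)
    then have "smooth_on \<Omega> (vector_rep A c (\<lambda>x. Y1 x + Y2 x))" by (rule smooth_on_transform[OF \<Omega>(1)]) (rule e)
    moreover have "tangent_on Z \<Omega> (vector_rep A c (\<lambda>x. Y1 x + Y2 x))"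
      by (rule tcong[OF _ e]) (use add.IH in \<open>auto simp: tangent_on_def inner_add_left\<close>)
    ultimately show ?case using add.IH by (simp add: e inner_add_right)
  next
    case (scale f Y)
    have e: "vector_rep A c (\<lambda>x. f x *\<^sub>R Y x) y = (f \<circ> cinv c) y *\<^sub>R vector_rep A c Y y" if "y \<in> \<Omega>" for y
      using linear_scale[OF lin[OF that]] by (simp add: vector_rep_apply)
    have "smooth_on \<Omega> (f \<circ> cinv c)"
      using smooth_fun_chart[OF ch V(1) scale(1)] V by (simp add: Int_absorb1)
    then have "smooth_on \<Omega> (\<lambda>y. (f \<circ> cinv c) y *\<^sub>R vector_rep A c Y y)"
      by (rule smooth_on_scaleR[OF \<Omega>(1)]) (use scale.IH in auto)
    then have "smooth_on \<Omega> (vector_rep A c (\<lambda>x. f x *\<^sub>R Y x))" by (rule smooth_on_transform[OF \<Omega>(1)]) (rule e)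
    moreover have "tangent_on Z \<Omega> (vector_rep A c (\<lambda>x. f x *\<^sub>R Y x))"
      by (rule tcong[OF _ e]) (use scale.IH in \<open>auto simp: tangent_on_def\<close>)
    ultimately show ?case using scale.IH by (simp add: e)
  next
    case (bracket Y1 Y2)
    define R1 where "R1 = vector_rep A c Y1"
    define R2 where "R2 = vector_rep A c Y2"
    have sm: "smooth_on \<Omega> R1" "smooth_on \<Omega> R2" and tan: "tangent_on Z \<Omega> R1" "tangent_on Z \<Omega> R2"
      and ort: "\<And>y. y \<in> \<Omega> \<Longrightarrow> gradient v y \<bullet> R1 y = 0" "\<And>y. y \<in> \<Omega> \<Longrightarrow> gradient v y \<bullet> R2 y = 0"
      using bracket.IH by (auto simp: R1_def R2_def)
    have e: "vector_rep A c (lie_bracket A Y1 Y2) y = fd R2 y (R1 y) - fd R1 y (R2 y)" if y: "y \<in> \<Omega>" for y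
    proof -
      have yc: "y \<in> snd c ` fst c" using y \<Omega>(2) by blast
      have i: "cinv c y \<in> fst c" "snd c (cinv c y) = y" using chart_props(6,7)[OF ch yc] by auto
      show ?thesis
        using lie_bracket_chart[OF ch i(1), of Y1 Y2] smooth_on_differentiable[OF sm(1) y] smooth_on_differentiable[OF sm(2) y]
        by (simp add: vector_rep_apply[of c "lie_bracket A Y1 Y2"] i R1_def R2_def)
    qed
    have "smooth_on \<Omega> (\<lambda>y. fd R2 y (R1 y) - fd R1 y (R2 y))"
      by (intro smooth_on_diff smooth_on_fd \<Omega>(1) sm)
    then have "smooth_on \<Omega> (vector_rep A c (lie_bracket A Y1 Y2))" by (rule smooth_on_transform[OF \<Omega>(1)]) (rule e)
    moreover have "tangent_on Z \<Omega> (vector_rep A c (lie_bracket A Y1 Y2))"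
      by (rule tcong[OF tangent_on_bracket[OF Z \<Omega>(1) smooth_on_Ck[OF sm(1)] smooth_on_Ck[OF sm(2)] tan] e])
    moreover have "gradient v y \<bullet> vector_rep A c (lie_bracket A Y1 Y2) y = 0" if y: "y \<in> \<Omega>" for y
    proof -
      have vy: "v differentiable at z" if "z \<in> \<Omega>" for z using smooth_on_differentiable[OF v that] .
      \<comment> \<open>The identity \<open>dv(R) = 0\<close> differentiated in the direction
        \<open>h\<close>; used for both fields, it leaves second derivatives of \<open>v\<close>
        that agree by symmetry.\<close>
      have *: "fd (\<lambda>z. fd v z h) y (R y) + fd v y (fd R y h) = 0"
        if R: "smooth_on \<Omega> R" "\<And>y. y \<in> \<Omega> \<Longrightarrow> gradient v y \<bullet> R y = 0" for R h
      proof -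
        have "((\<lambda>z. fd v z (R z)) has_derivative (\<lambda>h. fd (\<lambda>z. fd v z h) y (R y) + fd v y (fd R y h))) (at y)"
          by (rule has_derivative_fd_apply[OF \<Omega>(1) smooth_on_Ck[OF v] y smooth_on_differentiable[OF R(1) y]])
        moreover have "((\<lambda>z. fd v z (R z)) has_derivative (\<lambda>h. 0)) (at y)"
        proof (rule has_derivative_transform_within_open[OF has_derivative_const \<Omega>(1) y])
          show "0 = fd v z (R z)" if "z \<in> \<Omega>" for z using R(2)[OF that] gradient_inner[OF vy[OF that]] by simp
        qed
        ultimately have "(\<lambda>h. fd (\<lambda>z. fd v z h) y (R y) + fd v y (fd R y h)) = (\<lambda>h. 0)" by (rule has_derivative_unique)
        then show ?thesis by (rule fun_cong)
      qed
      have "fd (\<lambda>z. fd v z (R2 y)) y (R1 y) = fd (\<lambda>z. fd v z (R1 y)) y (R2 y)"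
        by (rule second_derivative_symmetric[OF \<Omega>(1) smooth_on_Ck[OF v] y])
      then have "fd v y (fd R2 y (R1 y)) = fd v y (fd R1 y (R2 y))"
        using *[OF sm(1) ort(1), of "R2 y"] *[OF sm(2) ort(2), of "R1 y"] by simp
      then show ?thesis by (simp add: e[OF y] inner_diff_right gradient_inner[OF vy[OF y]])
    qed
    ultimately show ?case by blast
  qed
qed

end

section \<open>Comparison of the two hypersurfaces\<close>

context subriemannian_manifold
begin

text \<open>The translations in coordinates as one map of time and position. Joint smoothness serves
  both ways: with the time fixed they are local isometries, with the position fixed they are
  curves.\<close>

lemma translation_chart:
  fixes \<Psi> :: "real \<Rightarrow> 'a \<Rightarrow> 'a"
  assumes iso: "isometric_translations A g vol p\<^sub>0 U \<delta> \<Psi>" and c: "c \<in> A" and G: "open G" "G \<subseteq> fst c" "G \<subseteq> U"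
  defines "P \<equiv> \<lambda>(a, y). snd c (\<Psi> a (cinv c y))"
    and "E \<equiv> {(a, y). a \<in> {-\<delta><..<\<delta>} \<and> y \<in> snd c ` G \<and> \<Psi> a (cinv c y) \<in> G}"
  shows "open E" "smooth_on E P" "open {y. (a, y) \<in> E}" "smooth_on {y. (a, y) \<in> E} (\<lambda>y. P (a, y))"
    "(a, y) \<in> E \<Longrightarrow> P (a, y) \<in> snd c ` G" "(a, y) \<in> E \<Longrightarrow> cinv c (P (a, y)) = \<Psi> a (cinv c y)"
    "(a, y) \<in> E \<Longrightarrow> cometric_rep c (P (a, y)) r s =
       cometric_rep c y (adjoint (fd (\<lambda>y. P (a, y)) y) r) (adjoint (fd (\<lambda>y. P (a, y)) y) s)"
    "(a, y) \<in> E \<Longrightarrow> vol_rep c (P (a, y)) (map (fd (\<lambda>y. P (a, y)) y) vs) = vol_rep c y vs"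
proof -
  note ch = atlas_is_chart[OF c]
  have sf: "smooth_family A U \<delta> \<Psi>" using iso by (simp add: isometric_translations_def)
  have oG: "open (snd c ` G)" by (rule chart_image_open_subset[OF ch G(1,2)])
  have inG: "cinv c y \<in> G" "cinv c y \<in> fst c" "cinv c y \<in> U" "snd c (cinv c y) = y" if y: "y \<in> snd c ` G" for y
  proof -
    from y obtain x where x: "x \<in> G" "y = snd c x" by blast
    then have "cinv c y = x" using G(2) chart_props(5)[OF ch, of x] by blast
    then show "cinv c y \<in> G" "cinv c y \<in> fst c" "cinv c y \<in> U" "snd c (cinv c y) = y" using x(1) x(2)[symmetric] G(2,3) by auto
  qed
  let ?I = "{-\<delta><..<\<delta>}"
  have cont: "continuous_on (?I \<times> U) (\<lambda>(a, x). \<Psi> a x)" using sf by (simp add: smooth_family_def)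
  have "continuous_on (?I \<times> snd c ` G) (\<lambda>s. (fst s, cinv c (snd s)))"
    by (intro continuous_intros continuous_on_compose2[OF chart_props(4)[OF ch]]) (use G in auto)
  from continuous_on_compose2[OF cont this] have "continuous_on (?I \<times> snd c ` G) (\<lambda>s. \<Psi> (fst s) (cinv c (snd s)))"
    using inG by (force simp: case_prod_beta)
  then have "open ((?I \<times> snd c ` G) \<inter> (\<lambda>s. \<Psi> (fst s) (cinv c (snd s))) -` G)"
    by (rule continuous_open_preimage) (auto intro: open_Times oG G(1))
  moreover have "E = (?I \<times> snd c ` G) \<inter> (\<lambda>s. \<Psi> (fst s) (cinv c (snd s))) -` G" by (auto simp: E_def)
  ultimately show oE: "open E" by simp
  have "smooth_on {(a, y). a \<in> ?I \<and> y \<in> snd c ` (fst c \<inter> U) \<and> \<Psi> a (cinv c y) \<in> fst c} P"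
    using sf c unfolding smooth_family_def P_def by blast
  then show sE: "smooth_on E P" by (rule smooth_on_subset) (use G in \<open>auto simp: E_def\<close>)
  have "open ((\<lambda>y. (a, y)) -` E)" for a by (rule open_vimage[OF oE]) (auto intro!: continuous_intros)
  then show oS: "open {y. (a, y) \<in> E}" for a by (simp add: vimage_def)
  show sS: "smooth_on {y. (a, y) \<in> E} (\<lambda>y. P (a, y))" for a
    by (rule smooth_on_compose[OF oS oE smooth_on_Pair[OF oS smooth_on_const smooth_on_id] sE]) simp
  have inE: "a \<in> ?I" "y \<in> snd c ` G" "\<Psi> a (cinv c y) \<in> G" if "(a, y) \<in> E" for a y using that by (auto simp: E_def)
  show "P (a, y) \<in> snd c ` G" if "(a, y) \<in> E" for a y using inE[OF that] by (simp add: P_def)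
  show "cinv c (P (a, y)) = \<Psi> a (cinv c y)" if "(a, y) \<in> E" for a y
    using inE(3)[OF that] G(2) chart_props(5)[OF ch] by (auto simp: P_def)
  have "cometric_rep c (P (a, y)) r s = cometric_rep c y (adjoint (fd (\<lambda>y. P (a, y)) y) r) (adjoint (fd (\<lambda>y. P (a, y)) y) s) \<and>
      vol_rep c (P (a, y)) (map (fd (\<lambda>y. P (a, y)) y) vs) = vol_rep c y vs" if E: "(a, y) \<in> E" for a y r s vs
  proof -
    define W where "W = G \<inter> \<Psi> a -` G"
    have "continuous_on G (\<Psi> a)"
    proof -
      have "continuous_on G (\<lambda>x. (a, x))" by (intro continuous_intros)
      moreover have "(\<lambda>x. (a, x)) ` G \<subseteq> ?I \<times> U" using inE(1)[OF E] G(3) by auto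
      ultimately have "continuous_on G (\<lambda>x. case (a, x) of (a, x) \<Rightarrow> \<Psi> a x)" by (rule continuous_on_compose2[OF cont])
      then show ?thesis by simp
    qed
    then have W: "open W" unfolding W_def using continuous_open_preimage G(1) by blast
    have yW: "cinv c y \<in> W" using inE[OF E] inG by (auto simp: W_def)
    have W': "W \<subseteq> fst c" "\<And>z. z \<in> W \<Longrightarrow> \<Psi> a z \<in> fst c" using G(2) by (auto simp: W_def)
    have y: "snd c (cinv c y) = y" "cinv c y \<in> U" "\<Psi> a (cinv c y) \<in> U" using inE[OF E] inG G(3) by auto
    have d: "(\<lambda>y. snd c (\<Psi> a (cinv c y))) differentiable at (snd c (cinv c y))"
      using smooth_on_differentiable[OF sS, of y a] E by (simp add: y P_def)
    have i: "g (cinv c y) (pullback_covector A (\<Psi> a) (cinv c y) w) (pullback_covector A (\<Psi> a) (cinv c y) e) = g (\<Psi> a (cinv c y)) w e"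
      "vol (\<Psi> a (cinv c y)) (map (tangent_map A (\<Psi> a) (cinv c y)) us) = vol (cinv c y) us" for w e us
      using iso inE(1)[OF E] y(2,3) unfolding isometric_translations_def by blast+
    from isometry_rep[OF ch W yW W' d i] show ?thesis by (simp add: y P_def)
  qed
  then show "(a, y) \<in> E \<Longrightarrow> cometric_rep c (P (a, y)) r s =
       cometric_rep c y (adjoint (fd (\<lambda>y. P (a, y)) y) r) (adjoint (fd (\<lambda>y. P (a, y)) y) s)"
    "(a, y) \<in> E \<Longrightarrow> vol_rep c (P (a, y)) (map (fd (\<lambda>y. P (a, y)) y) vs) = vol_rep c y vs" by blast+
qed

lemma curvature_translation:
  fixes \<Psi> :: "real \<Rightarrow> 'a \<Rightarrow> 'a"
  assumes iso: "isometric_translations A g vol p\<^sub>0 U \<delta> \<Psi>" and c: "c \<in> A"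
    and G: "open G" "G \<subseteq> fst c" "G \<subseteq> regular_set A g \<phi> U"
    and \<phi>: "smooth_fun A U \<phi>" "compatible U \<delta> \<Psi> \<phi>"
    and E: "a \<in> {-\<delta><..<\<delta>}" "y \<in> snd c ` G" "\<Psi> a (cinv c y) \<in> G"
  defines "u \<equiv> \<phi> \<circ> cinv c"
  shows "u (snd c (\<Psi> a (cinv c y))) = u y - a"
    "curvature_rep c p u (snd c (\<Psi> a (cinv c y))) = curvature_rep c p u y"
proof -
  note ch = atlas_is_chart[OF c]
  have U: "open U" using iso by (simp add: isometric_translations_def)
  have GU: "G \<subseteq> U" using G(3) by (auto simp: regular_set_def)
  define P where "P = (\<lambda>(a, y). snd c (\<Psi> a (cinv c y)))"
  define E1 where "E1 = {(a, y). a \<in> {-\<delta><..<\<delta>} \<and> y \<in> snd c ` G \<and> \<Psi> a (cinv c y) \<in> G}"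
  note tr = translation_chart[OF iso c G(1,2) GU, folded P_def E1_def]
  have sh: "u (P (a, z)) = u z - a" if z: "(a, z) \<in> E1" for z
  proof -
    from z obtain x where x: "x \<in> G" "z = snd c x" by (auto simp: E1_def)
    then have "cinv c z = x" using G(2) chart_props(5)[OF ch, of x] by blast
    then have "cinv c z \<in> U" "\<Psi> a (cinv c z) \<in> U" using z x GU by (auto simp: E1_def)
    then show ?thesis using \<phi>(2) tr(6)[OF z] E(1) unfolding compatible_def by (simp add: u_def)
  qed
  have yE: "(a, y) \<in> E1" using E by (simp add: E1_def)
  then show "u (snd c (\<Psi> a (cinv c y))) = u y - a" using sh by (simp add: P_def)
  note rc = regular_chart(4)[OF c U \<phi>(1)]
  have reg: "z \<in> {y \<in> snd c ` (fst c \<inter> U). (y, gradient (\<phi> \<circ> cinv c) y) \<in> flux_dom c}" if "z \<in> snd c ` G" for z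
    using that rc G(2,3) by blast
  have "curvature_rep c p (\<phi> \<circ> cinv c) ((\<lambda>y. P (a, y)) y) = curvature_rep c p (\<phi> \<circ> cinv c) y"
  proof (rule curvature_rep_natural[OF c U \<phi>(1) tr(3) tr(4)])
    show "{y. (a, y) \<in> E1} \<subseteq> {y \<in> snd c ` (fst c \<inter> U). (y, gradient (\<phi> \<circ> cinv c) y) \<in> flux_dom c}"
    proof
      fix z assume "z \<in> {y. (a, y) \<in> E1}"
      then have "z \<in> snd c ` G" by (simp add: E1_def)
      then show "z \<in> {y \<in> snd c ` (fst c \<inter> U). (y, gradient (\<phi> \<circ> cinv c) y) \<in> flux_dom c}" by (rule reg)
    qed
    fix z assume "z \<in> {y. (a, y) \<in> E1}"
    then have z: "(a, z) \<in> E1" by simp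
    show "P (a, z) \<in> {y \<in> snd c ` (fst c \<inter> U). (y, gradient (\<phi> \<circ> cinv c) y) \<in> flux_dom c}" by (rule reg[OF tr(5)[OF z]])
    show "cometric_rep c (P (a, z)) r s = cometric_rep c z (adjoint (fd (\<lambda>y. P (a, y)) z) r) (adjoint (fd (\<lambda>y. P (a, y)) z) s)" for r s
      by (rule tr(7)[OF z])
    show "vol_rep c (P (a, z)) (map (fd (\<lambda>y. P (a, y)) z) vs) = vol_rep c z vs" for vs by (rule tr(8)[OF z])
    show "(\<phi> \<circ> cinv c) (P (a, z)) = (\<phi> \<circ> cinv c) z - a" using sh[OF z] by (simp add: u_def)
  qed (use yE in simp)
  then show "curvature_rep c p u (snd c (\<Psi> a (cinv c y))) = curvature_rep c p u y" by (simp add: u_def P_def)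
qed

text \<open>A point \<open>y\<close> is moved by time \<open>u y\<close> to a point \<open>z\<close>
  of the first hypersurface and from there by time \<open>v z\<close> onto the second. Compatibility
  gives \<open>v z = v y - u y\<close>, so the sign of \<open>a\<close> yields
  \<open>u \<le> v\<close>, and invariance carries the curvature inequality back from the
  hypersurfaces to \<open>y\<close>.\<close>

lemma sliding_comparison:
  fixes \<Psi> :: "real \<Rightarrow> 'a \<Rightarrow> 'a"
  assumes iso: "isometric_translations A g vol p\<^sub>0 U \<delta> \<Psi>" and c: "c \<in> A"
    and G: "open G" "G \<subseteq> fst c" "G \<subseteq> regular_set A g \<phi> U" "G \<subseteq> regular_set A g \<psi> U" "p\<^sub>0 \<in> G"
    and \<phi>: "smooth_fun A U \<phi>" "compatible U \<delta> \<Psi> \<phi>" "\<phi> p\<^sub>0 = 0"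
    and \<psi>: "smooth_fun A U \<psi>" "compatible U \<delta> \<Psi> \<psi>" "\<psi> p\<^sub>0 = 0"
    and H: "p_mean_curvature A g vol U p \<phi> H\<^sub>1" "p_mean_curvature A g vol U p \<psi> H\<^sub>2"
    and a: "\<And>q. q \<in> U \<Longrightarrow> \<phi> q = 0 \<Longrightarrow> 0 \<le> a q \<and> a q < \<delta> \<and> \<Psi> (a q) q \<in> U \<and> \<psi> (\<Psi> (a q) q) = 0"
    and le: "\<And>q. q \<in> regular_set A g \<phi> U \<Longrightarrow> \<phi> q = 0 \<Longrightarrow> \<Psi> (a q) q \<in> regular_set A g \<psi> U \<Longrightarrow> H\<^sub>2 (\<Psi> (a q) q) \<le> H\<^sub>1 q"
  defines "u \<equiv> \<phi> \<circ> cinv c" and "v \<equiv> \<psi> \<circ> cinv c"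
  shows "\<exists>R>0. ball (snd c p\<^sub>0) R \<subseteq> snd c ` G \<and>
    (\<forall>y\<in>ball (snd c p\<^sub>0) R. u y \<le> v y \<and> curvature_rep c p v y \<le> curvature_rep c p u y)"
proof -
  note ch = atlas_is_chart[OF c]
  have U: "open U" and \<delta>: "\<delta> > 0" and \<Psi>0: "\<And>x. x \<in> U \<Longrightarrow> \<Psi> 0 x = x" using iso by (auto simp: isometric_translations_def)
  have GU: "G \<subseteq> U" using G(3) by (auto simp: regular_set_def)
  define y\<^sub>0 where "y\<^sub>0 = snd c p\<^sub>0"
  have p0: "p\<^sub>0 \<in> fst c" "cinv c y\<^sub>0 = p\<^sub>0" "p\<^sub>0 \<in> U" using G(2,5) GU chart_props(5)[OF ch] by (auto simp: y\<^sub>0_def)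
  define P where "P = (\<lambda>(a, y). snd c (\<Psi> a (cinv c y)))"
  define E where "E = {(a, y). a \<in> {-\<delta><..<\<delta>} \<and> y \<in> snd c ` G \<and> \<Psi> a (cinv c y) \<in> G}"
  note tr = translation_chart[OF iso c G(1,2) GU, folded P_def E_def]
  have oG: "open (snd c ` G)" by (rule chart_image_open_subset[OF ch G(1,2)])
  have y0: "y\<^sub>0 \<in> snd c ` G" using G(5) by (simp add: y\<^sub>0_def)
  have E0: "(0, y\<^sub>0) \<in> E" "P (0, y\<^sub>0) = y\<^sub>0" using y0 \<delta> p0 \<Psi>0 G(5) by (auto simp: E_def P_def y\<^sub>0_def)
  have sm: "smooth_on (snd c ` G) u" "smooth_on (snd c ` G) v"
    unfolding u_def v_def
    by (rule smooth_on_subset[OF smooth_fun_chart[OF ch U \<phi>(1)]] smooth_on_subset[OF smooth_fun_chart[OF ch U \<psi>(1)]]; use G(2) GU in blast)+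
  have iu: "isCont u y\<^sub>0" "isCont v y\<^sub>0"
    using smooth_on_continuous[OF sm(1)] smooth_on_continuous[OF sm(2)] continuous_on_eq_continuous_at[OF oG] y0 by auto
  have uv0: "u y\<^sub>0 = 0" "v y\<^sub>0 = 0" using \<phi>(3) \<psi>(3) p0 by (auto simp: u_def v_def)
  have "isCont P (0, y\<^sub>0)" using smooth_on_continuous[OF tr(2)] continuous_on_eq_continuous_at[OF tr(1)] E0(1) by blast
  \<comment> \<open>Both times vanish at \<open>y\<^sub>0\<close> and depend continuously on
    \<open>y\<close>, so near \<open>y\<^sub>0\<close> both moves stay in \<open>G\<close> and in
    the interval of admissible times.\<close>
  have tu: "((\<lambda>y. (u y, y)) \<longlongrightarrow> (0, y\<^sub>0)) (nhds y\<^sub>0)"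
    using iu(1) uv0 by (auto intro!: tendsto_eq_intros simp: isCont_def tendsto_nhds_iff)
  have tP: "((\<lambda>y. P (u y, y)) \<longlongrightarrow> y\<^sub>0) (nhds y\<^sub>0)"
    using isCont_tendsto_compose[OF \<open>isCont P (0, y\<^sub>0)\<close> tu] E0(2) by simp
  have tv: "((\<lambda>y. (v (P (u y, y)), P (u y, y))) \<longlongrightarrow> (0, y\<^sub>0)) (nhds y\<^sub>0)"
    using isCont_tendsto_compose[OF iu(2) tP] tP uv0 by (intro tendsto_Pair) auto
  have "\<forall>\<^sub>F y in nhds y\<^sub>0. (u y, y) \<in> E \<and> (v (P (u y, y)), P (u y, y)) \<in> E"
    using topological_tendstoD[OF tu tr(1) E0(1)] topological_tendstoD[OF tv tr(1) E0(1)] by (rule eventually_conj)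
  moreover have "\<forall>\<^sub>F y in nhds y\<^sub>0. y \<in> snd c ` G" using eventually_nhds_in_open[OF oG y0] .
  ultimately have "\<forall>\<^sub>F y in nhds y\<^sub>0. y \<in> snd c ` G \<and> (u y, y) \<in> E \<and> (v (P (u y, y)), P (u y, y)) \<in> E"
    by eventually_elim simp
  then obtain R where R: "R > 0" "\<And>y. dist y y\<^sub>0 < R \<Longrightarrow> y \<in> snd c ` G \<and> (u y, y) \<in> E \<and> (v (P (u y, y)), P (u y, y)) \<in> E"
    unfolding eventually_nhds_metric by blast
  have "y \<in> snd c ` G \<and> u y \<le> v y \<and> curvature_rep c p v y \<le> curvature_rep c p u y" if "dist y y\<^sub>0 < R" for y
  proof -
    note y = R(2)[OF that]
    define z where "z = P (u y, y)"
    define q where "q = cinv c z"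
    have Ey: "u y \<in> {-\<delta><..<\<delta>}" "y \<in> snd c ` G" "\<Psi> (u y) (cinv c y) \<in> G" using y by (auto simp: E_def)
    have Ez: "v z \<in> {-\<delta><..<\<delta>}" "z \<in> snd c ` G" "\<Psi> (v z) q \<in> G" using y by (auto simp: E_def z_def q_def)
    note 1 = curvature_translation[OF iso c G(1,2,3) \<phi>(1,2) Ey, folded u_def]
    note 2 = curvature_translation[OF iso c G(1,2,4) \<psi>(1,2) Ey, folded v_def]
    have z': "z = snd c (\<Psi> (u y) (cinv c y))" by (simp add: z_def P_def)
    have uz: "u z = 0" "v z = v y - u y" using 1(1) 2(1) by (simp_all add: z')
    have q: "q \<in> G" "snd c q = z" using Ez(2) G(2) chart_props(5)[OF ch] by (auto simp: q_def)
    have \<phi>q: "\<phi> q = 0" "\<psi> q = v z" using uz(1) by (simp_all add: u_def v_def q_def)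
    have aq: "0 \<le> a q" "a q < \<delta>" "\<Psi> (a q) q \<in> U" "\<psi> (\<Psi> (a q) q) = 0" using a[of q] \<phi>q q(1) GU by auto
    \<comment> \<open>The time of arrival on the second hypersurface is forced: compatibility gives
      \<open>\<psi> q - a q = 0\<close>.\<close>
    then have "a q = v z" using \<psi>(2) q(1) GU \<phi>q(2) unfolding compatible_def by auto
    then have le0: "u y \<le> v y" using aq(1) uz(2) by simp
    have Gq: "\<Psi> (a q) q \<in> G" using Ez(3) \<open>a q = v z\<close> by simp
    have "H\<^sub>2 (\<Psi> (a q) q) \<le> H\<^sub>1 q" using le q(1) \<phi>q(1) Gq G(3,4) by blast
    moreover have "H\<^sub>1 q = curvature_rep c p u z"
      using mean_curvature_formula[OF c _ U \<phi>(1) _ \<phi>q(1) H(1)] q G(2,3) unfolding u_def by auto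
    moreover have "H\<^sub>2 (\<Psi> (a q) q) = curvature_rep c p v (snd c (\<Psi> (a q) q))"
      using mean_curvature_formula[OF c _ U \<psi>(1) _ aq(4) H(2)] Gq G(2,4) unfolding v_def by auto
    moreover have "curvature_rep c p v (snd c (\<Psi> (a q) q)) = curvature_rep c p v z"
      using curvature_translation(2)[OF iso c G(1,2,4) \<psi>(1,2), of "a q" z, folded v_def] Ez \<open>a q = v z\<close> by (simp add: q_def)
    ultimately show ?thesis using 1(2) 2(2) le0 Ey(2) by (simp add: z')
  qed
  then show ?thesis using R(1) by (intro exI[of _ R]) (auto simp: y\<^sub>0_def dist_commute)
qed

end

section \<open>Vanishing of the proximal normals of the contact set\<close>

context subriemannian_manifold
begin

text \<open>\<open>\<kappa>\<close> is the orbit of \<open>z\<close> in the chart, restricted to an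
  open set of times during which it stays in \<open>\<Omega>\<close>; \<open>T\<close> is its
  velocity at 0.\<close>

lemma translation_velocity:
  fixes \<Psi> :: "real \<Rightarrow> 'a \<Rightarrow> 'a"
  assumes iso: "isometric_translations A g vol p\<^sub>0 U \<delta> \<Psi>" and c: "c \<in> A"
    and G: "open G" "G \<subseteq> fst c" "G \<subseteq> U" and z: "z \<in> \<Omega>" and \<Omega>: "open \<Omega>" "\<Omega> \<subseteq> snd c ` G"
  shows "\<exists>T J \<kappa>. open J \<and> 0 \<in> J \<and> (\<kappa> has_derivative (\<lambda>h. h *\<^sub>R T)) (at 0) \<and> \<kappa> 0 = z \<and>
    (\<forall>a\<in>J. a \<in> {-\<delta><..<\<delta>} \<and> \<Psi> a (cinv c z) \<in> G \<and> \<kappa> a = snd c (\<Psi> a (cinv c z)) \<and> \<kappa> a \<in> \<Omega>)"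
proof -
  note ch = atlas_is_chart[OF c]
  define P where "P = (\<lambda>(a, y). snd c (\<Psi> a (cinv c y)))"
  define E where "E = {(a, y). a \<in> {-\<delta><..<\<delta>} \<and> y \<in> snd c ` G \<and> \<Psi> a (cinv c y) \<in> G}"
  note tr = translation_chart[OF iso c G, folded P_def E_def]
  obtain x where x: "x \<in> G" "z = snd c x" using z \<Omega>(2) by blast
  then have cz: "cinv c z = x" using G(2) chart_props(5)[OF ch, of x] by blast
  have "\<Psi> 0 x = x" "\<delta> > 0" using iso x(1) G(3) by (auto simp: isometric_translations_def)
  then have E0: "(0, z) \<in> E" "P (0, z) = z" using x cz by (auto simp: E_def P_def)
  define J\<^sub>0 where "J\<^sub>0 = (\<lambda>a. (a, z)) -` E"
  have J0: "open J\<^sub>0" unfolding J\<^sub>0_def by (rule open_vimage[OF tr(1)]) (auto intro!: continuous_intros)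
  have sk: "smooth_on J\<^sub>0 (\<lambda>a. P (a, z))"
    by (rule smooth_on_compose[OF J0 tr(1) smooth_on_Pair[OF J0 smooth_on_id smooth_on_const] tr(2)]) (simp add: J\<^sub>0_def)
  define J where "J = J\<^sub>0 \<inter> (\<lambda>a. P (a, z)) -` \<Omega>"
  have oJ: "open J" unfolding J_def by (rule continuous_open_preimage[OF smooth_on_continuous[OF sk] J0 \<Omega>(1)])
  have J: "0 \<in> J" using E0 z by (simp add: J_def J\<^sub>0_def)
  have "0 \<in> J\<^sub>0" using J by (simp add: J_def)
  from smooth_on_has_derivative[OF sk this]
  have D: "((\<lambda>a. P (a, z)) has_derivative fd (\<lambda>a. P (a, z)) 0) (at 0)" .
  have "fd (\<lambda>a. P (a, z)) 0 = (\<lambda>h. h *\<^sub>R fd (\<lambda>a. P (a, z)) 0 1)"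
  proof
    fix h :: real
    show "fd (\<lambda>a. P (a, z)) 0 h = h *\<^sub>R fd (\<lambda>a. P (a, z)) 0 1"
      using linear_scale[OF has_derivative_linear[OF D], of h 1] by simp
  qed
  then have D': "((\<lambda>a. P (a, z)) has_derivative (\<lambda>h. h *\<^sub>R fd (\<lambda>a. P (a, z)) 0 1)) (at 0)" using D by simp
  have "\<forall>a\<in>J. a \<in> {-\<delta><..<\<delta>} \<and> \<Psi> a (cinv c z) \<in> G \<and> P (a, z) = snd c (\<Psi> a (cinv c z)) \<and> P (a, z) \<in> \<Omega>"
    by (auto simp: J_def J\<^sub>0_def E_def P_def)
  then show ?thesis using oJ J D' E0(2) by blast
qed

lemma coincide_near:
  fixes \<Psi> :: "real \<Rightarrow> 'a \<Rightarrow> 'a"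
  assumes dimM: "CARD('n) = m + 1" and iso: "isometric_translations A g vol p\<^sub>0 U \<delta> \<Psi>"
    and hor: "dim (horizontal g p\<^sub>0) = m + 1 - l"
    and reg: "p\<^sub>0 \<in> regular_set A g \<phi> U" "p\<^sub>0 \<in> regular_set A g \<psi> U"
    and \<phi>: "smooth_fun A U \<phi>" "compatible U \<delta> \<Psi> \<phi>" "\<phi> p\<^sub>0 = 0"
    and \<psi>: "smooth_fun A U \<psi>" "compatible U \<delta> \<Psi> \<psi>" "\<psi> p\<^sub>0 = 0"
    and p: "p \<ge> 0" and H: "p_mean_curvature A g vol U p \<phi> H\<^sub>1" "p_mean_curvature A g vol U p \<psi> H\<^sub>2"
    and a: "\<And>q. q \<in> U \<Longrightarrow> \<phi> q = 0 \<Longrightarrow> 0 \<le> a q \<and> a q < \<delta> \<and> \<Psi> (a q) q \<in> U \<and> \<psi> (\<Psi> (a q) q) = 0"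
    and le: "\<And>q. q \<in> regular_set A g \<phi> U \<Longrightarrow> \<phi> q = 0 \<Longrightarrow> \<Psi> (a q) q \<in> regular_set A g \<psi> U \<Longrightarrow> H\<^sub>2 (\<Psi> (a q) q) \<le> H\<^sub>1 q"
    and rank: "rank_condition A g p\<^sub>0 (m - l) m"
  shows "\<exists>W. open W \<and> p\<^sub>0 \<in> W \<and> W \<subseteq> U \<and> (\<forall>x\<in>W. \<phi> x = \<psi> x)"
proof -
  define c where "c = chart_at A p\<^sub>0"
  have c: "c \<in> A" "p\<^sub>0 \<in> fst c" and ch: "is_chart A c" using chart_at atlas_is_chart by (auto simp: c_def)
  have U: "open U" using iso by (simp add: isometric_translations_def)
  define u where "u = \<phi> \<circ> cinv c"
  define v where "v = \<psi> \<circ> cinv c"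
  define y\<^sub>0 where "y\<^sub>0 = snd c p\<^sub>0"
  define G where "G = fst c \<inter> (regular_set A g \<phi> U \<inter> regular_set A g \<psi> U)"
  have G: "open G" "G \<subseteq> fst c" "G \<subseteq> regular_set A g \<phi> U" "G \<subseteq> regular_set A g \<psi> U" "p\<^sub>0 \<in> G"
    using regular_set_open[OF U \<phi>(1)] regular_set_open[OF U \<psi>(1)] chart_props(1)[OF ch] c(2) reg by (auto simp: G_def)
  have GU: "G \<subseteq> U" using G(3) by (auto simp: regular_set_def)
  have cp0: "cinv c y\<^sub>0 = p\<^sub>0" using chart_props(5)[OF ch c(2)] by (simp add: y\<^sub>0_def)
  have y0G: "y\<^sub>0 \<in> snd c ` G" using G(5) by (simp add: y\<^sub>0_def)
  have oG: "open (snd c ` G)" by (rule chart_image_open_subset[OF ch G(1,2)])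
  have Gc: "snd c ` G \<subseteq> snd c ` fst c" using G(2) by blast
  have sm: "smooth_on (snd c ` G) u" "smooth_on (snd c ` G) v"
    unfolding u_def v_def
    by (rule smooth_on_subset[OF smooth_fun_chart[OF ch U \<phi>(1)]] smooth_on_subset[OF smooth_fun_chart[OF ch U \<psi>(1)]]; use G(2) GU in blast)+
  have fdom: "(y, gradient u y) \<in> flux_dom c" "(y, gradient v y) \<in> flux_dom c" if y: "y \<in> snd c ` G" for y
    using y regular_chart(4)[OF c(1) U \<phi>(1)] regular_chart(4)[OF c(1) U \<psi>(1)] G(2,3,4) unfolding u_def v_def by blast+
  obtain R1 where R1: "R1 > 0" "ball y\<^sub>0 R1 \<subseteq> snd c ` G"
      "\<And>y. y \<in> ball y\<^sub>0 R1 \<Longrightarrow> u y \<le> v y \<and> curvature_rep c p v y \<le> curvature_rep c p u y"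
    using sliding_comparison[OF iso c(1) G \<phi> \<psi> H a le, folded u_def v_def y\<^sub>0_def] by blast
  define s where "s y = sharp_rep c y (gradient v y) \<bullet> gradient v y" for y
  have s0: "s y > 0" if "y \<in> snd c ` G" for y using fdom(2)[OF that] by (simp add: flux_dom_def s_def)
  note op = sharp_rep_operator[OF ch]
  have y0c: "y\<^sub>0 \<in> snd c ` fst c" using y0G Gc by blast
  have "inj (vec_of c p\<^sub>0)" by (rule inj_on_inverseI[of _ "comps c p\<^sub>0"]) (simp add: ch c)
  then have "dim (horizontal g p\<^sub>0) = dim (range (sharp_rep c y\<^sub>0))"
    unfolding horizontal_chart[OF ch c(2)] y\<^sub>0_def by (intro dim_image_eq vec_of_linear ch c) (auto intro: inj_on_subset)
  then have dr: "dim (range (sharp_rep c y\<^sub>0)) = m + 1 - l" using hor by simp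
  have "sharp_rep c y\<^sub>0 (gradient v y\<^sub>0) \<noteq> 0" using s0[OF y0G] by (auto simp: s_def)
  then have "dim (range (sharp_rep c y\<^sub>0)) \<noteq> 0" by (auto simp: dim_eq_0)
  \<comment> \<open>The range contains a nonzero vector, which excludes \<open>l = m + 1\<close>; in
    that case the truncated difference \<open>m - l\<close> and the dimension would both be
    0.\<close>
  then have "m - l < dim (range (sharp_rep c y\<^sub>0))" using dr by simp
  from constrained_basis[OF op(1)[OF y0c] _ this, of "gradient v y\<^sub>0"] s0[OF y0G]
  obtain \<eta> :: "nat \<Rightarrow> real^'n" where \<eta>: "\<And>k. k < m - l \<Longrightarrow> sharp_rep c y\<^sub>0 (\<eta> k) \<bullet> gradient v y\<^sub>0 = 0"
    "\<And>b. (\<Sum>k<m-l. b k *\<^sub>R sharp_rep c y\<^sub>0 (\<eta> k)) = 0 \<Longrightarrow> \<forall>k<m-l. b k = 0"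
    by (auto simp: s_def)
  \<comment> \<open>The constant covectors \<open>\<eta> k\<close> are corrected by a multiple of
    \<open>dv\<close>, so that the fields stay in the kernel of \<open>dv\<close> away from
    \<open>y\<^sub>0\<close> too. \<open>s\<close> is the squared length of \<open>dv\<close>, and
    at \<open>y\<^sub>0\<close> the correction is 0.\<close>
  define Y where "Y k y = sharp_rep c y (\<eta> k - ((sharp_rep c y (\<eta> k) \<bullet> gradient v y) / s y) *\<^sub>R gradient v y)" for k y
  have gv: "smooth_on (snd c ` G) (gradient v)" by (rule smooth_on_gradient[OF oG sm(2)])
  note shs = sharp_rep_smooth[OF c(1) oG smooth_on_id]
  have ss: "smooth_on (snd c ` G) s" unfolding s_def by (intro smooth_on_inner oG gv shs) (use Gc in auto)
  have snz: "s y \<noteq> 0" if "y \<in> snd c ` G" for y using s0[OF that] by simp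
  have sY: "smooth_on (snd c ` G) (Y k)" for k
    unfolding Y_def
    by (rule shs, intro smooth_on_diff smooth_on_scaleR smooth_on_divide smooth_on_inner smooth_on_const oG gv shs ss)
      (use snz Gc in auto)
  have Yv: "gradient v y \<bullet> Y k y = 0" if y: "y \<in> snd c ` G" for y k
  proof -
    have yc: "y \<in> snd c ` fst c" using y Gc by blast
    show ?thesis using s0[OF y]
      by (simp add: Y_def linear_diff[OF op(1)[OF yc]] linear_scale[OF op(1)[OF yc]] inner_diff_left s_def inner_commute[of "gradient v y"])
  qed
  have Y0: "Y k y\<^sub>0 = sharp_rep c y\<^sub>0 (\<eta> k)" if "k < m - l" for k using \<eta>(1)[OF that] by (simp add: Y_def)
  have "\<forall>\<^sub>F y in nhds y\<^sub>0. \<forall>b. (\<Sum>k<m-l. b k *\<^sub>R Y k y) = 0 \<longrightarrow> (\<forall>k<m-l. b k = 0)"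
  proof (rule independent_near)
    show "isCont (Y k) y\<^sub>0" for k
      using smooth_on_continuous[OF sY] continuous_on_eq_continuous_at[OF oG] y0G by blast
    show "\<forall>k<m-l. b k = 0" if "(\<Sum>k<m-l. b k *\<^sub>R Y k y\<^sub>0) = 0" for b
      using \<eta>(2)[of b] that Y0 by simp
  qed
  then obtain R2 where R2: "R2 > 0"
    "\<And>y b. dist y y\<^sub>0 < R2 \<Longrightarrow> (\<Sum>k<m-l. b k *\<^sub>R Y k y) = 0 \<Longrightarrow> \<forall>k<m-l. b k = 0"
    unfolding eventually_nhds_metric by blast
  obtain W\<^sub>0 where W0: "open W\<^sub>0" "p\<^sub>0 \<in> W\<^sub>0"
    and rk: "\<forall>V X. open V \<and> V \<subseteq> W\<^sub>0 \<and>
       (\<forall>i<m - l. smooth_vector_field A V (X i) \<and> (\<forall>q\<in>V. X i q \<in> horizontal g q)) \<and>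
       (\<forall>q\<in>V. \<forall>b. (\<Sum>i<m - l. b i *\<^sub>R X i q) = 0 \<longrightarrow> (\<forall>i<m - l. b i = 0)) \<longrightarrow>
       (\<forall>q\<in>V. m \<le> lie_rank A V (m - l) X q)"
    using rank unfolding rank_condition_def by (elim exE conjE)
  have "open (snd c ` (fst c \<inter> W\<^sub>0))" "y\<^sub>0 \<in> snd c ` (fst c \<inter> W\<^sub>0)"
    using chart_image_open[OF ch W0(1)] W0(2) c(2) by (auto simp: y\<^sub>0_def)
  then obtain R3 where R3: "R3 > 0" "ball y\<^sub>0 R3 \<subseteq> snd c ` (fst c \<inter> W\<^sub>0)" using openE by blast
  \<comment> \<open>Halved, so that even the closed ball lies in all three open balls.\<close>
  define R where "R = min R1 (min R2 R3) / 2"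
  have R: "R > 0" "R < R1" "R < R2" "R < R3" using R1(1) R2(1) R3(1) by (auto simp: R_def)
  define \<Omega> where "\<Omega> = ball y\<^sub>0 R"
  \<comment> \<open>Contact is taken in the closed ball to obtain a closed set; tangency is claimed
    in the open ball \<open>\<Omega>\<close> only.\<close>
  define Z where "Z = {y \<in> cball y\<^sub>0 R. v y - u y = 0}"
  have \<Omega>: "open \<Omega>" "\<Omega> \<subseteq> ball y\<^sub>0 R1" "cball y\<^sub>0 R \<subseteq> ball y\<^sub>0 R1" using R by (auto simp: \<Omega>_def)
  have \<Omega>G: "\<Omega> \<subseteq> snd c ` G" "cball y\<^sub>0 R \<subseteq> snd c ` G" using \<Omega> R1(2) by blast+
  have \<Omega>c: "\<Omega> \<subseteq> snd c ` fst c" using \<Omega>G Gc by blast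
  have cu: "continuous_on (cball y\<^sub>0 R) u" "continuous_on (cball y\<^sub>0 R) v"
    using smooth_on_continuous[OF sm(1)] smooth_on_continuous[OF sm(2)] \<Omega>G(2) continuous_on_subset by blast+
  have clZ: "closed Z" unfolding Z_def
    by (intro continuous_closed_preimage_constant continuous_on_diff cu) simp
  have Zmem: "y \<in> Z \<longleftrightarrow> v y = u y" if "y \<in> \<Omega>" for y using that by (auto simp: Z_def \<Omega>_def)
  define X where "X k x = vec_of c x (Y k (snd c x))" for k x
  have Xrep: "vector_rep A c (X k) y = Y k y" if "y \<in> \<Omega>" for k y
  proof -
    have yc: "y \<in> snd c ` fst c" using that \<Omega>c by blast
    show ?thesis using chart_props(6,7)[OF ch yc] ch by (simp add: vector_rep_apply X_def)
  qed
  define V where "V = cinv c ` \<Omega>"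
  have V_eq: "V = fst c \<inter> snd c -` \<Omega>"
  proof
    show "V \<subseteq> fst c \<inter> snd c -` \<Omega>" using chart_props(6,7)[OF ch] \<Omega>c by (auto simp: V_def)
    show "fst c \<inter> snd c -` \<Omega> \<subseteq> V"
    proof
      fix x assume "x \<in> fst c \<inter> snd c -` \<Omega>"
      then show "x \<in> V" using chart_props(5)[OF ch, of x] unfolding V_def by (intro image_eqI[of _ _ "snd c x"]) auto
    qed
  qed
  have oV: "open V" "V \<subseteq> fst c" unfolding V_eq using continuous_open_preimage[OF chart_props(3,1)[OF ch] \<Omega>(1)] by auto
  have sndV: "snd c ` V = \<Omega>"
  proof
    show "snd c ` V \<subseteq> \<Omega>" by (auto simp: V_eq)
    show "\<Omega> \<subseteq> snd c ` V"
    proof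
      fix y assume y: "y \<in> \<Omega>"
      then have "snd c (cinv c y) = y" using chart_props(6)[OF ch] \<Omega>c by blast
      then show "y \<in> snd c ` V" using y by (intro image_eqI[of _ _ "cinv c y"]) (auto simp: V_def)
    qed
  qed
  have VW: "V \<subseteq> W\<^sub>0"
  proof
    fix x assume x: "x \<in> V"
    then have "snd c x \<in> ball y\<^sub>0 R3" using R by (auto simp: V_eq \<Omega>_def)
    then obtain x' where x': "x' \<in> fst c" "x' \<in> W\<^sub>0" "snd c x = snd c x'" using R3(2) by blast
    then have "x = x'" using chart_props(5)[OF ch, of x] chart_props(5)[OF ch, of x'] oV(2) x by auto
    then show "x \<in> W\<^sub>0" using x' by simp
  qed
  have sX: "smooth_on \<Omega> (vector_rep A c (X k))" for k
    by (rule smooth_on_transform[OF \<Omega>(1) smooth_on_subset[OF sY \<Omega>G(1)]]) (rule Xrep)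
  have Xhor: "Y k y \<in> range (sharp_rep c y)" for k y by (simp add: Y_def)
  have rankV: "\<forall>q\<in>V. m \<le> lie_rank A V (m - l) X q"
  proof (rule rk[THEN spec, THEN spec, THEN mp], intro conjI allI impI ballI oV(1) VW)
    show "smooth_vector_field A V (X i)" for i
      by (rule smooth_vector_fieldI_chart[OF ch oV]) (simp add: sndV sX)
    show "X i q \<in> horizontal g q" if "q \<in> V" for i q
    proof -
      have "q \<in> fst c" using that oV(2) by blast
      show ?thesis unfolding horizontal_chart[OF ch \<open>q \<in> fst c\<close>] X_def by (rule imageI) (rule Xhor)
    qed
    show "b i = 0" if q: "q \<in> V" and sum: "(\<Sum>i<m - l. b i *\<^sub>R X i q) = 0" and i: "i < m - l" for q b i
    proof -
      have qc: "q \<in> fst c" "dist (snd c q) y\<^sub>0 < R2" using q R by (auto simp: V_eq \<Omega>_def dist_commute)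
      note lin = comps_linear[OF ch qc(1)]
      have "(\<Sum>i<m - l. b i *\<^sub>R Y i (snd c q)) = comps c q (\<Sum>i<m - l. b i *\<^sub>R X i q)"
        by (simp add: linear_sum[OF lin] linear_scale[OF lin] X_def ch qc)
      also have "\<dots> = 0" unfolding sum by (rule linear_0[OF lin])
      finally show ?thesis using R2(2)[OF qc(2)] i by blast
    qed
  qed
  have tanX: "tangent_on Z \<Omega> (vector_rep A c (X k))" for k
  proof (rule contact_set_tangent[OF c(1) p \<Omega>(1) \<Omega>c smooth_on_subset[OF sm(1) \<Omega>G(1)] smooth_on_subset[OF sm(2) \<Omega>G(1)]])
    fix y assume y: "y \<in> \<Omega>"
    then have yG: "y \<in> snd c ` G" using \<Omega>G(1) by blast
    show "(y, gradient u y) \<in> flux_dom c" "(y, gradient v y) \<in> flux_dom c" using fdom[OF yG] .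
    show "curvature_rep c p v y \<le> curvature_rep c p u y" "u y \<le> v y" using R1(3)[of y] y \<Omega>(2) by blast+
    show "y \<in> Z \<longleftrightarrow> v y = u y" by (rule Zmem[OF y])
    show "vector_rep A c (X k) y \<in> range (sharp_rep c y)" unfolding Xrep[OF y] by (rule Xhor)
    show "gradient v y \<bullet> vector_rep A c (X k) y = 0" unfolding Xrep[OF y] by (rule Yv[OF yG])
  qed (rule order_refl)
  have Xv: "gradient v y \<bullet> vector_rep A c (X k) y = 0" if "y \<in> \<Omega>" for k y
    unfolding Xrep[OF that] by (rule Yv) (use that \<Omega>G(1) in blast)
  have normal0: "N = 0" if z: "z \<in> Z" "z \<in> ball y\<^sub>0 R" and N: "\<forall>x\<in>Z. norm N \<le> norm (x - (z + N))" for z N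
  proof -
    have z\<Omega>: "z \<in> \<Omega>" using z(2) by (simp add: \<Omega>_def)
    have zG: "z \<in> snd c ` G" using z\<Omega> \<Omega>G(1) by blast
    define q where "q = cinv c z"
    have q: "q \<in> V" "q \<in> fst c" "snd c q = z" using z\<Omega> chart_props(6,7)[OF ch] \<Omega>c by (auto simp: q_def V_def)
    define L where "L = {Q q |Q. Q \<in> lie_module A V (m - l) X}"
    have lm: "tangent_on Z \<Omega> (vector_rep A c Q)" "gradient v z \<bullet> vector_rep A c Q z = 0"
      if "Q \<in> lie_module A V (m - l) X" for Q
      using lie_module_tangent[OF c(1) \<Omega>(1) \<Omega>c clZ smooth_on_subset[OF sm(2) \<Omega>G(1)] sX tanX Xv that[unfolded V_def]] z\<Omega>
      by blast+
    obtain T J \<kappa> where J: "open J" "0 \<in> J" and \<kappa>: "(\<kappa> has_derivative (\<lambda>h. h *\<^sub>R T)) (at (0::real))" "\<kappa> 0 = z"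
      and \<kappa>': "\<And>a. a \<in> J \<Longrightarrow> a \<in> {-\<delta><..<\<delta>} \<and> \<Psi> a (cinv c z) \<in> G \<and> \<kappa> a = snd c (\<Psi> a (cinv c z)) \<and> \<kappa> a \<in> \<Omega>"
      using translation_velocity[OF iso c(1) G(1,2) GU z\<Omega> \<Omega>(1) \<Omega>G(1)] by blast
    have shift: "u (\<kappa> a) = u z - a" "v (\<kappa> a) = v z - a" if "a \<in> J" for a
      using \<kappa>'[OF that] curvature_translation(1)[OF iso c(1) G(1,2,3) \<phi>(1,2) _ zG, of a]
        curvature_translation(1)[OF iso c(1) G(1,2,4) \<psi>(1,2) _ zG, of a] by (auto simp: u_def v_def)
    have dv: "v differentiable at z" by (rule smooth_on_differentiable[OF sm(2) zG])
    have "((\<lambda>a. v (\<kappa> a)) has_derivative (\<lambda>h. fd v z (h *\<^sub>R T))) (at 0)"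
      by (rule has_derivative_compose[OF \<kappa>(1)]) (simp add: \<kappa>(2) fd_works[OF dv])
    moreover have "((\<lambda>a. v (\<kappa> a)) has_derivative (\<lambda>h. - h)) (at 0)"
    proof (rule has_derivative_transform_within_open[OF _ J])
      show "((\<lambda>a. v z - a) has_derivative (\<lambda>h. - h)) (at 0)" by (auto intro!: derivative_eq_intros)
    qed (simp add: shift)
    ultimately have "(\<lambda>h. fd v z (h *\<^sub>R T)) = (\<lambda>h. - h)" by (rule has_derivative_unique)
    then have "fd v z (1 *\<^sub>R T) = - 1" by (rule fun_cong)
    \<comment> \<open>Along the orbit \<open>v\<close> decreases at unit rate, so \<open>T\<close>
      lies outside the kernel of \<open>dv\<close>.\<close>
    then have Tv: "T \<bullet> gradient v z = - 1" by (simp add: inner_commute[of T] gradient_inner[OF dv])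
    have f: "((\<lambda>a. (\<kappa> a - (z + N)) \<bullet> (\<kappa> a - (z + N))) has_derivative (\<lambda>h. 2 * ((h *\<^sub>R T) \<bullet> (\<kappa> 0 - (z + N))))) (at 0)"
      by (auto intro!: derivative_eq_intros \<kappa>(1) simp: inner_commute)
    have min: "(\<kappa> 0 - (z + N)) \<bullet> (\<kappa> 0 - (z + N)) \<le> (\<kappa> a - (z + N)) \<bullet> (\<kappa> a - (z + N))" if "a \<in> J" for a
    proof -
      \<comment> \<open>Both functions drop by \<open>a\<close>, so the orbit of a contact point
        consists of contact points.\<close>
      have "v (\<kappa> a) = u (\<kappa> a)" unfolding shift[OF that] using Zmem[OF z\<Omega>] z(1) by simp
      then have "\<kappa> a \<in> Z" using Zmem[of "\<kappa> a"] \<kappa>'[OF that] by blast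
      then have "norm N \<le> norm (\<kappa> a - (z + N))" using N by blast
      then have "(norm N)\<^sup>2 \<le> (norm (\<kappa> a - (z + N)))\<^sup>2" by (intro power_mono) auto
      then show ?thesis by (simp add: \<kappa>(2) power2_norm_eq_inner)
    qed
    \<comment> \<open>The squared distance to \<open>z + N\<close> along the orbit is minimal at
      time 0, an interior point of \<open>J\<close>.\<close>
    have "(\<lambda>h. 2 * ((h *\<^sub>R T) \<bullet> (\<kappa> 0 - (z + N)))) = (\<lambda>h. 0)"
      by (rule differential_zero_maxmin[OF J(2,1) f]) (use min in blast)
    then have "2 * ((1 *\<^sub>R T) \<bullet> (\<kappa> 0 - (z + N))) = 0" by (rule fun_cong)
    then have TN: "T \<bullet> N = 0" by (simp add: \<kappa>(2))
    note lin = comps_linear[OF ch q(2)]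
    have "inj (comps c q)" by (rule inj_on_inverseI[of _ "vec_of c q"]) (simp add: ch q)
    then have "dim (comps c q ` L) = dim L" by (intro dim_image_eq lin) (auto intro: inj_on_subset)
    moreover have "m \<le> dim L" using rankV q(1) by (simp add: lie_rank_def L_def)
    ultimately have dim: "DIM(real^'n) \<le> Suc (dim (comps c q ` L))" using dimM by simp
    have ort: "x \<bullet> N = 0" "x \<bullet> gradient v z = 0" if x: "x \<in> comps c q ` L" for x
    proof -
      obtain Q where Q: "Q \<in> lie_module A V (m - l) X" "x = vector_rep A c Q z"
        using x by (auto simp: L_def vector_rep_apply q_def)
      show "x \<bullet> N = 0" using lm(1)[OF Q(1)] z(1) z\<Omega> N unfolding tangent_on_def Q(2) by blast
      show "x \<bullet> gradient v z = 0" using lm(2)[OF Q(1)] by (simp add: Q(2) inner_commute)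
    qed
    show ?thesis by (rule complement_normal_zero[OF dim ort TN]) (simp_all add: Tv)
  qed
  have "y\<^sub>0 \<in> Z" using \<phi>(3) \<psi>(3) R(1) cp0 by (simp add: Z_def u_def v_def)
  from no_normals_imp_ball[OF clZ this normal0] have ball: "ball y\<^sub>0 (R / 2) \<subseteq> Z" .
  define W where "W = fst c \<inter> snd c -` ball y\<^sub>0 (R / 2)"
  have "open W" unfolding W_def by (rule continuous_open_preimage[OF chart_props(3,1)[OF ch] open_ball])
  moreover have "p\<^sub>0 \<in> W" using c(2) R(1) by (simp add: W_def y\<^sub>0_def)
  moreover have "x \<in> U \<and> \<phi> x = \<psi> x" if x: "x \<in> W" for x
  proof -
    have xc: "x \<in> fst c" "snd c x \<in> Z" using x ball by (auto simp: W_def)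
    note i = chart_props(5)[OF ch xc(1)]
    have "snd c x \<in> snd c ` G" using xc(2) \<Omega>G(2) by (auto simp: Z_def)
    then obtain x' where x': "x' \<in> G" "snd c x = snd c x'" by blast
    then have "x = x'" using i chart_props(5)[OF ch, of x'] G(2) by auto
    then show ?thesis using x'(1) GU xc(2) i by (auto simp: Z_def u_def v_def)
  qed
  ultimately show ?thesis by blast
qed

end

theorem theoremC:
  fixes A :: "('a::{t2_space, second_countable_topology}, 'n::finite) chart set"
    and g :: "('a, 'n) cometric" and vol :: "'a \<Rightarrow> 'n form"
    and m l :: nat and p\<^sub>0 :: 'a and U \<Sigma>\<^sub>1 \<Sigma>\<^sub>2 :: "'a set"
    and \<delta> p :: real and \<Psi> :: "real \<Rightarrow> 'a \<Rightarrow> 'a"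
    and \<phi> \<psi> a H\<^sub>1 H\<^sub>2 :: "'a \<Rightarrow> real"
  assumes "smooth_manifold A" and "CARD('n) = m + 1"
    and "subriemannian A g" and "volume_form A vol"
    and "isometric_translations A g vol p\<^sub>0 U \<delta> \<Psi>"
    and "l \<le> m + 1" and "\<exists>W. open W \<and> p\<^sub>0 \<in> W \<and> (\<forall>x\<in>W. dim (horizontal g x) = m + 1 - l)"
    and "defining_function A U \<phi> \<Sigma>\<^sub>1" and "defining_function A U \<psi> \<Sigma>\<^sub>2"
    and "transversal A \<Psi> \<Sigma>\<^sub>1" and "transversal A \<Psi> \<Sigma>\<^sub>2"
    and "compatible U \<delta> \<Psi> \<phi>" and "compatible U \<delta> \<Psi> \<psi>"
    and "p\<^sub>0 \<in> \<Sigma>\<^sub>1 \<inter> \<Sigma>\<^sub>2" and "tangent_space A \<Sigma>\<^sub>1 p\<^sub>0 = tangent_space A \<Sigma>\<^sub>2 p\<^sub>0"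
    and "conorm g p\<^sub>0 (differential A \<phi> p\<^sub>0) \<noteq> 0" and "conorm g p\<^sub>0 (differential A \<psi> p\<^sub>0) \<noteq> 0"
    and "\<forall>q\<in>\<Sigma>\<^sub>1. 0 \<le> a q \<and> a q < \<delta> \<and> \<Psi> (a q) q \<in> \<Sigma>\<^sub>2"
    and "p \<ge> 0" and "p_mean_curvature A g vol U p \<phi> H\<^sub>1" and "p_mean_curvature A g vol U p \<psi> H\<^sub>2"
    and "\<forall>q\<in>regular_set A g \<phi> \<Sigma>\<^sub>1. \<Psi> (a q) q \<in> regular_set A g \<psi> \<Sigma>\<^sub>2 \<longrightarrow> H\<^sub>2 (\<Psi> (a q) q) \<le> H\<^sub>1 q"
    and "rank_condition A g p\<^sub>0 (m - l) m"
  shows "\<exists>W. open W \<and> p\<^sub>0 \<in> W \<and> \<Sigma>\<^sub>1 \<inter> W = \<Sigma>\<^sub>2 \<inter> W"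
proof -
  interpret subriemannian_manifold A g vol by unfold_locales (use assms(1,3,4) in auto)
  have \<Sigma>: "smooth_fun A U \<phi>" "smooth_fun A U \<psi>" "\<Sigma>\<^sub>1 = {x\<in>U. \<phi> x = 0}" "\<Sigma>\<^sub>2 = {x\<in>U. \<psi> x = 0}"
    using assms(8,9) by (auto simp: defining_function_def)
  have "\<exists>W. open W \<and> p\<^sub>0 \<in> W \<and> W \<subseteq> U \<and> (\<forall>x\<in>W. \<phi> x = \<psi> x)"
  proof (rule coincide_near[OF assms(2,5) _ _ _ \<Sigma>(1) assms(12) _ \<Sigma>(2) assms(13) _ assms(19,20,21) _ _ assms(23)])
    show "dim (horizontal g p\<^sub>0) = m + 1 - l" using assms(7) by blast
    show "p\<^sub>0 \<in> regular_set A g \<phi> U" "p\<^sub>0 \<in> regular_set A g \<psi> U" "\<phi> p\<^sub>0 = 0" "\<psi> p\<^sub>0 = 0"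
      using assms(14,16,17) by (auto simp: \<Sigma> regular_set_def)
    fix q assume "\<phi> q = 0"
    then show "0 \<le> a q \<and> a q < \<delta> \<and> \<Psi> (a q) q \<in> U \<and> \<psi> (\<Psi> (a q) q) = 0" if "q \<in> U"
      using assms(18) that by (auto simp: \<Sigma>)
    with \<open>\<phi> q = 0\<close> show "H\<^sub>2 (\<Psi> (a q) q) \<le> H\<^sub>1 q" if "q \<in> regular_set A g \<phi> U" "\<Psi> (a q) q \<in> regular_set A g \<psi> U"
      using assms(22) that by (auto simp: \<Sigma> regular_set_def)
  qed
  then obtain W where "open W" "p\<^sub>0 \<in> W" "W \<subseteq> U" "\<forall>x\<in>W. \<phi> x = \<psi> x" by blast
  then show ?thesis by (intro exI[of _ W]) (auto simp: \<Sigma>)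
qed

end
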